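(* Let $m,n\in\mathbb{N}$ with $m\le n$, let $\mathcal{O}$ be the ring of integers of a number field, let $\mathfrak{p}$ be a non-zero prime ideal of $\mathcal{O}$ and let $q$ be the cardinality of its residue field. Let $\mathcal{O}_{\mathfrak{p}}$ be the completion of $\mathcal{O}$ at $\mathfrak{p}$. Then $$\zeta_{G_{m,n}(\mathcal{O}_{\mathfrak{p}})}(s)=\sum_{I\subseteq\{0,\dots,m-1\}} f^I_{m,n}(q^{-1})\prod_{i\in I}\frac{q^{(m-i)(n+i)-(m-i)s}}{1-q^{(m-i)(n+i)-(m-i)s}}.$$
   Context: $\mathbb{N}$ is the set of positive integers. The group scheme $G_{m,n}$: let $\Lambda_{m,n}$ be the $\mathbb{Z}$-Lie lattice with $\mathbb{Z}$-basis $x_1,\dots,x_{m+n}$, $z_{ij}$ ($1\le i\le m$, $1\le j\le n$) and brackets $[x_i,x_{m+j}]=z_{ij}$, all brackets not following formally from these being zero. $G_{m,n}$ is the unipotent group scheme associated with the class-2 nilpotent Lie lattice $\Lambda_{m,n}$ (group commutators $xyx^{-1}y^{-1}$ are given by Lie brackets). Concretely, for a commutative ring $R$, $G_{m,n}(R)$ is the set $R^m\times R^n\times \mathrm{Mat}_{m\times n}(R)$ with multiplication $(a,b,c)(a',b',c')=(a+a',\,b+b',\,c+c'+a\,(b')^{T})$, where $a,b$ are column vectors. $G_{m,n}(\mathcal{O}_{\mathfrak p})$ is viewed as a topological group with the $\mathfrak p$-adic topology. Twist representation zeta function: for a topological group $G$ and $i\in\mathbb{N}$, $\mathrm{Irr}_i(G)$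 is the set of characters of continuous irreducible complex representations of $G$ of dimension $i$. Characters $\theta_1,\theta_2\in\mathrm{Irr}_i(G)$ are twist equivalent, $\theta_1\sim\theta_2$, if $\theta_1=\chi\theta_2$ for some $\chi\in\mathrm{Irr}_1(G)$. Put $\tilde a_i(G)=\#(\mathrm{Irr}_i(G)/\sim)$ and, if all these are finite, $\zeta_G(s)=\sum_{i\in\mathbb{N}}\tilde a_i(G)i^{-s}$. Polynomials: for integers $0\le b\le a$, $\binom{a}{b}_X=\frac{\prod_{k=1}^a(1-X^k)}{\prod_{k=1}^{a-b}(1-X^k)\prod_{k=1}^{b}(1-X^k)}$ (Gauss polynomial). For $I=\{i_1<\dots<i_\ell\}\subseteq\{0,\dots,j-1\}$, $\binom{j}{I}_X=\binom{j}{i_\ell}_X\binom{i_\ell}{i_{\ell-1}}_X\cdots\binom{i_2}{i_1}_X$. The Pochhammer symbol is $(X;Y)_k=\prod_{i=0}^{k-1}(1-XY^i)$. For $I=\{i_1<\dots<i_\ell\}\subseteq\{0,\dots,m-1\}$, $$f^I_{m,n}(X)=\binom{m}{I}_X\,(X^{n-m}X^{i_1+1};X)_{m-i_1},$$ with $f^{\emptyset}_{m,n}(X)=1$ (empty products are $1$). The identity is one of Dirichlet series (equivalently, of power series in $q^{-s}$). *)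

theory Defs
  imports
    "HOL-Analysis.Function_Topology"
    "HOL-Analysis.Product_Topology"
    "HOL-Algebra.Embedded_Algebras"
    "HOL-Algebra.QuotRing"
    "HOL-Algebra.Ideal_Product"
    "HOL-Computational_Algebra.Formal_Power_Series"
    "Jordan_Normal_Form.VS_Connect"
begin

hide_const (open) Multiset.mult

section \<open>Number fields and completions of their rings of integers\<close>

text \<open>
  The ambient type is an arbitrary field of characteristic 0. Here \<^term>\<open>class_ring\<close> is that type
  regarded as a ring with an explicit carrier and \<^term>\<open>\<rat>\<close> is its prime field.
\<close>

definition number_field :: "'k::field_char_0 set \<Rightarrow> bool" where
  "number_field K \<longleftrightarrow> subfield K class_ring \<and> ring.finite_dimension class_ring \<rat> K"

definition ring_of_integers :: "'k::field_char_0 set \<Rightarrow> 'k ring" where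
  "ring_of_integers K = class_ring\<lparr>carrier := {x \<in> K. algebraic_int x}\<rparr>"

text \<open>The quotient by the \<open>k\<close>-th power of an ideal, powers being taken in the semiring of ideals.\<close>

definition power_quot :: "'a ring \<Rightarrow> 'a set \<Rightarrow> nat \<Rightarrow> 'a set ring" where
  "power_quot R P k = R Quot (P [^]\<^bsub>ideals_set R\<^esub> k)"

text \<open>
  The completion is the inverse limit of the rings \<open>R/P\<^sup>k\<close>. The coset in component \<open>Suc k\<close> maps to the
  one in component \<open>k\<close> exactly if it is contained in it.
\<close>

definition completion :: "'a ring \<Rightarrow> 'a set \<Rightarrow> (nat \<Rightarrow> 'a set) ring" where
  "completion R P =
     \<lparr>carrier = {x. (\<forall>k. x k \<in> carrier (power_quot R P k)) \<and> (\<forall>k. x (Suc k) \<subseteq> x k)},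
      mult = (\<lambda>x y k. x k \<otimes>\<^bsub>power_quot R P k\<^esub> y k),
      one = (\<lambda>k. \<one>\<^bsub>power_quot R P k\<^esub>),
      zero = (\<lambda>k. \<zero>\<^bsub>power_quot R P k\<^esub>),
      add = (\<lambda>x y k. x k \<oplus>\<^bsub>power_quot R P k\<^esub> y k)\<rparr>"

text \<open>
  The adic topology: a neighbourhood base of \<open>x\<close> is given by the sets of all \<open>y\<close> which agree with \<open>x\<close>
  modulo \<open>P\<^sup>k\<close>.
\<close>

definition adic_topology :: "'a ring \<Rightarrow> 'a set \<Rightarrow> (nat \<Rightarrow> 'a set) topology" where
  "adic_topology R P =
     subtopology
       (product_topology (\<lambda>k. discrete_topology (carrier (power_quot R P k))) UNIV)
       (carrier (completion R P))"

definition residue_card :: "'a ring \<Rightarrow> 'a set \<Rightarrow> nat" where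
  "residue_card R P = card (carrier (R Quot P))"


section \<open>The groups \<open>G\<^sub>m\<^sub>,\<^sub>n(R)\<close>\<close>

text \<open>Column vectors and matrices over \<open>R\<close> are extensional functions on index sets starting at 0.\<close>

type_synonym 'r gmn = "(nat \<Rightarrow> 'r) \<times> (nat \<Rightarrow> 'r) \<times> (nat \<times> nat \<Rightarrow> 'r)"

definition G_group :: "nat \<Rightarrow> nat \<Rightarrow> 'r ring \<Rightarrow> 'r gmn monoid" where
  "G_group m n R =
     \<lparr>carrier = ({..<m} \<rightarrow>\<^sub>E carrier R) \<times> ({..<n} \<rightarrow>\<^sub>E carrier R) \<times> ({..<m} \<times> {..<n} \<rightarrow>\<^sub>E carrier R),
      mult = (\<lambda>(a, b, c) (a', b', c').
        (\<lambda>i\<in>{..<m}. a i \<oplus>\<^bsub>R\<^esub> a' i,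
         \<lambda>j\<in>{..<n}. b j \<oplus>\<^bsub>R\<^esub> b' j,
         \<lambda>(i, j)\<in>{..<m} \<times> {..<n}. c (i, j) \<oplus>\<^bsub>R\<^esub> c' (i, j) \<oplus>\<^bsub>R\<^esub> a i \<otimes>\<^bsub>R\<^esub> b' j)),
      one =
        (\<lambda>i\<in>{..<m}. \<zero>\<^bsub>R\<^esub>, \<lambda>j\<in>{..<n}. \<zero>\<^bsub>R\<^esub>, \<lambda>p\<in>{..<m} \<times> {..<n}. \<zero>\<^bsub>R\<^esub>)\<rparr>"

definition G_topology :: "nat \<Rightarrow> nat \<Rightarrow> 'r topology \<Rightarrow> 'r gmn topology" where
  "G_topology m n T =
     prod_topology (product_topology (\<lambda>_. T) {..<m})
       (prod_topology (product_topology (\<lambda>_. T) {..<n})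
         (product_topology (\<lambda>_. T) ({..<m} \<times> {..<n})))"


section \<open>Twist representation zeta functions\<close>

text \<open>
  In the following, \<open>G\<close> is a group and \<open>T\<close> a topology on its carrier. Preservation of the unit makes
  the matrices \<open>\<rho> g\<close> invertible; a matrix-valued map is continuous if all its entries are.
\<close>

definition cont_rep ::
  "('g, 'x) monoid_scheme \<Rightarrow> 'g topology \<Rightarrow> nat \<Rightarrow> ('g \<Rightarrow> complex mat) \<Rightarrow> bool" where
  "cont_rep G T d \<rho> \<longleftrightarrow>
     (\<forall>g\<in>carrier G. \<rho> g \<in> carrier_mat d d) \<and>
     \<rho> \<one>\<^bsub>G\<^esub> = 1\<^sub>m d \<and>
     (\<forall>g\<in>carrier G. \<forall>h\<in>carrier G. \<rho> (g \<otimes>\<^bsub>G\<^esub> h) = \<rho> g * \<rho> h) \<and>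
     (\<forall>r<d. \<forall>c<d. continuous_map T euclidean (\<lambda>g. \<rho> g $$ (r, c)))"

definition irreducible_rep ::
  "('g, 'x) monoid_scheme \<Rightarrow> nat \<Rightarrow> ('g \<Rightarrow> complex mat) \<Rightarrow> bool" where
  "irreducible_rep G d \<rho> \<longleftrightarrow> d > 0 \<and>
     (\<forall>W. VectorSpace.subspace class_ring W (module_vec TYPE(complex) d) \<and>
          (\<forall>g\<in>carrier G. \<forall>v\<in>W. \<rho> g *\<^sub>v v \<in> W) \<longrightarrow>
          W = {0\<^sub>v d} \<or> W = carrier_vec d)"

definition rep_character ::
  "('g, 'x) monoid_scheme \<Rightarrow> nat \<Rightarrow> ('g \<Rightarrow> complex mat) \<Rightarrow> 'g \<Rightarrow> complex" where
  "rep_character G d \<rho> = (\<lambda>g\<in>carrier G. \<Sum>r<d. \<rho> g $$ (r, r))"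

definition Irr ::
  "('g, 'x) monoid_scheme \<Rightarrow> 'g topology \<Rightarrow> nat \<Rightarrow> ('g \<Rightarrow> complex) set" where
  "Irr G T d = {rep_character G d \<rho> | \<rho>. cont_rep G T d \<rho> \<and> irreducible_rep G d \<rho>}"

definition twist_equiv ::
  "('g, 'x) monoid_scheme \<Rightarrow> 'g topology \<Rightarrow> nat \<Rightarrow> (('g \<Rightarrow> complex) \<times> ('g \<Rightarrow> complex)) set" where
  "twist_equiv G T d =
     {(\<theta>\<^sub>1, \<theta>\<^sub>2). \<theta>\<^sub>1 \<in> Irr G T d \<and> \<theta>\<^sub>2 \<in> Irr G T d \<and>
        (\<exists>\<chi>\<in>Irr G T 1. \<forall>g\<in>carrier G. \<theta>\<^sub>1 g = \<chi> g * \<theta>\<^sub>2 g)}"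

definition twist_classes ::
  "('g, 'x) monoid_scheme \<Rightarrow> 'g topology \<Rightarrow> nat \<Rightarrow> ('g \<Rightarrow> complex) set set" where
  "twist_classes G T d = Irr G T d // twist_equiv G T d"

text \<open>
  A formal Dirichlet series \<open>\<Sum>i\<ge>1. a\<^sub>i i\<^sup>-\<^sup>s\<close> is represented by its coefficient function; the value at
  0 plays no role. The first definition is meaningful only if all \<^term>\<open>twist_classes G T i\<close>
  with \<open>i > 0\<close> are finite.
\<close>

definition twist_zeta_coeff :: "('g, 'x) monoid_scheme \<Rightarrow> 'g topology \<Rightarrow> nat \<Rightarrow> rat" where
  "twist_zeta_coeff G T i = of_nat (card (twist_classes G T i))"

text \<open>
  The coefficient of \<open>i\<^sup>-\<^sup>s\<close> in \<open>F(q\<^sup>-\<^sup>s)\<close>, for \<open>q \<ge> 2\<close>: the sum has at most one term, and it is empty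
  unless \<open>i\<close> is a power of \<open>q\<close>.
\<close>

definition dirichlet_coeff_of_fps :: "nat \<Rightarrow> rat fps \<Rightarrow> nat \<Rightarrow> rat" where
  "dirichlet_coeff_of_fps q F i = (\<Sum>k | q ^ k = i. fps_nth F k)"


section \<open>The polynomials \<open>f\<^sup>I\<^sub>m\<^sub>,\<^sub>n\<close>\<close>

text \<open>
  Values at a point \<open>X\<close> of a field. The quotient in the first definition is the value of the
  Gauss polynomial provided that \<open>X\<close> is not a root of unity.
\<close>

definition gauss_binomial :: "nat \<Rightarrow> nat \<Rightarrow> 'a::field \<Rightarrow> 'a" where
  "gauss_binomial a b X =
     (\<Prod>k=1..a. 1 - X ^ k) / ((\<Prod>k=1..a - b. 1 - X ^ k) * (\<Prod>k=1..b. 1 - X ^ k))"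

fun gauss_chain :: "nat \<Rightarrow> nat list \<Rightarrow> 'a::field \<Rightarrow> 'a" where
  "gauss_chain j [] X = 1"
| "gauss_chain j (i # is) X = gauss_binomial j i X * gauss_chain i is X"

definition gauss_multinomial :: "nat \<Rightarrow> nat set \<Rightarrow> 'a::field \<Rightarrow> 'a" where
  "gauss_multinomial j I X = gauss_chain j (rev (sorted_list_of_set I)) X"

definition q_pochhammer :: "'a::field \<Rightarrow> 'a \<Rightarrow> nat \<Rightarrow> 'a" where
  "q_pochhammer X Y k = (\<Prod>i<k. 1 - X * Y ^ i)"

definition f_poly :: "nat \<Rightarrow> nat \<Rightarrow> nat set \<Rightarrow> 'a::field \<Rightarrow> 'a" where
  "f_poly m n I X =
     (if I = {} then 1
      else gauss_multinomial m I X *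
             q_pochhammer (X ^ (n - m) * X ^ (Min I + 1)) X (m - Min I))"

end

theory Submission
  imports Defs "HOL-Computational_Algebra.Fundamental_Theorem_Algebra" "HOL-Library.Function_Algebras"
begin

text \<open>
  The completed ring enters only through its dual: the characters of the ring of integers that are trivial on some
  power of \<open>P\<close> form a divisible torsion module \<open>D\<close> in which multiplication by a local uniformizer is
  surjective with kernel of order \<open>q\<close>. By Clifford theory for a group of class 2, the irreducible
  characters up to twists correspond to their central characters, that is to \<open>m \<times> n\<close> matrices \<open>\<Phi>\<close> over \<open>D\<close>;
  the dimension is the order of the module spanned by the rows of \<open>\<Phi>\<close>, acting on functions on that span.
  Multiplying a matrix of rank \<open>r\<close> by the uniformizer divides the order of its row span by \<open>q\<^sup>r\<close>. Counting the
  preimages gives a linear recursion for the generating functions by rank, which the sum over \<open>I\<close> solves.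
\<close>

text \<open>The subsets \<open>I\<close> record how the rank falls. Multiplying a matrix repeatedly
  by the uniformizer gives a weakly decreasing sequence of ranks ending in 0, and \<open>I\<close>
  consists of the numbers \<open>m - r\<close> for the positive ranks \<open>r\<close> that occur.
  Each stay at rank \<open>r = m - i\<close> contributes \<open>q ^ ((m - i) * (n + i))\<close>
  times \<open>fps_X ^ (m - i)\<close>, whence the geometric series; each drop contributes a count
  of matrices of given rank over the residue field, freed of powers of \<open>q\<close>, and the
  product of these counts is \<open>f_poly\<close>. Two obstacles shape the rest. The ideal
  \<open>P\<close> need not be principal, so the uniformizer \<open>\<pi>\<close> generates it only
  up to an element \<open>u\<close> outside of \<open>P\<close>, in the sense that
  \<open>u P \<subseteq> \<pi> S\<close>. Such a \<open>u\<close> is invertible modulo all powers of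
  \<open>P\<close>, and this takes the place of a localization. Moreover, a continuous
  representation is only known to have continuous entries; as small subgroups of the general linear
  group are trivial, it factors through a finite level, where all matrices have finite order and
  commuting families have common eigenvectors.\<close>

declare class_semiring.nat_pow_Suc [simp del]

text \<open>An axiomatic form of the quotient of a local field by its valuation ring.
  \<open>card_fibre\<close> says at once that \<open>\<pi>\<close> acts surjectively and that its
  kernel has \<open>q\<close> elements; \<open>simple_socle\<close> says that this kernel is a line
  over the residue field. \<open>S\<close> is any subring, because it will be the ring of integers
  itself and not its completion.\<close>

locale divisible_module =
  fixes S :: "'r::comm_ring_1 set" and D :: "'d::ab_group_add set"
    and act :: "'r \<Rightarrow> 'd \<Rightarrow> 'd" (infixr "\<star>" 75) and \<pi> :: 'r and q :: nat
  assumes S_0 [simp, intro]: "0 \<in> S" and S_1 [simp, intro]: "1 \<in> S"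
    and S_add [intro]: "a \<in> S \<Longrightarrow> b \<in> S \<Longrightarrow> a + b \<in> S"
    and S_mult [intro]: "a \<in> S \<Longrightarrow> b \<in> S \<Longrightarrow> a * b \<in> S"
    and S_uminus [intro]: "a \<in> S \<Longrightarrow> - a \<in> S"
    and D_0 [simp, intro]: "0 \<in> D"
    and D_add [intro]: "x \<in> D \<Longrightarrow> y \<in> D \<Longrightarrow> x + y \<in> D"
    and D_uminus [intro]: "x \<in> D \<Longrightarrow> - x \<in> D"
    and act_closed [intro]: "a \<in> S \<Longrightarrow> x \<in> D \<Longrightarrow> a \<star> x \<in> D"
    and act_add_right: "a \<in> S \<Longrightarrow> x \<in> D \<Longrightarrow> y \<in> D \<Longrightarrow> a \<star> (x + y) = a \<star> x + a \<star> y"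
    and act_add_left: "a \<in> S \<Longrightarrow> b \<in> S \<Longrightarrow> x \<in> D \<Longrightarrow> (a + b) \<star> x = a \<star> x + b \<star> x"
    and act_mult: "a \<in> S \<Longrightarrow> b \<in> S \<Longrightarrow> x \<in> D \<Longrightarrow> (a * b) \<star> x = a \<star> b \<star> x"
    and act_one [simp]: "x \<in> D \<Longrightarrow> 1 \<star> x = x"
    and pi_S [simp, intro]: "\<pi> \<in> S"
    and q_ge_2: "2 \<le> q"
    and torsion: "x \<in> D \<Longrightarrow> \<exists>k. \<pi> ^ k \<star> x = 0"
    and card_fibre: "x \<in> D \<Longrightarrow> card {y \<in> D. \<pi> \<star> y = x} = q"
    and simple_socle: "x \<in> D \<Longrightarrow> x \<noteq> 0 \<Longrightarrow> \<pi> \<star> x = 0 \<Longrightarrow> y \<in> D \<Longrightarrow> \<pi> \<star> y = 0 \<Longrightarrow> \<exists>a\<in>S. y = a \<star> x"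
begin

lemma S_diff [intro]: "a \<in> S \<Longrightarrow> b \<in> S \<Longrightarrow> a - b \<in> S"
  using S_add[of a "- b"] S_uminus[of b] by simp

lemma S_power [intro]: "a \<in> S \<Longrightarrow> a ^ k \<in> S"
  by (induction k) auto

lemma S_sum: "(\<And>i. i \<in> I \<Longrightarrow> a i \<in> S) \<Longrightarrow> sum a I \<in> S"
  by (induction I rule: infinite_finite_induct) auto

lemma D_diff [intro]: "x \<in> D \<Longrightarrow> y \<in> D \<Longrightarrow> x - y \<in> D"
  using D_add[of x "- y"] D_uminus[of y] by simp

lemma D_sum: "(\<And>i. i \<in> I \<Longrightarrow> f i \<in> D) \<Longrightarrow> sum f I \<in> D"
  by (induction I rule: infinite_finite_induct) auto

lemma act_zero_right [simp]: "a \<in> S \<Longrightarrow> a \<star> 0 = 0"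
  using act_add_right[of a 0 0] by simp

lemma act_zero_left [simp]: "x \<in> D \<Longrightarrow> 0 \<star> x = 0"
  using act_add_left[of 0 0 x] by simp

lemma act_minus_right: "a \<in> S \<Longrightarrow> x \<in> D \<Longrightarrow> a \<star> (- x) = - (a \<star> x)"
  using act_add_right[of a x "- x"] D_uminus[of x] by (simp add: eq_neg_iff_add_eq_0 add.commute)

lemma act_minus_left: "a \<in> S \<Longrightarrow> x \<in> D \<Longrightarrow> (- a) \<star> x = - (a \<star> x)"
  using act_add_left[of a "- a" x] S_uminus[of a] by (simp add: eq_neg_iff_add_eq_0 add.commute)

lemma act_diff_right: "a \<in> S \<Longrightarrow> x \<in> D \<Longrightarrow> y \<in> D \<Longrightarrow> a \<star> (x - y) = a \<star> x - a \<star> y"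
  using act_add_right[of a x "- y"] D_uminus[of y] act_minus_right[of a y] by simp

lemma act_diff_left: "a \<in> S \<Longrightarrow> b \<in> S \<Longrightarrow> x \<in> D \<Longrightarrow> (a - b) \<star> x = a \<star> x - b \<star> x"
  using act_add_left[of a "- b" x] S_uminus[of b] act_minus_left[of b x] by simp

lemma act_sum_right:
  "a \<in> S \<Longrightarrow> (\<And>i. i \<in> I \<Longrightarrow> f i \<in> D) \<Longrightarrow> a \<star> sum f I = (\<Sum>i\<in>I. a \<star> f i)"
proof (induction I rule: infinite_finite_induct)
  case (insert i I)
  then have "sum f I \<in> D" by (intro D_sum) auto
  with insert show ?case by (simp add: act_add_right)
qed auto

lemma act_sum_left:
  "x \<in> D \<Longrightarrow> (\<And>i. i \<in> I \<Longrightarrow> a i \<in> S) \<Longrightarrow> sum a I \<star> x = (\<Sum>i\<in>I. a i \<star> x)"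
proof (induction I rule: infinite_finite_induct)
  case (insert i I)
  then have "sum a I \<in> S" by (intro S_sum) auto
  with insert show ?case by (simp add: act_add_left)
qed auto

lemma act_commute: "a \<in> S \<Longrightarrow> b \<in> S \<Longrightarrow> x \<in> D \<Longrightarrow> a \<star> b \<star> x = b \<star> a \<star> x"
  by (metis act_mult mult.commute)

lemma act_pi_power_Suc: "x \<in> D \<Longrightarrow> \<pi> ^ Suc k \<star> x = \<pi> ^ k \<star> \<pi> \<star> x"
  by (metis S_power act_mult pi_S power_Suc2)

lemma act_pi_power_Suc': "x \<in> D \<Longrightarrow> \<pi> ^ Suc k \<star> x = \<pi> \<star> \<pi> ^ k \<star> x"
  by (simp add: act_mult S_power)

subsection \<open>Orders of elements\<close>

text \<open>Minus the valuation, in the model of a local field modulo its valuation ring.\<close>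

definition ord :: "'d \<Rightarrow> nat" where
  "ord x = (LEAST k. \<pi> ^ k \<star> x = 0)"

lemma act_pi_ord: "x \<in> D \<Longrightarrow> \<pi> ^ ord x \<star> x = 0"
  unfolding ord_def using torsion by (rule LeastI_ex)

lemma ord_le: "\<pi> ^ k \<star> x = 0 \<Longrightarrow> ord x \<le> k"
  unfolding ord_def by (rule Least_le)

lemma act_pi_mono: "x \<in> D \<Longrightarrow> \<pi> ^ k \<star> x = 0 \<Longrightarrow> k \<le> l \<Longrightarrow> \<pi> ^ l \<star> x = 0"
  using act_mult[of "\<pi> ^ (l - k)" "\<pi> ^ k" x] by (simp add: S_power flip: power_add)

lemma ord_le_iff: "x \<in> D \<Longrightarrow> ord x \<le> k \<longleftrightarrow> \<pi> ^ k \<star> x = 0"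
  using act_pi_mono[OF _ act_pi_ord] ord_le by blast

lemma ord_eq_0_iff: "x \<in> D \<Longrightarrow> ord x = 0 \<longleftrightarrow> x = 0"
  using ord_le_iff[of x 0] by simp

lemma ord_act_pi: "x \<in> D \<Longrightarrow> ord (\<pi> \<star> x) = ord x - 1"
proof (rule antisym)
  assume x: "x \<in> D"
  then have px: "\<pi> \<star> x \<in> D" by auto
  show "ord (\<pi> \<star> x) \<le> ord x - 1"
    using x px act_pi_ord[OF x] act_pi_power_Suc[OF x, of "ord x - 1"]
    by (cases "ord x") (auto simp: ord_le_iff ord_eq_0_iff S_power)
  show "ord x - 1 \<le> ord (\<pi> \<star> x)"
    using x px act_pi_ord[OF px] ord_le_iff[OF x, of "Suc (ord (\<pi> \<star> x))"]
    by (simp add: act_pi_power_Suc del: power_Suc)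
qed

lemma ord_act_le: "a \<in> S \<Longrightarrow> x \<in> D \<Longrightarrow> ord (a \<star> x) \<le> ord x"
  by (simp add: ord_le_iff act_closed act_commute[of "\<pi> ^ ord x" a] S_power act_pi_ord)

text \<open>The cyclic submodules form a chain. An element \<open>y\<close> killed by
  \<open>\<pi> ^ Suc f\<close> has \<open>\<pi> ^ f \<star> y\<close> in the socle, where it is a
  multiple of the last nonzero \<open>\<pi>\<close>-multiple of \<open>x\<close>; subtracting a
  suitable multiple of \<open>x\<close> from \<open>y\<close> lowers the exponent.\<close>

lemma in_orbitI:
  assumes x: "x \<in> D" and y: "y \<in> D" and le: "ord y \<le> ord x"
  shows "\<exists>a\<in>S. y = a \<star> x"
proof (cases "x = 0")
  case True
  then show ?thesis using le y x ord_eq_0_iff[of y] ord_eq_0_iff[of 0] by (intro bexI[of _ 0]) auto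
next
  case False
  then obtain e where e: "ord x = Suc e" using x ord_eq_0_iff by (cases "ord x") auto
  let ?z = "\<pi> ^ e \<star> x"
  have z: "?z \<in> D" "?z \<noteq> 0" "\<pi> \<star> ?z = 0"
    using x e ord_le_iff[OF x, of e] act_pi_ord[OF x] by (auto simp: act_pi_power_Suc' S_power simp del: power_Suc)
  have "f \<le> Suc e \<Longrightarrow> y \<in> D \<Longrightarrow> \<pi> ^ f \<star> y = 0 \<Longrightarrow> \<exists>a\<in>S. y = a \<star> x" for f y
  proof (induction f arbitrary: y)
    case 0
    then show ?case using x by (intro bexI[of _ 0]) auto
  next
    case (Suc f)
    obtain a where a: "a \<in> S" "\<pi> ^ f \<star> y = a \<star> ?z"
      using simple_socle[OF z, of "\<pi> ^ f \<star> y"] Suc.prems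
      by (auto simp: act_pi_power_Suc' S_power simp del: power_Suc)
    \<comment> \<open>Multiplying by \<open>\<pi> ^ f\<close> completes the power to
      \<open>\<pi> ^ e\<close>, so that \<open>b \<star> x\<close> and \<open>y\<close> have the
      same image in the socle; this uses \<open>f \<le> e\<close>.\<close>
    define b where "b = a * \<pi> ^ (e - f)"
    have b: "b \<in> S" using a by (auto simp: b_def)
    have "\<pi> ^ f \<star> b \<star> x = a \<star> ?z"
    proof -
      have "\<pi> ^ f * b = a * \<pi> ^ e"
        using Suc.prems(1) by (simp add: b_def mult.left_commute flip: power_add)
      then show ?thesis
        using x a b act_mult[of "\<pi> ^ f" b x] act_mult[of a "\<pi> ^ e" x] by (simp add: S_power)
    qed
    then have "\<pi> ^ f \<star> (y - b \<star> x) = 0"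
      using a b x Suc.prems by (simp add: act_diff_right S_power act_closed)
    then obtain c where c: "c \<in> S" "y - b \<star> x = c \<star> x"
      using Suc.IH[of "y - b \<star> x"] Suc.prems b x by auto
    then have "y = (c + b) \<star> x" using b x by (simp add: act_add_left algebra_simps)
    with b c show ?case by blast
  qed
  from this[of "ord x" y] show ?thesis using assms e by (simp add: ord_le_iff)
qed

lemma card_killed: "card {x \<in> D. \<pi> ^ k \<star> x = 0} = q ^ k \<and> finite {x \<in> D. \<pi> ^ k \<star> x = 0}"
proof (induction k)
  case 0
  have "{x \<in> D. \<pi> ^ 0 \<star> x = 0} = {0}" by auto
  then show ?case by simp
next
  case (Suc k)
  have eq: "{x \<in> D. \<pi> ^ Suc k \<star> x = 0} = (\<Union>y\<in>{x \<in> D. \<pi> ^ k \<star> x = 0}. {x \<in> D. \<pi> \<star> x = y})"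
    by (auto simp: act_pi_power_Suc act_closed simp del: power_Suc)
  have fin: "finite {x \<in> D. \<pi> \<star> x = y}" if "y \<in> D" for y
    using card_fibre[OF that] q_ge_2 by (intro card_ge_0_finite) auto
  have "card {x \<in> D. \<pi> ^ Suc k \<star> x = 0} = (\<Sum>y\<in>{x \<in> D. \<pi> ^ k \<star> x = 0}. card {x \<in> D. \<pi> \<star> x = y})"
    unfolding eq using Suc fin by (intro card_UN_disjoint) auto
  also have "\<dots> = (\<Sum>y\<in>{x \<in> D. \<pi> ^ k \<star> x = 0}. q)"
    by (intro sum.cong) (auto simp: card_fibre)
  finally show ?case using Suc fin unfolding eq by (auto intro!: finite_UN_I)
qed

text \<open>Together with \<open>card_killed\<close> this gives the order of a cyclic
  submodule.\<close>

lemma orbit_eq: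
  assumes x: "x \<in> D"
  shows "(\<lambda>a. a \<star> x) ` S = {y \<in> D. \<pi> ^ ord x \<star> y = 0}"
proof (intro equalityI subsetI)
  fix y assume "y \<in> (\<lambda>a. a \<star> x) ` S"
  then show "y \<in> {y \<in> D. \<pi> ^ ord x \<star> y = 0}"
    using x by (auto simp: act_closed act_commute[of "\<pi> ^ ord x"] S_power act_pi_ord)
next
  fix y assume "y \<in> {y \<in> D. \<pi> ^ ord x \<star> y = 0}"
  then show "y \<in> (\<lambda>a. a \<star> x) ` S"
    using in_orbitI[OF x, of y] by (auto simp: ord_le_iff)
qed

lemma card_orbit: "x \<in> D \<Longrightarrow> card ((\<lambda>a. a \<star> x) ` S) = q ^ ord x"
  and finite_orbit: "x \<in> D \<Longrightarrow> finite ((\<lambda>a. a \<star> x) ` S)"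
  by (simp_all add: orbit_eq card_killed)

lemma finite_fibre: "y \<in> D \<Longrightarrow> finite {x \<in> D. \<pi> \<star> x = y}"
  using card_fibre q_ge_2 by (intro card_ge_0_finite) auto

subsection \<open>Row spans\<close>

text \<open>The index sets are arbitrary because elimination deletes a row and a column. Rows vanish
  outside of \<open>J\<close>, so that they are equal as functions as soon as their entries agree,
  also after a column has been deleted.\<close>

definition rowspan :: "'i set \<Rightarrow> 'j set \<Rightarrow> ('i \<times> 'j \<Rightarrow> 'd) \<Rightarrow> ('j \<Rightarrow> 'd) set" where
  "rowspan I J f = (\<lambda>a j. if j \<in> J then \<Sum>i\<in>I. a i \<star> f (i, j) else 0) ` (I \<rightarrow> S)"

lemma rowspan_cong:
  assumes "\<And>i j. i \<in> I \<Longrightarrow> j \<in> J \<Longrightarrow> f (i, j) = g (i, j)"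
  shows "rowspan I J f = rowspan I J g"
  unfolding rowspan_def by (intro image_cong refl ext) (auto intro!: sum.cong simp: assms)

lemma rowspanI: "a \<in> I \<rightarrow> S \<Longrightarrow> (\<lambda>j. if j \<in> J then \<Sum>i\<in>I. a i \<star> f (i, j) else 0) \<in> rowspan I J f"
  unfolding rowspan_def by (rule imageI)

lemma rowspan_empty: "rowspan {} J f = {\<lambda>_. 0}"
  by (simp add: rowspan_def cong: if_cong)

lemma rowspan_insert:
  assumes "finite I" "i \<notin> I"
  shows "rowspan (insert i I) J f =
    (\<lambda>(b, w) j. (if j \<in> J then b \<star> f (i, j) else 0) + w j) ` (S \<times> rowspan I J f)"
proof (intro equalityI subsetI)
  fix v assume "v \<in> rowspan (insert i I) J f"
  then obtain a where a: "a \<in> insert i I \<rightarrow> S"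
    and v: "v = (\<lambda>j. if j \<in> J then \<Sum>i\<in>insert i I. a i \<star> f (i, j) else 0)"
    by (auto simp: rowspan_def)
  show "v \<in> (\<lambda>(b, w) j. (if j \<in> J then b \<star> f (i, j) else 0) + w j) ` (S \<times> rowspan I J f)"
    using a assms v
    by (intro image_eqI[of _ _ "(a i, \<lambda>j. if j \<in> J then \<Sum>i\<in>I. a i \<star> f (i, j) else 0)"])
       (auto simp: rowspan_def)
next
  fix v assume "v \<in> (\<lambda>(b, w) j. (if j \<in> J then b \<star> f (i, j) else 0) + w j) ` (S \<times> rowspan I J f)"
  then obtain b a where a: "b \<in> S" "a \<in> I \<rightarrow> S"
    and v: "v = (\<lambda>j. (if j \<in> J then b \<star> f (i, j) else 0) + (if j \<in> J then \<Sum>i\<in>I. a i \<star> f (i, j) else 0))"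
    by (auto simp: rowspan_def)
  have "(\<Sum>k\<in>I. (a(i := b)) k \<star> f (k, j)) = (\<Sum>k\<in>I. a k \<star> f (k, j))" for j
    using assms by (intro sum.cong) auto
  then show "v \<in> rowspan (insert i I) J f"
    unfolding rowspan_def using a assms v
    by (intro image_eqI[of _ _ "a(i := b)"]) (auto simp: fun_eq_iff)
qed

lemma rowspan_mem: "v \<in> rowspan I J f \<Longrightarrow> f \<in> I \<times> J \<rightarrow> D \<Longrightarrow> v j \<in> D"
  by (auto simp: rowspan_def intro!: D_sum act_closed)

lemma rowspan_outside: "v \<in> rowspan I J f \<Longrightarrow> j \<notin> J \<Longrightarrow> v j = 0"
  by (auto simp: rowspan_def)

lemma zero_in_rowspan: "f \<in> I \<times> J \<rightarrow> D \<Longrightarrow> (\<lambda>_. 0) \<in> rowspan I J f"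
  unfolding rowspan_def
  by (intro image_eqI[of _ _ "\<lambda>_. 0"]) (auto simp: Pi_iff fun_eq_iff)

lemma rowspan_add:
  assumes f: "f \<in> I \<times> J \<rightarrow> D" and v: "v \<in> rowspan I J f" and w: "w \<in> rowspan I J f"
  shows "(\<lambda>j. v j + w j) \<in> rowspan I J f"
proof -
  from v w obtain a b where a: "a \<in> I \<rightarrow> S" "b \<in> I \<rightarrow> S"
    and "v = (\<lambda>j. if j \<in> J then \<Sum>i\<in>I. a i \<star> f (i, j) else 0)"
    and "w = (\<lambda>j. if j \<in> J then \<Sum>i\<in>I. b i \<star> f (i, j) else 0)"
    by (auto simp: rowspan_def)
  then have "(\<lambda>j. v j + w j) = (\<lambda>j. if j \<in> J then \<Sum>i\<in>I. (a i + b i) \<star> f (i, j) else 0)"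
    using f by (auto simp: fun_eq_iff Pi_iff act_add_left sum.distrib[symmetric] intro!: sum.cong)
  moreover have "(\<lambda>i. a i + b i) \<in> I \<rightarrow> S" using a by auto
  ultimately show ?thesis using rowspanI[of "\<lambda>i. a i + b i" I J f] by simp
qed

lemma rowspan_act:
  assumes f: "f \<in> I \<times> J \<rightarrow> D" and v: "v \<in> rowspan I J f" and c: "c \<in> S"
  shows "(\<lambda>j. c \<star> v j) \<in> rowspan I J f"
proof -
  from v obtain a where a: "a \<in> I \<rightarrow> S"
    and "v = (\<lambda>j. if j \<in> J then \<Sum>i\<in>I. a i \<star> f (i, j) else 0)"
    by (auto simp: rowspan_def)
  then have "(\<lambda>j. c \<star> v j) = (\<lambda>j. if j \<in> J then \<Sum>i\<in>I. (c * a i) \<star> f (i, j) else 0)"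
    using f c by (auto simp: fun_eq_iff Pi_iff act_mult act_sum_right act_closed intro!: sum.cong)
  moreover have "(\<lambda>i. c * a i) \<in> I \<rightarrow> S" using a c by auto
  ultimately show ?thesis using rowspanI[of "\<lambda>i. c * a i" I J f] by simp
qed

lemma rowspan_minus:
  assumes f: "f \<in> I \<times> J \<rightarrow> D" and v: "v \<in> rowspan I J f" and w: "w \<in> rowspan I J f"
  shows "(\<lambda>j. v j - w j) \<in> rowspan I J f"
proof -
  have "(\<lambda>j. v j + (- 1) \<star> w j) \<in> rowspan I J f"
    using assms by (intro rowspan_add rowspan_act) auto
  moreover have "(- 1) \<star> w j = - w j" for j
    using rowspan_mem[OF w f, of j] act_minus_left[of 1] by simp
  ultimately show ?thesis by simp
qed

lemma finite_rowspan:
  assumes "finite I" "finite J" "f \<in> I \<times> J \<rightarrow> D"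
  shows "finite (rowspan I J f)"
  using assms(1,3)
proof (induction I rule: finite_induct)
  case empty
  then show ?case by (simp add: rowspan_empty)
next
  case (insert i I)
  let ?g = "\<lambda>b j. if j \<in> J then b \<star> f (i, j) else 0"
  have "finite (PiE J (\<lambda>j. (\<lambda>b. b \<star> f (i, j)) ` S))"
    using insert.prems \<open>finite J\<close> by (intro finite_PiE finite_orbit) auto
  moreover have "?g ` S \<subseteq> (\<lambda>h j. if j \<in> J then h j else 0) ` (PiE J (\<lambda>j. (\<lambda>b. b \<star> f (i, j)) ` S))"
  proof
    fix v assume "v \<in> ?g ` S"
    then obtain b where "b \<in> S" "v = ?g b" by auto
    then show "v \<in> (\<lambda>h j. if j \<in> J then h j else 0) ` (PiE J (\<lambda>j. (\<lambda>b. b \<star> f (i, j)) ` S))"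
      by (intro image_eqI[of _ _ "\<lambda>j\<in>J. b \<star> f (i, j)"]) auto
  qed
  ultimately have "finite (?g ` S)" by (meson finite_imageI finite_subset)
  moreover have "finite (rowspan I J f)" using insert by auto
  ultimately have "finite ((\<lambda>(u, w) j. u j + w j) ` (?g ` S \<times> rowspan I J f))" by blast
  moreover have "rowspan (insert i I) J f = (\<lambda>(u, w) j. u j + w j) ` (?g ` S \<times> rowspan I J f)"
    unfolding rowspan_insert[OF insert(1,2)] by force
  ultimately show ?case by simp
qed

text \<open>
  The pivot \<open>f (i, j)\<close> generates column \<open>j\<close> and row \<open>i\<close>, so subtracting multiples of row \<open>i\<close> clears the
  column, and a combination of the rows is determined by its \<open>j\<close>-th entry and its part in the
  complementary rows.
\<close>
lemma card_rowspan_pivot: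
  assumes fin: "finite I" "finite J" and f: "f \<in> I \<times> J \<rightarrow> D" and i: "i \<in> I" and j: "j \<in> J"
    and u: "\<And>i'. i' \<in> I - {i} \<Longrightarrow> u i' \<in> S \<and> f (i', j) = u i' \<star> f (i, j)"
    and y: "\<And>j'. j' \<in> J \<Longrightarrow> \<exists>c\<in>S. f (i, j') = c \<star> f (i, j)"
  shows "card (rowspan I J f) = q ^ ord (f (i, j)) *
    card (rowspan (I - {i}) (J - {j}) (\<lambda>(i', j'). f (i', j') - u i' \<star> f (i, j')))"
proof -
  define p where "p = f (i, j)"
  define g where "g = (\<lambda>(i', j'). f (i', j') - u i' \<star> f (i, j'))"
  define R where "R = rowspan (I - {i}) (J - {j}) g"
  have p: "p \<in> D" using f i j by (auto simp: p_def)
  have g: "g \<in> (I - {i}) \<times> J \<rightarrow> D" using f i u by (auto simp: g_def intro!: D_diff act_closed)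
  have R_j: "w j = 0" if "w \<in> R" for w using that by (auto simp: R_def rowspan_def)
  have gj: "g (i', j) = 0" if "i' \<in> I - {i}" for i' using u[OF that] by (simp add: g_def)
  obtain c where c: "\<And>j'. j' \<in> J \<Longrightarrow> j' \<noteq> j \<Longrightarrow> c j' \<in> S \<and> f (i, j') = c j' \<star> p"
    using y unfolding p_def by metis
  \<comment> \<open>A multiple of the pivot row is recovered from its \<open>j\<close>-th entry
    \<open>z\<close>, as all its entries are multiples of the pivot. Indexing by \<open>z\<close>
    instead of by the coefficient makes the parametrization injective.\<close>
  define row where "row z = (\<lambda>j'. if j' \<in> J then (if j' = j then z else c j' \<star> z) else 0)" for z
  have row: "(\<lambda>j'. if j' \<in> J then b \<star> f (i, j') else 0) = row (b \<star> p)" if "b \<in> S" for b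
    using c that p by (auto simp: row_def p_def[symmetric] act_commute intro!: ext)
  have span: "rowspan I J f = (\<lambda>(z, w) j'. row z j' + w j') ` ((\<lambda>b. b \<star> p) ` S \<times> R)"
  proof -
    \<comment> \<open>Row \<open>i'\<close> is \<open>u i'\<close> times the pivot row plus the
      cleared row of \<open>g\<close>, so the pivot row collects the products
      \<open>a i' * u i'\<close> in addition to \<open>a i\<close>.\<close>
    have lincomb: "(\<lambda>j'. if j' \<in> J then \<Sum>i'\<in>I. a i' \<star> f (i', j') else 0) =
        (\<lambda>j'. row ((a i + (\<Sum>i'\<in>I - {i}. a i' * u i')) \<star> p) j' +
          (if j' \<in> J - {j} then \<Sum>i'\<in>I - {i}. a i' \<star> g (i', j') else 0))"
      if a: "a \<in> I \<rightarrow> S" for a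
    proof -
      let ?b = "a i + (\<Sum>i'\<in>I - {i}. a i' * u i')"
      have b: "?b \<in> S" using a i u by (auto intro!: S_add S_sum S_mult)
      have sum_eq: "(\<Sum>i'\<in>I. a i' \<star> f (i', j')) = ?b \<star> f (i, j') + (\<Sum>i'\<in>I - {i}. a i' \<star> g (i', j'))"
        if j': "j' \<in> J" for j'
      proof -
        have fij: "f (i, j') \<in> D" using f i j' by auto
        have "(\<Sum>i'\<in>I. a i' \<star> f (i', j')) = a i \<star> f (i, j') + (\<Sum>i'\<in>I - {i}. a i' \<star> f (i', j'))"
          using fin i by (simp add: sum.remove)
        also have "(\<Sum>i'\<in>I - {i}. a i' \<star> f (i', j')) =
            (\<Sum>i'\<in>I - {i}. (a i' * u i') \<star> f (i, j') + a i' \<star> g (i', j'))"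
          using a u f i j' fij
          by (intro sum.cong refl) (auto simp: g_def act_mult act_diff_right act_closed Pi_iff)
        also have "\<dots> = (\<Sum>i'\<in>I - {i}. a i' * u i') \<star> f (i, j') + (\<Sum>i'\<in>I - {i}. a i' \<star> g (i', j'))"
          using a u fij by (subst act_sum_left) (auto simp: sum.distrib S_mult Pi_iff)
        finally show ?thesis
          using a u i fij by (subst act_add_left) (auto simp: add.assoc intro!: S_sum S_mult)
      qed
      have sum_j: "(\<Sum>i'\<in>I - {i}. a i' \<star> g (i', j)) = 0"
        using a gj by (intro sum.neutral) (auto simp: Pi_iff)
      show ?thesis
      proof (rule ext)
        fix j'
        show "(if j' \<in> J then \<Sum>i'\<in>I. a i' \<star> f (i', j') else 0) = row (?b \<star> p) j' +
          (if j' \<in> J - {j} then \<Sum>i'\<in>I - {i}. a i' \<star> g (i', j') else 0)"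
          using fun_cong[OF row[OF b], of j'] sum_eq[of j'] sum_j by (cases "j' = j") auto
      qed
    qed
    show ?thesis
    proof (intro equalityI subsetI)
      fix v assume "v \<in> rowspan I J f"
      then obtain a where a: "a \<in> I \<rightarrow> S"
        and v: "v = (\<lambda>j'. if j' \<in> J then \<Sum>i'\<in>I. a i' \<star> f (i', j') else 0)"
        by (auto simp: rowspan_def)
      have "a i + (\<Sum>i'\<in>I - {i}. a i' * u i') \<in> S"
        using a i u by (auto intro!: S_add S_sum S_mult)
      then show "v \<in> (\<lambda>(z, w) j'. row z j' + w j') ` ((\<lambda>b. b \<star> p) ` S \<times> R)"
        unfolding v lincomb[OF a] R_def rowspan_def using a by fastforce
    next
      fix v assume "v \<in> (\<lambda>(z, w) j'. row z j' + w j') ` ((\<lambda>b. b \<star> p) ` S \<times> R)"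
      then obtain b a where b: "b \<in> S" and a: "a \<in> I - {i} \<rightarrow> S"
        and v: "v = (\<lambda>j'. row (b \<star> p) j' + (if j' \<in> J - {j} then \<Sum>i'\<in>I - {i}. a i' \<star> g (i', j') else 0))"
        by (auto simp: R_def rowspan_def)
      \<comment> \<open>Subtracting the sum in advance makes the collected coefficient of the pivot
        row equal to \<open>b\<close>.\<close>
      define a' where "a' = a(i := b - (\<Sum>i'\<in>I - {i}. a i' * u i'))"
      have a': "a' \<in> I \<rightarrow> S" using a b u by (auto simp: a'_def intro!: S_diff S_sum S_mult)
      have eq: "(\<Sum>i'\<in>I - {i}. a' i' * u i') = (\<Sum>i'\<in>I - {i}. a i' * u i')"
        "\<And>j'. (\<Sum>i'\<in>I - {i}. a' i' \<star> g (i', j')) = (\<Sum>i'\<in>I - {i}. a i' \<star> g (i', j'))"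
        by (auto simp: a'_def intro!: sum.cong)
      have "v = (\<lambda>j'. if j' \<in> J then \<Sum>i'\<in>I. a' i' \<star> f (i', j') else 0)"
        unfolding lincomb[OF a'] v eq by (simp add: a'_def)
      with a' show "v \<in> rowspan I J f" by (auto simp: rowspan_def)
    qed
  qed
  have "inj_on (\<lambda>(z, w) j'. row z j' + w j') ((\<lambda>b. b \<star> p) ` S \<times> R)"
  proof (rule inj_onI, clarify)
    fix b w b' w'
    assume w: "w \<in> R" "w' \<in> R" and eq: "(\<lambda>j'. row (b \<star> p) j' + w j') = (\<lambda>j'. row (b' \<star> p) j' + w' j')"
    have "b \<star> p = b' \<star> p" using fun_cong[OF eq, of j] R_j[OF w(1)] R_j[OF w(2)] j by (simp add: row_def)
    with eq show "b \<star> p = b' \<star> p \<and> w = w'" by (auto simp: fun_eq_iff)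
  qed
  then show ?thesis
    unfolding span using card_orbit[OF p]
    by (simp add: card_image card_cartesian_product p_def R_def g_def)
qed

end

context divisible_module begin
subsection \<open>Ranks\<close>

lemma pivot_exists:
  assumes fin: "finite I" "finite J" and f: "f \<in> I \<times> J \<rightarrow> D" and nz: "\<exists>x\<in>I \<times> J. f x \<noteq> 0"
  obtains i j where "i \<in> I" "j \<in> J" "f (i, j) \<noteq> 0"
    "\<And>x. x \<in> I \<times> J \<Longrightarrow> ord (f x) \<le> ord (f (i, j))"
proof -
  let ?A = "(\<lambda>x. ord (f x)) ` (I \<times> J)"
  have A: "finite ?A" "?A \<noteq> {}" using fin nz by auto
  obtain x where x: "x \<in> I \<times> J" "Max ?A = ord (f x)" using Max_in[OF A] by auto
  have max: "ord (f y) \<le> ord (f x)" if "y \<in> I \<times> J" for y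
    using Max_ge[OF A(1), of "ord (f y)"] that x(2) by simp
  obtain y where y: "y \<in> I \<times> J" "f y \<noteq> 0" using nz by blast
  have "f x \<noteq> 0"
    using max[OF y(1)] y f x(1) ord_eq_0_iff[of "f y"] ord_eq_0_iff[of "f x"] by (auto simp: Pi_iff)
  with x max show ?thesis by (intro that[of "fst x" "snd x"]) auto
qed

lemma rowspan_eq_zero:
  assumes "\<And>x. x \<in> I \<times> J \<Longrightarrow> f x = 0"
  shows "rowspan I J f = {\<lambda>_. 0}"
proof -
  have "rowspan I J f = (\<lambda>a _. 0) ` (I \<rightarrow> S)"
    unfolding rowspan_def using assms
    by (intro image_cong refl ext) (auto intro!: sum.neutral simp: Pi_iff)
  moreover have "(\<lambda>_. 0) \<in> I \<rightarrow> S" by auto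
  ultimately show ?thesis by blast
qed

text \<open>The minimal number of generators of the row span \<open>M\<close>: its order divided by
  that of \<open>\<pi> M\<close> is \<open>q ^ r\<close>, where \<open>r\<close> is the dimension of
  \<open>M\<close> modulo \<open>\<pi> M\<close>. It is a relation because it takes elimination to
  see that this quotient is a power of \<open>q\<close>.\<close>

definition has_rank :: "'i set \<Rightarrow> 'j set \<Rightarrow> ('i \<times> 'j \<Rightarrow> 'd) \<Rightarrow> nat \<Rightarrow> bool" where
  "has_rank I J f r \<longleftrightarrow> card (rowspan I J f) = q ^ r * card (rowspan I J (\<lambda>x. \<pi> \<star> f x))"

text \<open>The same pivot and the same multipliers clear the column of \<open>f\<close> and that of
  its product with \<open>\<pi>\<close>. Only the order of the pivot changes, by exactly one since
  the pivot is nonzero, and this is the one factor \<open>q\<close> by which the two ranks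
  differ.\<close>

lemma has_rank_pivot:
  assumes fin: "finite I" "finite J" and f: "f \<in> I \<times> J \<rightarrow> D" and i: "i \<in> I" and j: "j \<in> J"
    and nz: "f (i, j) \<noteq> 0" and max: "\<And>x. x \<in> I \<times> J \<Longrightarrow> ord (f x) \<le> ord (f (i, j))"
    and u: "\<And>i'. i' \<in> I - {i} \<Longrightarrow> u i' \<in> S \<and> f (i', j) = u i' \<star> f (i, j)"
  shows "has_rank I J f (Suc r) \<longleftrightarrow>
    has_rank (I - {i}) (J - {j}) (\<lambda>(i', j'). f (i', j') - u i' \<star> f (i, j')) r"
proof -
  let ?g = "\<lambda>(i', j'). f (i', j') - u i' \<star> f (i, j')"
  have fij: "f (i, j) \<in> D" using f i j by auto
  have row: "\<exists>c\<in>S. f (i, j') = c \<star> f (i, j)" if "j' \<in> J" for j'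
    using that max[of "(i, j')"] i f fij by (intro in_orbitI) auto
  have row': "\<exists>c\<in>S. \<pi> \<star> f (i, j') = c \<star> \<pi> \<star> f (i, j)" if "j' \<in> J" for j'
    using row[OF that] act_commute[OF pi_S _ fij] by metis
  have u': "u i' \<in> S \<and> \<pi> \<star> f (i', j) = u i' \<star> \<pi> \<star> f (i, j)" if "i' \<in> I - {i}" for i'
    using u[OF that] act_commute[OF pi_S _ fij] by metis
  have pf: "(\<lambda>x. \<pi> \<star> f x) \<in> I \<times> J \<rightarrow> D" using f by auto
  have 1: "card (rowspan I J f) = q ^ ord (f (i, j)) * card (rowspan (I - {i}) (J - {j}) ?g)"
    using fin f i j u row by (rule card_rowspan_pivot)
  have "card (rowspan I J (\<lambda>x. \<pi> \<star> f x)) = q ^ ord (\<pi> \<star> f (i, j)) *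
      card (rowspan (I - {i}) (J - {j}) (\<lambda>(i', j'). \<pi> \<star> f (i', j') - u i' \<star> \<pi> \<star> f (i, j')))"
    using fin pf i j u' row' by (rule card_rowspan_pivot)
  moreover have "rowspan (I - {i}) (J - {j}) (\<lambda>(i', j'). \<pi> \<star> f (i', j') - u i' \<star> \<pi> \<star> f (i, j')) =
      rowspan (I - {i}) (J - {j}) (\<lambda>x. \<pi> \<star> ?g x)"
    using f i u by (intro rowspan_cong) (auto simp: act_diff_right act_closed act_commute[of \<pi>] Pi_iff)
  moreover have "ord (f (i, j)) = Suc (ord (\<pi> \<star> f (i, j)))"
    using ord_act_pi[OF fij] ord_eq_0_iff[OF fij] nz by simp
  ultimately show ?thesis
    using 1 q_ge_2 unfolding has_rank_def by auto
qed

text \<open>Elimination with an entry of largest order as pivot, of which all other entries are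
  multiples; each round splits off a row and a column. The clause for \<open>r = 0\<close> says that
  only the zero matrix has rank 0, which starts the recursion by rank.\<close>

lemma rank_exists:
  assumes "finite I" "finite J" "f \<in> I \<times> J \<rightarrow> D"
  shows "(\<exists>k. card (rowspan I J f) = q ^ k) \<and>
    (\<exists>r\<le>card I. r \<le> card J \<and> has_rank I J f r \<and> (r = 0 \<longrightarrow> (\<forall>x\<in>I \<times> J. f x = 0)))"
  using assms
proof (induction "card I" arbitrary: I J f)
  case 0
  then show ?case by (auto simp: rowspan_empty has_rank_def intro: exI[of _ 0])
next
  case (Suc n)
  show ?case
  proof (cases "\<exists>x\<in>I \<times> J. f x \<noteq> 0")
    case False
    then have "rowspan I J f = {\<lambda>_. 0}" "rowspan I J (\<lambda>x. \<pi> \<star> f x) = {\<lambda>_. 0}"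
      by (auto intro!: rowspan_eq_zero)
    with False show ?thesis by (auto simp: has_rank_def intro: exI[of _ 0])
  next
    case True
    obtain i j where ij: "i \<in> I" "j \<in> J" "f (i, j) \<noteq> 0"
      and max: "\<And>x. x \<in> I \<times> J \<Longrightarrow> ord (f x) \<le> ord (f (i, j))"
      using pivot_exists[OF Suc.prems True] by metis
    have orb: "\<exists>c\<in>S. f x = c \<star> f (i, j)" if "x \<in> I \<times> J" for x
      using that max[OF that] ij Suc.prems(3) by (intro in_orbitI) blast+
    then have "\<forall>i'\<in>I - {i}. \<exists>c. c \<in> S \<and> f (i', j) = c \<star> f (i, j)"
      using ij by blast
    then obtain u where u: "\<And>i'. i' \<in> I - {i} \<Longrightarrow> u i' \<in> S \<and> f (i', j) = u i' \<star> f (i, j)"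
      by metis
    let ?g = "\<lambda>(i', j'). f (i', j') - u i' \<star> f (i, j')"
    have g: "?g \<in> (I - {i}) \<times> (J - {j}) \<rightarrow> D"
      using Suc.prems u ij by (auto intro!: D_diff act_closed)
    have n: "n = card (I - {i})" using Suc ij by simp
    have IH: "\<exists>k. card (rowspan (I - {i}) (J - {j}) ?g) = q ^ k"
      "\<exists>r\<le>card (I - {i}). r \<le> card (J - {j}) \<and> has_rank (I - {i}) (J - {j}) ?g r"
      using Suc.hyps(1)[OF n _ _ g] Suc.prems by auto
    have "card (rowspan I J f) = q ^ ord (f (i, j)) * card (rowspan (I - {i}) (J - {j}) ?g)"
      using Suc.prems ij u orb by (intro card_rowspan_pivot) auto
    moreover obtain k where "card (rowspan (I - {i}) (J - {j}) ?g) = q ^ k" using IH by blast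
    ultimately have "card (rowspan I J f) = q ^ (ord (f (i, j)) + k)" by (simp add: power_add)
    moreover obtain r where r: "r \<le> card (I - {i})" "r \<le> card (J - {j})"
      "has_rank (I - {i}) (J - {j}) ?g r" using IH by blast
    have "has_rank I J f (Suc r) \<longleftrightarrow> has_rank (I - {i}) (J - {j}) ?g r"
      using Suc.prems ij max u by (intro has_rank_pivot) auto
    moreover have "Suc r \<le> card I" "Suc r \<le> card J"
      using r ij Suc.prems card_Suc_Diff1[of I i] card_Suc_Diff1[of J j] by auto
    ultimately show ?thesis using r by blast
  qed
qed

lemma card_rowspan_pos:
  "finite I \<Longrightarrow> finite J \<Longrightarrow> f \<in> I \<times> J \<rightarrow> D \<Longrightarrow> 0 < card (rowspan I J f)"
  using rank_exists[of I J f] q_ge_2 by auto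

lemma has_rank_unique:
  assumes "finite I" "finite J" "f \<in> I \<times> J \<rightarrow> D" "has_rank I J f r" "has_rank I J f s"
  shows "r = s"
proof -
  have "(\<lambda>x. \<pi> \<star> f x) \<in> I \<times> J \<rightarrow> D" using assms by auto
  then have "0 < card (rowspan I J (\<lambda>x. \<pi> \<star> f x))" using assms by (intro card_rowspan_pos)
  with assms(4,5) have "q ^ r = q ^ s" by (simp add: has_rank_def)
  then show ?thesis using q_ge_2 by simp
qed

end

section \<open>Counting functions on a disjoint union, and matrices of given rank over a finite
  field\<close>

lemma card_PiE_Un:
  assumes "finite X" "finite Y" "X \<inter> Y = {}" "\<And>x. x \<in> X \<union> Y \<Longrightarrow> finite (A x)"
  shows "card {f \<in> PiE (X \<union> Y) A. P f} =
    (\<Sum>g\<in>PiE X A. card {h \<in> PiE Y A. P (\<lambda>x. if x \<in> X then g x else h x)})"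
proof -
  let ?m = "\<lambda>(g, h) x. if x \<in> X then g x else h x"
  have "bij_betw ?m (SIGMA g:PiE X A. {h \<in> PiE Y A. P (?m (g, h))}) {f \<in> PiE (X \<union> Y) A. P f}"
  proof (rule bij_betw_byWitness[where f' = "\<lambda>f. (restrict f X, restrict f Y)"])
    show "\<forall>p\<in>SIGMA g:PiE X A. {h \<in> PiE Y A. P (?m (g, h))}.
        (restrict (?m p) X, restrict (?m p) Y) = p"
      using assms(3) by (auto simp: fun_eq_iff restrict_def PiE_iff extensional_def)
    show "\<forall>f\<in>{f \<in> PiE (X \<union> Y) A. P f}. ?m (restrict f X, restrict f Y) = f"
      by (auto simp: fun_eq_iff PiE_iff extensional_def)
    show "?m ` (SIGMA g:PiE X A. {h \<in> PiE Y A. P (?m (g, h))}) \<subseteq> {f \<in> PiE (X \<union> Y) A. P f}"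
      by (auto simp: PiE_iff extensional_def)
    have "?m (restrict f X, restrict f Y) = f" if "f \<in> PiE (X \<union> Y) A" for f
      using that by (auto simp: fun_eq_iff PiE_iff extensional_def)
    then show "(\<lambda>f. (restrict f X, restrict f Y)) ` {f \<in> PiE (X \<union> Y) A. P f}
        \<subseteq> (SIGMA g:PiE X A. {h \<in> PiE Y A. P (?m (g, h))})"
      by (auto simp: PiE_iff)
  qed
  then have "card {f \<in> PiE (X \<union> Y) A. P f} = card (SIGMA g:PiE X A. {h \<in> PiE Y A. P (?m (g, h))})"
    by (simp add: bij_betw_same_card)
  also have "\<dots> = (\<Sum>g\<in>PiE X A. card {h \<in> PiE Y A. P (?m (g, h))})"
    using assms finite_PiE[of Y A] by (intro card_SigmaI) (auto intro!: finite_PiE)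
  finally show ?thesis by simp
qed

lemma sum_if_const:
  "finite A \<Longrightarrow> (\<Sum>x\<in>A. if P x then c else 0) = (c::nat) * card {x \<in> A. P x}"
  by (simp add: sum.inter_filter[symmetric])

lemma image_times_left: "(\<lambda>(z, w). F z w) ` (g ` S \<times> B) = (\<lambda>(b, w). F (g b) w) ` (S \<times> B)"
  by force

text \<open>The number of \<open>m\<close> by \<open>n\<close> matrices of rank \<open>r\<close>
  over a field with \<open>q\<close> elements, built row by row: a new row lies in the span of the
  others, for which there are \<open>q ^ r\<close> choices, or it raises the rank. The truncated
  difference is correctly 0 if \<open>r - 1 \<ge> n\<close>.\<close>

fun rank_count :: "nat \<Rightarrow> nat \<Rightarrow> nat \<Rightarrow> nat \<Rightarrow> nat" where
  "rank_count q 0 n r = (if r = 0 then 1 else 0)"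
| "rank_count q (Suc m) n r =
    q ^ r * rank_count q m n r + (if r = 0 then 0 else (q ^ n - q ^ (r - 1)) * rank_count q m n (r - 1))"

context divisible_module begin

subsection \<open>Counting matrices over the socle\<close>

definition socle :: "'d set" where
  "socle = {x \<in> D. \<pi> \<star> x = 0}"

lemma card_socle: "card socle = q" and finite_socle: "finite socle"
  using card_killed[of 1] by (simp_all add: socle_def)

lemma zero_in_socle: "0 \<in> socle" by (simp add: socle_def)

lemma socle_D: "x \<in> socle \<Longrightarrow> x \<in> D" by (simp add: socle_def)

lemma act_socle: "a \<in> S \<Longrightarrow> x \<in> socle \<Longrightarrow> a \<star> x \<in> socle"
  by (auto simp: socle_def act_closed act_commute[of \<pi>])

text \<open>The ring acts on the socle through a field.\<close>
lemma socle_inverse: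
  assumes a: "a \<in> S" and x: "x \<in> socle" "a \<star> x \<noteq> 0"
  obtains b where "b \<in> S" "\<And>y. y \<in> socle \<Longrightarrow> b \<star> a \<star> y = y"
proof -
  obtain b where b: "b \<in> S" "x = b \<star> a \<star> x"
    using simple_socle[of "a \<star> x" x] act_socle[OF a x(1)] x by (auto simp: socle_def)
  have "b \<star> a \<star> y = y" if y: "y \<in> socle" for y
  proof -
    have "x \<noteq> 0" using x a by auto
    then obtain c where c: "c \<in> S" "y = c \<star> x"
      using simple_socle[of x y] x y by (auto simp: socle_def)
    have "b \<star> a \<star> c \<star> x = c \<star> b \<star> a \<star> x"
      using a b(1) c(1) socle_D[OF x(1)] act_commute[of a c x] act_commute[of b c "a \<star> x"] act_closed[of a x]
      by simp
    with b c show ?thesis by simp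
  qed
  with b(1) show ?thesis by (rule that)
qed

text \<open>Linear algebra over the residue field, which acts on the socle: a nonzero row has
  \<open>q\<close> multiples, and unless the row lies in the span of the others, these meet the span
  only in 0.\<close>

lemma card_rowspan_add_row:
  assumes fin: "finite I" "finite J" and i: "i \<notin> I" and f: "f \<in> insert i I \<times> J \<rightarrow> socle"
  shows "card (rowspan (insert i I) J f) =
    (if (\<lambda>j. if j \<in> J then f (i, j) else 0) \<in> rowspan I J f then 1 else q) * card (rowspan I J f)"
proof -
  define v where "v = (\<lambda>j. if j \<in> J then f (i, j) else 0)"
  define B where "B = rowspan I J f"
  have f': "f \<in> I \<times> J \<rightarrow> D" using f by (auto simp: socle_def Pi_iff)
  have v: "v j \<in> socle" for j using f by (auto simp: v_def zero_in_socle)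
  have v_D: "v j \<in> D" for j using v[of j] by (rule socle_D)
  define A where "A = (\<lambda>b j. b \<star> v j) ` S"
  have A: "rowspan (insert i I) J f = (\<lambda>(z, w) j. z j + w j) ` (A \<times> B)"
  proof -
    have "(\<lambda>j. if j \<in> J then b \<star> f (i, j) else 0) = (\<lambda>j. b \<star> v j)" if "b \<in> S" for b
      using that by (auto simp: v_def)
    then have "rowspan (insert i I) J f = (\<lambda>(b, w) j. b \<star> v j + w j) ` (S \<times> B)"
      unfolding rowspan_insert[OF fin(1) i] B_def
      by (intro image_cong refl) (auto simp: fun_eq_iff)
    then show ?thesis
      unfolding A_def image_times_left by simp
  qed
  show ?thesis
  proof (cases "v \<in> B")
    case True
    have "z \<in> B" if "z \<in> A" for z
      using that True rowspan_act[OF f'] by (auto simp: A_def B_def)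
    then have "rowspan (insert i I) J f \<subseteq> B"
      unfolding A using rowspan_add[OF f'] by (auto simp: B_def)
    moreover have "w \<in> rowspan (insert i I) J f" if "w \<in> B" for w
    proof -
      have "(\<lambda>_. 0) \<in> A" unfolding A_def using v_D by (intro image_eqI[of _ _ 0]) auto
      with that show ?thesis unfolding A by (intro image_eqI[of _ _ "(\<lambda>_. 0, w)"]) auto
    qed
    ultimately have "rowspan (insert i I) J f = B" by auto
    with True show ?thesis by (simp add: B_def v_def)
  next
    case False
    have "inj_on (\<lambda>(z, w) j. z j + w j) (A \<times> B)"
    proof (rule inj_onI, clarify)
      fix z w z' w' assume z: "z \<in> A" "z' \<in> A" and w: "w \<in> B" "w' \<in> B"
        and eq: "(\<lambda>j. z j + w j) = (\<lambda>j. z' j + w' j)"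
      obtain b b' where b: "b \<in> S" "b' \<in> S" and zb: "z = (\<lambda>j. b \<star> v j)" "z' = (\<lambda>j. b' \<star> v j)"
        using z by (auto simp: A_def)
      have "(\<lambda>j. w' j - w j) \<in> B" using w rowspan_minus[OF f'] by (simp add: B_def)
      moreover have "(\<lambda>j. w' j - w j) = (\<lambda>j. (b - b') \<star> v j)"
        using fun_cong[OF eq] b v_D by (auto simp: zb act_diff_left fun_eq_iff algebra_simps)
      ultimately have in_B: "(\<lambda>j. (b - b') \<star> v j) \<in> B" by simp
      \<comment> \<open>Otherwise the scalar is invertible on the socle, and \<open>v\<close> itself
        would lie in \<open>B\<close>.\<close>
      have "(b - b') \<star> v j = 0" for j
      proof (rule ccontr)
        assume "(b - b') \<star> v j \<noteq> 0"
        then obtain c where "c \<in> S" and c: "\<And>y. y \<in> socle \<Longrightarrow> c \<star> (b - b') \<star> y = y"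
          using socle_inverse[OF S_diff[OF b] v] by metis
        then have "(\<lambda>j. c \<star> (b - b') \<star> v j) \<in> B"
          using rowspan_act[OF f'] in_B by (simp add: B_def)
        then show False using c[OF v] False by simp
      qed
      then have "z = z'" using b v_D by (auto simp: zb fun_eq_iff act_diff_left)
      with eq show "z = z' \<and> w = w'" by (auto simp: fun_eq_iff)
    qed
    then have "card (rowspan (insert i I) J f) = card A * card B"
      unfolding A by (simp add: card_image card_cartesian_product)
    moreover have "card A = q"
    proof -
      have "v \<noteq> (\<lambda>_. 0)" using False zero_in_rowspan[OF f'] by (auto simp: B_def)
      then obtain j where j: "v j \<noteq> 0" by auto
      have "bij_betw (\<lambda>z. z j) A ((\<lambda>b. b \<star> v j) ` S)"
      proof (rule bij_betw_imageI)
        show "inj_on (\<lambda>z. z j) A"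
        proof (rule inj_onI)
          fix z z' assume z: "z \<in> A" "z' \<in> A" and eq: "z j = z' j"
          obtain b b' where b: "b \<in> S" "b' \<in> S" and zb: "z = (\<lambda>j. b \<star> v j)" "z' = (\<lambda>j. b' \<star> v j)"
            using z by (auto simp: A_def)
          \<comment> \<open>A scalar that kills the nonzero entry \<open>v j\<close> kills the whole
            socle, so a multiple of \<open>v\<close> is determined by its \<open>j\<close>-th
            entry.\<close>
          have "(b - b') \<star> v k = 0" for k
          proof (rule ccontr)
            assume "(b - b') \<star> v k \<noteq> 0"
            then obtain c where c: "c \<in> S" "\<And>y. y \<in> socle \<Longrightarrow> c \<star> (b - b') \<star> y = y"
              using socle_inverse[OF S_diff[OF b] v] by metis
            have "(b - b') \<star> v j = 0" using eq b v_D by (simp add: zb act_diff_left)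
            then show False using c(2)[OF v, of j] c(1) j by simp
          qed
          then show "z = z'" using b v_D by (auto simp: zb fun_eq_iff act_diff_left)
        qed
        show "(\<lambda>z. z j) ` A = (\<lambda>b. b \<star> v j) ` S" by (auto simp: A_def)
      qed
      then have "card A = q ^ ord (v j)" using card_orbit[OF v_D] bij_betw_same_card by metis
      moreover have "ord (v j) \<le> 1" using v[of j] ord_le[of 1 "v j"] by (simp add: socle_def)
      moreover have "ord (v j) \<noteq> 0" using j ord_eq_0_iff[OF v_D] by simp
      ultimately show ?thesis by (simp add: le_Suc_eq)
    qed
    ultimately show ?thesis using False by (simp add: B_def v_def)
  qed
qed

text \<open>Over the socle the row span is a vector space over the residue field, and the exponent
  of its order is the rank. The induction over the rows is that of
  \<open>rank_count\<close>.\<close>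

lemma card_socle_rank:
  assumes "finite I" "finite J"
  shows "card {f \<in> I \<times> J \<rightarrow>\<^sub>E socle. card (rowspan I J f) = q ^ r} = rank_count q (card I) (card J) r"
  using assms(1)
proof (induction I arbitrary: r rule: finite_induct)
  case empty
  have "Suc 0 = q ^ r \<longleftrightarrow> r = 0"
    using q_ge_2 nat_power_eq_Suc_0_iff[of q r] eq_commute[of "Suc 0" "q ^ r"] by auto
  then show ?case by (simp add: rowspan_empty)
next
  case (insert i I)
  let ?X = "{i} \<times> J" and ?Y = "I \<times> J"
  let ?m = "\<lambda>h g x. if x \<in> ?Y then h x else g x"
  have split: "insert i I \<times> J = ?Y \<union> ?X" by auto
  have count: "card {g \<in> ?X \<rightarrow>\<^sub>E socle. card (rowspan (insert i I) J (?m h g)) = q ^ r} =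
      (if card (rowspan I J h) = q ^ r then q ^ r else 0) +
      (if r \<noteq> 0 \<and> card (rowspan I J h) = q ^ (r - 1) then q ^ card J - q ^ (r - 1) else 0)"
    if h: "h \<in> ?Y \<rightarrow>\<^sub>E socle" for h
  proof -
    define B where "B = rowspan I J h"
    define V where "V = {v. (\<forall>j\<in>J. v j \<in> socle) \<and> (\<forall>j. j \<notin> J \<longrightarrow> v j = 0)}"
    define vec where "vec g = (\<lambda>j. if j \<in> J then g (i, j) else 0)" for g :: "'a \<times> 'b \<Rightarrow> 'd"
    have h_D: "h \<in> I \<times> J \<rightarrow> D" using h by (auto simp: PiE_iff socle_def)
    have bij: "bij_betw vec (?X \<rightarrow>\<^sub>E socle) V"
      by (rule bij_betw_byWitness[where f' = "\<lambda>v. restrict (\<lambda>(_, j). v j) ?X"])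
         (auto simp: vec_def V_def PiE_iff extensional_def fun_eq_iff split: if_splits)
    have "card (?X \<rightarrow>\<^sub>E socle) = q ^ card J"
      using insert assms(2) by (simp add: card_PiE card_socle card_cartesian_product)
    then have card_V: "card V = q ^ card J" using bij_betw_same_card[OF bij] by simp
    have fin_V: "finite V"
      using bij_betw_finite[OF bij] assms(2) finite_socle by (auto intro!: finite_PiE)
    have "B \<subseteq> V"
    proof
      fix v assume "v \<in> B"
      then obtain a where a: "a \<in> I \<rightarrow> S" "v = (\<lambda>j. if j \<in> J then \<Sum>i\<in>I. a i \<star> h (i, j) else 0)"
        by (auto simp: B_def rowspan_def)
      have "\<pi> \<star> (\<Sum>i\<in>I. a i \<star> h (i, j)) = 0" if "j \<in> J" for j
        using that a h act_socle
        by (subst act_sum_right) (auto simp: PiE_iff socle_def Pi_iff intro!: sum.neutral)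
      with a show "v \<in> V" using h_D
        by (auto simp: V_def socle_def intro!: D_sum act_closed)
    qed
    have card_m: "card (rowspan (insert i I) J (?m h g)) = (if vec g \<in> B then 1 else q) * card B"
      if g: "g \<in> ?X \<rightarrow>\<^sub>E socle" for g
    proof -
      have "rowspan I J (?m h g) = B" unfolding B_def by (intro rowspan_cong) auto
      moreover have "(\<lambda>j. if j \<in> J then ?m h g (i, j) else 0) = vec g"
        using insert by (auto simp: vec_def)
      moreover have "?m h g \<in> insert i I \<times> J \<rightarrow> socle" using h g by auto
      ultimately show ?thesis using card_rowspan_add_row[OF insert(1) assms(2) insert(2), of "?m h g"] by simp
    qed
    obtain s where s: "card B = q ^ s" using rank_exists[OF insert(1) assms(2) h_D] by (auto simp: B_def)
    have "card {g \<in> ?X \<rightarrow>\<^sub>E socle. card (rowspan (insert i I) J (?m h g)) = q ^ r} =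
        card {g \<in> ?X \<rightarrow>\<^sub>E socle. (if vec g \<in> B then s else Suc s) = r}"
    proof (rule arg_cong[where f = card], intro Collect_cong conj_cong refl)
      fix g assume "g \<in> ?X \<rightarrow>\<^sub>E socle"
      then show "card (rowspan (insert i I) J (?m h g)) = q ^ r \<longleftrightarrow> (if vec g \<in> B then s else Suc s) = r"
        using card_m[of g] q_ge_2 by (auto simp: s simp flip: power_Suc)
    qed
    also have "\<dots> = card {v \<in> V. (if v \<in> B then s else Suc s) = r}"
      using bij by (intro bij_betw_same_card[of vec]) (auto simp: bij_betw_def inj_on_def)
    \<comment> \<open>Rows in the span keep the exponent \<open>s\<close>, and all other rows raise
      it by one.\<close>
    also have "{v \<in> V. (if v \<in> B then s else Suc s) = r} =
        (if r = s then B else {}) \<union> (if r = Suc s then V - B else {})"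
      using \<open>B \<subseteq> V\<close> by auto
    also have "card \<dots> = (if r = s then q ^ r else 0) + (if r = Suc s then q ^ card J - q ^ s else 0)"
      using fin_V \<open>B \<subseteq> V\<close> s card_V card_Diff_subset[of B V] finite_subset[of B V] by simp
    also have "\<dots> = (if s = r then q ^ r else 0) + (if r \<noteq> 0 \<and> s = r - 1 then q ^ card J - q ^ (r - 1) else 0)"
      by (cases r) auto
    moreover have "card (rowspan I J h) = q ^ k \<longleftrightarrow> s = k" for k
      using s q_ge_2 by (simp add: B_def)
    ultimately show ?thesis by (simp only:)
  qed
  have fin_h: "finite (?Y \<rightarrow>\<^sub>E socle)" using insert assms(2) finite_socle by (intro finite_PiE) auto
  have "card {f \<in> insert i I \<times> J \<rightarrow>\<^sub>E socle. card (rowspan (insert i I) J f) = q ^ r} =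
      (\<Sum>h\<in>?Y \<rightarrow>\<^sub>E socle. card {g \<in> ?X \<rightarrow>\<^sub>E socle. card (rowspan (insert i I) J (?m h g)) = q ^ r})"
    unfolding split using insert assms(2) finite_socle by (intro card_PiE_Un) auto
  also have "\<dots> = (\<Sum>h\<in>?Y \<rightarrow>\<^sub>E socle. (if card (rowspan I J h) = q ^ r then q ^ r else 0)) +
      (\<Sum>h\<in>?Y \<rightarrow>\<^sub>E socle. if r \<noteq> 0 \<and> card (rowspan I J h) = q ^ (r - 1) then q ^ card J - q ^ (r - 1) else 0)"
    by (simp add: count sum.distrib)
  also have "(\<Sum>h\<in>?Y \<rightarrow>\<^sub>E socle. (if card (rowspan I J h) = q ^ r then q ^ r else 0)) =
      q ^ r * card {h \<in> ?Y \<rightarrow>\<^sub>E socle. card (rowspan I J h) = q ^ r}"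
    using fin_h by (simp add: sum_if_const)
  also have "(\<Sum>h\<in>?Y \<rightarrow>\<^sub>E socle. if r \<noteq> 0 \<and> card (rowspan I J h) = q ^ (r - 1) then q ^ card J - q ^ (r - 1) else 0) =
      (if r = 0 then 0 else (q ^ card J - q ^ (r - 1)) * card {h \<in> ?Y \<rightarrow>\<^sub>E socle. card (rowspan I J h) = q ^ (r - 1)})"
    using fin_h by (simp add: sum_if_const)
  finally show ?case using insert by simp
qed

subsection \<open>Counting division by the uniformizer\<close>

lemma finite_PiE_fibre:
  "finite X \<Longrightarrow> (\<And>x. x \<in> X \<Longrightarrow> \<psi> x \<in> D) \<Longrightarrow> finite (PiE X (\<lambda>x. {y \<in> D. \<pi> \<star> y = \<psi> x}))"
  by (intro finite_PiE finite_fibre) auto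

text \<open>Elimination along a pivot of \<open>\<psi>\<close>. The entries of \<open>f\<close> in
  the pivot row and the pivot column are arbitrary preimages, which gives
  \<open>q ^ (card I + card J - 1)\<close> choices, and clearing maps the remaining entries
  bijectively to the preimages of the cleared matrix. After \<open>s\<close> rounds
  \<open>\<psi>\<close> has become 0, and the matrices of rank \<open>r - s\<close> over the socle
  remain. The exponents add up to \<open>s * (card I + card J - s)\<close>.\<close>

theorem card_rank_fibre:
  assumes "finite I" "finite J" "\<psi> \<in> I \<times> J \<rightarrow> D" "has_rank I J \<psi> s"
  shows "card {f \<in> PiE (I \<times> J) (\<lambda>x. {y \<in> D. \<pi> \<star> y = \<psi> x}).
      card (rowspan I J f) = q ^ r * card (rowspan I J \<psi>)} =
    (if s \<le> r then q ^ (s * (card I + card J - s)) * rank_count q (card I - s) (card J - s) (r - s) else 0)"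
  using assms
proof (induction "card I" arbitrary: I J \<psi> r s rule: less_induct)
  case less
  show ?case
  proof (cases "\<exists>x\<in>I \<times> J. \<psi> x \<noteq> 0")
    case False
    then have zero: "rowspan I J \<psi> = {\<lambda>_. 0}" "rowspan I J (\<lambda>x. \<pi> \<star> \<psi> x) = {\<lambda>_. 0}"
      by (auto intro!: rowspan_eq_zero)
    then have "has_rank I J \<psi> 0" by (simp add: has_rank_def)
    then have s: "s = 0" by (rule has_rank_unique[OF less.prems])
    have "PiE (I \<times> J) (\<lambda>x. {y \<in> D. \<pi> \<star> y = \<psi> x}) = I \<times> J \<rightarrow>\<^sub>E socle"
      using False by (intro PiE_cong) (auto simp: socle_def)
    then show ?thesis
      using s card_socle_rank[OF less.prems(1,2), of r] zero by simp
  next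
    case True
    note fin = less.prems(1,2) and psi = less.prems(3)
    obtain i j where ij: "i \<in> I" "j \<in> J" "\<psi> (i, j) \<noteq> 0"
      and max: "\<And>x. x \<in> I \<times> J \<Longrightarrow> ord (\<psi> x) \<le> ord (\<psi> (i, j))"
      using pivot_exists[OF fin psi True] by metis
    define A where "A x = {y \<in> D. \<pi> \<star> y = \<psi> x}" for x
    define X where "X = {i} \<times> J \<union> (I - {i}) \<times> {j}"
    define Y where "Y = (I - {i}) \<times> (J - {j})"
    have XY: "I \<times> J = X \<union> Y" "X \<inter> Y = {}" "finite X" "finite Y"
      using ij fin by (auto simp: X_def Y_def)
    have cards: "card (I - {i}) = card I - 1" "card (J - {j}) = card J - 1" "1 \<le> card I" "1 \<le> card J"
      using ij fin by (auto simp: Suc_le_eq card_gt_0_iff)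
    have "card X = card ({i} \<times> J) + card ((I - {i}) \<times> {j})"
      unfolding X_def using fin by (intro card_Un_disjoint) auto
    then have "card X = card I + card J - 1" using cards by (simp add: card_cartesian_product)
    moreover have "card (PiE X A) = (\<Prod>x\<in>X. q)"
      unfolding card_PiE[OF XY(3)] A_def
    proof (intro prod.cong refl card_fibre)
      fix x assume "x \<in> X"
      then have "x \<in> I \<times> J" using XY(1) by blast
      with psi show "\<psi> x \<in> D" by blast
    qed
    ultimately have card_PiE_X: "card (PiE X A) = q ^ (card I + card J - 1)" by simp
    have fin_A: "finite (A x)" if "x \<in> X \<union> Y" for x
      using that psi unfolding A_def XY(1)[symmetric] by (intro finite_fibre) auto
    obtain s' where s': "s = Suc s'"
    proof -
      have "s \<noteq> 0" using rank_exists[OF fin psi] has_rank_unique[OF fin psi less.prems(4)] True by auto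
      then show ?thesis using that by (cases s) auto
    qed
    define c where "c = (if s \<le> r then q ^ (s' * (card I - 1 + (card J - 1) - s')) *
      rank_count q (card I - 1 - s') (card J - 1 - s') (r - s) else 0)"
    have main: "card {h \<in> PiE Y A. card (rowspan I J (\<lambda>x. if x \<in> X then g x else h x)) =
        q ^ r * card (rowspan I J \<psi>)} = c"
      if g: "g \<in> PiE X A" for g
    proof -
      \<comment> \<open>A pivot of \<open>\<psi>\<close> stays a pivot for every choice of preimages
        on the cross \<open>X\<close>: orders fall by exactly one under \<open>\<pi>\<close>, except
        at 0, and \<open>g (i, j)\<close> is not 0.\<close>
      have gX: "g x \<in> D \<and> \<pi> \<star> g x = \<psi> x \<and> ord (g x) \<le> ord (g (i, j))" if "x \<in> X" for x
      proof -
        have "(i, j) \<in> X" using ij by (auto simp: X_def)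
        with g that have "g x \<in> D" "\<pi> \<star> g x = \<psi> x" "g (i, j) \<in> D" "\<pi> \<star> g (i, j) = \<psi> (i, j)"
          by (auto simp: A_def PiE_iff)
        moreover from this have "ord (g x) - 1 \<le> ord (g (i, j)) - 1"
          using max[of x] that XY(1) ord_act_pi[of "g x"] ord_act_pi[of "g (i, j)"] by auto
        moreover have "g (i, j) \<noteq> 0" using \<open>\<pi> \<star> g (i, j) = \<psi> (i, j)\<close> ij by auto
        ultimately show ?thesis using ord_eq_0_iff[of "g (i, j)"] by auto
      qed
      have ijX: "(i, j) \<in> X" "\<And>i'. i' \<in> I - {i} \<Longrightarrow> (i', j) \<in> X" "\<And>j'. j' \<in> J \<Longrightarrow> (i, j') \<in> X"
        using ij by (auto simp: X_def)
      have orb: "\<exists>c\<in>S. g x = c \<star> g (i, j)" if "x \<in> X" for x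
        using gX[OF that] gX[OF ijX(1)] by (intro in_orbitI) auto
      then have "\<forall>i'\<in>I - {i}. \<exists>c. c \<in> S \<and> g (i', j) = c \<star> g (i, j)"
        using ijX by blast
      then obtain u where u: "\<And>i'. i' \<in> I - {i} \<Longrightarrow> u i' \<in> S \<and> g (i', j) = u i' \<star> g (i, j)"
        by metis
      \<comment> \<open>The multipliers that clear the column of \<open>f\<close> also clear that of
        \<open>\<psi>\<close>, so clearing commutes with the action of \<open>\<pi>\<close>. They
        depend on \<open>g\<close>, but the resulting count \<open>c\<close> does not.\<close>
      have u_psi: "u i' \<in> S \<and> \<psi> (i', j) = u i' \<star> \<psi> (i, j)" if "i' \<in> I - {i}" for i'
        using u[OF that] gX[OF ijX(1)] gX[OF ijX(2)[OF that]] act_commute[of \<pi> "u i'" "g (i, j)"] by auto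
      define \<psi>' where "\<psi>' = (\<lambda>(i', j'). \<psi> (i', j') - u i' \<star> \<psi> (i, j'))"
      define A' where "A' x = {y \<in> D. \<pi> \<star> y = \<psi>' x}" for x
      define shift where "shift h = restrict (\<lambda>(i', j'). h (i', j') - u i' \<star> g (i, j')) Y" for h
      have psi': "\<psi>' \<in> (I - {i}) \<times> (J - {j}) \<rightarrow> D"
        using psi u ij by (auto simp: \<psi>'_def intro!: D_diff act_closed)
      have ug: "u i' \<star> g (i, j') \<in> D \<and> \<pi> \<star> u i' \<star> g (i, j') = u i' \<star> \<psi> (i, j')"
        if "(i', j') \<in> Y" for i' j'
      proof -
        have *: "u i' \<in> S" "g (i, j') \<in> D" "\<pi> \<star> g (i, j') = \<psi> (i, j')"
          using that u[of i'] gX[of "(i, j')"] ijX(3)[of j'] by (auto simp: Y_def)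
        then show ?thesis using act_commute[of \<pi> "u i'" "g (i, j')"] by auto
      qed
      have bij: "bij_betw shift (PiE Y A) (PiE Y A')"
      proof (rule bij_betw_byWitness[where f' = "\<lambda>h. restrict (\<lambda>(i', j'). h (i', j') + u i' \<star> g (i, j')) Y"])
        show "\<forall>h\<in>PiE Y A. restrict (\<lambda>(i', j'). shift h (i', j') + u i' \<star> g (i, j')) Y = h"
          by (auto simp: shift_def fun_eq_iff PiE_iff extensional_def)
        show "\<forall>h\<in>PiE Y A'. shift (restrict (\<lambda>(i', j'). h (i', j') + u i' \<star> g (i, j')) Y) = h"
          by (auto simp: shift_def fun_eq_iff PiE_iff extensional_def)
        show "shift ` PiE Y A \<subseteq> PiE Y A'"
        proof (rule image_subsetI, rule PiE_I)
          fix h x assume h: "h \<in> PiE Y A" and x: "x \<in> Y"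
          obtain i' j' where x_eq: "x = (i', j')" by force
          have "h x \<in> D" "\<pi> \<star> h x = \<psi> x" using h x by (auto simp: A_def)
          with x ug[of i' j'] show "shift h x \<in> A' x"
            by (auto simp: shift_def A'_def \<psi>'_def x_eq act_diff_right)
        qed (auto simp: shift_def)
        show "(\<lambda>h. restrict (\<lambda>(i', j'). h (i', j') + u i' \<star> g (i, j')) Y) ` PiE Y A' \<subseteq> PiE Y A"
        proof (rule image_subsetI, rule PiE_I)
          fix h x assume h: "h \<in> PiE Y A'" and x: "x \<in> Y"
          obtain i' j' where x_eq: "x = (i', j')" by force
          have "h x \<in> D" "\<pi> \<star> h x = \<psi>' x" using h x by (auto simp: A'_def)
          with x ug[of i' j'] show "restrict (\<lambda>(i', j'). h (i', j') + u i' \<star> g (i, j')) Y x \<in> A x"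
            by (auto simp: A_def \<psi>'_def x_eq act_add_right)
        qed auto
      qed
      have rank': "has_rank (I - {i}) (J - {j}) \<psi>' s'"
        using has_rank_pivot[OF fin psi ij max u_psi, of s'] less.prems(4) by (simp add: s' \<psi>'_def)
      have card_psi: "card (rowspan I J \<psi>) = q ^ ord (\<psi> (i, j)) * card (rowspan (I - {i}) (J - {j}) \<psi>')"
        unfolding \<psi>'_def
      proof (rule card_rowspan_pivot[OF fin psi ij(1,2) u_psi])
        fix j' assume "j' \<in> J"
        then show "\<exists>c\<in>S. \<psi> (i, j') = c \<star> \<psi> (i, j)"
          using max[of "(i, j')"] psi ij by (intro in_orbitI) auto
      qed
      have step: "card (rowspan I J (\<lambda>x. if x \<in> X then g x else h x)) = q ^ r * card (rowspan I J \<psi>) \<longleftrightarrow>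
          r \<noteq> 0 \<and> card (rowspan (I - {i}) (J - {j}) (shift h)) = q ^ (r - 1) * card (rowspan (I - {i}) (J - {j}) \<psi>')"
        if h: "h \<in> PiE Y A" for h
      proof -
        let ?f = "\<lambda>x. if x \<in> X then g x else h x"
        have f: "?f \<in> I \<times> J \<rightarrow> D"
        proof
          fix x assume "x \<in> I \<times> J"
          then show "?f x \<in> D" using XY(1) gX[of x] h by (auto simp: A_def)
        qed
        have row: "\<exists>c\<in>S. ?f (i, j') = c \<star> ?f (i, j)" if "j' \<in> J" for j'
          using orb[OF ijX(3)[OF that]] ijX(1) ijX(3)[OF that] by simp
        have col: "u i' \<in> S \<and> ?f (i', j) = u i' \<star> ?f (i, j)" if "i' \<in> I - {i}" for i'
          using u[OF that] ijX(1) ijX(2)[OF that] by simp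
        have 1: "card (rowspan I J ?f) = q ^ ord (?f (i, j)) *
            card (rowspan (I - {i}) (J - {j}) (\<lambda>(i', j'). ?f (i', j') - u i' \<star> ?f (i, j')))"
          using fin f ij(1,2) col row by (rule card_rowspan_pivot)
        have 2: "rowspan (I - {i}) (J - {j}) (\<lambda>(i', j'). ?f (i', j') - u i' \<star> ?f (i, j')) =
            rowspan (I - {i}) (J - {j}) (shift h)"
        proof (intro rowspan_cong)
          fix i' j' assume "i' \<in> I - {i}" "j' \<in> J - {j}"
          then have "(i', j') \<in> Y" "(i', j') \<notin> X" "(i, j') \<in> X" using XY(2) ijX(3) by (auto simp: Y_def)
          then show "(\<lambda>(i', j'). ?f (i', j') - u i' \<star> ?f (i, j')) (i', j') = shift h (i', j')"
            by (simp add: shift_def)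
        qed
        have 3: "ord (g (i, j)) = Suc (ord (\<psi> (i, j)))"
        proof -
          have *: "g (i, j) \<in> D" "\<pi> \<star> g (i, j) = \<psi> (i, j)" using gX[OF ijX(1)] by auto
          moreover have "g (i, j) \<noteq> 0" using * ij by auto
          ultimately show ?thesis
            using ord_act_pi[of "g (i, j)"] ord_eq_0_iff[of "g (i, j)"] by simp
        qed
        have sh: "shift h \<in> PiE Y A'" using bij h by (auto simp: bij_betw_def)
        have sh_D: "shift h \<in> (I - {i}) \<times> (J - {j}) \<rightarrow> D"
          using sh by (auto simp: A'_def Y_def PiE_iff)
        obtain t where t: "has_rank (I - {i}) (J - {j}) (shift h) t"
          using rank_exists[OF _ _ sh_D] fin by auto
        have "rowspan (I - {i}) (J - {j}) (\<lambda>x. \<pi> \<star> shift h x) = rowspan (I - {i}) (J - {j}) \<psi>'"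
          using sh by (intro rowspan_cong) (auto simp: A'_def Y_def PiE_iff)
        with t have card_sh: "card (rowspan (I - {i}) (J - {j}) (shift h)) = q ^ t * card (rowspan (I - {i}) (J - {j}) \<psi>')"
          by (simp add: has_rank_def)
        define C where "C = card (rowspan (I - {i}) (J - {j}) \<psi>')"
        have "C > 0" unfolding C_def using fin psi' by (intro card_rowspan_pos) auto
        have "card (rowspan I J ?f) = q ^ r * card (rowspan I J \<psi>) \<longleftrightarrow>
            q ^ Suc (ord (\<psi> (i, j)) + t) * C = q ^ (r + ord (\<psi> (i, j))) * C"
          using 1 2 3 card_sh card_psi ijX(1) by (simp add: power_add mult_ac C_def)
        also have "\<dots> \<longleftrightarrow> Suc t = r" using \<open>C > 0\<close> q_ge_2 by (simp del: power_Suc)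
        also have "\<dots> \<longleftrightarrow> r \<noteq> 0 \<and> q ^ t * C = q ^ (r - 1) * C"
          using \<open>C > 0\<close> q_ge_2 by auto
        finally show ?thesis using card_sh by (simp add: C_def)
      qed
      have "card {h \<in> PiE Y A. card (rowspan I J (\<lambda>x. if x \<in> X then g x else h x)) =
          q ^ r * card (rowspan I J \<psi>)} =
        card {h \<in> PiE Y A. r \<noteq> 0 \<and> card (rowspan (I - {i}) (J - {j}) (shift h)) =
          q ^ (r - 1) * card (rowspan (I - {i}) (J - {j}) \<psi>')}"
        using step by (intro arg_cong[where f = card] Collect_cong conj_cong refl) auto
      also have "\<dots> = card {h \<in> PiE Y A'. r \<noteq> 0 \<and> card (rowspan (I - {i}) (J - {j}) h) =
          q ^ (r - 1) * card (rowspan (I - {i}) (J - {j}) \<psi>')}"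
        using bij by (intro bij_betw_same_card[of shift]) (auto simp: bij_betw_def inj_on_def)
      also have "\<dots> = c"
      proof (cases r)
        case 0
        then show ?thesis by (simp add: c_def s')
      next
        case (Suc r')
        have "card {h \<in> PiE Y A'. card (rowspan (I - {i}) (J - {j}) h) =
          q ^ r' * card (rowspan (I - {i}) (J - {j}) \<psi>')} = c"
          unfolding A'_def Y_def using less.hyps[OF _ _ _ psi' rank', of r'] fin cards Suc
          by (simp add: c_def s')
        then show ?thesis using Suc by simp
      qed
      finally show ?thesis .
    qed
    have "card {f \<in> PiE (I \<times> J) A. card (rowspan I J f) = q ^ r * card (rowspan I J \<psi>)} =
        (\<Sum>g\<in>PiE X A. c)"
      unfolding XY(1) using card_PiE_Un[OF XY(3,4,2) fin_A] main by simp
    also have "\<dots> = q ^ (card I + card J - 1) * c" by (simp add: card_PiE_X)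
    also have "\<dots> = (if s \<le> r then q ^ (s * (card I + card J - s)) *
        rank_count q (card I - s) (card J - s) (r - s) else 0)"
    proof -
      \<comment> \<open>The bounds on the rank keep the subtractions in the exponents exact.\<close>
      obtain r1 where r1: "r1 \<le> card I" "r1 \<le> card J" "has_rank I J \<psi> r1"
        using rank_exists[OF fin psi] by auto
      then have le: "s \<le> card I" "s \<le> card J" using has_rank_unique[OF fin psi less.prems(4)] by auto
      obtain a b where ab: "card I = s + a" "card J = s + b" using le by (metis le_Suc_ex)
      have "card I + card J - 1 + s' * (card I - 1 + (card J - 1) - s') = s * (card I + card J - s)"
        by (simp add: ab s' algebra_simps)
      then show ?thesis by (simp add: c_def s' flip: power_add mult.assoc)
    qed
    finally show ?thesis unfolding A_def[abs_def] .
  qed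
qed

end

context divisible_module begin

subsection \<open>The generating function of row span sizes\<close>

definition mats_of_rank :: "'i set \<Rightarrow> 'j set \<Rightarrow> nat \<Rightarrow> nat \<Rightarrow> ('i \<times> 'j \<Rightarrow> 'd) set" where
  "mats_of_rank I J r k = {f \<in> I \<times> J \<rightarrow>\<^sub>E D. has_rank I J f r \<and> card (rowspan I J f) = q ^ k}"

lemma mats_of_rank_0:
  assumes "finite I" "finite J"
  shows "mats_of_rank I J 0 k = (if k = 0 then {\<lambda>x\<in>I \<times> J. 0} else {})"
proof -
  have zero: "f = (\<lambda>x\<in>I \<times> J. 0)" if "f \<in> I \<times> J \<rightarrow>\<^sub>E D" "has_rank I J f 0" for f
  proof -
    have f: "f \<in> I \<times> J \<rightarrow> D" using that by auto
    obtain r where "has_rank I J f r" "r = 0 \<longrightarrow> (\<forall>x\<in>I \<times> J. f x = 0)"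
      using rank_exists[OF assms f] by auto
    with has_rank_unique[OF assms f] that(2) have "\<forall>x\<in>I \<times> J. f x = 0" by blast
    with that(1) show ?thesis by (auto simp: fun_eq_iff PiE_iff extensional_def)
  qed
  have span: "rowspan I J (\<lambda>x\<in>I \<times> J. 0) = {\<lambda>_. 0}"
    "rowspan I J (\<lambda>x. \<pi> \<star> (\<lambda>x\<in>I \<times> J. 0) x) = {\<lambda>_. 0}"
    by (auto intro!: rowspan_eq_zero)
  have q: "1 = q ^ k \<longleftrightarrow> k = 0" using q_ge_2 by (cases k) auto
  have mem: "f \<in> mats_of_rank I J 0 k \<longleftrightarrow> f = (\<lambda>x\<in>I \<times> J. 0) \<and> k = 0" for f
  proof (cases "f = (\<lambda>x\<in>I \<times> J. 0)")
    case True
    then show ?thesis using span q by (auto simp: mats_of_rank_def has_rank_def)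
  qed (use zero in \<open>auto simp: mats_of_rank_def\<close>)
  show ?thesis using mem by (cases "k = 0") auto
qed

text \<open>Passing from \<open>f\<close> to its product \<open>\<psi>\<close> with
  \<open>\<pi>\<close> lowers the exponent of the order of the row span by the rank
  \<open>r\<close>. As \<open>r\<close> is positive, \<open>k\<close> decreases, which drives both
  the finiteness proof and the recursion of the generating functions.\<close>

lemma mats_of_rank_fibres:
  assumes fin: "finite I" "finite J" and r: "0 < r"
  shows "mats_of_rank I J r k = (if r \<le> k then
      \<Union>\<psi>\<in>\<Union>s\<in>{..card I}. mats_of_rank I J s (k - r).
        {f \<in> PiE (I \<times> J) (\<lambda>x. {y \<in> D. \<pi> \<star> y = \<psi> x}).
          card (rowspan I J f) = q ^ r * card (rowspan I J \<psi>)}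
    else {})" (is "_ = ?R")
proof (intro equalityI subsetI)
  fix f assume "f \<in> mats_of_rank I J r k"
  then have f: "f \<in> I \<times> J \<rightarrow>\<^sub>E D" "has_rank I J f r" "card (rowspan I J f) = q ^ k"
    by (auto simp: mats_of_rank_def)
  define \<psi> where "\<psi> = (\<lambda>x\<in>I \<times> J. \<pi> \<star> f x)"
  have psi: "\<psi> \<in> I \<times> J \<rightarrow>\<^sub>E D" using f by (auto simp: \<psi>_def)
  have span: "rowspan I J (\<lambda>x. \<pi> \<star> f x) = rowspan I J \<psi>"
    by (intro rowspan_cong) (simp add: \<psi>_def)
  obtain l where l: "card (rowspan I J \<psi>) = q ^ l" using rank_exists[OF fin, of \<psi>] psi by auto
  obtain s where s: "s \<le> card I" "has_rank I J \<psi> s" using rank_exists[OF fin, of \<psi>] psi by auto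
  have "q ^ k = q ^ (r + l)" using f(2,3) l by (simp add: has_rank_def span power_add)
  then have k: "k = r + l" using q_ge_2 by simp
  have "\<psi> \<in> mats_of_rank I J s (k - r)" using psi s l k by (simp add: mats_of_rank_def)
  moreover have "f \<in> PiE (I \<times> J) (\<lambda>x. {y \<in> D. \<pi> \<star> y = \<psi> x})"
    using f by (auto simp: \<psi>_def PiE_iff)
  moreover have "card (rowspan I J f) = q ^ r * card (rowspan I J \<psi>)"
    using f by (simp add: has_rank_def span)
  ultimately show "f \<in> ?R" using k s(1) by auto
next
  fix f assume "f \<in> ?R"
  then obtain s \<psi> where "r \<le> k" and psi: "\<psi> \<in> mats_of_rank I J s (k - r)"
    and f: "f \<in> PiE (I \<times> J) (\<lambda>x. {y \<in> D. \<pi> \<star> y = \<psi> x})"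
    and c: "card (rowspan I J f) = q ^ r * card (rowspan I J \<psi>)"
    by (auto split: if_splits)
  have "rowspan I J (\<lambda>x. \<pi> \<star> f x) = rowspan I J \<psi>"
    using f by (intro rowspan_cong) (auto simp: PiE_iff)
  then have "has_rank I J f r" using c by (simp add: has_rank_def)
  moreover have "card (rowspan I J f) = q ^ k"
    using c psi \<open>r \<le> k\<close> by (simp add: mats_of_rank_def flip: power_add)
  moreover have "f \<in> I \<times> J \<rightarrow>\<^sub>E D" using f by (auto simp: PiE_iff)
  ultimately show "f \<in> mats_of_rank I J r k" by (simp add: mats_of_rank_def)
qed

lemma finite_mats_of_rank:
  assumes fin: "finite I" "finite J"
  shows "finite (mats_of_rank I J r k)"
proof (induction k arbitrary: r rule: less_induct)
  case (less k)
  show ?case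
  proof (cases "r = 0")
    case True
    then show ?thesis by (simp add: mats_of_rank_0[OF fin])
  next
    case False
    then have r: "0 < r" by simp
    have "finite {f \<in> PiE (I \<times> J) (\<lambda>x. {y \<in> D. \<pi> \<star> y = \<psi> x}). P f}"
      if "\<psi> \<in> mats_of_rank I J s l" for \<psi> s l P
    proof (rule finite_subset[OF _ finite_PiE_fibre])
      show "finite (I \<times> J)" using fin by simp
      show "\<psi> x \<in> D" if "x \<in> I \<times> J" for x
        using \<open>\<psi> \<in> mats_of_rank I J s l\<close> that by (auto simp: mats_of_rank_def PiE_iff)
    qed auto
    then show ?thesis
      unfolding mats_of_rank_fibres[OF fin r] using less r by auto
  qed
qed

lemma mats_of_rank_disjoint:
  assumes "finite I" "finite J" "r \<noteq> s"
  shows "mats_of_rank I J r k \<inter> mats_of_rank I J s k = {}"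
proof (rule ccontr)
  assume "mats_of_rank I J r k \<inter> mats_of_rank I J s k \<noteq> {}"
  then obtain f where "f \<in> I \<times> J \<rightarrow> D" "has_rank I J f r" "has_rank I J f s"
    by (auto simp: mats_of_rank_def)
  then show False using has_rank_unique[OF assms(1,2)] assms(3) by blast
qed

lemma card_mats_of_rank:
  assumes fin: "finite I" "finite J" and r: "0 < r" "r \<le> card I"
  shows "card (mats_of_rank I J r k) = (if r \<le> k then
    \<Sum>s\<le>r. q ^ (s * (card I + card J - s)) * rank_count q (card I - s) (card J - s) (r - s) *
      card (mats_of_rank I J s (k - r)) else 0)"
proof (cases "r \<le> k")
  case True
  define F where "F \<psi> = {f \<in> PiE (I \<times> J) (\<lambda>x. {y \<in> D. \<pi> \<star> y = \<psi> x}).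
      card (rowspan I J f) = q ^ r * card (rowspan I J \<psi>)}" for \<psi>
  define N where "N = (\<Union>s\<in>{..card I}. mats_of_rank I J s (k - r))"
  define c where "c s = (if s \<le> r then q ^ (s * (card I + card J - s)) *
      rank_count q (card I - s) (card J - s) (r - s) else 0)" for s
  have N_D: "\<psi> \<in> I \<times> J \<rightarrow>\<^sub>E D" if "\<psi> \<in> N" for \<psi> using that by (auto simp: N_def mats_of_rank_def)
  have card_F: "card (F \<psi>) = c s" if "\<psi> \<in> mats_of_rank I J s l" for \<psi> s l
  proof -
    have "\<psi> \<in> I \<times> J \<rightarrow> D" "has_rank I J \<psi> s" using that by (auto simp: mats_of_rank_def)
    then show ?thesis unfolding F_def c_def by (rule card_rank_fibre[OF fin])
  qed
  have "mats_of_rank I J r k = (\<Union>\<psi>\<in>N. F \<psi>)"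
    unfolding mats_of_rank_fibres[OF fin r(1)] N_def F_def using True by simp
  also have "card \<dots> = (\<Sum>\<psi>\<in>N. card (F \<psi>))"
  proof (rule card_UN_disjoint)
    show "finite N" unfolding N_def using finite_mats_of_rank[OF fin] by auto
    show "\<forall>\<psi>\<in>N. finite (F \<psi>)"
    proof
      fix \<psi> assume psi: "\<psi> \<in> N"
      show "finite (F \<psi>)"
      proof (rule finite_subset[OF _ finite_PiE_fibre])
        show "finite (I \<times> J)" using fin by simp
        show "\<psi> x \<in> D" if "x \<in> I \<times> J" for x using N_D[OF psi] that by (auto simp: PiE_iff)
      qed (auto simp: F_def)
    qed
    show "\<forall>\<psi>\<in>N. \<forall>\<psi>'\<in>N. \<psi> \<noteq> \<psi>' \<longrightarrow> F \<psi> \<inter> F \<psi>' = {}"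
    proof (intro ballI impI, rule ccontr)
      fix \<psi> \<psi>' assume N: "\<psi> \<in> N" "\<psi>' \<in> N" "\<psi> \<noteq> \<psi>'" and "F \<psi> \<inter> F \<psi>' \<noteq> {}"
      then obtain f where "f \<in> F \<psi>" "f \<in> F \<psi>'" by auto
      then have "\<psi> x = \<psi>' x" if "x \<in> I \<times> J" for x
        using that by (auto simp: F_def PiE_iff)
      then have "\<psi> = \<psi>'" using N_D[OF N(1)] N_D[OF N(2)] by (auto intro: PiE_ext)
      with N(3) show False by simp
    qed
  qed
  also have "\<dots> = (\<Sum>s\<in>{..card I}. \<Sum>\<psi>\<in>mats_of_rank I J s (k - r). card (F \<psi>))"
    unfolding N_def
  proof (rule sum.UNION_disjoint)
    show "\<forall>s\<in>{..card I}. \<forall>s'\<in>{..card I}. s \<noteq> s' \<longrightarrow>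
        mats_of_rank I J s (k - r) \<inter> mats_of_rank I J s' (k - r) = {}"
      using mats_of_rank_disjoint[OF fin] by blast
  qed (use finite_mats_of_rank[OF fin] in auto)
  also have "\<dots> = (\<Sum>s\<in>{..card I}. c s * card (mats_of_rank I J s (k - r)))"
    by (intro sum.cong refl) (simp add: card_F)
  also have "\<dots> = (\<Sum>s\<le>r. c s * card (mats_of_rank I J s (k - r)))"
    using r(2) by (intro sum.mono_neutral_right) (auto simp: c_def)
  finally show ?thesis using True by (simp add: c_def)
next
  case False
  then show ?thesis unfolding mats_of_rank_fibres[OF fin r(1)] by simp
qed

lemma mats_of_span_eq:
  assumes fin: "finite I" "finite J"
  shows "{f \<in> I \<times> J \<rightarrow>\<^sub>E D. card (rowspan I J f) = q ^ k} = (\<Union>r\<in>{..card I}. mats_of_rank I J r k)"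
proof (intro equalityI subsetI)
  fix f assume f: "f \<in> {f \<in> I \<times> J \<rightarrow>\<^sub>E D. card (rowspan I J f) = q ^ k}"
  then obtain r where "r \<le> card I" "has_rank I J f r" using rank_exists[OF fin, of f] by auto
  with f show "f \<in> (\<Union>r\<in>{..card I}. mats_of_rank I J r k)" by (auto simp: mats_of_rank_def)
qed (auto simp: mats_of_rank_def)

lemma finite_mats_of_span:
  "finite I \<Longrightarrow> finite J \<Longrightarrow> finite {f \<in> I \<times> J \<rightarrow>\<^sub>E D. card (rowspan I J f) = q ^ k}"
  using finite_mats_of_rank by (subst mats_of_span_eq) auto

definition rank_fps :: "'i set \<Rightarrow> 'j set \<Rightarrow> nat \<Rightarrow> rat fps" where
  "rank_fps I J r = Abs_fps (\<lambda>k. of_nat (card (mats_of_rank I J r k)))"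

lemma rank_fps_0: "finite I \<Longrightarrow> finite J \<Longrightarrow> rank_fps I J 0 = 1"
  by (rule fps_ext) (simp add: rank_fps_def mats_of_rank_0)

text \<open>The term \<open>s = r\<close> puts the unknown on both sides, but the factor
  \<open>fps_X ^ r\<close> has no constant term, so the equation can be solved for it.\<close>

lemma rank_fps_rec:
  assumes "finite I" "finite J" "0 < r" "r \<le> card I"
  shows "rank_fps I J r = fps_X ^ r * (\<Sum>s\<le>r. fps_const (of_nat (q ^ (s * (card I + card J - s)) *
    rank_count q (card I - s) (card J - s) (r - s))) * rank_fps I J s)"
  by (rule fps_ext)
     (auto simp: rank_fps_def fps_X_power_mult_nth fps_sum_nth card_mats_of_rank[OF assms])

lemma card_mats_of_span:
  assumes fin: "finite I" "finite J"
  shows "of_nat (card {f \<in> I \<times> J \<rightarrow>\<^sub>E D. card (rowspan I J f) = q ^ k}) =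
    fps_nth (\<Sum>r\<le>card I. rank_fps I J r) k"
proof -
  have "card (\<Union>r\<in>{..card I}. mats_of_rank I J r k) = (\<Sum>r\<le>card I. card (mats_of_rank I J r k))"
    using finite_mats_of_rank[OF fin] mats_of_rank_disjoint[OF fin]
    by (intro card_UN_disjoint) blast+
  then show ?thesis
    unfolding mats_of_span_eq[OF fin] by (simp add: rank_fps_def fps_sum_nth)
qed

end

section \<open>Solving the recursion for the generating functions\<close>

lemma rank_count_0: "rank_count q m n 0 = 1"
  by (induction m) auto

lemma rank_count_eq_0: "m < r \<Longrightarrow> rank_count q m n r = 0"
  by (induction m arbitrary: r) auto

context
  fixes q :: nat and X :: rat
  assumes q: "2 \<le> q" and X: "X = 1 / of_nat q"
begin

lemma one_minus_X_power: "0 < k \<Longrightarrow> 1 - X ^ k \<noteq> 0"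
proof -
  assume "0 < k"
  have "(1::rat) < of_nat q ^ k" using q \<open>0 < k\<close> by (intro one_less_power) auto
  then show ?thesis by (simp add: X power_divide)
qed

lemma q_X_power: "k \<le> l \<Longrightarrow> of_nat q ^ l * X ^ k = of_nat q ^ (l - k)"
  using q by (simp add: X power_divide power_diff)

lemma prod_one_minus_nonzero: "(\<Prod>k=1..a. 1 - X ^ k) \<noteq> 0"
  using one_minus_X_power by simp

lemma gauss_binomial_0: "gauss_binomial a 0 X = 1"
  using prod_one_minus_nonzero[of a] by (simp add: gauss_binomial_def)

lemma gauss_binomial_self: "gauss_binomial a a X = 1"
  using prod_one_minus_nonzero[of a] by (simp add: gauss_binomial_def)

lemma gauss_binomial_symmetric: "b \<le> a \<Longrightarrow> gauss_binomial a (a - b) X = gauss_binomial a b X"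
  by (simp add: gauss_binomial_def mult.commute)

lemma gauss_binomial_pascal:
  assumes "r < a"
  shows "gauss_binomial (Suc a) (Suc r) X = gauss_binomial a (Suc r) X + X ^ (a - r) * gauss_binomial a r X"
proof -
  define F where "F a = (\<Prod>k=1..a. 1 - X ^ k)" for a
  have F: "F (Suc a) = F a * (1 - X ^ Suc a)" "F a \<noteq> 0" for a
    using prod_one_minus_nonzero by (simp_all add: F_def)
  obtain d where a: "a = Suc (r + d)" using assms less_imp_Suc_add by blast
  have nz: "1 - X ^ Suc r \<noteq> 0" "1 - X ^ Suc d \<noteq> 0" "1 - X ^ Suc a \<noteq> 0"
    using one_minus_X_power by blast+
  have "(1 - X ^ Suc a) / (F r * (1 - X ^ Suc r) * (F d * (1 - X ^ Suc d))) =
      1 / (F r * (1 - X ^ Suc r) * F d) + X ^ Suc d / (F r * (F d * (1 - X ^ Suc d)))"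
  proof -
    have "1 - X ^ Suc a = (1 - X ^ Suc d) + X ^ Suc d * (1 - X ^ Suc r)"
      by (simp add: a algebra_simps power_add)
    moreover have "(v + x * u) / (F r * u * (F d * v)) = 1 / (F r * u * F d) + x / (F r * (F d * v))"
      if "u \<noteq> 0" "v \<noteq> 0" for u v x
      using that F(2)[of r] F(2)[of d] by (simp add: field_simps)
    ultimately show ?thesis using nz by (simp only: not_False_eq_True)
  qed
  then have "F a * ((1 - X ^ Suc a) / (F r * (1 - X ^ Suc r) * (F d * (1 - X ^ Suc d)))) =
      F a * (1 / (F r * (1 - X ^ Suc r) * F d) + X ^ Suc d / (F r * (F d * (1 - X ^ Suc d))))"
    by (simp only:)
  moreover have gb: "gauss_binomial a b X = F a / (F (a - b) * F b)" for a b
    by (simp add: gauss_binomial_def F_def)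
  moreover have "Suc a - Suc r = Suc d" "a - Suc r = d" "a - r = Suc d" by (simp_all add: a)
  ultimately show ?thesis
    unfolding gb by (simp add: F(1) distrib_left mult_ac del: power_Suc)
qed

text \<open>The classical product formula, with the powers of \<open>q\<close> collected in front so
  that the rest is a polynomial in \<open>X = 1 / q\<close>. In this form the recursion over the
  rows is Pascal's rule for Gauss binomials.\<close>

lemma rank_count_closed:
  assumes "r \<le> m" "r \<le> n"
  shows "of_nat (rank_count q m n r) =
    of_nat q ^ (r * (m + n - r)) * gauss_binomial m r X * (\<Prod>i<r. 1 - X ^ (n - i))"
  using assms
proof (induction m arbitrary: r)
  case 0
  then show ?case by (simp add: gauss_binomial_0)
next
  case (Suc m)
  show ?case
  proof (cases r)
    case 0
    then show ?thesis using rank_count_0[of q "Suc m" n] by (simp add: gauss_binomial_0)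
  next
    case (Suc s)
    define P where "P = (\<Prod>i<s. 1 - X ^ (n - i))"
    have s: "s \<le> m" "s < n" using Suc Suc.prems by auto
    have "q ^ s \<le> q ^ n" using q s by (intro power_increasing) auto
    then have diff: "(of_nat (q ^ n - q ^ s) :: rat) = of_nat q ^ n * (1 - X ^ (n - s))"
      using q_X_power[of "n - s" n] s by (simp add: of_nat_diff algebra_simps)
    have IH: "(of_nat (rank_count q m n s) :: rat) = of_nat q ^ (s * (m + n - s)) * gauss_binomial m s X * P"
      using Suc.IH[of s] s by (simp add: P_def)
    \<comment> \<open>The excess \<open>X ^ (m - s)\<close> is the factor that occurs in Pascal's
      rule.\<close>
    have e1: "of_nat q ^ n * of_nat q ^ (s * (m + n - s)) = of_nat q ^ (r * (Suc m + n - r)) * X ^ (m - s)"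
    proof -
      obtain d where d: "m = s + d" using s le_Suc_ex by blast
      have "r * (Suc m + n - r) = n + s * (m + n - s) + (m - s)"
        using s by (simp add: Suc d algebra_simps)
      then show ?thesis using q_X_power[of "m - s" "r * (Suc m + n - r)"] by (simp add: power_add)
    qed
    have A: "(of_nat (rank_count q (Suc m) n r) :: rat) = of_nat q ^ r * of_nat (rank_count q m n r) +
        of_nat q ^ (r * (Suc m + n - r)) * X ^ (m - s) * (gauss_binomial m s X * (P * (1 - X ^ (n - s))))"
    proof -
      have "(of_nat (rank_count q (Suc m) n r) :: rat) = of_nat q ^ r * of_nat (rank_count q m n r) +
          of_nat (q ^ n - q ^ s) * of_nat (rank_count q m n s)"
        by (simp add: Suc)
      also have "of_nat (q ^ n - q ^ s) * (of_nat (rank_count q m n s) :: rat) =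
          (of_nat q ^ n * of_nat q ^ (s * (m + n - s))) * (gauss_binomial m s X * (P * (1 - X ^ (n - s))))"
        unfolding diff IH by (simp only: mult_ac)
      finally show ?thesis unfolding e1 .
    qed
    show ?thesis
    proof (cases "r \<le> m")
      case True
      have e2: "r + r * (m + n - r) = r * (Suc m + n - r)" using True by (simp add: Suc_diff_le)
      have "(of_nat (rank_count q m n r) :: rat) =
          of_nat q ^ (r * (m + n - r)) * (gauss_binomial m r X * (P * (1 - X ^ (n - s))))"
        using Suc.IH[OF True Suc.prems(2)] unfolding Suc by (simp add: P_def mult.assoc)
      then have "(of_nat q ^ r * of_nat (rank_count q m n r) :: rat) =
          of_nat q ^ (r * (Suc m + n - r)) * (gauss_binomial m r X * (P * (1 - X ^ (n - s))))"
        unfolding e2[symmetric] power_add by (simp only: mult.assoc)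
      then show ?thesis
        unfolding A using gauss_binomial_pascal[of s m] True Suc
        by (simp add: P_def algebra_simps)
    next
      case False
      \<comment> \<open>The rank is the full number \<open>Suc m\<close> of rows, which
        \<open>m\<close> rows cannot reach, so the first summand of the recursion is 0.\<close>
      then have "s = m" using s Suc by simp
      then show ?thesis
        unfolding A using rank_count_eq_0[of m r] Suc
        by (simp add: P_def gauss_binomial_self)
    qed
  qed
qed

lemma gauss_chain_snoc:
  "gauss_chain j (is @ [i]) X = gauss_chain j is X * gauss_binomial (last (j # is)) i X"
  by (induction "is" arbitrary: j) auto

lemma sorted_list_of_set_insert_less:
  assumes "finite I" "\<And>k. k \<in> I \<Longrightarrow> i < k"
  shows "sorted_list_of_set (insert i I) = i # sorted_list_of_set I"
proof -
  have "Min (insert i I) = i" using assms by (intro Min_eqI) (auto intro: less_imp_le)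
  moreover have "insert i I - {i} = I" using assms by auto
  ultimately show ?thesis using sorted_list_of_set_nonempty[of "insert i I"] assms(1) by simp
qed

lemma prod_lessThan_add: "(\<Prod>i<s + t. g i) = (\<Prod>i<s. g i) * (\<Prod>i<t. g (s + i))"
  for g :: "nat \<Rightarrow> 'a::comm_monoid_mult"
  by (induction t) (simp_all add: mult.assoc)

text \<open>The symbol of length \<open>k\<close> that belongs to the minimum \<open>m - k\<close>
  is the product of the factors \<open>1 - X ^ (n - i)\<close> with \<open>i < k\<close>, read
  backwards. In this form its length can be split.\<close>

lemma q_pochhammer_split:
  assumes "s \<le> r" "r \<le> m" "m \<le> n"
  shows "q_pochhammer (X ^ (n - m) * X ^ (m - r + 1)) X r =
    q_pochhammer (X ^ (n - m) * X ^ (m - s + 1)) X s * (\<Prod>i<r - s. 1 - X ^ (n - s - i))"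
proof -
  have poch: "q_pochhammer (X ^ (n - m) * X ^ (m - k + 1)) X k = (\<Prod>i<k. 1 - X ^ (n - i))"
    if "k \<le> m" for k
  proof -
    have "q_pochhammer (X ^ (n - m) * X ^ (m - k + 1)) X k = (\<Prod>i<k. 1 - X ^ (n - (k - Suc i)))"
      unfolding q_pochhammer_def
    proof (intro prod.cong refl)
      fix i assume "i \<in> {..<k}"
      then have "n - m + (m - k + 1) + i = n - (k - Suc i)" using that assms(3) by auto
      then show "1 - X ^ (n - m) * X ^ (m - k + 1) * X ^ i = 1 - X ^ (n - (k - Suc i))"
        by (simp only: power_add[symmetric])
    qed
    also have "\<dots> = (\<Prod>i<k. 1 - X ^ (n - i))" by (rule prod.nat_diff_reindex)
    finally show ?thesis .
  qed
  have "(\<Prod>i<r. 1 - X ^ (n - i)) = (\<Prod>i<s + (r - s). 1 - X ^ (n - i))" using assms(1) by simp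
  also have "\<dots> = (\<Prod>i<s. 1 - X ^ (n - i)) * (\<Prod>i<r - s. 1 - X ^ (n - (s + i)))"
    by (rule prod_lessThan_add)
  finally show ?thesis
    unfolding poch[OF assms(2)] poch[OF le_trans[OF assms(1,2)]] diff_diff_left .
qed

text \<open>A new minimum lengthens the chain of binomials by one factor and the Pochhammer product
  by \<open>r - s\<close> factors. Together these are the normalized number of matrices of rank
  \<open>r - s\<close> with \<open>m - s\<close> rows and \<open>n - s\<close> columns. The empty
  set counts as having minimum \<open>m\<close>, that is \<open>s = 0\<close>.\<close>

lemma f_poly_insert:
  assumes I: "I \<subseteq> {..<m}" "I = {} \<and> s = 0 \<or> I \<noteq> {} \<and> Min I = m - s" and s: "s < r" "r \<le> m" "m \<le> n"
  shows "f_poly m n (insert (m - r) I) X =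
    f_poly m n I X * gauss_binomial (m - s) (r - s) X * (\<Prod>i<r - s. 1 - X ^ (n - s - i))"
proof -
  have fin: "finite I" using I(1) finite_subset by blast
  have less: "m - r < k" if "k \<in> I" for k
    using I(2) that s Min_le[OF fin that] by auto
  have list: "sorted_list_of_set (insert (m - r) I) = (m - r) # sorted_list_of_set I"
    using fin less by (rule sorted_list_of_set_insert_less)
  have last: "last (m # rev (sorted_list_of_set I)) = m - s"
    using I(2) fin sorted_list_of_set_nonempty[of I] by (auto simp: last_rev)
  have gauss: "gauss_multinomial m (insert (m - r) I) X =
      gauss_multinomial m I X * gauss_binomial (m - s) (r - s) X"
    unfolding gauss_multinomial_def list using gauss_chain_snoc last
      gauss_binomial_symmetric[of "r - s" "m - s"] s by simp
  have Min: "Min (insert (m - r) I) = m - r" using fin less by (intro Min_eqI) (auto intro: less_imp_le)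
  have poch: "q_pochhammer (X ^ (n - m) * X ^ (m - r + 1)) X r =
      q_pochhammer (X ^ (n - m) * X ^ (m - s + 1)) X s * (\<Prod>i<r - s. 1 - X ^ (n - s - i))"
    using s by (intro q_pochhammer_split) auto
  have f: "f_poly m n (insert (m - r) I) X = gauss_multinomial m I X * gauss_binomial (m - s) (r - s) X *
      (q_pochhammer (X ^ (n - m) * X ^ (m - s + 1)) X s * (\<Prod>i<r - s. 1 - X ^ (n - s - i)))"
  proof -
    have "m - (m - r) = r" using s by simp
    then show ?thesis by (simp only: f_poly_def Min gauss poch insert_not_empty if_False)
  qed
  show ?thesis
  proof (cases "I = {}")
    case True
    then show ?thesis using I(2) unfolding f by (simp add: f_poly_def gauss_multinomial_def q_pochhammer_def)
  next
    case False
    then have "Min I = m - s" "s \<le> m" using I(2) s by auto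
    then show ?thesis using False unfolding f by (simp add: f_poly_def)
  qed
qed

text \<open>Subsets are sorted by \<open>m - Min I\<close>, which plays the role of the rank.
  Deleting the minimum shows that the sums over these classes of subsets satisfy the same recursion
  as the series \<open>W r\<close>, once the term \<open>s = r\<close> has been moved to the
  left.\<close>

theorem rank_recursion_solution:
  fixes W :: "nat \<Rightarrow> rat fps"
  assumes mn: "m \<le> n" and W0: "W 0 = 1"
    and W: "\<And>r. 0 < r \<Longrightarrow> r \<le> m \<Longrightarrow> W r = fps_X ^ r *
      (\<Sum>s\<le>r. fps_const (of_nat (q ^ (s * (m + n - s)) * rank_count q (m - s) (n - s) (r - s))) * W s)"
  shows "(\<Sum>r\<le>m. W r) = (\<Sum>I\<in>Pow {..<m}. fps_const (f_poly m n I X) *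
    (\<Prod>i\<in>I. (fps_const (of_nat (q ^ ((m - i) * (n + i)))) * fps_X ^ (m - i)) /
      (1 - fps_const (of_nat (q ^ ((m - i) * (n + i)))) * fps_X ^ (m - i))))"
proof -
  define T where "T i = (fps_const (of_nat (q ^ ((m - i) * (n + i)))) * fps_X ^ (m - i) :: rat fps)" for i
  define trm where "trm I = fps_const (f_poly m n I X) * (\<Prod>i\<in>I. T i / (1 - T i))" for I
  define fam where "fam r = (if r = 0 then {{}} else {I. I \<subseteq> {..<m} \<and> I \<noteq> {} \<and> Min I = m - r})" for r
  define d where "d s r = gauss_binomial (m - s) (r - s) X * (\<Prod>i<r - s. 1 - X ^ (n - s - i))" for s r
  have fam: "I \<subseteq> {..<m}" "I = {} \<and> r = 0 \<or> I \<noteq> {} \<and> Min I = m - r" if "I \<in> fam r" for I r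
    using that by (auto simp: fam_def split: if_splits)
  have fin_fam: "finite (fam r)" for r
    by (rule finite_subset[of _ "Pow {..<m}"]) (auto simp: fam_def)
  have fam_Pow: "(\<Union>r\<in>{..m}. fam r) = Pow {..<m}"
  proof (intro equalityI subsetI)
    fix I assume I: "I \<in> Pow {..<m}"
    show "I \<in> (\<Union>r\<in>{..m}. fam r)"
    proof (cases "I = {}")
      case False
      then have "Min I \<in> I" using I finite_subset[of I "{..<m}"] by (intro Min_in) auto
      then have "Min I < m" using I by auto
      then have "I \<in> fam (m - Min I)" using I False by (auto simp: fam_def)
      then show ?thesis by auto
    qed (auto simp: fam_def)
  qed (use fam in auto)
  have fam_disj: "fam r \<inter> fam s = {}" if "r \<le> m" "s \<le> m" "r \<noteq> s" for r s
    using that by (auto simp: fam_def split: if_splits)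
  \<comment> \<open>Deleting the minimum leaves a set with a larger minimum or the empty set, which
    has rank 0.\<close>
  have fam_rec: "fam r = insert (m - r) ` (\<Union>s\<in>{..<r}. fam s)" if r: "0 < r" "r \<le> m" for r
  proof (intro equalityI subsetI)
    fix I assume "I \<in> fam r"
    then have I: "I \<subseteq> {..<m}" "I \<noteq> {}" "Min I = m - r" using r by (auto simp: fam_def)
    have fin: "finite I" using I finite_subset by blast
    have mem: "m - r \<in> I" using Min_in[OF fin I(2)] I(3) by simp
    define I' where "I' = I - {m - r}"
    have "I' \<in> (\<Union>s\<in>{..<r}. fam s)"
    proof (cases "I' = {}")
      case True
      then show ?thesis using r by (auto simp: fam_def)
    next
      case False
      have "Min I' \<in> I'" using False fin by (intro Min_in) (auto simp: I'_def)
      then have "Min I' \<in> I" "Min I' \<noteq> m - r" by (auto simp: I'_def)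
      then have "m - r < Min I'" "Min I' < m" using I Min_le[OF fin, of "Min I'"] by auto
      then have "I' \<in> fam (m - Min I')" "m - Min I' < r" using I False by (auto simp: fam_def I'_def)
      then show ?thesis by auto
    qed
    moreover have "I = insert (m - r) I'" using mem by (auto simp: I'_def)
    ultimately show "I \<in> insert (m - r) ` (\<Union>s\<in>{..<r}. fam s)" by blast
  next
    fix I assume "I \<in> insert (m - r) ` (\<Union>s\<in>{..<r}. fam s)"
    then obtain s I' where s: "s < r" "I' \<in> fam s" and I: "I = insert (m - r) I'" by auto
    note fam' = fam[OF s(2)]
    have fin: "finite I'" using fam' finite_subset by blast
    have "m - r \<le> k" if "k \<in> I'" for k using fam'(2) s(1) Min_le[OF fin that] that by auto
    then have "Min I = m - r" unfolding I using fin by (intro Min_eqI) auto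
    then show "I \<in> fam r" using r fam' I by (auto simp: fam_def)
  qed
  have inner: "m - r \<notin> I" if "I \<in> fam s" "s < r" "r \<le> m" for I s r
  proof
    assume mem: "m - r \<in> I"
    have "finite I" using fam(1)[OF that(1)] finite_subset by blast
    then have "Min I \<le> m - r" using mem by (rule Min_le)
    moreover have "Min I = m - s" using fam(2)[OF that(1)] mem by auto
    ultimately show False using that(2,3) by simp
  qed
  have sum_rec: "(\<Sum>I\<in>fam r. trm I) = T (m - r) / (1 - T (m - r)) *
      (\<Sum>s<r. fps_const (d s r) * (\<Sum>I\<in>fam s. trm I))" if r: "0 < r" "r \<le> m" for r
  proof -
    have "inj_on (insert (m - r)) (\<Union>s\<in>{..<r}. fam s)"
      using inner r by (intro inj_onI) (auto dest!: insert_ident[THEN iffD1, rotated 2])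
    then have "(\<Sum>I\<in>fam r. trm I) = (\<Sum>I\<in>(\<Union>s\<in>{..<r}. fam s). trm (insert (m - r) I))"
      unfolding fam_rec[OF r] by (simp add: sum.reindex)
    also have "\<dots> = (\<Sum>s<r. \<Sum>I\<in>fam s. trm (insert (m - r) I))"
    proof (rule sum.UNION_disjoint)
      show "\<forall>i\<in>{..<r}. \<forall>j\<in>{..<r}. i \<noteq> j \<longrightarrow> fam i \<inter> fam j = {}"
        using r by (intro ballI impI fam_disj) auto
    qed (use fin_fam in auto)
    also have "\<dots> = (\<Sum>s<r. \<Sum>I\<in>fam s. T (m - r) / (1 - T (m - r)) * (fps_const (d s r) * trm I))"
    proof (intro sum.cong refl)
      fix s I assume s: "s \<in> {..<r}" and I: "I \<in> fam s"
      have "f_poly m n (insert (m - r) I) X = f_poly m n I X * d s r"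
        unfolding d_def using f_poly_insert[OF fam[OF I], of r n] s r mn by simp
      moreover have "finite I" "m - r \<notin> I" using fam(1)[OF I] finite_subset inner[OF I] s r by auto
      ultimately show "trm (insert (m - r) I) = T (m - r) / (1 - T (m - r)) * (fps_const (d s r) * trm I)"
        by (simp add: trm_def mult_ac flip: fps_const_mult)
    qed
    finally show ?thesis by (simp add: sum_distrib_left)
  qed
  have T_unit: "T i / (1 - T i) * (1 - T i) = T i" if "i < m" for i
  proof -
    have "fps_nth (1 - T i) 0 \<noteq> 0" using that by (simp add: T_def)
    then show ?thesis by (simp add: fps_divide_unit mult.assoc inverse_mult_eq_1)
  qed
  have W_rec: "W r = T (m - r) / (1 - T (m - r)) * (\<Sum>s<r. fps_const (d s r) * W s)"
    if r: "0 < r" "r \<le> m" for r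
  proof -
    have T_r: "T (m - r) = fps_const (of_nat q ^ (r * (m + n - r))) * fps_X ^ r"
    proof -
      have "n + (m - r) = m + n - r" using r by simp
      then show ?thesis using r by (simp add: T_def)
    qed
    \<comment> \<open>The powers of \<open>q\<close> combine to an exponent that does not involve
      \<open>s\<close>, so \<open>T (m - r)\<close> can be taken out of the sum.\<close>
    have coeff: "of_nat (q ^ (s * (m + n - s)) * rank_count q (m - s) (n - s) (r - s)) =
        of_nat q ^ (r * (m + n - r)) * d s r" if s: "s < r" for s
    proof -
      obtain e where e: "r = s + e" using s le_Suc_ex[of s r] by auto
      obtain a where a: "m = r + a" using r le_Suc_ex by blast
      obtain b where b: "n = m + b" using mn le_Suc_ex by blast
      have "s * (m + n - s) + (r - s) * (m - s + (n - s) - (r - s)) = r * (m + n - r)"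
        unfolding b a e by (simp add: algebra_simps)
      moreover have "r - s \<le> m - s" "r - s \<le> n - s" using r mn by auto
      ultimately show ?thesis
        using rank_count_closed[of "r - s" "m - s" "n - s"]
        by (simp add: d_def mult.assoc flip: power_add)
    qed
    have "W r = fps_X ^ r * ((\<Sum>s<r. fps_const (of_nat q ^ (r * (m + n - r))) * (fps_const (d s r) * W s)) +
        fps_const (of_nat q ^ (r * (m + n - r))) * W r)"
    proof -
      have "W r = fps_X ^ r *
        ((\<Sum>s<r. fps_const (of_nat (q ^ (s * (m + n - s)) * rank_count q (m - s) (n - s) (r - s))) * W s) +
          fps_const (of_nat (q ^ (r * (m + n - r)) * rank_count q (m - r) (n - r) (r - r))) * W r)"
        by (subst W[OF r]) (simp add: lessThan_Suc_atMost[symmetric])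
      also have "(\<Sum>s<r. fps_const (of_nat (q ^ (s * (m + n - s)) * rank_count q (m - s) (n - s) (r - s))) * W s) =
          (\<Sum>s<r. fps_const (of_nat q ^ (r * (m + n - r))) * (fps_const (d s r) * W s))"
        by (intro sum.cong refl) (simp only: coeff lessThan_iff fps_const_mult[symmetric] mult.assoc)
      finally show ?thesis by (simp add: rank_count_0)
    qed
    also have "\<dots> = T (m - r) * (\<Sum>s<r. fps_const (d s r) * W s) + T (m - r) * W r"
      by (simp only: T_r sum_distrib_left distrib_left mult_ac)
    finally have "(1 - T (m - r)) * W r = T (m - r) * (\<Sum>s<r. fps_const (d s r) * W s)"
      by (simp add: algebra_simps)
    also have "\<dots> = (1 - T (m - r)) * (T (m - r) / (1 - T (m - r)) * (\<Sum>s<r. fps_const (d s r) * W s))"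
      using T_unit[of "m - r"] r by (simp add: mult.assoc[symmetric] mult.commute[of "1 - T (m - r)"])
    finally have eq: "(1 - T (m - r)) * W r = (1 - T (m - r)) * (T (m - r) / (1 - T (m - r)) * (\<Sum>s<r. fps_const (d s r) * W s))" .
    \<comment> \<open>The constant term of \<open>T (m - r)\<close> is 0 because \<open>r\<close> is
      positive, so \<open>1 - T (m - r)\<close> can be cancelled.\<close>
    have "fps_nth (1 - T (m - r)) 0 \<noteq> 0" using r by (simp add: T_r)
    then have "1 - T (m - r) \<noteq> 0" by (metis fps_zero_nth)
    with eq show ?thesis using mult_left_cancel by blast
  qed
  have "W r = (\<Sum>I\<in>fam r. trm I)" if "r \<le> m" for r
    using that
  proof (induction r rule: less_induct)
    case (less r)
    show ?case
    proof (cases "r = 0")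
      case True
      then show ?thesis by (simp add: W0 fam_def trm_def f_poly_def)
    next
      case False
      then have r: "0 < r" by simp
      show ?thesis unfolding W_rec[OF r less.prems] sum_rec[OF r less.prems] using less by simp
    qed
  qed
  then have "(\<Sum>r\<le>m. W r) = (\<Sum>r\<le>m. \<Sum>I\<in>fam r. trm I)" by simp
  also have "\<dots> = (\<Sum>I\<in>(\<Union>r\<in>{..m}. fam r). trm I)"
    using fin_fam fam_disj by (intro sum.UNION_disjoint[symmetric]) auto
  finally show ?thesis unfolding fam_Pow trm_def T_def .
qed

end

section \<open>Local structure of the ring of integers at a prime\<close>

interpretation rat_vs: vector_space "\<lambda>r x. of_rat r * (x :: 'k::field_char_0)"
  by unfold_locales (simp_all add: algebra_simps of_rat_add of_rat_mult)

text \<open>Expresses that \<open>H\<close> has finite index in \<open>A\<close>; \<open>R\<close>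
  may meet a coset more than once.\<close>

definition fin_reps :: "'a::ab_group_add set \<Rightarrow> 'a set \<Rightarrow> 'a set \<Rightarrow> bool" where
  "fin_reps A H R \<longleftrightarrow> finite R \<and> R \<subseteq> A \<and> (\<forall>x\<in>A. \<exists>r\<in>R. x - r \<in> H)"

lemma fin_reps_pigeonhole:
  fixes f :: "nat \<Rightarrow> 'a::ab_group_add"
  assumes "fin_reps A H R" "\<And>k. f k \<in> A" "\<And>x y. x \<in> H \<Longrightarrow> y \<in> H \<Longrightarrow> x - y \<in> H"
  obtains i j where "i < j" "f j - f i \<in> H"
proof -
  have "\<exists>r. r \<in> R \<and> f k - r \<in> H" for k using assms(1,2) unfolding fin_reps_def by blast
  then obtain r where r: "\<And>k. r k \<in> R \<and> f k - r k \<in> H" by metis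
  then have "range r \<subseteq> R" by auto
  then have "\<not> inj r" using assms(1) finite_subset range_inj_infinite unfolding fin_reps_def by blast
  then obtain i j where "r i = r j" "i \<noteq> j" by (auto simp: inj_def)
  then obtain i j where ij: "r i = r j" "i < j" by (metis linorder_neqE_nat)
  have "(f j - r j) - (f i - r i) \<in> H" using r assms(3) by blast
  with ij show ?thesis using that[of i j] by simp
qed

text \<open>Finite dimension enters as a finite set \<open>T\<close> that spans \<open>K\<close>
  over the rationals; its size bounds the rank of \<open>S\<close>.\<close>

locale number_field_prime =
  fixes K S P :: "'k::field_char_0 set" and T :: "'k set"
  assumes K_mult: "x \<in> K \<Longrightarrow> y \<in> K \<Longrightarrow> x * y \<in> K"
    and K_inverse: "x \<in> K \<Longrightarrow> inverse x \<in> K"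
    and T: "finite T" "K \<subseteq> rat_vs.span T"
    and S_eq: "S = {x \<in> K. algebraic_int x}"
    and S_0: "0 \<in> S" and S_1: "1 \<in> S"
    and S_add: "x \<in> S \<Longrightarrow> y \<in> S \<Longrightarrow> x + y \<in> S"
    and S_mult: "x \<in> S \<Longrightarrow> y \<in> S \<Longrightarrow> x * y \<in> S"
    and S_uminus: "x \<in> S \<Longrightarrow> - x \<in> S"
    and P_S: "P \<subseteq> S"
    and P_0: "0 \<in> P"
    and P_add: "x \<in> P \<Longrightarrow> y \<in> P \<Longrightarrow> x + y \<in> P"
    and P_mult: "x \<in> S \<Longrightarrow> y \<in> P \<Longrightarrow> x * y \<in> P"
    and P_1: "1 \<notin> P"
    and P_prime: "x \<in> S \<Longrightarrow> y \<in> S \<Longrightarrow> x * y \<in> P \<Longrightarrow> x \<in> P \<or> y \<in> P"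
    and P_nonzero: "\<exists>x\<in>P. x \<noteq> 0"
begin

lemma S_diff: "x \<in> S \<Longrightarrow> y \<in> S \<Longrightarrow> x - y \<in> S"
  using S_add[of x "- y"] S_uminus[of y] by simp

lemma S_power: "x \<in> S \<Longrightarrow> x ^ k \<in> S"
  by (induction k) (simp_all add: S_1 S_mult)

lemma S_of_nat: "of_nat n \<in> S"
  by (induction n) (simp_all add: S_0 S_1 S_add)

lemma S_of_int: "of_int n \<in> S"
  by (cases n) (simp_all add: S_of_nat S_uminus S_diff S_1 del: of_nat_Suc)

lemma S_sum: "(\<And>i. i \<in> I \<Longrightarrow> f i \<in> S) \<Longrightarrow> sum f I \<in> S"
  by (induction I rule: infinite_finite_induct) (simp_all add: S_0 S_add)

lemma P_diff: "x \<in> P \<Longrightarrow> y \<in> P \<Longrightarrow> x - y \<in> P"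
  using P_add[of x "(- 1) * y"] P_mult[of "- 1" y] S_uminus[OF S_1] by simp

lemma P_power: "x \<in> S \<Longrightarrow> x ^ k \<in> P \<Longrightarrow> x \<in> P"
  by (induction k) (use P_1 P_prime S_power in auto)

lemma P_power_pos: "x \<in> P \<Longrightarrow> 0 < k \<Longrightarrow> x ^ k \<in> P"
  by (cases k) (use P_S in \<open>auto simp: power_Suc2 P_mult S_power simp del: power_Suc\<close>)

lemma P_prod: "finite I \<Longrightarrow> (\<And>i. i \<in> I \<Longrightarrow> f i \<in> S - P) \<Longrightarrow> prod f I \<in> S - P"
  by (induction I rule: finite_induct) (use S_1 P_1 P_prime S_mult in auto)

lemma poly_in_S:
  assumes "\<And>i. coeff f i \<in> \<int>" "x \<in> S"
  shows "poly f x \<in> S"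
  using assms(1)
proof (induction f)
  case (pCons a f)
  have "coeff f i \<in> \<int>" for i using pCons.prems[of "Suc i"] by simp
  moreover have "a \<in> S" using pCons.prems[of 0] S_of_int by (auto simp: Ints_def)
  ultimately show ?case using pCons.IH assms(2) by (simp add: S_add S_mult)
qed (simp add: S_0)

text \<open>In an integral equation of a nonzero element of \<open>P\<close>, divided by a power of
  this element, the lowest nonzero coefficient becomes a multiple of the element and hence a nonzero
  integer in \<open>P\<close>. The least positive integer in \<open>P\<close> is prime because
  \<open>P\<close> is.\<close>

lemma rational_prime_in_P: "\<exists>p. prime p \<and> of_nat p \<in> P"
proof -
  obtain \<alpha> where \<alpha>: "\<alpha> \<in> P" "\<alpha> \<noteq> 0" using P_nonzero by blast
  then have "\<alpha> \<in> S" "algebraic_int \<alpha>" using P_S S_eq by auto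
  then obtain f where f: "lead_coeff f = 1" "\<And>i. coeff f i \<in> \<int>" "poly f \<alpha> = 0"
    by (auto elim!: algebraic_int.cases)
  have "f \<noteq> 0" using f(1) by auto
  then have "\<exists>n::nat. n > 0 \<and> of_nat n \<in> P"
    using f(2,3)
  proof (induction f)
    case (pCons a f)
    have f_int: "coeff f i \<in> \<int>" for i using pCons.prems(2)[of "Suc i"] by simp
    obtain c where c: "a = of_int c" using pCons.prems(2)[of 0] by (auto simp: Ints_def)
    show ?case
    proof (cases "a = 0")
      case True
      then have "f \<noteq> 0" "poly f \<alpha> = 0" using pCons.prems \<alpha> pCons.hyps by auto
      then show ?thesis using pCons.IH f_int by blast
    next
      case False
      have "a = (- poly f \<alpha>) * \<alpha>" using pCons.prems(3) by (simp add: eq_neg_iff_add_eq_0 mult.commute)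
      then have "a \<in> P" using P_mult[OF S_uminus[OF poly_in_S[OF f_int \<open>\<alpha> \<in> S\<close>]] \<alpha>(1)] by simp
      moreover have "- a \<in> P" using P_diff[OF P_0 \<open>a \<in> P\<close>] by simp
      moreover have "of_nat (nat \<bar>c\<bar>) = a \<or> of_nat (nat \<bar>c\<bar>) = - a"
        by (cases "0 \<le> c") (simp_all add: c)
      moreover have "nat \<bar>c\<bar> > 0" using False c by auto
      ultimately show ?thesis by metis
    qed
  qed simp
  then obtain p where p: "p > 0" "of_nat p \<in> P" and least: "\<And>n. n > 0 \<Longrightarrow> of_nat n \<in> P \<Longrightarrow> p \<le> n"
    using LeastI_ex[of "\<lambda>n. n > 0 \<and> of_nat n \<in> P"] Least_le[of "\<lambda>n. n > 0 \<and> of_nat n \<in> P"]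
    by (metis (no_types, lifting))
  have "p \<noteq> 1" using p(2) P_1 by auto
  moreover have "d = 1 \<or> d = p" if dvd: "d dvd p" for d
  proof -
    obtain e where e: "p = d * e" using dvd unfolding dvd_def by blast
    then have "of_nat d * of_nat e \<in> P" using p by simp
    then have "of_nat d \<in> P \<or> of_nat e \<in> P" using P_prime S_of_nat by blast
    then have "p \<le> d \<or> p \<le> e" using least e p(1) by (metis bot_nat_0.not_eq_extremum mult_is_0)
    then show ?thesis using e p(1) by auto
  qed
  ultimately have "prime p" using p(1) by (auto simp: prime_nat_iff)
  with p show ?thesis by blast
qed

text \<open>Independence modulo \<open>p\<close> implies independence over the rationals. After
  denominators are cleared, the coefficients of a relation are divisible by \<open>p\<close>, and
  division by \<open>p\<close> gives another relation; so they are divisible by all powers of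
  \<open>p\<close> and vanish.\<close>

lemma independent_mod_card:
  assumes p: "prime (p::nat)" and B: "finite B" "B \<subseteq> S"
    and ind: "\<And>c :: 'k \<Rightarrow> int. (\<exists>s\<in>S. (\<Sum>b\<in>B. of_int (c b) * b) = of_nat p * s) \<Longrightarrow> \<forall>b\<in>B. int p dvd c b"
  shows "card B \<le> card T"
proof -
  have p0: "(of_nat p :: 'k) \<noteq> 0" "p > 1" using p prime_gt_1_nat[of p] by auto
  have descent: "\<forall>b\<in>B. int p ^ k dvd c b" if "(\<Sum>b\<in>B. of_int (c b) * b) = 0" for c k
    using that
  proof (induction k arbitrary: c)
    case (Suc k)
    have "\<forall>b\<in>B. int p dvd c b" using ind[of c] Suc.prems S_0 by force
    then obtain c' where c': "\<And>b. b \<in> B \<Longrightarrow> c b = int p * c' b" unfolding dvd_def by metis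
    have "of_nat p * (\<Sum>b\<in>B. of_int (c' b) * b) = (\<Sum>b\<in>B. of_int (c b) * b)"
      by (simp add: sum_distrib_left c' mult.assoc)
    then have "(\<Sum>b\<in>B. of_int (c' b) * b) = 0" using Suc.prems p0 by simp
    then show ?case using Suc.IH c' by auto
  qed simp
  have "rat_vs.independent B"
  proof (rule rat_vs.independent_if_scalars_zero[OF B(1)])
    fix f x assume sum: "(\<Sum>b\<in>B. of_rat (f b) * b) = 0" and x: "x \<in> B"
    define d where "d = (\<Prod>b\<in>B. snd (quotient_of (f b)))"
    have d: "d \<noteq> 0" using B(1) quotient_of_denom_pos' by (auto simp: d_def less_imp_neq[symmetric])
    define c where "c b = fst (quotient_of (f b)) * (\<Prod>b'\<in>B - {b}. snd (quotient_of (f b')))" for b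
    have c: "of_int (c b) = (of_int d * of_rat (f b) :: 'k)" if "b \<in> B" for b
    proof -
      let ?n = "fst (quotient_of (f b))" and ?m = "snd (quotient_of (f b))"
      have m: "?m \<noteq> 0" using quotient_of_denom_pos'[of "f b"] by simp
      have "f b = of_int ?n / of_int ?m" using quotient_of_div[of "f b" ?n ?m] by simp
      then have "(of_rat (f b) :: 'k) = of_int ?n / of_int ?m" by (metis of_rat_divide of_rat_of_int_eq)
      moreover have "d = ?m * (\<Prod>b'\<in>B - {b}. snd (quotient_of (f b')))"
        unfolding d_def using B(1) that by (simp add: prod.remove)
      ultimately show ?thesis using m by (simp add: c_def)
    qed
    have "(\<Sum>b\<in>B. of_int (c b) * b) = of_int d * (\<Sum>b\<in>B. of_rat (f b) * b)"
      by (simp add: sum_distrib_left c mult.assoc)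
    then have "int p ^ k dvd c x" for k using descent sum x by simp
    then have "int p ^ nat \<bar>c x\<bar> dvd c x" by blast
    moreover have "nat \<bar>c x\<bar> < p ^ nat \<bar>c x\<bar>" using p0(2) by (simp add: power_gt_expt)
    then have "\<bar>c x\<bar> < int p ^ nat \<bar>c x\<bar>" by (metis nat_less_iff abs_ge_zero of_nat_power nat_int zless_nat_eq_int_zless)
    ultimately have "c x = 0" using dvd_imp_le_int[of "c x" "int p ^ nat \<bar>c x\<bar>"] by auto
    then show "f x = 0" using c[OF x] d by simp
  qed
  moreover have "B \<subseteq> rat_vs.span T" using B T S_eq by auto
  ultimately show ?thesis using rat_vs.independent_span_bound[OF T(1)] by blast
qed

text \<open>A set \<open>B\<close> of largest size that is independent modulo \<open>p\<close> spans
  \<open>S\<close> modulo \<open>p\<close>, and its combinations with coefficients from 0 to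
  \<open>p - 1\<close> are representatives. The largest size exists by
  \<open>independent_mod_card\<close>; this takes the place of an integral basis.\<close>

lemma fin_reps_mod_prime:
  assumes p: "prime (p::nat)"
  shows "\<exists>R. fin_reps S ((\<lambda>s. of_nat p * s) ` S) R"
proof -
  define ind where "ind B \<longleftrightarrow> finite B \<and> B \<subseteq> S \<and>
    (\<forall>c :: 'k \<Rightarrow> int. (\<exists>s\<in>S. (\<Sum>b\<in>B. of_int (c b) * b) = of_nat p * s) \<longrightarrow> (\<forall>b\<in>B. int p dvd c b))" for B
  have "ind {}" by (simp add: ind_def)
  moreover have "card B \<le> card T" if "ind B" for B using that independent_mod_card[OF p, of B] by (auto simp: ind_def)
  ultimately obtain B where B: "ind B" and max: "\<And>B'. ind B' \<Longrightarrow> card B' \<le> card B"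
    using ex_has_greatest_nat[of ind "{}" card "Suc (card T)"] by (metis le_imp_less_Suc)
  have fin: "finite B" "B \<subseteq> S" using B by (auto simp: ind_def)
  define R where "R = (\<lambda>e. \<Sum>b\<in>B. of_int (e b) * b) ` (B \<rightarrow>\<^sub>E {0..<int p})"
  have "finite R" unfolding R_def using fin by (intro finite_imageI finite_PiE) auto
  moreover have "R \<subseteq> S" unfolding R_def using fin by (auto intro!: S_sum S_mult S_of_int)
  moreover have "\<exists>r\<in>R. x - r \<in> (\<lambda>s. of_nat p * s) ` S" if x: "x \<in> S" for x
  proof -
    have "\<exists>e s. s \<in> S \<and> x = (\<Sum>b\<in>B. of_int (e b) * b) + of_nat p * s"
    proof (cases "x \<in> B")
      case True
      have "(\<Sum>b\<in>B. of_int (if b = x then 1 else 0) * b) = (\<Sum>b\<in>B. if b = x then b else 0)"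
        by (intro sum.cong) auto
      also have "\<dots> = x" using fin True by simp
      finally show ?thesis using S_0
        by (intro exI[of _ "\<lambda>b. if b = x then 1 else 0"] exI[of _ 0]) simp
    next
      case False
      then have "\<not> ind (insert x B)" using max[of "insert x B"] fin by auto
      then obtain c s where s: "s \<in> S" and c: "(\<Sum>b\<in>insert x B. of_int (c b) * b) = of_nat p * s"
        and nd: "\<not> (\<forall>b\<in>insert x B. int p dvd c b)"
        using fin x unfolding ind_def by blast
      have c': "of_int (c x) * x + (\<Sum>b\<in>B. of_int (c b) * b) = of_nat p * s" using c fin False by simp
      \<comment> \<open>If \<open>p\<close> divided this coefficient, a relation among the elements
        of \<open>B\<close> would remain, and all coefficients would be divisible. So the
        coefficient is invertible modulo \<open>p\<close>, and the relation can be solved for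
        \<open>x\<close>.\<close>
      have "\<not> int p dvd c x"
      proof
        assume "int p dvd c x"
        then obtain k where k: "c x = int p * k" unfolding dvd_def by blast
        have "(\<Sum>b\<in>B. of_int (c b) * b) = of_nat p * (s - of_int k * x)"
          using c' by (simp add: k algebra_simps)
        moreover have "s - of_int k * x \<in> S" using s x by (intro S_diff S_mult S_of_int)
        ultimately have "\<forall>b\<in>B. int p dvd c b" using B unfolding ind_def by blast
        with nd \<open>int p dvd c x\<close> show False by simp
      qed
      then have "coprime (c x) (int p)"
        using p by (metis coprime_commute prime_imp_coprime prime_nat_int_transfer)
      then obtain u v where uv: "u * c x + v * int p = 1" using bezout_int[of "c x" "int p"] by (metis coprime_iff_gcd_eq_1)
      have "x = of_int (u * c x + v * int p) * x" by (simp add: uv)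
      also have "\<dots> = of_int u * (of_int (c x) * x) + of_nat p * (of_int v * x)" by (simp add: algebra_simps)
      also have "of_int (c x) * x = of_nat p * s - (\<Sum>b\<in>B. of_int (c b) * b)" using c' by (simp add: algebra_simps)
      also have "of_int u * (of_nat p * s - (\<Sum>b\<in>B. of_int (c b) * b)) + of_nat p * (of_int v * x) =
          (\<Sum>b\<in>B. of_int (- u * c b) * b) + of_nat p * (of_int u * s + of_int v * x)"
        by (simp add: algebra_simps sum_distrib_left sum_negf)
      finally show ?thesis using s x by (metis S_add S_mult S_of_int)
    qed
    then obtain e s where s: "s \<in> S" and x_eq: "x = (\<Sum>b\<in>B. of_int (e b) * b) + of_nat p * s" by blast
    define r where "r = (\<Sum>b\<in>B. of_int (restrict (\<lambda>b. e b mod int p) B b) * b)"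
    have "r \<in> R" unfolding r_def R_def using p prime_gt_0_nat[of p] by (intro imageI) auto
    moreover have "x - r = of_nat p * (s + (\<Sum>b\<in>B. of_int (e b div int p) * b))"
    proof -
      have e: "(of_int (e b) :: 'k) = of_int (e b mod int p) + of_nat p * of_int (e b div int p)" for b
        by (metis mod_mult_div_eq of_int_add of_int_mult of_int_of_nat_eq)
      have "(\<Sum>b\<in>B. of_int (e b) * b) =
          (\<Sum>b\<in>B. of_int (e b mod int p) * b + of_nat p * (of_int (e b div int p) * b))"
        by (intro sum.cong refl) (subst e, simp only: distrib_right mult.assoc)
      also have "\<dots> = r + of_nat p * (\<Sum>b\<in>B. of_int (e b div int p) * b)"
        by (simp add: r_def sum.distrib sum_distrib_left)
      finally have "(\<Sum>b\<in>B. of_int (e b) * b) = r + of_nat p * (\<Sum>b\<in>B. of_int (e b div int p) * b)" .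
      then show ?thesis by (simp add: x_eq algebra_simps)
    qed
    moreover have "s + (\<Sum>b\<in>B. of_int (e b div int p) * b) \<in> S"
      using s fin by (auto intro!: S_add S_sum S_mult S_of_int)
    ultimately show ?thesis by auto
  qed
  ultimately show ?thesis unfolding fin_reps_def by blast
qed

text \<open>
  An element \<open>\<gamma>\<close> with \<open>\<gamma> P \<subseteq> p S\<close> but \<open>\<gamma> \<notin> p S\<close> makes \<open>\<gamma> / p\<close> a non-integral multiplier of \<open>P\<close> into \<open>S\<close>. It
  cannot map \<open>P\<close> to itself, because otherwise two of its powers would agree modulo \<open>S\<close> and it would
  be integral. So it maps some element of \<open>P\<close> to an element outside of \<open>P\<close>.
\<close>
theorem local_uniformizer:
  obtains \<pi> u where "\<pi> \<in> P" "u \<in> S" "u \<notin> P" "\<And>y. y \<in> P \<Longrightarrow> \<exists>b\<in>S. u * y = \<pi> * b"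
proof -
  obtain p where p: "prime p" "of_nat p \<in> P" using rational_prime_in_P by blast
  have p0: "(of_nat p :: 'k) \<noteq> 0" using p(1) prime_gt_0_nat[of p] by simp
  define J where "J = (\<lambda>s. of_nat p * s) ` S"
  obtain R where R: "fin_reps S J R" using fin_reps_mod_prime[OF p(1)] by (auto simp: J_def)
  have J_add: "x + y \<in> J" if "x \<in> J" "y \<in> J" for x y
    using that S_add by (auto simp: J_def distrib_left[symmetric])
  have J_mult: "x * y \<in> J" if "x \<in> S" "y \<in> J" for x y
    using that S_mult by (auto simp: J_def mult.left_commute[of x])
  have J_diff: "x - y \<in> J" if "x \<in> J" "y \<in> J" for x y
    using that S_diff by (auto simp: J_def right_diff_distrib[symmetric])
  have J_P: "J \<subseteq> P" using P_mult p(2) by (auto simp: J_def mult.commute)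
  have J_S: "J \<subseteq> S" using J_P P_S by auto
  \<comment> \<open>The annihilator of \<open>\<beta>\<close> in the localization at
    \<open>P\<close> of \<open>S\<close> modulo \<open>J\<close>, with the factor \<open>s\<close>
    in the role of a denominator. Elements of \<open>L 1\<close> are those that vanish in the
    localization.\<close>
  define L where "L \<beta> = {x \<in> S. \<exists>s\<in>S - P. s * (\<beta> * x) \<in> J}" for \<beta>
  have L_J: "x + t \<in> L \<beta>" if x: "x \<in> L \<beta>" and "t \<in> J" "\<beta> \<in> S" for x t \<beta>
  proof -
    obtain s where s: "s \<in> S - P" "s * (\<beta> * x) \<in> J" using x by (auto simp: L_def)
    have "s * \<beta> * t \<in> J" using s that by (intro J_mult S_mult) auto
    then have "s * (\<beta> * (x + t)) \<in> J" using J_add[OF s(2), of "s * \<beta> * t"] by (simp add: algebra_simps)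
    then show ?thesis using s x that J_S by (auto simp: L_def S_add)
  qed
  have one_notin: "1 \<notin> L 1" using J_P by (auto simp: L_def)
  define good where "good \<beta> \<longleftrightarrow> \<beta> \<in> S \<and> \<beta> \<notin> L 1" for \<beta>
  have "good 1" using one_notin S_1 by (simp add: good_def)
  moreover have "card (R \<inter> L \<beta>) \<le> card R" for \<beta> using R by (intro card_mono) (auto simp: fin_reps_def)
  \<comment> \<open>As for associated primes, a nonzero element with a maximal annihilator is
    chosen. Since \<open>L \<beta>\<close> is a union of cosets of \<open>J\<close>, its size can be
    measured by the representatives in it, of which there are at most \<open>card R\<close>.\<close>
  ultimately obtain \<beta> where \<beta>: "good \<beta>" and max: "\<And>\<beta>'. good \<beta>' \<Longrightarrow> card (R \<inter> L \<beta>') \<le> card (R \<inter> L \<beta>)"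
    using ex_has_greatest_nat[of good 1 "\<lambda>\<beta>. card (R \<inter> L \<beta>)" "Suc (card R)"] by (metis le_imp_less_Suc)
  have \<beta>S: "\<beta> \<in> S" using \<beta> by (simp add: good_def)
  have P_L: "x \<in> L \<beta>" if x: "x \<in> P" for x
  proof (rule ccontr)
    assume nx: "x \<notin> L \<beta>"
    have xS: "x \<in> S" using x P_S by auto
    \<comment> \<open>Two powers of \<open>x\<close> agree modulo \<open>J\<close>, and
      \<open>x ^ (j - i) - 1\<close> is outside of \<open>P\<close>, so \<open>x ^ i\<close>
      vanishes in the localization: \<open>x\<close> is nilpotent there. The last multiple of
      \<open>\<beta>\<close> by a power of \<open>x\<close> that does not vanish has an annihilator
      that contains \<open>L \<beta>\<close> and \<open>x\<close>, against maximality.\<close>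
    obtain i j where ij: "i < j" "x ^ j - x ^ i \<in> J"
      using fin_reps_pigeonhole[OF R, of "\<lambda>k. x ^ k"] S_power[OF xS] J_diff by blast
    have "\<beta> * x ^ i \<in> L 1"
    proof -
      let ?s = "x ^ (j - i) - 1"
      have "x ^ (j - i) \<in> P" using ij(1) x by (intro P_power_pos) auto
      then have "?s \<notin> P" using P_1 P_diff[of "x ^ (j - i)" ?s] by auto
      moreover have "?s \<in> S" using S_diff S_power xS S_1 by blast
      moreover have eq: "?s * (1 * (\<beta> * x ^ i)) = \<beta> * (x ^ j - x ^ i)"
        using ij(1) by (simp add: algebra_simps flip: power_add)
      have "?s * (1 * (\<beta> * x ^ i)) \<in> J" unfolding eq using \<beta>S ij(2) by (rule J_mult)
      moreover have "\<beta> * x ^ i \<in> S" using \<beta>S xS by (intro S_mult S_power)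
      ultimately show ?thesis unfolding L_def by blast
    qed
    define l where "l = (LEAST k. \<beta> * x ^ k \<in> L 1)"
    have l: "\<beta> * x ^ l \<in> L 1" unfolding l_def by (rule LeastI[of _ i]) fact
    have "l \<noteq> 0" using l \<beta> by (intro notI) (simp add: good_def)
    then obtain l' where l': "l = Suc l'" by (cases l) auto
    define \<beta>' where "\<beta>' = \<beta> * x ^ l'"
    have \<beta>'S: "\<beta>' \<in> S" using \<beta>S xS by (auto simp: \<beta>'_def intro!: S_mult S_power)
    have "\<beta>' \<notin> L 1" using not_less_Least[of l' "\<lambda>k. \<beta> * x ^ k \<in> L 1"] l' by (simp add: \<beta>'_def l_def)
    then have good: "good \<beta>'" using \<beta>'S by (simp add: good_def)
    have sub: "L \<beta> \<subseteq> L \<beta>'"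
    proof
      fix y assume "y \<in> L \<beta>"
      then obtain s where s: "s \<in> S - P" "s * (\<beta> * y) \<in> J" "y \<in> S" by (auto simp: L_def)
      have "s * (\<beta>' * y) \<in> J" using J_mult[OF S_power[OF xS] s(2), of l'] by (simp add: \<beta>'_def mult_ac)
      with s show "y \<in> L \<beta>'" by (auto simp: L_def)
    qed
    have x_in: "x \<in> L \<beta>'" using l xS by (auto simp: L_def \<beta>'_def l' mult_ac)
    obtain r where r: "r \<in> R" "x - r \<in> J" using R xS by (auto simp: fin_reps_def)
    have "r - x \<in> J" using J_diff[OF _ r(2), of 0] J_mult[OF S_0 r(2)] by simp
    then have "r \<in> L \<beta>'" using L_J[OF x_in _ \<beta>'S, of "r - x"] by simp
    moreover have "r \<notin> L \<beta>" using L_J[OF _ r(2) \<beta>S, of r] nx by auto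
    ultimately have "R \<inter> L \<beta> \<subset> R \<inter> L \<beta>'" using sub r by blast
    then have "card (R \<inter> L \<beta>) < card (R \<inter> L \<beta>')" using R by (intro psubset_card_mono) (auto simp: fin_reps_def)
    with max[OF good] show False by simp
  qed
  have "\<forall>r\<in>R \<inter> L \<beta>. \<exists>s. s \<in> S - P \<and> s * (\<beta> * r) \<in> J" by (auto simp: L_def)
  then obtain t where t: "\<And>r. r \<in> R \<inter> L \<beta> \<Longrightarrow> t r \<in> S - P \<and> t r * (\<beta> * r) \<in> J" by metis
  \<comment> \<open>A common denominator for the finitely many representatives in
    \<open>L \<beta>\<close>; it turns the local relation between \<open>\<beta> P\<close> and
    \<open>J\<close> into \<open>\<gamma> P \<subseteq> J\<close>.\<close>
  define s where "s = prod t (R \<inter> L \<beta>)"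
  have fin: "finite (R \<inter> L \<beta>)" using R by (auto simp: fin_reps_def)
  have s: "s \<in> S - P" unfolding s_def using fin t by (intro P_prod) auto
  define \<gamma> where "\<gamma> = s * \<beta>"
  have \<gamma>S: "\<gamma> \<in> S" using s \<beta>S by (auto simp: \<gamma>_def S_mult)
  have \<gamma>P: "\<gamma> * x \<in> J" if x: "x \<in> P" for x
  proof -
    obtain r where r: "r \<in> R" "x - r \<in> J" using R x P_S unfolding fin_reps_def by blast
    have "r - x \<in> J" using J_diff[OF _ r(2), of 0] J_mult[OF S_0 r(2)] by simp
    then have rL: "r \<in> R \<inter> L \<beta>" using L_J[OF P_L[OF x] _ \<beta>S, of "r - x"] r by simp
    have "prod t (R \<inter> L \<beta> - {r}) \<in> S - P" using fin t by (intro P_prod) auto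
    then have "prod t (R \<inter> L \<beta> - {r}) * (t r * (\<beta> * r)) \<in> J" using t[OF rL] J_mult by blast
    moreover have "s = t r * prod t (R \<inter> L \<beta> - {r})" unfolding s_def using fin rL by (simp add: prod.remove)
    ultimately have "\<gamma> * r \<in> J" by (simp add: \<gamma>_def mult_ac)
    moreover have "\<gamma> * (x - r) \<in> J" using \<gamma>S r(2) by (rule J_mult)
    ultimately show ?thesis using J_add by (fastforce simp: algebra_simps)
  qed
  have \<gamma>J: "\<gamma> \<notin> J" using \<beta> s by (auto simp: good_def L_def \<gamma>_def)
  define \<xi> where "\<xi> = \<gamma> / of_nat p"
  have \<xi>_S: "\<xi> * x \<in> S" if "x \<in> P" for x using \<gamma>P[OF that] p0 by (auto simp: \<xi>_def J_def)
  have "of_nat p * \<xi> = \<gamma>" using p0 by (simp add: \<xi>_def)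
  then have \<xi>_notin: "\<xi> \<notin> S" using \<gamma>J by (auto simp: J_def)
  have \<xi>K: "\<xi> \<in> K" using \<gamma>S S_of_nat[of p] K_mult[OF _ K_inverse] by (auto simp: \<xi>_def S_eq divide_inverse)
  have "\<exists>\<pi>\<in>P. \<xi> * \<pi> \<notin> P"
  proof (rule ccontr)
    assume "\<not> ?thesis"
    then have stable: "\<xi> * x \<in> P" if "x \<in> P" for x using that by auto
    have pow: "\<xi> ^ k * of_nat p \<in> P" for k
      by (induction k) (simp_all add: p(2) stable mult.assoc)
    obtain i j where ij: "i < j" "\<xi> ^ j * of_nat p - \<xi> ^ i * of_nat p \<in> J"
      using fin_reps_pigeonhole[OF R, of "\<lambda>k. \<xi> ^ k * of_nat p"] pow P_S J_diff by blast
    then obtain t where t: "t \<in> S" "\<xi> ^ j * of_nat p - \<xi> ^ i * of_nat p = of_nat p * t" by (auto simp: J_def)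
    then have "of_nat p * (\<xi> ^ j - \<xi> ^ i) = of_nat p * t" by (simp add: algebra_simps)
    then have t_eq: "\<xi> ^ j - \<xi> ^ i = t" using p0 by simp
    define f where "f = (monom 1 j - monom 1 i :: 'k poly)"
    have deg: "degree f = j"
      using ij(1) degree_add_eq_left[of "- monom 1 i" "monom (1::'k) j"]
      by (simp add: f_def degree_monom_eq)
    have "algebraic_int \<xi>"
    proof (rule algebraic_int_root)
      show "algebraic_int t" using t S_eq by auto
      show "poly f \<xi> = t" using t_eq by (simp add: f_def poly_monom)
      show "\<forall>i. coeff f i \<in> \<int>" by (auto simp: f_def)
      show "lead_coeff f = 1" unfolding deg using ij(1) by (simp add: f_def)
      show "degree f > 0" using deg ij(1) by simp
    qed
    with \<xi>K \<xi>_notin show False by (simp add: S_eq)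
  qed
  then obtain \<pi> where \<pi>: "\<pi> \<in> P" "\<xi> * \<pi> \<notin> P" by blast
  \<comment> \<open>The second element is \<open>u = \<xi> * \<pi>\<close>: for \<open>y\<close> in
    \<open>P\<close> the quotient of \<open>u * y\<close> by \<open>\<pi>\<close> is
    \<open>\<xi> * y\<close>, which lies in \<open>S\<close>.\<close>
  show ?thesis
  proof (rule that[OF \<pi>(1) \<xi>_S[OF \<pi>(1)] \<pi>(2)])
    fix y assume "y \<in> P"
    then show "\<exists>b\<in>S. \<xi> * \<pi> * y = \<pi> * b" using \<xi>_S by (intro bexI[of _ "\<xi> * y"]) auto
  qed
qed

end

section \<open>Characters of abelian groups\<close>

text \<open>The multiplicative group of the complex numbers, written additively.\<close>
typedef cstar = "{z::complex. z \<noteq> 0}" morphisms cval Cstar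
  by (rule exI[of _ 1]) simp

setup_lifting type_definition_cstar

instantiation cstar :: ab_group_add
begin

lift_definition zero_cstar :: cstar is 1 by simp
lift_definition plus_cstar :: "cstar \<Rightarrow> cstar \<Rightarrow> cstar" is "(*)" by simp
lift_definition uminus_cstar :: "cstar \<Rightarrow> cstar" is inverse by simp
lift_definition minus_cstar :: "cstar \<Rightarrow> cstar \<Rightarrow> cstar" is "(/)" by simp

instance
  by standard (transfer; simp add: divide_inverse)+

end

lemma cval_0 [simp]: "cval 0 = 1" by transfer simp
lemma cval_add [simp]: "cval (x + y) = cval x * cval y" by transfer simp
lemma cval_uminus [simp]: "cval (- x) = inverse (cval x)" by transfer simp
lemma cval_nonzero [simp]: "cval x \<noteq> 0" by transfer simp
lemma cval_sum: "cval (sum f A) = (\<Prod>x\<in>A. cval (f x))"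
  by (induction A rule: infinite_finite_induct) simp_all
lemma cval_eq_1_iff [simp]: "cval x = 1 \<longleftrightarrow> x = 0" by transfer simp

definition nmul :: "nat \<Rightarrow> 'a::ab_group_add \<Rightarrow> 'a" where
  "nmul n z = (\<Sum>_<n. z)"

lemma nmul_0 [simp]: "nmul 0 z = 0" and nmul_Suc [simp]: "nmul (Suc n) z = z + nmul n z"
  by (simp_all add: nmul_def add.commute)

lemma nmul_add: "nmul (m + n) z = nmul m z + nmul n z"
  by (induction m) (simp_all add: add_ac)

lemma cval_nmul: "cval (nmul n z) = cval z ^ n"
  by (induction n) simp_all

lemma card_nmul_eq: "0 < n \<Longrightarrow> card {z. nmul n z = (w::cstar)} = n \<and> finite {z. nmul n z = w}"
proof -
  assume n: "0 < n"
  have "bij_betw cval {z. nmul n z = w} {c. c ^ n = cval w}"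
  proof (rule bij_betw_byWitness[where f' = Cstar])
    show "Cstar ` {c. c ^ n = cval w} \<subseteq> {z. nmul n z = w}"
    proof clarify
      fix c assume c: "c ^ n = cval w"
      then have "c \<noteq> 0" using n by (metis cval_nonzero zero_power)
      then have "cval (nmul n (Cstar c)) = cval w" using c by (simp add: cval_nmul Cstar_inverse)
      then show "nmul n (Cstar c) = w" by (simp add: cval_inject)
    qed
    show "\<forall>c\<in>{c. c ^ n = cval w}. cval (Cstar c) = c"
      using n by (auto intro!: Cstar_inverse) (metis cval_nonzero zero_power)
  qed (auto simp: cval_inverse cval_nmul[symmetric])
  then show ?thesis
    using card_nth_roots[of "cval w" n] finite_nth_roots[OF n, of "cval w"] n
      bij_betw_same_card bij_betw_finite by (metis cval_nonzero)
qed

definition add_subgroup :: "'a::ab_group_add set \<Rightarrow> bool" where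
  "add_subgroup A \<longleftrightarrow> 0 \<in> A \<and> (\<forall>x\<in>A. \<forall>y\<in>A. x + y \<in> A) \<and> (\<forall>x\<in>A. - x \<in> A)"

lemma add_subgroupD:
  assumes "add_subgroup A"
  shows "0 \<in> A" "x \<in> A \<Longrightarrow> y \<in> A \<Longrightarrow> x + y \<in> A" "x \<in> A \<Longrightarrow> - x \<in> A" "x \<in> A \<Longrightarrow> y \<in> A \<Longrightarrow> x - y \<in> A"
  using assms unfolding add_subgroup_def by (auto simp: diff_conv_add_uminus simp del: add_uminus_conv_diff)

lemma add_subgroup_nmul: "add_subgroup A \<Longrightarrow> x \<in> A \<Longrightarrow> nmul n x \<in> A"
  by (induction n) (simp_all add: add_subgroupD)

definition cosets :: "'a::ab_group_add set \<Rightarrow> 'a set \<Rightarrow> 'a set set" where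
  "cosets A H = (\<lambda>a. (+) a ` H) ` A"

lemma coset_eq_iff:
  assumes "add_subgroup H"
  shows "(+) a ` H = (+) b ` H \<longleftrightarrow> a - b \<in> H"
proof
  assume "(+) a ` H = (+) b ` H"
  moreover have "a \<in> (+) a ` H" using add_subgroupD(1)[OF assms] by force
  ultimately show "a - b \<in> H" by auto
next
  assume ab: "a - b \<in> H"
  have "x \<in> (+) b ` H" if "x \<in> (+) a ` H" for x
    using that add_subgroupD(2)[OF assms ab] by (force simp: image_iff algebra_simps)
  moreover have "x \<in> (+) a ` H" if xb: "x \<in> (+) b ` H" for x
  proof -
    obtain h where h: "h \<in> H" "x = b + h" using xb by auto
    then have "h - (a - b) \<in> H" using add_subgroupD(4)[OF assms] ab by auto
    moreover have "x = a + (h - (a - b))" using h by simp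
    ultimately show ?thesis by blast
  qed
  ultimately show "(+) a ` H = (+) b ` H" by blast
qed

text \<open>Functions are 0 outside of \<open>A\<close>, so that a character of \<open>A\<close> is
  a single function and the extensions can be counted.\<close>

definition extensions :: "'a::ab_group_add set \<Rightarrow> 'a set \<Rightarrow> ('a \<Rightarrow> cstar) \<Rightarrow> ('a \<Rightarrow> cstar) set" where
  "extensions A H \<chi> = {\<phi>. (\<forall>x\<in>A. \<forall>y\<in>A. \<phi> (x + y) = \<phi> x + \<phi> y) \<and> (\<forall>x. x \<notin> A \<longrightarrow> \<phi> x = 0) \<and> (\<forall>x\<in>H. \<phi> x = \<chi> x)}"

lemma extension_0: "add_subgroup A \<Longrightarrow> \<phi> \<in> extensions A H \<chi> \<Longrightarrow> \<phi> 0 = 0"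
  using add_subgroupD(1)[of A] unfolding extensions_def by (auto dest!: bspec[of _ _ 0])

lemma extension_nmul:
  "add_subgroup A \<Longrightarrow> \<phi> \<in> extensions A H \<chi> \<Longrightarrow> x \<in> A \<Longrightarrow> \<phi> (nmul n x) = nmul n (\<phi> x)"
proof (induction n)
  case (Suc n)
  then show ?case using add_subgroup_nmul[of A x n] by (simp add: extensions_def)
qed (simp add: extension_0)

text \<open>One step from \<open>B\<close> to the subgroup generated by \<open>B\<close> and
  \<open>x\<close>, where \<open>N\<close> is the order of \<open>x\<close> modulo \<open>B\<close>.
  Both the index of \<open>H\<close> and the number of extensions of \<open>\<chi>\<close> are
  multiplied by \<open>N\<close>.\<close>

locale adjoin =
  fixes H B :: "'a::ab_group_add set" and x :: 'a and N :: nat and \<chi> :: "'a \<Rightarrow> cstar"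
  assumes H: "add_subgroup H" and B: "add_subgroup B" and HB: "H \<subseteq> B"
    and N: "0 < N" "nmul N x \<in> B" and N_least: "\<And>n. 0 < n \<Longrightarrow> n < N \<Longrightarrow> nmul n x \<notin> B"
begin

definition B' :: "'a set" where
  "B' = {b + nmul i x | b i. b \<in> B \<and> i < N}"

lemma exponent_unique:
  assumes "b \<in> B" "c \<in> B" "i < N" "j < N" "b + nmul i x = c + nmul j x"
  shows "i = j" "b = c"
proof -
  have *: "i = j" if "i \<le> j" "b \<in> B" "c \<in> B" "j < N" "b + nmul i x = c + nmul j x" for i j b c
  proof (rule ccontr)
    assume "i \<noteq> j"
    then have "nmul (j - i) x \<notin> B" using that by (intro N_least) auto
    moreover have "nmul j x = nmul (j - i) x + nmul i x" using that(1) by (simp flip: nmul_add)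
    then have "nmul (j - i) x = b - c" using that(5) by (simp add: algebra_simps)
    ultimately show False using add_subgroupD(4)[OF B] that by simp
  qed
  show "i = j" using *[of i j b c] *[of j i c b] assms by (metis linear)
  with assms(5) show "b = c" by simp
qed

lemma B'_I: "b \<in> B \<Longrightarrow> i < N \<Longrightarrow> b + nmul i x \<in> B'"
  by (auto simp: B'_def)

lemma B_subset: "B \<subseteq> B'"
  using B'_I[of _ 0] N by auto

lemma x_in: "x \<in> B'"
proof (cases "N = 1")
  case True
  then show ?thesis using N B_subset by auto
next
  case False
  then show ?thesis using B'_I[of 0 1] N add_subgroupD(1)[OF B] by simp
qed

lemma nmul_overflow: "N \<le> k \<Longrightarrow> b + nmul k x = (b + nmul N x) + nmul (k - N) x"
  by (simp add: add.assoc flip: nmul_add)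

lemma add_subgroup_B': "add_subgroup B'"
  unfolding add_subgroup_def
proof (intro conjI ballI)
  show "0 \<in> B'" using B_subset add_subgroupD(1)[OF B] by auto
next
  fix y z assume "y \<in> B'" "z \<in> B'"
  then obtain b i c j where *: "b \<in> B" "c \<in> B" "i < N" "j < N" "y = b + nmul i x" "z = c + nmul j x"
    by (auto simp: B'_def)
  then have sum: "y + z = (b + c) + nmul (i + j) x" by (simp add: nmul_add algebra_simps)
  show "y + z \<in> B'"
  proof (cases "i + j < N")
    case True
    then show ?thesis unfolding sum using * add_subgroupD(2)[OF B] by (intro B'_I) auto
  next
    case False
    then show ?thesis unfolding sum using * N add_subgroupD(2)[OF B]
      by (subst nmul_overflow) (auto intro!: B'_I)
  qed
next
  fix y assume "y \<in> B'"
  then obtain b i where *: "b \<in> B" "i < N" "y = b + nmul i x" by (auto simp: B'_def)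
  show "- y \<in> B'"
  proof (cases "i = 0")
    case True
    then show ?thesis using * B_subset add_subgroupD(3)[OF B] by auto
  next
    case False
    have "nmul N x = nmul i x + nmul (N - i) x" using *(2) by (simp flip: nmul_add)
    then have eq: "- y = (- b - nmul N x) + nmul (N - i) x" by (simp add: * algebra_simps)
    show ?thesis
      unfolding eq using * False N add_subgroupD(4)[OF B add_subgroupD(3)[OF B]] by (intro B'_I) auto
  qed
qed

lemma card_cosets_B':
  assumes "finite (cosets B H)"
  shows "card (cosets B' H) = N * card (cosets B H)" "finite (cosets B' H)"
proof -
  let ?f = "\<lambda>(i, C). (+) (nmul i x) ` C"
  have img: "cosets B' H = ?f ` ({..<N} \<times> cosets B H)"
  proof (intro equalityI subsetI)
    fix C assume "C \<in> cosets B' H"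
    then obtain b i where *: "b \<in> B" "i < N" "C = (+) (b + nmul i x) ` H" by (auto simp: cosets_def B'_def)
    then have "C = ?f (i, (+) b ` H)" by (simp add: image_image add_ac)
    then show "C \<in> ?f ` ({..<N} \<times> cosets B H)" using * by (auto simp: cosets_def)
  next
    fix C assume "C \<in> ?f ` ({..<N} \<times> cosets B H)"
    then obtain b i where *: "b \<in> B" "i < N" "C = (+) (nmul i x) ` (+) b ` H" by (auto simp: cosets_def)
    then have "C = (+) (b + nmul i x) ` H" by (simp add: image_image add_ac)
    then show "C \<in> cosets B' H" using * B'_I by (auto simp: cosets_def)
  qed
  have "inj_on ?f ({..<N} \<times> cosets B H)"
  proof (rule inj_onI)
    fix p p' assume pp: "p \<in> {..<N} \<times> cosets B H" "p' \<in> {..<N} \<times> cosets B H" "?f p = ?f p'"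
    obtain i C j E where p: "p = (i, C)" "p' = (j, E)" by (cases p, cases p') blast
    with pp have i: "i \<in> {..<N}" and j: "j \<in> {..<N}" and C: "C \<in> cosets B H" and E: "E \<in> cosets B H"
      and eq: "(+) (nmul i x) ` C = (+) (nmul j x) ` E"
      by auto
    obtain b c where b: "b \<in> B" "C = (+) b ` H" and c: "c \<in> B" "E = (+) c ` H"
      using C E by (auto simp: cosets_def)
    have "(+) (b + nmul i x) ` H = (+) (c + nmul j x) ` H"
      using eq by (simp add: b c image_image add_ac)
    then have h': "(b + nmul i x) - (c + nmul j x) \<in> H" by (simp add: coset_eq_iff[OF H])
    define h where "h = (b + nmul i x) - (c + nmul j x)"
    have "c + h \<in> B" unfolding h_def using c(1) subsetD[OF HB h'] by (rule add_subgroupD(2)[OF B])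
    moreover have "b + nmul i x = (c + h) + nmul j x" by (simp add: h_def algebra_simps)
    ultimately have "i = j" "b = c + h" using exponent_unique[of b "c + h" i j] b i j by auto
    then have "b - c \<in> H" using h' by (simp add: h_def)
    then show "p = p'" unfolding p using \<open>i = j\<close> b c by (simp add: coset_eq_iff[OF H])
  qed
  then show "card (cosets B' H) = N * card (cosets B H)"
    unfolding img by (simp add: card_image card_cartesian_product)
  show "finite (cosets B' H)" unfolding img using assms by auto
qed

text \<open>The normal form \<open>b + nmul i x\<close> with \<open>i < N\<close> defines an
  extension from its value \<open>z\<close> at \<open>x\<close>. The equation for \<open>z\<close>
  is exactly what additivity requires when the sum of two exponents overflows
  \<open>N\<close>.\<close>

lemma extensions_over:
  assumes \<phi>: "\<phi> \<in> extensions B H \<chi>"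
  shows "bij_betw (\<lambda>\<psi>. \<psi> x) {\<psi> \<in> extensions B' H \<chi>. \<forall>b\<in>B. \<psi> b = \<phi> b} {z. nmul N z = \<phi> (nmul N x)}"
proof (rule bij_betw_imageI)
  show "inj_on (\<lambda>\<psi>. \<psi> x) {\<psi> \<in> extensions B' H \<chi>. \<forall>b\<in>B. \<psi> b = \<phi> b}"
  proof (rule inj_onI, clarify)
    fix \<psi> \<psi>' assume *: "\<psi> \<in> extensions B' H \<chi>" "\<psi>' \<in> extensions B' H \<chi>" "\<forall>b\<in>B. \<psi> b = \<phi> b" "\<forall>b\<in>B. \<psi>' b = \<phi> b"
      and eq: "\<psi> x = \<psi>' x"
    have "\<psi> y = \<psi>' y" for y
    proof (cases "y \<in> B'")
      case True
      then obtain b i where b: "b \<in> B" "i < N" "y = b + nmul i x" by (auto simp: B'_def)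
      have "f y = f b + nmul i (f x)" if "f \<in> extensions B' H \<chi>" for f
      proof -
        have "b \<in> B'" "nmul i x \<in> B'"
          using b B_subset add_subgroup_nmul[OF add_subgroup_B' x_in] by auto
        then have "f y = f b + f (nmul i x)" using that unfolding b(3) extensions_def by blast
        then show ?thesis using extension_nmul[OF add_subgroup_B' that x_in] by simp
      qed
      from this[OF *(1)] this[OF *(2)] show ?thesis using *(3,4) eq b(1) by simp
    qed (use * in \<open>auto simp: extensions_def\<close>)
    then show "\<psi> = \<psi>'" by auto
  qed
  show "(\<lambda>\<psi>. \<psi> x) ` {\<psi> \<in> extensions B' H \<chi>. \<forall>b\<in>B. \<psi> b = \<phi> b} = {z. nmul N z = \<phi> (nmul N x)}"
  proof (intro equalityI subsetI)
    fix z assume "z \<in> (\<lambda>\<psi>. \<psi> x) ` {\<psi> \<in> extensions B' H \<chi>. \<forall>b\<in>B. \<psi> b = \<phi> b}"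
    then obtain \<psi> where \<psi>: "\<psi> \<in> extensions B' H \<chi>" "\<forall>b\<in>B. \<psi> b = \<phi> b" "z = \<psi> x" by auto
    then have "nmul N z = \<psi> (nmul N x)" using extension_nmul[OF add_subgroup_B' \<psi>(1) x_in, of N] by simp
    then show "z \<in> {z. nmul N z = \<phi> (nmul N x)}" using \<psi> N by simp
  next
    fix z assume "z \<in> {z. nmul N z = \<phi> (nmul N x)}"
    then have z: "nmul N z = \<phi> (nmul N x)" by simp
    have "\<forall>y\<in>B'. \<exists>p. fst p \<in> B \<and> snd p < N \<and> y = fst p + nmul (snd p) x"
      by (auto simp: B'_def)
    then obtain p where p: "\<And>y. y \<in> B' \<Longrightarrow> fst (p y) \<in> B \<and> snd (p y) < N \<and> y = fst (p y) + nmul (snd (p y)) x"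
      by metis
    define \<psi> where "\<psi> y = (if y \<in> B' then \<phi> (fst (p y)) + nmul (snd (p y)) z else 0)" for y
    have \<psi>: "\<psi> (b + nmul i x) = \<phi> b + nmul i z" if "b \<in> B" "i < N" for b i
      using exponent_unique[of "fst (p (b + nmul i x))" b "snd (p (b + nmul i x))" i] that p[OF B'_I[OF that]]
      by (simp add: \<psi>_def B'_I)
    have \<psi>_B: "\<psi> b = \<phi> b" if "b \<in> B" for b using \<psi>[of b 0] that N by simp
    have \<phi>_add: "\<phi> (b + c) = \<phi> b + \<phi> c" if "b \<in> B" "c \<in> B" for b c using \<phi> that by (simp add: extensions_def)
    have "\<psi> (y + w) = \<psi> y + \<psi> w" if yw: "y \<in> B'" "w \<in> B'" for y w
    proof -
      obtain b i c j where *: "b \<in> B" "c \<in> B" "i < N" "j < N" and y: "y = b + nmul i x" and w: "w = c + nmul j x"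
        using yw by (auto simp: B'_def)
      have sum: "y + w = (b + c) + nmul (i + j) x" by (simp add: y w nmul_add algebra_simps)
      have bc: "b + c \<in> B" using * add_subgroupD(2)[OF B] by auto
      have rhs: "\<psi> y + \<psi> w = \<phi> (b + c) + nmul (i + j) z"
        using * by (simp add: y w \<psi> \<phi>_add nmul_add algebra_simps)
      show ?thesis
      proof (cases "i + j < N")
        case True
        then show ?thesis unfolding rhs unfolding sum using bc by (simp add: \<psi>)
      next
        case False
        have "\<psi> (y + w) = \<phi> (b + c + nmul N x) + nmul (i + j - N) z"
          unfolding sum using False * bc N add_subgroupD(2)[OF B]
          by (subst nmul_overflow) (auto intro!: \<psi>)
        also have "\<dots> = \<phi> (b + c) + (nmul N z + nmul (i + j - N) z)"
          using \<phi>_add[OF bc N(2)] by (simp only: z add.assoc)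
        also have "nmul N z + nmul (i + j - N) z = nmul (i + j) z" using False by (simp flip: nmul_add)
        finally show ?thesis unfolding rhs .
      qed
    qed
    moreover have "\<psi> y = \<chi> y" if "y \<in> H" for y
      using that HB \<phi> \<psi>_B[of y] by (auto simp: extensions_def)
    ultimately have "\<psi> \<in> extensions B' H \<chi>" by (auto simp: extensions_def \<psi>_def)
    moreover have "\<psi> x = z"
    proof (cases "N = 1")
      case True
      then show ?thesis using \<psi>_B[of x] N z by simp
    next
      case False
      then show ?thesis using \<psi>[of 0 1] N add_subgroupD(1)[OF B] extension_0[OF B \<phi>] by simp
    qed
    ultimately show "z \<in> (\<lambda>\<psi>. \<psi> x) ` {\<psi> \<in> extensions B' H \<chi>. \<forall>b\<in>B. \<psi> b = \<phi> b}" using \<psi>_B by blast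
  qed
qed

lemma card_extensions_B':
  assumes "finite (extensions B H \<chi>)"
  shows "card (extensions B' H \<chi>) = N * card (extensions B H \<chi>)" "finite (extensions B' H \<chi>)"
proof -
  let ?F = "\<lambda>\<phi>. {\<psi> \<in> extensions B' H \<chi>. \<forall>b\<in>B. \<psi> b = \<phi> b}"
  have F: "card (?F \<phi>) = N \<and> finite (?F \<phi>)" if "\<phi> \<in> extensions B H \<chi>" for \<phi>
    using bij_betw_same_card[OF extensions_over[OF that]] bij_betw_finite[OF extensions_over[OF that]]
      card_nmul_eq[OF N(1), of "\<phi> (nmul N x)"] by simp
  have Un: "extensions B' H \<chi> = (\<Union>\<phi>\<in>extensions B H \<chi>. ?F \<phi>)"
  proof (intro equalityI subsetI)
    fix \<psi> assume \<psi>: "\<psi> \<in> extensions B' H \<chi>"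
    define \<phi> where "\<phi> y = (if y \<in> B then \<psi> y else 0)" for y
    have "\<phi> \<in> extensions B H \<chi>"
      using \<psi> B_subset HB add_subgroupD(2)[OF B] by (auto simp: extensions_def \<phi>_def subset_iff)
    moreover have "\<forall>b\<in>B. \<psi> b = \<phi> b" by (simp add: \<phi>_def)
    ultimately show "\<psi> \<in> (\<Union>\<phi>\<in>extensions B H \<chi>. ?F \<phi>)" using \<psi> by blast
  qed auto
  have "finite (\<Union>\<phi>\<in>extensions B H \<chi>. ?F \<phi>)" using F assms by simp
  then show "finite (extensions B' H \<chi>)" by (subst Un)
  have "card (\<Union>\<phi>\<in>extensions B H \<chi>. ?F \<phi>) = (\<Sum>\<phi>\<in>extensions B H \<chi>. card (?F \<phi>))"
  proof (rule card_UN_disjoint)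
    show "\<forall>\<phi>\<in>extensions B H \<chi>. \<forall>\<phi>'\<in>extensions B H \<chi>. \<phi> \<noteq> \<phi>' \<longrightarrow> ?F \<phi> \<inter> ?F \<phi>' = {}"
    proof (intro ballI impI, rule ccontr)
      fix \<phi> \<phi>' assume *: "\<phi> \<in> extensions B H \<chi>" "\<phi>' \<in> extensions B H \<chi>" "\<phi> \<noteq> \<phi>'" "?F \<phi> \<inter> ?F \<phi>' \<noteq> {}"
      then have "\<forall>b\<in>B. \<phi> b = \<phi>' b" by force
      moreover have "\<phi> b = \<phi>' b" if "b \<notin> B" for b using * that by (simp add: extensions_def)
      ultimately have "\<phi> = \<phi>'" by (intro ext) blast
      then show False using *(3) by simp
    qed
  qed (use assms F in simp_all)
  then show "card (extensions B' H \<chi>) = N * card (extensions B H \<chi>)"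
    using F by (simp flip: Un)
qed

end

text \<open>A relative form of the fact that a finite abelian group has as many characters as
  elements. The representatives are adjoined one at a time, and the index and the number of
  extensions grow by the same factor, because \<open>N\<close>-th roots of a nonzero complex number
  are exactly \<open>N\<close> in number.\<close>

theorem card_extensions:
  assumes A: "add_subgroup A" and H: "add_subgroup H" and HA: "H \<subseteq> A" and R: "fin_reps A H R"
    and \<chi>: "\<And>x y. x \<in> H \<Longrightarrow> y \<in> H \<Longrightarrow> \<chi> (x + y) = \<chi> x + \<chi> y"
  shows "card (extensions A H \<chi>) = card (cosets A H)" "finite (cosets A H)"
proof -
  have fin_R: "finite R" and R_A: "R \<subseteq> A" using R by (auto simp: fin_reps_def)
  have "\<exists>B. add_subgroup B \<and> H \<union> Q \<subseteq> B \<and> B \<subseteq> A \<and> finite (cosets B H) \<and> finite (extensions B H \<chi>) \<and>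
      card (extensions B H \<chi>) = card (cosets B H)" if "finite Q" "Q \<subseteq> A" for Q
    using that
  proof (induction Q rule: finite_induct)
    case empty
    have "extensions H H \<chi> = {\<lambda>y. if y \<in> H then \<chi> y else 0}"
      using \<chi> add_subgroupD(2)[OF H] by (fastforce simp: extensions_def)
    moreover have "(+) a ` H = H" if "a \<in> H" for a
      using coset_eq_iff[OF H, of a 0] that by simp
    then have "cosets H H = {H}" using add_subgroupD(1)[OF H] by (auto simp: cosets_def)
    ultimately show ?case using H HA by (intro exI[of _ H]) simp
  next
    case (insert x Q)
    then obtain B where hyp: "add_subgroup B" "H \<union> Q \<subseteq> B" "B \<subseteq> A" "finite (cosets B H)" "finite (extensions B H \<chi>)"
      "card (extensions B H \<chi>) = card (cosets B H)" by auto
    have x: "x \<in> A" using insert by auto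
    obtain i j where ij: "i < j" "nmul j x - nmul i x \<in> H"
    proof -
      have "\<exists>r. r \<in> R \<and> nmul k x - r \<in> H" for k
        using R add_subgroup_nmul[OF A x] by (auto simp: fin_reps_def)
      then obtain r where r: "\<And>k. r k \<in> R \<and> nmul k x - r k \<in> H" by metis
      then have "range r \<subseteq> R" by auto
      then have "\<not> inj r" using fin_R finite_subset range_inj_infinite by blast
      then obtain i j where "r i = r j" "i \<noteq> j" by (auto simp: inj_def)
      then obtain i j where ij: "r i = r j" "i < j" by (metis linorder_neqE_nat)
      have "(nmul j x - r j) - (nmul i x - r i) \<in> H" using r add_subgroupD(4)[OF H] by blast
      with ij show ?thesis using that[of i j] by simp
    qed
    have "nmul j x - nmul i x = nmul (j - i) x"
      using ij(1) nmul_add[of "j - i" i x] by simp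
    then have ex: "0 < j - i \<and> nmul (j - i) x \<in> B" using ij hyp by auto
    define N where "N = (LEAST n. 0 < n \<and> nmul n x \<in> B)"
    have N: "0 < N \<and> nmul N x \<in> B" unfolding N_def using ex by (rule LeastI)
    interpret adjoin H B x N \<chi>
    proof
      show "nmul n x \<notin> B" if "0 < n" "n < N" for n
        using that not_less_Least[of n "\<lambda>n. 0 < n \<and> nmul n x \<in> B"] by (auto simp: N_def)
    qed (use H hyp N in auto)
    have "B' \<subseteq> A"
    proof
      fix y assume "y \<in> B'"
      then obtain b i where b: "b \<in> B" and y: "y = b + nmul i x" by (auto simp: B'_def)
      show "y \<in> A"
        unfolding y using b hyp(3) add_subgroup_nmul[OF A x] by (intro add_subgroupD(2)[OF A]) auto
    qed
    moreover have "H \<union> insert x Q \<subseteq> B'" using hyp(2) B_subset x_in by auto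
    ultimately show ?case
      using add_subgroup_B' card_cosets_B'[OF hyp(4)] card_extensions_B'[OF hyp(5)] hyp(6)
      by (intro exI[of _ B'] conjI) simp_all
  qed
  from this[OF fin_R R_A] obtain B where B: "add_subgroup B" "H \<union> R \<subseteq> B" "B \<subseteq> A" "finite (cosets B H)"
    "card (extensions B H \<chi>) = card (cosets B H)" by auto
  have "A \<subseteq> B"
  proof
    fix a assume "a \<in> A"
    then obtain r where "r \<in> R" "a - r \<in> H" using R by (auto simp: fin_reps_def)
    then have "(a - r) + r \<in> B" using B add_subgroupD(2)[OF B(1)] by blast
    then show "a \<in> B" by simp
  qed
  then show "card (extensions A H \<chi>) = card (cosets A H)" "finite (cosets A H)" using B by auto
qed

section \<open>The Pontryagin dual of the completed ring\<close>

text \<open>What is used of the powers \<open>PP k\<close> of the prime ideal \<open>P\<close>. Up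
  to \<open>u\<close>, which is invertible modulo each \<open>PP k\<close>, the element
  \<open>\<pi>\<close> generates \<open>P\<close> and \<open>\<pi> ^ k\<close> generates
  \<open>PP k\<close>; an actual generator of \<open>P\<close> in \<open>S\<close> may not
  exist.\<close>

locale local_filtration =
  fixes S P :: "'k::field_char_0 set" and PP :: "nat \<Rightarrow> 'k set" and \<pi> u :: 'k and R :: "'k set"
  assumes S_0: "0 \<in> S" and S_1: "1 \<in> S"
    and S_add: "x \<in> S \<Longrightarrow> y \<in> S \<Longrightarrow> x + y \<in> S"
    and S_mult: "x \<in> S \<Longrightarrow> y \<in> S \<Longrightarrow> x * y \<in> S"
    and S_uminus: "x \<in> S \<Longrightarrow> - x \<in> S"
    and PP_0: "PP 0 = S" and PP_1: "PP 1 = P"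
    and PP_zero: "0 \<in> PP k"
    and PP_add: "x \<in> PP k \<Longrightarrow> y \<in> PP k \<Longrightarrow> x + y \<in> PP k"
    and PP_mult: "x \<in> S \<Longrightarrow> y \<in> PP k \<Longrightarrow> x * y \<in> PP k"
    and PP_Suc: "PP (Suc k) \<subseteq> PP k"
    and PP_prod: "x \<in> PP k \<Longrightarrow> y \<in> P \<Longrightarrow> x * y \<in> PP (Suc k)"
    and P_1: "1 \<notin> P"
    and R: "fin_reps S P R"
    and unit_mod_P: "a \<in> S \<Longrightarrow> a \<notin> P \<Longrightarrow> \<exists>b\<in>S. a * b - 1 \<in> P"
    and pi: "\<pi> \<in> P" "\<pi> \<noteq> 0" and u: "u \<in> S" "u \<notin> P"
    and divide: "y \<in> PP k \<Longrightarrow> \<exists>b\<in>S. u ^ k * y = \<pi> ^ k * b"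
begin

lemma S_diff: "x \<in> S \<Longrightarrow> y \<in> S \<Longrightarrow> x - y \<in> S"
  using S_add[of x "- y"] S_uminus[of y] by simp

lemma S_power: "x \<in> S \<Longrightarrow> x ^ k \<in> S"
  by (induction k) (simp_all add: S_1 S_mult)

lemma PP_uminus: "x \<in> PP k \<Longrightarrow> - x \<in> PP k"
  using PP_mult[of "- 1" x k] S_uminus[OF S_1] by simp

lemma PP_diff: "x \<in> PP k \<Longrightarrow> y \<in> PP k \<Longrightarrow> x - y \<in> PP k"
  using PP_add[of x k "- y"] PP_uminus[of y] by simp

lemma PP_mono: "k \<le> l \<Longrightarrow> PP l \<subseteq> PP k"
  by (rule lift_Suc_antimono_le[of PP]) (rule PP_Suc)

lemma PP_S: "x \<in> PP k \<Longrightarrow> x \<in> S"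
  using PP_mono[of 0 k] PP_0 by auto

lemma P_S: "x \<in> P \<Longrightarrow> x \<in> S"
  using PP_S[of x 1] PP_1 by auto

lemma pi_S: "\<pi> \<in> S"
  using pi(1) by (rule P_S)

lemma P_power: "x \<in> P \<Longrightarrow> x ^ k \<in> PP k"
proof (induction k)
  case (Suc k)
  then show ?case using PP_prod[of "x ^ k" k x] by (simp add: mult.commute)
qed (simp add: PP_0 S_1)

lemma add_subgroup_PP: "add_subgroup (PP k)"
  by (simp add: add_subgroup_def PP_zero PP_add PP_uminus)

lemma add_subgroup_S: "add_subgroup S" and add_subgroup_P: "add_subgroup P"
  using add_subgroup_PP[of 0] add_subgroup_PP[of 1] by (simp_all add: PP_0 PP_1[simplified])

text \<open>If \<open>b\<close> inverts \<open>a\<close> modulo \<open>PP k\<close> and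
  \<open>c\<close> inverts it modulo \<open>P\<close>, the product of the two errors lies in
  \<open>PP (Suc k)\<close>, and its negative is the error of
  \<open>b + c - b * a * c\<close>.\<close>

lemma unit_mod_PP:
  assumes a: "a \<in> S" "a \<notin> P"
  shows "\<exists>b\<in>S. b * a - 1 \<in> PP k"
proof (induction k)
  case 0
  then show ?case using S_diff[OF _ S_1] S_1 S_mult[OF S_1] a by (intro bexI[of _ 1]) (auto simp: PP_0)
next
  case (Suc k)
  obtain b where b: "b \<in> S" "b * a - 1 \<in> PP k" using Suc by blast
  obtain c where c: "c \<in> S" "a * c - 1 \<in> P" using unit_mod_P[OF a] by blast
  have "(b * a - 1) * (a * c - 1) \<in> PP (Suc k)" using PP_prod[OF b(2) c(2)] .
  then have "- ((b * a - 1) * (a * c - 1)) \<in> PP (Suc k)" by (rule PP_uminus)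
  moreover have "- ((b * a - 1) * (a * c - 1)) = (b + c - b * a * c) * a - 1" by (simp add: algebra_simps)
  ultimately show ?case using b c a S_diff S_add S_mult by (metis (no_types, lifting))
qed

lemma u_notin_P: "u ^ k \<notin> P"
proof
  assume k: "u ^ k \<in> P"
  obtain b where b: "b \<in> S" "b * u - 1 \<in> PP 1" using unit_mod_PP[OF u] by blast
  have "\<exists>c\<in>S. c * u ^ k - 1 \<in> P" for k
  proof (induction k)
    case 0
    then show ?case using S_1 PP_zero[of 1] by (intro bexI[of _ 1]) (simp_all add: PP_1[simplified])
  next
    case (Suc k)
    then obtain c where c: "c \<in> S" "c * u ^ k - 1 \<in> P" by blast
    have "(c * u ^ k) * (b * u - 1) \<in> P"
      using PP_mult[of "c * u ^ k" "b * u - 1" 1] b c u S_mult S_power PP_1 by auto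
    then have "(c * u ^ k) * (b * u - 1) + (c * u ^ k - 1) \<in> P"
      using c add_subgroupD(2)[OF add_subgroup_P] by blast
    moreover have "(c * u ^ k) * (b * u - 1) + (c * u ^ k - 1) = (c * b) * u ^ Suc k - 1"
      by (simp add: algebra_simps)
    ultimately show ?case using b c S_mult by metis
  qed
  then obtain c where c: "c \<in> S" "c * u ^ k - 1 \<in> P" by blast
  have "c * u ^ k \<in> P" using PP_mult[of c "u ^ k" 1] c k PP_1 by simp
  then have "c * u ^ k - (c * u ^ k - 1) \<in> P" using c add_subgroupD(4)[OF add_subgroup_P] by blast
  then show False using P_1 by simp
qed

text \<open>In the ambient field \<open>\<pi>\<close> cancels from
  \<open>u ^ Suc k * (\<pi> * x) = \<pi> ^ Suc k * s\<close>, and the remaining factor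
  \<open>u ^ Suc k\<close> is invertible modulo \<open>PP k\<close>.\<close>

lemma pi_cancel_PP:
  assumes x: "x \<in> S" "\<pi> * x \<in> PP (Suc k)"
  shows "x \<in> PP k"
proof -
  obtain s where s: "s \<in> S" "u ^ Suc k * (\<pi> * x) = \<pi> ^ Suc k * s" using divide[OF x(2)] by blast
  then have "\<pi> * (u ^ Suc k * x) = \<pi> * (\<pi> ^ k * s)" by (simp add: mult_ac)
  then have eq: "u ^ Suc k * x = \<pi> ^ k * s" using mult_left_cancel[OF pi(2)] by blast
  have "u ^ Suc k * x \<in> PP k"
    unfolding eq using PP_mult[OF s(1) P_power[OF pi(1)]] by (simp add: mult.commute)
  moreover obtain b where b: "b \<in> S" "b * u ^ Suc k - 1 \<in> PP k"
    using unit_mod_PP[OF S_power[OF u(1)] u_notin_P] by blast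
  ultimately have "b * (u ^ Suc k * x) \<in> PP k" "x * (b * u ^ Suc k - 1) \<in> PP k"
    using x(1) PP_mult by blast+
  then have "b * (u ^ Suc k * x) - x * (b * u ^ Suc k - 1) \<in> PP k" by (rule PP_diff)
  moreover have "b * (u ^ Suc k * x) - x * (b * u ^ Suc k - 1) = x"
    by (simp add: algebra_simps del: power_Suc)
  ultimately show ?thesis by simp
qed

lemma P_divide:
  assumes "y \<in> P"
  shows "u * y / \<pi> \<in> S"
proof -
  obtain b where "b \<in> S" "u * y = \<pi> * b" using divide[of y 1] assms PP_1 by auto
  then show ?thesis using pi(2) by simp
qed

definition q :: nat where
  "q = card (cosets S P)"

definition act :: "'k \<Rightarrow> ('k \<Rightarrow> cstar) \<Rightarrow> 'k \<Rightarrow> cstar" where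
  "act a \<chi> = (\<lambda>x. if x \<in> S then \<chi> (a * x) else 0)"

definition chars :: "nat \<Rightarrow> ('k \<Rightarrow> cstar) set" where
  "chars k = extensions S (PP k) (\<lambda>_. 0)"

definition D :: "('k \<Rightarrow> cstar) set" where
  "D = (\<Union>k. chars k)"

lemma charsD:
  assumes "\<chi> \<in> chars k"
  shows "x \<in> S \<Longrightarrow> y \<in> S \<Longrightarrow> \<chi> (x + y) = \<chi> x + \<chi> y" "x \<notin> S \<Longrightarrow> \<chi> x = 0" "x \<in> PP k \<Longrightarrow> \<chi> x = 0"
  using assms by (auto simp: chars_def extensions_def)

lemma chars_mono: "k \<le> l \<Longrightarrow> \<chi> \<in> chars k \<Longrightarrow> \<chi> \<in> chars l"
  using PP_mono[of k l] by (auto simp: chars_def extensions_def)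

lemma D_obtain2:
  assumes "\<chi> \<in> D" "\<psi> \<in> D"
  obtains k where "\<chi> \<in> chars k" "\<psi> \<in> chars k"
proof -
  obtain k l where "\<chi> \<in> chars k" "\<psi> \<in> chars l" using assms by (auto simp: D_def)
  then show ?thesis using that[of "max k l"] chars_mono by (meson max.cobounded1 max.cobounded2)
qed

lemma char_diff:
  assumes "\<chi> \<in> D" "x \<in> S" "y \<in> S"
  shows "\<chi> (x - y) = \<chi> x - \<chi> y"
proof -
  obtain k where "\<chi> \<in> chars k" using assms by (auto simp: D_def)
  then have "\<chi> (x - y + y) = \<chi> (x - y) + \<chi> y" using assms S_diff by (intro charsD) auto
  then show ?thesis by simp
qed

lemma char_add: "\<chi> \<in> D \<Longrightarrow> x \<in> S \<Longrightarrow> y \<in> S \<Longrightarrow> \<chi> (x + y) = \<chi> x + \<chi> y"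
  using charsD(1) by (auto simp: D_def)

lemma act_chars:
  assumes a: "a \<in> S" and \<chi>: "\<chi> \<in> chars k"
  shows "act a \<chi> \<in> chars k"
  unfolding chars_def extensions_def mem_Collect_eq
proof (intro conjI ballI allI impI)
  fix x y assume "x \<in> S" "y \<in> S"
  then show "act a \<chi> (x + y) = act a \<chi> x + act a \<chi> y"
    using S_add S_mult[OF a] charsD(1)[OF \<chi>, of "a * x" "a * y"] by (simp add: act_def distrib_left)
next
  fix x assume "x \<notin> S"
  then show "act a \<chi> x = 0" by (simp add: act_def)
next
  fix x assume "x \<in> PP k"
  then show "act a \<chi> x = 0"
    using PP_S PP_mult[OF a] charsD(3)[OF \<chi>, of "a * x"] by (simp add: act_def)
qed

text \<open>Modulo any \<open>PP l\<close> an element \<open>w\<close> of \<open>PP (Suc k)\<close>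
  is \<open>\<pi>\<close> times an element of \<open>PP k\<close>: the quotient
  \<open>u * w / \<pi>\<close> lies in \<open>PP k\<close>, and the factor \<open>u\<close> is
  removed by its inverse modulo \<open>PP l\<close>, where \<open>l\<close> is some level of
  \<open>\<chi>\<close>.\<close>

lemma act_pi_chars:
  assumes "\<chi> \<in> D" "act \<pi> \<chi> \<in> chars k"
  shows "\<chi> \<in> chars (Suc k)"
proof -
  obtain l where l: "\<chi> \<in> chars l" using assms(1) by (auto simp: D_def)
  have "\<chi> w = 0" if w: "w \<in> PP (Suc k)" for w
  proof -
    have wP: "w \<in> P" using w PP_mono[of 1 "Suc k"] PP_1 by auto
    have wS: "w \<in> S" using w by (rule PP_S)
    define t where "t = u * w / \<pi>"
    have t: "t \<in> S" "\<pi> * t = u * w"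
        unfolding t_def using P_divide[OF wP] pi(2) nonzero_mult_div_cancel_left[of \<pi>] by simp_all
    have "\<pi> * t \<in> PP (Suc k)" unfolding t(2) using u(1) w by (rule PP_mult)
    then have "t \<in> PP k" by (rule pi_cancel_PP[OF t(1)])
    moreover obtain v where v: "v \<in> S" "v * u - 1 \<in> PP l" using unit_mod_PP[OF u] by blast
    ultimately have vt: "v * t \<in> PP k" by (intro PP_mult)
    have w': "w * (v * u - 1) \<in> PP l" using wS v by (intro PP_mult)
    have "w = \<pi> * (v * t) - w * (v * u - 1)"
      using t(2) mult.left_commute[of \<pi> v t] by (simp add: algebra_simps)
    then have "\<chi> w = \<chi> (\<pi> * (v * t) - w * (v * u - 1))" by (rule arg_cong)
    also have "\<dots> = \<chi> (\<pi> * (v * t)) - \<chi> (w * (v * u - 1))"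
      using pi_S v t S_mult PP_S[OF w'] by (intro char_diff[OF assms(1)]) auto
    also have "\<chi> (w * (v * u - 1)) = 0" using w' by (rule charsD(3)[OF l])
    finally have "\<chi> w = \<chi> (\<pi> * (v * t))" by simp
    also have "\<chi> (\<pi> * (v * t)) = act \<pi> \<chi> (v * t)" using v t S_mult by (simp add: act_def)
    also have "\<dots> = 0" using charsD(3)[OF assms(2) vt] .
    finally show ?thesis by simp
  qed
  then show ?thesis using charsD[OF l] by (auto simp: chars_def extensions_def)
qed

lemma card_extensions_P:
  assumes "\<And>x y. x \<in> P \<Longrightarrow> y \<in> P \<Longrightarrow> \<chi> (x + y) = \<chi> x + \<chi> y"
  shows "card (extensions S P \<chi>) = q"
  unfolding q_def using assms R P_S by (intro card_extensions add_subgroup_S add_subgroup_P) auto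

lemma finite_cosets: "finite (cosets S P)"
  using card_extensions(2)[OF add_subgroup_S add_subgroup_P _ R, of "\<lambda>_. 0"] P_S by auto

lemma q_ge_2: "2 \<le> q"
proof -
  have "(+) 1 ` P \<noteq> (+) 0 ` P" using coset_eq_iff[OF add_subgroup_P, of 1 0] P_1 by simp
  then have "card {(+) 1 ` P, (+) 0 ` P} = 2" by simp
  moreover have "{(+) 1 ` P, (+) 0 ` P} \<subseteq> cosets S P" 
    unfolding cosets_def using S_0 S_1 by blast
  ultimately show ?thesis unfolding q_def using card_mono[OF finite_cosets] by metis
qed

text \<open>A solution \<open>\<psi>\<close> is prescribed on \<open>P\<close>, where its value is
  that of \<open>\<chi>\<close> at the quotient by \<open>\<pi>\<close>, and it is free otherwise.
  So the solutions are the extensions to \<open>S\<close> of one character of \<open>P\<close>, and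
  their number is the index of \<open>P\<close>.\<close>

lemma act_pi_fibre:
  assumes \<chi>: "\<chi> \<in> D"
  shows "card {\<psi> \<in> D. act \<pi> \<psi> = \<chi>} = q"
proof -
  obtain k where k: "\<chi> \<in> chars k" using \<chi> by (auto simp: D_def)
  obtain v where v: "v \<in> S" "v * u - 1 \<in> PP (Suc k)" using unit_mod_PP[OF u] by blast
  \<comment> \<open>The argument stands for \<open>y / \<pi>\<close>: it lies in \<open>S\<close>,
    and \<open>v * u\<close> is 1 modulo \<open>PP (Suc k)\<close>, the level at which the solutions
    live.\<close>
  define \<phi> where "\<phi> y = \<chi> (v * (u * y / \<pi>))" for y
  have \<phi>_add: "\<phi> (x + y) = \<phi> x + \<phi> y" if "x \<in> P" "y \<in> P" for x y
  proof -
    have "v * (u * (x + y) / \<pi>) = v * (u * x / \<pi>) + v * (u * y / \<pi>)"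
      by (simp add: distrib_left add_divide_distrib)
    moreover have "v * (u * x / \<pi>) \<in> S" "v * (u * y / \<pi>) \<in> S"
      using that P_divide v(1) S_mult by blast+
    ultimately show ?thesis unfolding \<phi>_def using charsD(1)[OF k] by metis
  qed
  have "{\<psi> \<in> D. act \<pi> \<psi> = \<chi>} = extensions S P \<phi>"
  proof (intro equalityI subsetI)
    fix \<psi> assume "\<psi> \<in> {\<psi> \<in> D. act \<pi> \<psi> = \<chi>}"
    then have \<psi>: "\<psi> \<in> D" "act \<pi> \<psi> = \<chi>" by auto
    then have \<psi>k: "\<psi> \<in> chars (Suc k)" using act_pi_chars k by simp
    have "\<psi> y = \<phi> y" if y: "y \<in> P" for y
    proof -
      define t where "t = u * y / \<pi>"
      have t: "t \<in> S" "\<pi> * t = u * y"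
        unfolding t_def using P_divide[OF y] pi(2) nonzero_mult_div_cancel_left[of \<pi>] by simp_all
      have y': "y * (v * u - 1) \<in> PP (Suc k)" using P_S[OF y] v by (intro PP_mult)
      have "y = \<pi> * (v * t) - y * (v * u - 1)"
        using t(2) mult.left_commute[of \<pi> v t] by (simp add: algebra_simps)
      then have "\<psi> y = \<psi> (\<pi> * (v * t) - y * (v * u - 1))" by (rule arg_cong)
      also have "\<dots> = \<psi> (\<pi> * (v * t)) - \<psi> (y * (v * u - 1))"
        using pi_S v t S_mult PP_S[OF y'] by (intro char_diff[OF \<psi>(1)]) auto
      also have "\<psi> (y * (v * u - 1)) = 0" using y' by (rule charsD(3)[OF \<psi>k])
      finally have "\<psi> y = \<psi> (\<pi> * (v * t))" by simp
      also have "\<psi> (\<pi> * (v * t)) = act \<pi> \<psi> (v * t)" using v t S_mult by (simp add: act_def)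
      finally show ?thesis by (simp add: \<psi>(2) \<phi>_def t_def)
    qed
    then show "\<psi> \<in> extensions S P \<phi>" using charsD[OF \<psi>k] by (auto simp: extensions_def)
  next
    fix \<psi> assume \<psi>: "\<psi> \<in> extensions S P \<phi>"
    have "\<psi> w = 0" if w: "w \<in> PP (Suc k)" for w
    proof -
      have wP: "w \<in> P" using w PP_mono[of 1 "Suc k"] PP_1 by auto
      define t where "t = u * w / \<pi>"
      have t: "t \<in> S" "\<pi> * t = u * w"
        unfolding t_def using P_divide[OF wP] pi(2) nonzero_mult_div_cancel_left[of \<pi>] by simp_all
      have "\<pi> * t \<in> PP (Suc k)" unfolding t(2) using u(1) w by (rule PP_mult)
      then have "v * t \<in> PP k" using v(1) PP_mult pi_cancel_PP[OF t(1)] by blast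
      then show ?thesis using \<psi> wP charsD(3)[OF k] by (simp add: extensions_def \<phi>_def t_def)
    qed
    then have "\<psi> \<in> chars (Suc k)" using \<psi> by (auto simp: chars_def extensions_def)
    then have "\<psi> \<in> D" by (auto simp: D_def)
    moreover have "act \<pi> \<psi> x = \<chi> x" for x
    proof (cases "x \<in> S")
      case True
      have "\<pi> * x \<in> P" using PP_mult[OF True, of \<pi> 1] pi(1) PP_1 by (simp add: mult.commute)
      then have "act \<pi> \<psi> x = \<chi> (v * (u * x))"
        using \<psi> True pi(2) by (simp add: act_def extensions_def \<phi>_def)
      also have "\<dots> = \<chi> (x * (v * u - 1)) + \<chi> x"
      proof -
        have "x * (v * u - 1) \<in> S" using True v u S_mult S_diff S_1 by simp
        then have "\<chi> (x * (v * u - 1) + x) = \<chi> (x * (v * u - 1)) + \<chi> x"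
          using True by (rule charsD(1)[OF k])
        then show ?thesis by (simp add: algebra_simps)
      qed
      also have "x * (v * u - 1) \<in> PP k" using PP_mult[OF True v(2)] PP_Suc by blast
      then have "\<chi> (x * (v * u - 1)) = 0" by (rule charsD(3)[OF k])
      finally show ?thesis by simp
    qed (simp add: act_def charsD(2)[OF k])
    ultimately show "\<psi> \<in> {\<psi> \<in> D. act \<pi> \<psi> = \<chi>}" by auto
  qed
  then show ?thesis using card_extensions_P[of \<phi>] \<phi>_add by simp
qed

lemma act_pi_zero_chars: "\<chi> \<in> D \<Longrightarrow> act \<pi> \<chi> = 0 \<Longrightarrow> \<chi> \<in> extensions S P (\<lambda>_. 0)"
  using act_pi_chars[of \<chi> 0] PP_1 by (simp add: chars_def extensions_def PP_0)

text \<open>Characters killed by \<open>\<pi>\<close> are characters of the residue field. The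
  multiples of a nonzero one by elements of the residue field are pairwise different, which gives
  \<open>q\<close> of them, and there are only \<open>q\<close> in all.\<close>

lemma socle_orbit:
  assumes \<chi>: "\<chi> \<in> D" "\<chi> \<noteq> 0" "act \<pi> \<chi> = 0" and \<psi>: "\<psi> \<in> D" "act \<pi> \<psi> = 0"
  shows "\<exists>a\<in>S. \<psi> = act a \<chi>"
proof -
  let ?E = "extensions S P (\<lambda>_. 0)"
  have E: "?E = chars 1" by (simp add: chars_def PP_1[simplified])
  have \<chi>E: "\<chi> \<in> chars 1" using act_pi_zero_chars[OF \<chi>(1,3)] E by simp
  have eq_iff: "act a \<chi> = act b \<chi> \<longleftrightarrow> a - b \<in> P" if ab: "a \<in> S" "b \<in> S" for a b
  proof
    assume "a - b \<in> P"
    then have "\<chi> (a * x) = \<chi> (b * x)" if "x \<in> S" for x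
    proof -
      have "x * (a - b) \<in> PP 1" using \<open>a - b \<in> P\<close> that PP_mult[of x "a - b" 1] PP_1 by simp
      then have "\<chi> (x * (a - b)) = 0" by (rule charsD(3)[OF \<chi>E])
      then have "\<chi> (a * x - b * x) = 0" by (simp add: algebra_simps)
      then show ?thesis using char_diff[OF \<chi>(1), of "a * x" "b * x"] ab that S_mult by simp
    qed
    then show "act a \<chi> = act b \<chi>" by (auto simp: act_def)
  next
    assume eq: "act a \<chi> = act b \<chi>"
    show "a - b \<in> P"
    proof (rule ccontr)
      assume "a - b \<notin> P"
      moreover have "a - b \<in> S" using ab S_diff by blast
      ultimately obtain c where c: "c \<in> S" "c * (a - b) - 1 \<in> PP 1" using unit_mod_PP[of "a - b" 1] by blast
      have "\<chi> x = 0" for x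
      proof (cases "x \<in> S")
        case True
        have "x * (c * (a - b) - 1) \<in> PP 1" using True c(2) by (rule PP_mult)
        then have "\<chi> (x * (c * (a - b) - 1)) = 0" by (rule charsD(3)[OF \<chi>E])
        moreover have cx: "c * x \<in> S" using c True S_mult by simp
        then have "\<chi> (a * (c * x)) = \<chi> (b * (c * x))" using fun_cong[OF eq, of "c * x"] by (simp add: act_def)
        then have "\<chi> (a * (c * x) - b * (c * x)) = 0" using char_diff[OF \<chi>(1)] ab cx S_mult by simp
        moreover have "\<chi> ((a * (c * x) - b * (c * x)) - x * (c * (a - b) - 1)) =
            \<chi> (a * (c * x) - b * (c * x)) - \<chi> (x * (c * (a - b) - 1))"
          using ab c cx True S_mult S_diff S_1 by (intro char_diff[OF \<chi>(1)]) auto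
        moreover have "(a * (c * x) - b * (c * x)) - x * (c * (a - b) - 1) = x" by (simp add: algebra_simps)
        ultimately show ?thesis by simp
      qed (simp add: charsD(2)[OF \<chi>E])
      then show False using \<chi>(2) by auto
    qed
  qed
  \<comment> \<open>The multiple \<open>act a \<chi>\<close> depends only on the coset of
    \<open>a\<close>, so a choice of representatives turns it into a map on cosets.\<close>
  define F where "F C = act (SOME a. a \<in> S \<and> C = (+) a ` P) \<chi>" for C
  have F: "F ((+) a ` P) = act a \<chi>" if "a \<in> S" for a
  proof -
    let ?b = "SOME b. b \<in> S \<and> (+) a ` P = (+) b ` P"
    have "\<exists>b. b \<in> S \<and> (+) a ` P = (+) b ` P" using that by blast
    then have "?b \<in> S \<and> (+) a ` P = (+) ?b ` P" by (rule someI_ex)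
    then have "?b \<in> S" "a - ?b \<in> P" using coset_eq_iff[OF add_subgroup_P, of a ?b] by blast+
    then have "act a \<chi> = act ?b \<chi>" using eq_iff[OF that] by blast
    then show ?thesis unfolding F_def by (rule sym)
  qed
  have "inj_on F (cosets S P)"
  proof (rule inj_onI)
    fix C C' assume "C \<in> cosets S P" "C' \<in> cosets S P" and eq: "F C = F C'"
    then obtain a b where "a \<in> S" "b \<in> S" "C = (+) a ` P" "C' = (+) b ` P" by (auto simp: cosets_def)
    then show "C = C'" using eq F eq_iff coset_eq_iff[OF add_subgroup_P] by simp
  qed
  then have "card (F ` cosets S P) = q" by (simp add: card_image q_def)
  moreover have "F ` cosets S P = (\<lambda>a. act a \<chi>) ` S" using F by (force simp: cosets_def)
  moreover have "card ?E = q" by (rule card_extensions_P) simp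
  moreover have "(\<lambda>a. act a \<chi>) ` S \<subseteq> ?E" using act_chars[OF _ \<chi>E] E by auto
  moreover have "finite ?E" using \<open>card ?E = q\<close> q_ge_2 by (intro card_ge_0_finite) simp
  ultimately have "(\<lambda>a. act a \<chi>) ` S = ?E" by (intro card_subset_eq) auto
  then show ?thesis using act_pi_zero_chars[OF \<psi>] by blast
qed

lemma divisible_module_dual: "divisible_module S D act \<pi> q"
proof unfold_locales
  show "0 \<in> D" by (auto simp: D_def chars_def extensions_def)
  show "x + y \<in> D" if xy: "x \<in> D" "y \<in> D" for x y
  proof -
    obtain k where "x \<in> chars k" "y \<in> chars k" using D_obtain2[OF xy] by blast
    then have "x + y \<in> chars k" by (auto simp: chars_def extensions_def)
    then show ?thesis by (auto simp: D_def)
  qed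
  show "- x \<in> D" if x: "x \<in> D" for x
  proof -
    obtain k where "x \<in> chars k" using x by (auto simp: D_def)
    then have "- x \<in> chars k" by (auto simp: chars_def extensions_def)
    then show ?thesis by (auto simp: D_def)
  qed
  show "act a x \<in> D" if "a \<in> S" "x \<in> D" for a x
    using that act_chars by (auto simp: D_def)
  show "act a (x + y) = act a x + act a y" for a x y
    by (auto simp: act_def)
  show "act (a + b) x = act a x + act b x" if "a \<in> S" "b \<in> S" "x \<in> D" for a b x
    using that char_add[OF that(3)] S_mult by (auto simp: act_def distrib_right fun_eq_iff)
  show "act (a * b) x = act a (act b x)" if "a \<in> S" "b \<in> S" for a b x
    using that S_mult by (auto simp: act_def fun_eq_iff mult_ac)
  show "act 1 x = x" if "x \<in> D" for x
    using that charsD(2) by (auto simp: act_def D_def fun_eq_iff)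
  show "\<exists>k. act (\<pi> ^ k) x = 0" if x: "x \<in> D" for x
  proof -
    obtain k where k: "x \<in> chars k" using x by (auto simp: D_def)
    have "\<pi> ^ k * y \<in> PP k" if "y \<in> S" for y
      using PP_mult[OF that P_power[OF pi(1)]] by (simp add: mult.commute)
    then have "act (\<pi> ^ k) x = 0" using charsD(3)[OF k] by (auto simp: act_def)
    then show ?thesis by blast
  qed
  show "0 \<in> S" "1 \<in> S" "\<pi> \<in> S" "2 \<le> q" by (fact S_0 S_1 pi_S q_ge_2)+
  show "a + b \<in> S" "a * b \<in> S" if "a \<in> S" "b \<in> S" for a b
    using that by (simp_all add: S_add S_mult)
  show "- a \<in> S" if "a \<in> S" for a
    using that by (rule S_uminus)
  show "card {y \<in> D. act \<pi> y = x} = q" if "x \<in> D" for x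
    using that by (rule act_pi_fibre)
  show "\<exists>a\<in>S. y = act a x" if "x \<in> D" "x \<noteq> 0" "act \<pi> x = 0" "y \<in> D" "act \<pi> y = 0" for x y
    using that by (rule socle_orbit)
qed

end

section \<open>Families of matrices\<close>

text \<open>Irreducibility for a family over any index set, so that a representation of the
  completed group can be compared with its restriction to the dense subgroup over
  \<open>S\<close>.\<close>

definition irreducible_on :: "'g set \<Rightarrow> nat \<Rightarrow> ('g \<Rightarrow> complex mat) \<Rightarrow> bool" where
  "irreducible_on X d \<rho> \<longleftrightarrow> 0 < d \<and>
     (\<forall>W. W \<subseteq> carrier_vec d \<and> 0\<^sub>v d \<in> W \<and> (\<forall>v\<in>W. \<forall>w\<in>W. v + w \<in> W) \<and> (\<forall>c. \<forall>v\<in>W. c \<cdot>\<^sub>v v \<in> W) \<and>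
          (\<forall>g\<in>X. \<forall>v\<in>W. \<rho> g *\<^sub>v v \<in> W) \<longrightarrow> W = {0\<^sub>v d} \<or> W = carrier_vec d)"

lemma irreducible_onD:
  assumes "irreducible_on X d \<rho>" "W \<subseteq> carrier_vec d" "0\<^sub>v d \<in> W"
    "\<And>v w. v \<in> W \<Longrightarrow> w \<in> W \<Longrightarrow> v + w \<in> W" "\<And>c v. v \<in> W \<Longrightarrow> c \<cdot>\<^sub>v v \<in> W"
    "\<And>g v. g \<in> X \<Longrightarrow> v \<in> W \<Longrightarrow> \<rho> g *\<^sub>v v \<in> W"
  shows "W = {0\<^sub>v d} \<or> W = carrier_vec d"
proof -
  have "W \<subseteq> carrier_vec d \<and> 0\<^sub>v d \<in> W \<and> (\<forall>v\<in>W. \<forall>w\<in>W. v + w \<in> W) \<and> (\<forall>c. \<forall>v\<in>W. c \<cdot>\<^sub>v v \<in> W) \<and>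
      (\<forall>g\<in>X. \<forall>v\<in>W. \<rho> g *\<^sub>v v \<in> W) \<longrightarrow> W = {0\<^sub>v d} \<or> W = carrier_vec d"
    using assms(1) unfolding irreducible_on_def by (elim conjE) (rule spec)
  then show ?thesis using assms(2-6) by simp
qed

lemma subspace_module_vec_iff:
  "VectorSpace.subspace class_ring W (module_vec TYPE(complex) d) \<longleftrightarrow>
    W \<subseteq> carrier_vec d \<and> 0\<^sub>v d \<in> W \<and> (\<forall>v\<in>W. \<forall>w\<in>W. v + w \<in> W) \<and> (\<forall>c. \<forall>v\<in>W. c \<cdot>\<^sub>v v \<in> W)"
proof -
  interpret vec_space "TYPE(complex)" d .
  have "VectorSpace.subspace class_ring W (module_vec TYPE(complex) d) \<longleftrightarrow>
      submodule class_ring W (module_vec TYPE(complex) d)"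
    using vectorspace_axioms by (simp add: VectorSpace.subspace_def)
  also have "\<dots> \<longleftrightarrow> W \<subseteq> carrier_vec d \<and> 0\<^sub>v d \<in> W \<and> (\<forall>v\<in>W. \<forall>w\<in>W. v + w \<in> W) \<and> (\<forall>c. \<forall>v\<in>W. c \<cdot>\<^sub>v v \<in> W)"
    using module_axioms by (auto simp: LinearCombinations.submodule_def module_vec_simps)
  finally show ?thesis .
qed

lemma irreducible_rep_iff: "irreducible_rep G d \<rho> \<longleftrightarrow> irreducible_on (carrier G) d \<rho>"
  by (simp only: irreducible_rep_def irreducible_on_def subspace_module_vec_iff conj_assoc)

definition mtrace :: "complex mat \<Rightarrow> complex" where
  "mtrace A = (\<Sum>r<dim_row A. A $$ (r, r))"

lemma mtrace_mult_commute:
  assumes "A \<in> carrier_mat d e" "B \<in> carrier_mat e d"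
  shows "mtrace (A * B) = mtrace (B * A)"
proof -
  have "mtrace (A * B) = (\<Sum>r<d. \<Sum>s<e. A $$ (r, s) * B $$ (s, r))"
    using assms by (auto simp: mtrace_def scalar_prod_def atLeast0LessThan intro!: sum.cong)
  also have "\<dots> = (\<Sum>s<e. \<Sum>r<d. B $$ (s, r) * A $$ (r, s))"
    by (subst sum.swap) (simp add: mult.commute)
  also have "\<dots> = mtrace (B * A)"
    using assms by (auto simp: mtrace_def scalar_prod_def atLeast0LessThan intro!: sum.cong)
  finally show ?thesis .
qed

lemma mtrace_one: "mtrace (1\<^sub>m d) = of_nat d"
  by (simp add: mtrace_def)

lemma mult_mat_unit_vec:
  fixes A :: "complex mat"
  shows "A \<in> carrier_mat d e \<Longrightarrow> i < e \<Longrightarrow> A *\<^sub>v unit_vec e i = col A i"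
  by (intro eq_vecI) (auto simp: mult_mat_vec_def scalar_prod_right_unit)

lemma mult_mat_zero_vec: "(A :: complex mat) \<in> carrier_mat d e \<Longrightarrow> A *\<^sub>v 0\<^sub>v e = 0\<^sub>v d"
  by (intro eq_vecI) auto

lemma zero_smult_add_vec:
  "(v :: complex vec) \<in> carrier_vec d \<Longrightarrow> w \<in> carrier_vec d \<Longrightarrow> 0 \<cdot>\<^sub>v v + w = w"
  by (intro eq_vecI) auto

lemma eq_matI_mult_vec:
  fixes A B :: "complex mat"
  assumes "A \<in> carrier_mat d e" "B \<in> carrier_mat d e" "\<And>v. v \<in> carrier_vec e \<Longrightarrow> A *\<^sub>v v = B *\<^sub>v v"
  shows "A = B"
proof (rule eq_matI)
  fix i j assume ij: "i < dim_row B" "j < dim_col B"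
  have "col A j = col B j"
    using assms ij mult_mat_unit_vec[of A d e j] mult_mat_unit_vec[of B d e j] by auto
  then show "A $$ (i, j) = B $$ (i, j)" using ij assms by (metis carrier_matD index_col)
qed (use assms in auto)

text \<open>
  The kernel and the range of an intertwiner are invariant, so a nonzero one is invertible, and the
  dimensions are compared through the trace of the identity.
\<close>
lemma intertwiner:
  assumes irr: "irreducible_on X d \<rho>" "irreducible_on X e \<sigma>"
    and \<rho>: "\<And>g. g \<in> X \<Longrightarrow> \<rho> g \<in> carrier_mat d d" and \<sigma>: "\<And>g. g \<in> X \<Longrightarrow> \<sigma> g \<in> carrier_mat e e"
    and M: "M \<in> carrier_mat d e" and nz: "\<exists>v\<in>carrier_vec e. M *\<^sub>v v \<noteq> 0\<^sub>v d"
    and eq: "\<And>g. g \<in> X \<Longrightarrow> \<rho> g * M = M * \<sigma> g"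
  shows "d = e" "g \<in> X \<Longrightarrow> mtrace (\<rho> g) = mtrace (\<sigma> g)"
proof -
  have eq_vec: "\<rho> g *\<^sub>v (M *\<^sub>v v) = M *\<^sub>v (\<sigma> g *\<^sub>v v)" if "g \<in> X" "v \<in> carrier_vec e" for g v
    using arg_cong[OF eq[OF that(1)], of "\<lambda>A. A *\<^sub>v v"] that M \<rho> \<sigma>
    by (metis assoc_mult_mat_vec)
  define ker where "ker = {v \<in> carrier_vec e. M *\<^sub>v v = 0\<^sub>v d}"
  have "ker = {0\<^sub>v e} \<or> ker = carrier_vec e"
  proof (rule irreducible_onD[OF irr(2)])
    show "v + w \<in> ker" if "v \<in> ker" "w \<in> ker" for v w
      using that M by (auto simp: ker_def mult_add_distrib_mat_vec)
    show "c \<cdot>\<^sub>v v \<in> ker" if "v \<in> ker" for c v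
      using that M by (auto simp: ker_def mult_mat_vec)
    show "\<sigma> g *\<^sub>v v \<in> ker" if "g \<in> X" "v \<in> ker" for g v
      using that eq_vec[of g v] mult_mat_zero_vec[OF \<rho>[of g]] \<sigma>[of g] by (auto simp: ker_def)
  qed (use M in \<open>auto simp: ker_def\<close>)
  then have ker: "ker = {0\<^sub>v e}" using nz by (auto simp: ker_def)
  define ran where "ran = (\<lambda>v. M *\<^sub>v v) ` carrier_vec e"
  have "ran = {0\<^sub>v d} \<or> ran = carrier_vec d"
  proof (rule irreducible_onD[OF irr(1)])
    show "0\<^sub>v d \<in> ran" using M by (auto simp: ran_def intro!: image_eqI[of _ _ "0\<^sub>v e"])
    show "v + w \<in> ran" if vw: "v \<in> ran" "w \<in> ran" for v w
    proof -
      obtain v' w' where "v' \<in> carrier_vec e" "w' \<in> carrier_vec e" "v = M *\<^sub>v v'" "w = M *\<^sub>v w'"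
        using vw by (auto simp: ran_def)
      then show ?thesis using M
        by (auto simp: ran_def mult_add_distrib_mat_vec[symmetric] intro!: imageI)
    qed
    show "c \<cdot>\<^sub>v v \<in> ran" if v: "v \<in> ran" for c v
    proof -
      obtain v' where "v' \<in> carrier_vec e" "v = M *\<^sub>v v'" using v by (auto simp: ran_def)
      then show ?thesis using M by (auto simp: ran_def mult_mat_vec[symmetric] intro!: imageI)
    qed
    show "\<rho> g *\<^sub>v v \<in> ran" if v: "g \<in> X" "v \<in> ran" for g v
    proof -
      obtain v' where v': "v' \<in> carrier_vec e" "v = M *\<^sub>v v'" using v by (auto simp: ran_def)
      have "\<sigma> g *\<^sub>v v' \<in> carrier_vec e" using \<sigma>[OF v(1)] v'(1) by auto
      then show ?thesis using eq_vec[OF v(1) v'(1)] by (simp add: v' ran_def)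
    qed
  qed (use M in \<open>auto simp: ran_def\<close>)
  then have ran: "ran = carrier_vec d" using nz by (auto simp: ran_def)
  have "\<forall>i<d. \<exists>v. v \<in> carrier_vec e \<and> M *\<^sub>v v = unit_vec d i"
  proof (intro allI impI)
    fix i assume "i < d"
    then have "unit_vec d i \<in> ran" unfolding ran by simp
    then show "\<exists>v. v \<in> carrier_vec e \<and> M *\<^sub>v v = unit_vec d i" by (auto simp: ran_def)
  qed
  then obtain n where n: "\<And>i. i < d \<Longrightarrow> n i \<in> carrier_vec e \<and> M *\<^sub>v n i = unit_vec d i" by metis
  define N where "N = mat_of_cols e (map n [0..<d])"
  have N: "N \<in> carrier_mat e d" by (simp add: N_def mat_of_cols_def)
  have col_N: "col N i = n i" if "i < d" for i
    unfolding N_def using that n[OF that] by (subst col_mat_of_cols) auto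
  have MN: "M * N = 1\<^sub>m d"
  proof (rule eq_matI_mult_vec[of _ d d])
    fix v :: "complex vec" assume v: "v \<in> carrier_vec d"
    show "(M * N) *\<^sub>v v = 1\<^sub>m d *\<^sub>v v"
    proof -
      have "M * N = 1\<^sub>m d"
      proof (rule eq_matI)
        fix i j assume ij: "i < dim_row (1\<^sub>m d)" "j < dim_col (1\<^sub>m d)"
        then have "(M * N) $$ (i, j) = (M *\<^sub>v col N j) $ i" using M N by auto
        then show "(M * N) $$ (i, j) = 1\<^sub>m d $$ (i, j)" using ij n[of j] col_N[of j] by auto
      qed (use M N in auto)
      then show ?thesis by simp
    qed
  qed (use M N in auto)
  have NM: "N * M = 1\<^sub>m e"
  proof (rule eq_matI_mult_vec[of _ e e])
    fix v :: "complex vec" assume v: "v \<in> carrier_vec e"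
    have Mv: "M *\<^sub>v v \<in> carrier_vec d" using M v by auto
    let ?w = "N *\<^sub>v (M *\<^sub>v v) - v"
    have Nw: "N *\<^sub>v (M *\<^sub>v v) \<in> carrier_vec e" using N Mv by auto
    have "M *\<^sub>v (N *\<^sub>v (M *\<^sub>v v)) = (M * N) *\<^sub>v (M *\<^sub>v v)"
      using assoc_mult_mat_vec[OF M N Mv] by simp
    also have "\<dots> = M *\<^sub>v v" unfolding MN using Mv by simp
    finally have "M *\<^sub>v ?w = 0\<^sub>v d"
      using M v Nw Mv by (simp add: mult_minus_distrib_mat_vec)
    then have "?w \<in> ker" using Nw v by (auto simp: ker_def)
    then have w: "?w = 0\<^sub>v e" unfolding ker by simp
    have "N *\<^sub>v (M *\<^sub>v v) = ?w + v" using N Nw v by (intro eq_vecI) auto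
    also have "\<dots> = v" unfolding w using v by simp
    finally show "(N * M) *\<^sub>v v = 1\<^sub>m e *\<^sub>v v"
      using assoc_mult_mat_vec[OF N M v] v by simp
  qed (use M N in auto)
  have "(of_nat d :: complex) = of_nat e"
    using mtrace_mult_commute[OF M N] MN NM by (simp add: mtrace_one)
  then show de: "d = e" by simp
  assume g: "g \<in> X"
  have "\<rho> g = \<rho> g * (M * N)" using \<rho>[OF g] by (simp add: MN)
  also have "\<dots> = M * \<sigma> g * N" using \<rho>[OF g] M N eq[OF g] by (metis assoc_mult_mat)
  finally have "mtrace (\<rho> g) = mtrace (M * (\<sigma> g * N))" using M N \<sigma>[OF g] by (metis assoc_mult_mat)
  also have "\<dots> = mtrace (\<sigma> g * N * M)"
    using mtrace_mult_commute[OF M, of "\<sigma> g * N"] N \<sigma>[OF g] by auto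
  also have "\<sigma> g * N * M = \<sigma> g" using M N \<sigma>[OF g] NM by (metis assoc_mult_mat right_mult_one_mat)
  finally show "mtrace (\<rho> g) = mtrace (\<sigma> g)" .
qed

text \<open>Schur's lemma with an eigenvector at hand: its eigenspace is invariant and
  nonzero.\<close>

lemma commuting_scalar:
  assumes irr: "irreducible_on X d \<rho>" and \<rho>: "\<And>g. g \<in> X \<Longrightarrow> \<rho> g \<in> carrier_mat d d"
    and A: "A \<in> carrier_mat d d" and comm: "\<And>g. g \<in> X \<Longrightarrow> \<rho> g * A = A * \<rho> g"
    and v: "v \<in> carrier_vec d" "v \<noteq> 0\<^sub>v d" "A *\<^sub>v v = c \<cdot>\<^sub>v v"
  shows "w \<in> carrier_vec d \<Longrightarrow> A *\<^sub>v w = c \<cdot>\<^sub>v w"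
proof -
  define W where "W = {w \<in> carrier_vec d. A *\<^sub>v w = c \<cdot>\<^sub>v w}"
  have "W = {0\<^sub>v d} \<or> W = carrier_vec d"
  proof (rule irreducible_onD[OF irr])
    show "w + w' \<in> W" if "w \<in> W" "w' \<in> W" for w w'
      using that A by (auto simp: W_def mult_add_distrib_mat_vec smult_add_distrib_vec)
    show "b \<cdot>\<^sub>v w \<in> W" if "w \<in> W" for b w
      using that A by (auto simp: W_def mult_mat_vec smult_smult_assoc mult.commute)
    show "\<rho> g *\<^sub>v w \<in> W" if g: "g \<in> X" and w: "w \<in> W" for g w
    proof -
      have w': "w \<in> carrier_vec d" "A *\<^sub>v w = c \<cdot>\<^sub>v w" using w by (auto simp: W_def)
      have "A *\<^sub>v (\<rho> g *\<^sub>v w) = \<rho> g *\<^sub>v (A *\<^sub>v w)"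
        using comm[OF g] A \<rho>[OF g] w' by (metis assoc_mult_mat_vec)
      then show ?thesis using w' \<rho>[OF g] by (auto simp: W_def mult_mat_vec)
    qed
  qed (use A in \<open>auto simp: W_def\<close>)
  moreover have "v \<in> W" using v by (simp add: W_def)
  ultimately have "W = carrier_vec d" using v by auto
  then show "w \<in> carrier_vec d \<Longrightarrow> A *\<^sub>v w = c \<cdot>\<^sub>v w" by (auto simp: W_def)
qed

text \<open>The vector \<open>p(T) v\<close>, evaluated by Horner's rule.\<close>

definition poly_act :: "complex mat \<Rightarrow> complex vec \<Rightarrow> complex poly \<Rightarrow> complex vec" where
  "poly_act T v p = foldr (\<lambda>a w. a \<cdot>\<^sub>v v + T *\<^sub>v w) (coeffs p) (0\<^sub>v (dim_vec v))"

lemma poly_act_0: "v \<in> carrier_vec d \<Longrightarrow> poly_act T v 0 = 0\<^sub>v d"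
  by (simp add: poly_act_def)

lemma poly_act_pCons:
  assumes "T \<in> carrier_mat d d" "v \<in> carrier_vec d"
  shows "poly_act T v (pCons a p) = a \<cdot>\<^sub>v v + T *\<^sub>v poly_act T v p"
proof (cases "a = 0 \<and> p = 0")
  case True
  moreover have "T *\<^sub>v 0\<^sub>v d = 0\<^sub>v d" using assms by auto
  ultimately show ?thesis using assms by (auto simp: poly_act_0[OF assms(2)])
next
  case False
  then show ?thesis by (auto simp: poly_act_def cCons_def)
qed

lemma poly_act_carrier:
  assumes "T \<in> carrier_mat d d" "v \<in> carrier_vec d"
  shows "poly_act T v p \<in> carrier_vec d"
  using assms by (induction p) (auto simp: poly_act_0[OF assms(2)] poly_act_pCons[OF assms])

lemma poly_act_smult:
  assumes "T \<in> carrier_mat d d" "v \<in> carrier_vec d"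
  shows "poly_act T v (Polynomial.smult c p) = c \<cdot>\<^sub>v poly_act T v p"
proof (induction p)
  case (pCons a p)
  have "T *\<^sub>v (c \<cdot>\<^sub>v poly_act T v p) = c \<cdot>\<^sub>v (T *\<^sub>v poly_act T v p)"
    using mult_mat_vec[OF assms(1) poly_act_carrier[OF assms]] .
  then show ?case
    using assms poly_act_carrier[OF assms, of p] pCons
    by (simp add: poly_act_pCons[OF assms] smult_add_distrib_vec smult_smult_assoc)
qed (use poly_act_0[OF assms(2)] in auto)

lemma poly_act_add:
  assumes "T \<in> carrier_mat d d" "v \<in> carrier_vec d"
  shows "poly_act T v (p + r) = poly_act T v p + poly_act T v r"
proof (induction p r rule: poly_induct2)
  case 0
  show ?case using poly_act_0[OF assms(2)] by simp
next
  case (pCons a p b r)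
  have c: "poly_act T v p \<in> carrier_vec d" "poly_act T v r \<in> carrier_vec d"
    using poly_act_carrier[OF assms] by auto
  have Tc: "T *\<^sub>v poly_act T v p \<in> carrier_vec d" "T *\<^sub>v poly_act T v r \<in> carrier_vec d"
    using c assms by auto
  show ?case
    unfolding add_pCons poly_act_pCons[OF assms] pCons mult_add_distrib_mat_vec[OF assms(1) c]
    using assms Tc by (intro eq_vecI) (auto simp: distrib_right)
qed

text \<open>Write \<open>p = (X - z) r\<close> with a root \<open>z\<close>. Either
  \<open>r(T) v\<close> is an eigenvector, or it is 0 and \<open>r\<close> is an annihilator of
  smaller degree. All vectors stay in \<open>W\<close>, which will be a joint eigenspace of other
  matrices.\<close>

lemma eigenvector_of_annihilator:
  assumes T: "T \<in> carrier_mat d d" and v: "v \<in> carrier_vec d" "v \<noteq> 0\<^sub>v d" "v \<in> W"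
    and W: "\<And>w w'. w \<in> W \<Longrightarrow> w' \<in> W \<Longrightarrow> w + w' \<in> W" "\<And>c w. w \<in> W \<Longrightarrow> c \<cdot>\<^sub>v w \<in> W"
      "\<And>w. w \<in> W \<Longrightarrow> T *\<^sub>v w \<in> W" "0\<^sub>v d \<in> W"
    and p: "p \<noteq> 0" "poly_act T v p = 0\<^sub>v d"
  shows "\<exists>w c. w \<in> W \<and> w \<in> carrier_vec d \<and> w \<noteq> 0\<^sub>v d \<and> T *\<^sub>v w = c \<cdot>\<^sub>v w"
  using p
proof (induction "degree p" arbitrary: p rule: less_induct)
  case less
  have in_W: "poly_act T v p \<in> W" for p
    by (induction p) (use W v poly_act_0[OF v(1)] in \<open>auto simp: poly_act_pCons[OF T v(1)]\<close>)
  show ?case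
  proof (cases "degree p = 0")
    case True
    then obtain a where a: "p = [:a:]" by (metis degree_eq_zeroE)
    have "T *\<^sub>v 0\<^sub>v d = 0\<^sub>v d" using T by auto
    then have "a \<cdot>\<^sub>v v = 0\<^sub>v d"
      using less.prems(2) v(1) by (simp add: a poly_act_pCons[OF T v(1)] poly_act_0[OF v(1)])
    then have "a * v $ i = 0" if "i < d" for i
      using that v(1) by (metis carrier_vecD index_smult_vec(1) index_zero_vec(1))
    moreover have "a \<noteq> 0" using less.prems(1) a by auto
    ultimately have "v = 0\<^sub>v d" using v(1) by (intro eq_vecI) auto
    with v(2) show ?thesis by simp
  next
    case False
    then obtain z where "poly p z = 0"
      using Fundamental_Theorem_Algebra.fundamental_theorem_of_algebra[of p] by (auto simp: constant_degree)
    then obtain r where r: "p = [:- z, 1:] * r" by (auto simp: poly_eq_0_iff_dvd dvd_def)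
    have r0: "r \<noteq> 0" using less.prems(1) r by auto
    have "degree p = Suc (degree r)" unfolding r using r0 by (subst degree_mult_eq) auto
    then have deg: "degree r < degree p" by simp
    have c: "poly_act T v r \<in> carrier_vec d" using poly_act_carrier[OF T v(1)] .
    have "p = pCons 0 r + Polynomial.smult (- z) r" unfolding r by simp
    then have "0\<^sub>v d = (0 \<cdot>\<^sub>v v + T *\<^sub>v poly_act T v r) + (- z) \<cdot>\<^sub>v poly_act T v r"
      using less.prems(2) by (simp only: poly_act_add[OF T v(1)] poly_act_pCons[OF T v(1)] poly_act_smult[OF T v(1)])
    then have "T *\<^sub>v poly_act T v r = z \<cdot>\<^sub>v poly_act T v r"
    proof -
      assume eq: "0\<^sub>v d = (0 \<cdot>\<^sub>v v + T *\<^sub>v poly_act T v r) + (- z) \<cdot>\<^sub>v poly_act T v r"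
      show ?thesis
      proof (rule eq_vecI)
        fix i assume "i < dim_vec (z \<cdot>\<^sub>v poly_act T v r)"
        then have i: "i < d" using c by simp
        have "0 = ((0 \<cdot>\<^sub>v v + T *\<^sub>v poly_act T v r) + (- z) \<cdot>\<^sub>v poly_act T v r) $ i"
          using arg_cong[OF eq, of "\<lambda>w. w $ i"] i by simp
        also have "\<dots> = (T *\<^sub>v poly_act T v r) $ i - z * poly_act T v r $ i"
          using i c v(1) T by simp
        finally show "(T *\<^sub>v poly_act T v r) $ i = (z \<cdot>\<^sub>v poly_act T v r) $ i"
          using i c by simp
      qed (use c T in auto)
    qed
    then show ?thesis
      using less.hyps[OF deg r0] in_W[of r] c by (cases "poly_act T v r = 0\<^sub>v d") auto
  qed
qed

lemma poly_act_monom: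
  assumes "T \<in> carrier_mat d d" "v \<in> carrier_vec d"
  shows "poly_act T v (monom 1 k) = (T ^\<^sub>m k) *\<^sub>v v"
proof (induction k)
  case 0
  have "T *\<^sub>v 0\<^sub>v d = 0\<^sub>v d" using assms by auto
  then show ?case
    using assms poly_act_0[OF assms(2)] by (simp add: monom_0 poly_act_pCons[OF assms])
next
  case (Suc k)
  have "T ^\<^sub>m Suc k = T * T ^\<^sub>m k" using assms(1) by (induction k) (auto simp: assoc_mult_mat[of _ d d _ d _ d])
  moreover have Tm: "T ^\<^sub>m k \<in> carrier_mat d d" using assms(1) by auto
  from Tm have Tk: "(T ^\<^sub>m k) *\<^sub>v v \<in> carrier_vec d" using assms(2) by (rule mult_mat_vec_carrier)
  ultimately have "(T ^\<^sub>m Suc k) *\<^sub>v v = T *\<^sub>v ((T ^\<^sub>m k) *\<^sub>v v)"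
    using assms assoc_mult_mat_vec[OF assms(1) Tm assms(2)] by simp
  moreover have "T *\<^sub>v ((T ^\<^sub>m k) *\<^sub>v v) \<in> carrier_vec d" using assms(1) Tk by (rule mult_mat_vec_carrier)
  ultimately show ?case
    using Suc assms by (simp add: monom_Suc poly_act_pCons[OF assms] zero_smult_add_vec del: pow_mat.simps)
qed

text \<open>The joint eigenspace of the matrices treated so far is invariant under the next one
  because they commute, and \<open>X ^ N - 1\<close> is the annihilating polynomial needed to find
  an eigenvector in it.\<close>

lemma common_eigenvector:
  fixes \<M> :: "complex mat set"
  assumes "finite \<M>" "\<And>T. T \<in> \<M> \<Longrightarrow> T \<in> carrier_mat d d"
    and "\<And>T T'. T \<in> \<M> \<Longrightarrow> T' \<in> \<M> \<Longrightarrow> T * T' = T' * T"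
    and "\<And>T. T \<in> \<M> \<Longrightarrow> \<exists>N>0. T ^\<^sub>m N = 1\<^sub>m d" and "0 < d"
  shows "\<exists>v\<in>carrier_vec d. v \<noteq> 0\<^sub>v d \<and> (\<forall>T\<in>\<M>. \<exists>c. T *\<^sub>v v = c \<cdot>\<^sub>v v)"
  using assms(1-4)
proof (induction \<M> rule: finite_induct)
  case empty
  have "unit_vec d 0 \<noteq> (0\<^sub>v d :: complex vec)" using assms(5) by (metis index_unit_vec(1) index_zero_vec(1) zero_neq_one)
  then show ?case by (intro bexI[of _ "unit_vec d 0"]) auto
next
  case (insert T \<M>)
  have T: "T \<in> carrier_mat d d" using insert.prems(1) by simp
  obtain v where v: "v \<in> carrier_vec d" "v \<noteq> 0\<^sub>v d" "\<forall>T\<in>\<M>. \<exists>c. T *\<^sub>v v = c \<cdot>\<^sub>v v"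
    using insert.IH insert.prems by auto
  then obtain c where c: "\<And>T'. T' \<in> \<M> \<Longrightarrow> T' *\<^sub>v v = c T' \<cdot>\<^sub>v v" by metis
  obtain N where N: "0 < N" "T ^\<^sub>m N = 1\<^sub>m d" using insert.prems(3)[of T] by auto
  define W where "W = {w \<in> carrier_vec d. \<forall>T'\<in>\<M>. T' *\<^sub>v w = c T' \<cdot>\<^sub>v w}"
  have \<M>: "T' \<in> carrier_mat d d" if "T' \<in> \<M>" for T' using that insert.prems(1) by simp
  define p where "p = (monom 1 N + Polynomial.smult (- 1) (monom 1 0) :: complex poly)"
  have "coeff p N \<noteq> 0" using N(1) by (simp add: p_def coeff_monom coeff_pCons split: nat.split)
  then have p0: "p \<noteq> 0" by auto
  have "poly_act T v p = 0\<^sub>v d"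
    unfolding p_def poly_act_add[OF T v(1)] poly_act_smult[OF T v(1)] poly_act_monom[OF T v(1)]
    using N v(1) T by (intro eq_vecI) auto
  moreover have "T *\<^sub>v w \<in> W" if w: "w \<in> W" for w
  proof -
    have w': "w \<in> carrier_vec d" using w by (simp add: W_def)
    have "T' *\<^sub>v (T *\<^sub>v w) = c T' \<cdot>\<^sub>v (T *\<^sub>v w)" if T': "T' \<in> \<M>" for T'
    proof -
      have "T' *\<^sub>v (T *\<^sub>v w) = (T' * T) *\<^sub>v w"
        using assoc_mult_mat_vec[OF \<M>[OF T'] T w'] by simp
      also have "T' * T = T * T'" using insert.prems(2)[of T' T] T' by simp
      also have "(T * T') *\<^sub>v w = T *\<^sub>v (T' *\<^sub>v w)"
        using assoc_mult_mat_vec[OF T \<M>[OF T'] w'] .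
      also have "T' *\<^sub>v w = c T' \<cdot>\<^sub>v w" using w T' by (simp add: W_def)
      also have "T *\<^sub>v (c T' \<cdot>\<^sub>v w) = c T' \<cdot>\<^sub>v (T *\<^sub>v w)" using T w' by (rule mult_mat_vec)
      finally show ?thesis .
    qed
    then show ?thesis using T w' by (simp add: W_def)
  qed
  moreover have "v \<in> W" using v(1) c by (simp add: W_def)
  moreover have "w + w' \<in> W" if "w \<in> W" "w' \<in> W" for w w'
  proof -
    have "T' *\<^sub>v (w + w') = T' *\<^sub>v w + T' *\<^sub>v w'" if "T' \<in> \<M>" for T'
      using \<open>w \<in> W\<close> \<open>w' \<in> W\<close> by (intro mult_add_distrib_mat_vec[OF \<M>[OF that]]) (auto simp: W_def)
    then show ?thesis using that by (auto simp: W_def smult_add_distrib_vec)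
  qed
  moreover have "b \<cdot>\<^sub>v w \<in> W" if "w \<in> W" for b w
  proof -
    have "T' *\<^sub>v (b \<cdot>\<^sub>v w) = b \<cdot>\<^sub>v (T' *\<^sub>v w)" if "T' \<in> \<M>" for T'
      using \<open>w \<in> W\<close> by (intro mult_mat_vec[OF \<M>[OF that]]) (auto simp: W_def)
    then show ?thesis using that by (auto simp: W_def smult_smult_assoc mult.commute)
  qed
  moreover have "0\<^sub>v d \<in> W" using mult_mat_zero_vec[OF \<M>] by (auto simp: W_def)
  ultimately obtain w b where "w \<in> W" "w \<in> carrier_vec d" "w \<noteq> 0\<^sub>v d" "T *\<^sub>v w = b \<cdot>\<^sub>v w"
    using eigenvector_of_annihilator[OF T v(1,2), of W p] p0 by blast
  then show ?case by (intro bexI[of _ w]) (auto simp: W_def)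
qed

section \<open>Representations of the group over the ring of integers\<close>

type_synonym 'k heis = "(nat \<Rightarrow> 'k) \<times> (nat \<Rightarrow> 'k) \<times> (nat \<times> nat \<Rightarrow> 'k)"

fun heis_mult :: "'k::ring heis \<Rightarrow> 'k heis \<Rightarrow> 'k heis" where
  "heis_mult (a, b, c) (a', b', c') = (a + a', b + b', \<lambda>(i, j). c (i, j) + c' (i, j) + a i * b' j)"

context local_filtration begin

sublocale dual: divisible_module S D act \<pi> q
  by (rule divisible_module_dual)

definition vecs :: "nat \<Rightarrow> (nat \<Rightarrow> 'k) set" where
  "vecs n = {a. \<forall>i<n. a i \<in> S}"

definition mats :: "nat \<Rightarrow> nat \<Rightarrow> (nat \<times> nat \<Rightarrow> 'k) set" where
  "mats m n = {c. \<forall>i<m. \<forall>j<n. c (i, j) \<in> S}"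

text \<open>The group over the ring of integers, which will be dense in the completed group. Entries
  outside of the index ranges are arbitrary, so that tuples are added as functions;
  \<open>heis_cong\<close> ignores these entries.\<close>

definition heis :: "nat \<Rightarrow> nat \<Rightarrow> 'k heis set" where
  "heis m n = vecs m \<times> vecs n \<times> mats m n"

fun heis_cong :: "nat \<Rightarrow> nat \<Rightarrow> nat \<Rightarrow> 'k heis \<Rightarrow> 'k heis \<Rightarrow> bool" where
  "heis_cong m n k (a, b, c) (a', b', c') \<longleftrightarrow> (\<forall>i<m. a i - a' i \<in> PP k) \<and> (\<forall>j<n. b j - b' j \<in> PP k) \<and>
    (\<forall>i<m. \<forall>j<n. c (i, j) - c' (i, j) \<in> PP k)"

definition outer :: "(nat \<Rightarrow> 'k) \<Rightarrow> (nat \<Rightarrow> 'k) \<Rightarrow> nat \<times> nat \<Rightarrow> 'k" where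
  "outer a b = (\<lambda>(i, j). a i * b j)"

definition pair_row :: "nat \<Rightarrow> (nat \<Rightarrow> 'k \<Rightarrow> cstar) \<Rightarrow> (nat \<Rightarrow> 'k) \<Rightarrow> cstar" where
  "pair_row n y b = (\<Sum>j<n. y j (b j))"

definition central :: "nat \<Rightarrow> nat \<Rightarrow> (nat \<times> nat \<Rightarrow> 'k \<Rightarrow> cstar) \<Rightarrow> (nat \<times> nat \<Rightarrow> 'k) \<Rightarrow> cstar" where
  "central m n \<Phi> c = (\<Sum>i<m. \<Sum>j<n. \<Phi> (i, j) (c (i, j)))"

definition comb :: "nat \<Rightarrow> nat \<Rightarrow> (nat \<times> nat \<Rightarrow> 'k \<Rightarrow> cstar) \<Rightarrow> (nat \<Rightarrow> 'k) \<Rightarrow> nat \<Rightarrow> 'k \<Rightarrow> cstar" where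
  "comb m n \<Phi> a = (\<lambda>j. if j \<in> {..<n} then \<Sum>i\<in>{..<m}. act (a i) (\<Phi> (i, j)) else 0)"

definition span :: "nat \<Rightarrow> nat \<Rightarrow> (nat \<times> nat \<Rightarrow> 'k \<Rightarrow> cstar) \<Rightarrow> (nat \<Rightarrow> 'k \<Rightarrow> cstar) set" where
  "span m n \<Phi> = dual.rowspan {..<m} {..<n} \<Phi>"

text \<open>The induced representation of Clifford theory in monomial form. Basis vectors are
  indexed by the row span through the enumeration \<open>e\<close>. An element
  \<open>(a, 0, 0)\<close> translates the index by \<open>comb m n \<Phi> a\<close>, an element
  \<open>(0, b, 0)\<close> is diagonal and acts through the negatives of the elements of the span,
  and the centre acts through \<open>\<Phi>\<close>.\<close>

definition std_rep ::
  "nat \<Rightarrow> nat \<Rightarrow> (nat \<times> nat \<Rightarrow> 'k \<Rightarrow> cstar) \<Rightarrow> (nat \<Rightarrow> nat \<Rightarrow> 'k \<Rightarrow> cstar) \<Rightarrow> 'k heis \<Rightarrow> complex mat" where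
  "std_rep m n \<Phi> e = (\<lambda>(a, b, c). mat (card (span m n \<Phi>)) (card (span m n \<Phi>))
    (\<lambda>(s, t). if e s = e t + comb m n \<Phi> a then cval (central m n \<Phi> c - pair_row n (e s) b) else 0))"

lemma vecs_add: "a \<in> vecs n \<Longrightarrow> b \<in> vecs n \<Longrightarrow> a + b \<in> vecs n"
  and vecs_uminus: "a \<in> vecs n \<Longrightarrow> - a \<in> vecs n"
  and vecs_0: "0 \<in> vecs n" and mats_0: "0 \<in> mats m n"
  and mats_add: "c \<in> mats m n \<Longrightarrow> c' \<in> mats m n \<Longrightarrow> c + c' \<in> mats m n"
  and mats_uminus: "c \<in> mats m n \<Longrightarrow> - c \<in> mats m n"
  and outer_mats: "a \<in> vecs m \<Longrightarrow> b \<in> vecs n \<Longrightarrow> outer a b \<in> mats m n"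
  by (auto simp: vecs_def mats_def outer_def S_add S_uminus S_0 S_mult)

lemma vecs_diff: "a \<in> vecs n \<Longrightarrow> b \<in> vecs n \<Longrightarrow> a - b \<in> vecs n"
  and mats_diff: "c \<in> mats m n \<Longrightarrow> c' \<in> mats m n \<Longrightarrow> c - c' \<in> mats m n"
  by (auto simp: vecs_def mats_def S_diff)

lemma heis_mult_eq: "heis_mult (a, b, c) (a', b', c') = (a + a', b + b', c + c' + outer a b')"
  by (auto simp: outer_def)

lemma heis_mult_closed: "g \<in> heis m n \<Longrightarrow> h \<in> heis m n \<Longrightarrow> heis_mult g h \<in> heis m n"
  by (auto simp: heis_def heis_mult_eq intro!: vecs_add mats_add outer_mats simp del: heis_mult.simps)

lemma heis_cong_refl: "heis_cong m n k g g"
  by (cases g) (simp add: PP_zero)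

lemma heis_cong_mult:
  assumes "g \<in> heis m n" "g' \<in> heis m n" "h \<in> heis m n" "h' \<in> heis m n"
    and "heis_cong m n k g g'" "heis_cong m n k h h'"
  shows "heis_cong m n k (heis_mult g h) (heis_mult g' h')"
proof -
  obtain a b c a' b' c' where g: "g = (a, b, c)" "g' = (a', b', c')" by (cases g, cases g') auto
  obtain x y z x' y' z' where h: "h = (x, y, z)" "h' = (x', y', z')" by (cases h, cases h') auto
  have "a i + x i - (a' i + x' i) \<in> PP k" if "i < m" for i
    using PP_add[of "a i - a' i" k "x i - x' i"] assms(5,6) that by (simp add: g h algebra_simps)
  moreover have "b i + y i - (b' i + y' i) \<in> PP k" if "i < n" for i
    using PP_add[of "b i - b' i" k "y i - y' i"] assms(5,6) that by (simp add: g h algebra_simps)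
  moreover have "c (i, j) + z (i, j) + a i * y j - (c' (i, j) + z' (i, j) + a' i * y' j) \<in> PP k"
    if ij: "i < m" "j < n" for i j
  proof -
    have "a i * (y j - y' j) \<in> PP k" "y' j * (a i - a' i) \<in> PP k"
      using assms ij by (auto simp: g h heis_def vecs_def intro!: PP_mult)
    moreover have "c (i, j) - c' (i, j) \<in> PP k" "z (i, j) - z' (i, j) \<in> PP k"
      using assms(5,6) ij by (auto simp: g h)
    ultimately have "(c (i, j) - c' (i, j)) + (z (i, j) - z' (i, j)) + (a i * (y j - y' j) + y' j * (a i - a' i)) \<in> PP k"
      by (intro PP_add)
    then show ?thesis by (simp add: algebra_simps)
  qed
  ultimately show ?thesis by (simp add: g h)
qed

lemma comb_span: "a \<in> vecs m \<Longrightarrow> comb m n \<Phi> a \<in> span m n \<Phi>"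
  unfolding comb_def span_def by (rule dual.rowspanI) (auto simp: vecs_def)

lemma span_comb: "y \<in> span m n \<Phi> \<Longrightarrow> \<exists>a\<in>vecs m. y = comb m n \<Phi> a"
proof -
  assume "y \<in> span m n \<Phi>"
  then obtain a where a: "a \<in> {..<m} \<rightarrow> S" and y: "y = comb m n \<Phi> a"
    unfolding span_def dual.rowspan_def comb_def by (elim imageE)
  from a have "a \<in> vecs m" by (auto simp: vecs_def)
  with y show ?thesis by blast
qed

lemma comb_0: "\<Phi> \<in> {..<m} \<times> {..<n} \<rightarrow> D \<Longrightarrow> comb m n \<Phi> 0 = 0"
  by (auto simp: comb_def fun_eq_iff Pi_iff)

lemma comb_add:
  assumes "\<Phi> \<in> {..<m} \<times> {..<n} \<rightarrow> D" "a \<in> vecs m" "b \<in> vecs m"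
  shows "comb m n \<Phi> (a + b) = comb m n \<Phi> a + comb m n \<Phi> b"
proof (rule ext)
  fix j
  show "comb m n \<Phi> (a + b) j = (comb m n \<Phi> a + comb m n \<Phi> b) j"
  proof (cases "j < n")
    case True
    have "(\<Sum>i<m. act ((a + b) i) (\<Phi> (i, j))) = (\<Sum>i<m. act (a i) (\<Phi> (i, j)) + act (b i) (\<Phi> (i, j)))"
      using assms True by (intro sum.cong refl) (auto simp: vecs_def Pi_iff intro!: dual.act_add_left)
    then show ?thesis using True by (simp add: comb_def sum.distrib)
  qed (simp add: comb_def)
qed

context
  fixes m n k :: nat and \<Phi> :: "nat \<times> nat \<Rightarrow> 'k \<Rightarrow> cstar"
  assumes \<Phi>: "\<And>i j. i < m \<Longrightarrow> j < n \<Longrightarrow> \<Phi> (i, j) \<in> chars k"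
begin

lemma \<Phi>_D: "\<Phi> \<in> {..<m} \<times> {..<n} \<rightarrow> D"
  using \<Phi> by (auto simp: D_def)

lemma finite_span: "finite (span m n \<Phi>)"
  unfolding span_def using \<Phi>_D by (intro dual.finite_rowspan) auto

lemma span_add: "y \<in> span m n \<Phi> \<Longrightarrow> z \<in> span m n \<Phi> \<Longrightarrow> y + z \<in> span m n \<Phi>"
  using dual.rowspan_add[OF \<Phi>_D, of y z] by (simp add: span_def plus_fun_def)

lemma span_diff: "y \<in> span m n \<Phi> \<Longrightarrow> z \<in> span m n \<Phi> \<Longrightarrow> y - z \<in> span m n \<Phi>"
  using dual.rowspan_minus[OF \<Phi>_D, of y z] by (simp add: span_def fun_diff_def)

lemma span_0: "0 \<in> span m n \<Phi>"
  using comb_span[OF vecs_0] comb_0[OF \<Phi>_D] by metis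

lemma chars_add: "\<chi> \<in> chars k \<Longrightarrow> \<psi> \<in> chars k \<Longrightarrow> \<chi> + \<psi> \<in> chars k"
  by (auto simp: chars_def extensions_def)

lemma chars_0: "0 \<in> chars k"
  by (auto simp: chars_def extensions_def)

lemma chars_sum: "(\<And>i. i \<in> I \<Longrightarrow> f i \<in> chars k) \<Longrightarrow> sum f I \<in> chars k"
  by (induction I rule: infinite_finite_induct) (simp_all add: chars_0 chars_add)

lemma span_chars:
  assumes "y \<in> span m n \<Phi>" "j < n"
  shows "y j \<in> chars k"
proof -
  obtain a where "a \<in> vecs m" "y = comb m n \<Phi> a" using span_comb assms by blast
  then show ?thesis
    using assms(2) \<Phi> by (auto simp: comb_def vecs_def intro!: chars_sum act_chars)
qed

lemma chars_cong:
  assumes "\<chi> \<in> chars k" "x \<in> S" "y \<in> S" "x - y \<in> PP k"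
  shows "\<chi> x = \<chi> y"
proof -
  have "\<chi> \<in> D" using assms(1) by (auto simp: D_def)
  then show ?thesis using char_diff[of \<chi> x y] assms charsD(3)[OF assms(1,4)] by simp
qed

lemma pair_row_add_right:
  "y \<in> span m n \<Phi> \<Longrightarrow> b \<in> vecs n \<Longrightarrow> b' \<in> vecs n \<Longrightarrow> pair_row n y (b + b') = pair_row n y b + pair_row n y b'"
  unfolding pair_row_def sum.distrib[symmetric]
  by (intro sum.cong refl) (auto simp: vecs_def intro!: charsD(1)[OF span_chars])

lemma pair_row_add_left: "pair_row n (y + z) b = pair_row n y b + pair_row n z b"
  by (simp add: pair_row_def sum.distrib)

lemma pair_row_cong:
  "y \<in> span m n \<Phi> \<Longrightarrow> b \<in> vecs n \<Longrightarrow> b' \<in> vecs n \<Longrightarrow> (\<And>j. j < n \<Longrightarrow> b j - b' j \<in> PP k) \<Longrightarrow>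
    pair_row n y b = pair_row n y b'"
  unfolding pair_row_def
  by (intro sum.cong refl) (auto simp: vecs_def intro!: chars_cong[OF span_chars])

lemma pair_row_0: "y \<in> span m n \<Phi> \<Longrightarrow> pair_row n y 0 = 0"
  unfolding pair_row_def by (intro sum.neutral) (auto intro!: charsD(3)[OF span_chars] PP_zero)

lemma central_add:
  assumes "c \<in> mats m n" "c' \<in> mats m n"
  shows "central m n \<Phi> (c + c') = central m n \<Phi> c + central m n \<Phi> c'"
  unfolding central_def sum.distrib[symmetric]
  using assms by (intro sum.cong refl) (auto simp: mats_def intro!: charsD(1)[OF \<Phi>])

lemma central_cong:
  assumes "c \<in> mats m n" "c' \<in> mats m n" "\<And>i j. i < m \<Longrightarrow> j < n \<Longrightarrow> c (i, j) - c' (i, j) \<in> PP k"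
  shows "central m n \<Phi> c = central m n \<Phi> c'"
  unfolding central_def using assms by (intro sum.cong refl) (auto simp: mats_def intro!: chars_cong[OF \<Phi>])

lemma central_0: "central m n \<Phi> 0 = 0"
  unfolding central_def by (intro sum.neutral ballI) (auto intro!: charsD(3)[OF \<Phi>] PP_zero)

text \<open>The commutator of \<open>(a, 0, 0)\<close> and \<open>(0, b, 0)\<close> is the central
  element given by \<open>outer a b\<close>. This is how the row span arises: conjugation by
  \<open>a\<close> shifts a character of \<open>b\<close>, up to sign, by
  \<open>comb m n \<Phi> a\<close>.\<close>

lemma central_outer:
  assumes "a \<in> vecs m" "b \<in> vecs n"
  shows "central m n \<Phi> (outer a b) = pair_row n (comb m n \<Phi> a) b"
proof -
  have app: "sum f A x = (\<Sum>i\<in>A. f i x)" for f :: "nat \<Rightarrow> 'k \<Rightarrow> cstar" and A x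
    by (induction A rule: infinite_finite_induct) auto
  have "pair_row n (comb m n \<Phi> a) b = (\<Sum>j<n. \<Sum>i<m. act (a i) (\<Phi> (i, j)) (b j))"
    unfolding pair_row_def by (intro sum.cong refl) (simp add: comb_def app)
  also have "\<dots> = (\<Sum>j<n. \<Sum>i<m. \<Phi> (i, j) (a i * b j))"
    using assms by (intro sum.cong refl) (auto simp: act_def vecs_def)
  finally show ?thesis unfolding central_def outer_def by (subst sum.swap) simp
qed

lemma comb_cong:
  assumes "a \<in> vecs m" "a' \<in> vecs m" "\<And>i. i < m \<Longrightarrow> a i - a' i \<in> PP k"
  shows "comb m n \<Phi> a = comb m n \<Phi> a'"
proof -
  have "act (a i) (\<Phi> (i, j)) = act (a' i) (\<Phi> (i, j))" if ij: "i < m" "j < n" for i j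
  proof (rule ext)
    fix x
    show "act (a i) (\<Phi> (i, j)) x = act (a' i) (\<Phi> (i, j)) x"
    proof (cases "x \<in> S")
      case True
      have "x * (a i - a' i) \<in> PP k" using True assms(3)[OF ij(1)] by (rule PP_mult)
      then have "a i * x - a' i * x \<in> PP k" by (simp add: algebra_simps)
      moreover have "a i * x \<in> S" "a' i * x \<in> S" using assms(1,2) ij True by (auto simp: vecs_def intro!: S_mult)
      ultimately show ?thesis using chars_cong[OF \<Phi>[OF ij]] True by (simp add: act_def)
    qed (simp add: act_def)
  qed
  then show ?thesis unfolding comb_def by (intro ext) (auto intro!: sum.cong)
qed

context
  fixes e :: "nat \<Rightarrow> nat \<Rightarrow> 'k \<Rightarrow> cstar"
  assumes e: "bij_betw e {..<card (span m n \<Phi>)} (span m n \<Phi>)"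
begin

abbreviation "dd \<equiv> card (span m n \<Phi>)"
abbreviation "std \<equiv> std_rep m n \<Phi> e"

lemma e_span: "s < dd \<Longrightarrow> e s \<in> span m n \<Phi>"
  using e by (auto simp: bij_betw_def)

lemma e_inj: "s < dd \<Longrightarrow> t < dd \<Longrightarrow> e s = e t \<Longrightarrow> s = t"
  using e unfolding bij_betw_def inj_on_def by blast

lemma e_surj: "y \<in> span m n \<Phi> \<Longrightarrow> \<exists>s<dd. e s = y"
proof -
  assume "y \<in> span m n \<Phi>"
  then have "y \<in> e ` {..<dd}" using e by (simp add: bij_betw_def)
  then show ?thesis by blast
qed

lemma dd_pos: "0 < dd"
  using finite_span span_0 by (auto simp: card_gt_0_iff)

lemma std_carrier: "std g \<in> carrier_mat dd dd"
  by (cases g) (simp add: std_rep_def)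

lemma std_mult_vec:
  assumes "w \<in> carrier_vec dd" "s < dd" "t < dd" "e s = e t + comb m n \<Phi> a"
  shows "(std (a, b, c) *\<^sub>v w) $ s = cval (central m n \<Phi> c - pair_row n (e s) b) * w $ t"
proof -
  have eq_t: "e s = e t' + comb m n \<Phi> a \<longleftrightarrow> t' = t" if "t' < dd" for t'
    using assms(3,4) that e_inj[of t' t] by auto
  have "(std (a, b, c) *\<^sub>v w) $ s = (\<Sum>t'\<in>{0..<dd}.
      (if e s = e t' + comb m n \<Phi> a then cval (central m n \<Phi> c - pair_row n (e s) b) else 0) * w $ t')"
    using assms(1,2) by (simp add: std_rep_def scalar_prod_def)
  also have "\<dots> = (\<Sum>t'\<in>{0..<dd}. if t' = t then cval (central m n \<Phi> c - pair_row n (e s) b) * w $ t' else 0)"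
    using eq_t by (intro sum.cong refl) auto
  finally show ?thesis using assms(3) by simp
qed

lemma pre_image: "a \<in> vecs m \<Longrightarrow> s < dd \<Longrightarrow> \<exists>t<dd. e s = e t + comb m n \<Phi> a"
proof -
  assume *: "a \<in> vecs m" "s < dd"
  then have "e s - comb m n \<Phi> a \<in> span m n \<Phi>" by (intro span_diff e_span comb_span)
  then obtain t where "t < dd" "e t = e s - comb m n \<Phi> a" using e_surj by blast
  then show ?thesis by (intro exI[of _ t]) simp
qed

lemma std_mult:
  assumes g: "g \<in> heis m n" and h: "h \<in> heis m n"
  shows "std (heis_mult g h) = std g * std h"
proof (rule eq_matI_mult_vec[of _ dd dd])
  obtain a b c where g_eq: "g = (a, b, c)" by (cases g) auto
  obtain a' b' c' where h_eq: "h = (a', b', c')" by (cases h) auto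
  have mem: "a \<in> vecs m" "b \<in> vecs n" "c \<in> mats m n" "a' \<in> vecs m" "b' \<in> vecs n" "c' \<in> mats m n"
    using g h by (auto simp: heis_def g_eq h_eq)
  fix w :: "complex vec" assume w: "w \<in> carrier_vec dd"
  have hw: "std h *\<^sub>v w \<in> carrier_vec dd" using std_carrier w by (rule mult_mat_vec_carrier)
  have "std (heis_mult g h) *\<^sub>v w = std g *\<^sub>v (std h *\<^sub>v w)"
  proof (rule eq_vecI)
    fix s assume "s < dim_vec (std g *\<^sub>v (std h *\<^sub>v w))"
    then have s: "s < dd" using std_carrier[of g] by auto
    obtain t where t: "t < dd" "e s = e t + comb m n \<Phi> a" using pre_image[OF mem(1) s] by blast
    obtain r where r: "r < dd" "e t = e r + comb m n \<Phi> a'" using pre_image[OF mem(4) t(1)] by blast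
    have "e s = e r + comb m n \<Phi> (a + a')"
      using t r comb_add[OF \<Phi>_D mem(1,4)] by (simp add: add_ac)
    then have "(std (heis_mult g h) *\<^sub>v w) $ s =
        cval (central m n \<Phi> (c + c' + outer a b') - pair_row n (e s) (b + b')) * w $ r"
      unfolding g_eq h_eq heis_mult_eq using std_mult_vec[OF w s r(1)] by blast
    \<comment> \<open>The term \<open>outer a b'\<close> of the group law compensates for
      \<open>b'\<close> being paired with \<open>e s\<close> on the left but with \<open>e t\<close>
      on the right.\<close>
    also have "central m n \<Phi> (c + c' + outer a b') - pair_row n (e s) (b + b') =
        (central m n \<Phi> c - pair_row n (e s) b) + (central m n \<Phi> c' - pair_row n (e t) b')"
    proof -
      have "pair_row n (e s) b' = pair_row n (e t) b' + pair_row n (comb m n \<Phi> a) b'"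
        unfolding t(2) by (rule pair_row_add_left)
      then show ?thesis
        using mem by (simp add: central_add mats_add outer_mats central_outer pair_row_add_right e_span[OF s])
    qed
    also have "cval \<dots> * w $ r = cval (central m n \<Phi> c - pair_row n (e s) b) * (std h *\<^sub>v w) $ t"
      unfolding h_eq using std_mult_vec[OF w t(1) r] by simp
    also have "\<dots> = (std g *\<^sub>v (std h *\<^sub>v w)) $ s"
      unfolding g_eq using std_mult_vec[OF hw s t] by simp
    finally show "(std (heis_mult g h) *\<^sub>v w) $ s = (std g *\<^sub>v (std h *\<^sub>v w)) $ s" .
  qed (simp add: carrier_matD[OF std_carrier])
  also have "\<dots> = (std g * std h) *\<^sub>v w"
    using assoc_mult_mat_vec[OF std_carrier std_carrier w] by simp
  finally show "std (heis_mult g h) *\<^sub>v w = (std g * std h) *\<^sub>v w" .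
qed (simp_all add: std_carrier mult_carrier_mat[OF std_carrier std_carrier])

lemma std_cong:
  assumes "g \<in> heis m n" "h \<in> heis m n" "heis_cong m n k g h"
  shows "std g = std h"
proof -
  obtain a b c where g_eq: "g = (a, b, c)" by (cases g) auto
  obtain a' b' c' where h_eq: "h = (a', b', c')" by (cases h) auto
  have eqs: "comb m n \<Phi> a = comb m n \<Phi> a'" "central m n \<Phi> c = central m n \<Phi> c'"
    "\<And>s. s < dd \<Longrightarrow> pair_row n (e s) b = pair_row n (e s) b'"
    using assms unfolding g_eq h_eq heis_def
    by (auto intro!: comb_cong central_cong pair_row_cong e_span)
  show ?thesis
    unfolding g_eq h_eq std_rep_def prod.case
  proof (intro cong_mat refl)
    fix s t assume "s < dd"
    then show "(case (s, t) of (s, t) \<Rightarrow> if e s = e t + comb m n \<Phi> a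
          then cval (central m n \<Phi> c - pair_row n (e s) b) else 0) =
        (case (s, t) of (s, t) \<Rightarrow> if e s = e t + comb m n \<Phi> a'
          then cval (central m n \<Phi> c' - pair_row n (e s) b') else 0)"
      by (simp only: prod.case eqs)
  qed
qed

lemma std_central: "std (0, 0, c) = cval (central m n \<Phi> c) \<cdot>\<^sub>m 1\<^sub>m dd"
proof (rule eq_matI)
  fix s t assume "s < dim_row (cval (central m n \<Phi> c) \<cdot>\<^sub>m 1\<^sub>m dd)" "t < dim_col (cval (central m n \<Phi> c) \<cdot>\<^sub>m 1\<^sub>m dd)"
  then have st: "s < dd" "t < dd" by auto
  have "e s = e t + comb m n \<Phi> 0 \<longleftrightarrow> s = t" using e_inj[OF st] comb_0[OF \<Phi>_D] by auto
  then show "std (0, 0, c) $$ (s, t) = (cval (central m n \<Phi> c) \<cdot>\<^sub>m 1\<^sub>m dd) $$ (s, t)"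
    using st pair_row_0[OF e_span[OF st(1)]] pair_row_0[OF e_span[OF st(2)]] by (simp add: std_rep_def)
qed (simp_all add: std_rep_def)

lemma std_one: "std (0, 0, 0) = 1\<^sub>m dd"
proof -
  have "std (0, 0, 0) = 1 \<cdot>\<^sub>m 1\<^sub>m dd" unfolding std_central by (simp add: central_0)
  also have "\<dots> = 1\<^sub>m dd" by (intro eq_matI) auto
  finally show ?thesis .
qed

text \<open>The elements of the span are different characters of \<open>b\<close>, so a unit vector
  can be isolated from any nonzero vector of \<open>W\<close>; the translations by \<open>a\<close>
  carry it to all other unit vectors.\<close>

lemma std_irreducible: "irreducible_on (heis m n) dd std"
  unfolding irreducible_on_def
proof (intro conjI allI impI dd_pos)
  fix W assume "W \<subseteq> carrier_vec dd \<and> 0\<^sub>v dd \<in> W \<and> (\<forall>v\<in>W. \<forall>w\<in>W. v + w \<in> W) \<and> (\<forall>c. \<forall>v\<in>W. c \<cdot>\<^sub>v v \<in> W) \<and>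
      (\<forall>g\<in>heis m n. \<forall>v\<in>W. std g *\<^sub>v v \<in> W)"
  then have W: "W \<subseteq> carrier_vec dd" "0\<^sub>v dd \<in> W" "\<And>v w. v \<in> W \<Longrightarrow> w \<in> W \<Longrightarrow> v + w \<in> W"
    "\<And>c v. v \<in> W \<Longrightarrow> c \<cdot>\<^sub>v v \<in> W" "\<And>g v. g \<in> heis m n \<Longrightarrow> v \<in> W \<Longrightarrow> std g *\<^sub>v v \<in> W" by blast+
  show "W = {0\<^sub>v dd} \<or> W = carrier_vec dd"
  proof (cases "W = {0\<^sub>v dd}")
    case False
    then obtain w0 where w0: "w0 \<in> W" "w0 \<noteq> 0\<^sub>v dd" using W(2) by blast
    have w0c: "w0 \<in> carrier_vec dd" using w0 W(1) by auto
    obtain s where s: "s < dd" "w0 $ s \<noteq> 0"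
    proof -
      have "\<exists>s<dd. w0 $ s \<noteq> 0"
      proof (rule ccontr)
        assume "\<not> (\<exists>s<dd. w0 $ s \<noteq> 0)"
        then have "w0 = 0\<^sub>v dd" using w0c by (intro eq_vecI) auto
        with w0(2) show False by simp
      qed
      then show ?thesis using that by blast
    qed
    have sep: "\<exists>w\<in>W. w $ s \<noteq> 0 \<and> (\<forall>t\<in>Y. w $ t = 0)" if "finite Y" "Y \<subseteq> {..<dd} - {s}" for Y
      using that
    proof (induction Y rule: finite_induct)
      case empty
      then show ?case using w0(1) s(2) by auto
    next
      case (insert t Y)
      then obtain w where w: "w \<in> W" "w $ s \<noteq> 0" "\<forall>t\<in>Y. w $ t = 0" by auto
      have t: "t < dd" "t \<noteq> s" using insert.prems by auto
      have wc: "w \<in> carrier_vec dd" using w W(1) by auto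
      have "e t \<noteq> e s" using e_inj t s by blast
      then obtain j where j: "e t j \<noteq> e s j" by auto
      have jn: "j < n"
      proof (rule ccontr)
        assume "\<not> j < n"
        then have "e t j = 0" "e s j = 0"
          using dual.rowspan_outside[of _ "{..<m}" "{..<n}" \<Phi> j] e_span[OF t(1)] e_span[OF s(1)] by (auto simp: span_def)
        with j show False by simp
      qed
      then obtain x where x: "e t j x \<noteq> e s j x" using j by auto
      have xS: "x \<in> S"
      proof (rule ccontr)
        assume "x \<notin> S"
        then have "e t j x = 0" "e s j x = 0"
          using charsD(2)[OF span_chars[OF e_span jn]] t s by blast+
        with x show False by simp
      qed
      \<comment> \<open>Concentrated at a position \<open>j\<close> with a value \<open>x\<close>
        that separates \<open>e t\<close> from \<open>e s\<close>.\<close>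
      define b where "b = (\<lambda>j'. if j' = j then x else 0)"
      have b: "b \<in> vecs n" using xS S_0 by (auto simp: b_def vecs_def)
      have pair: "pair_row n (e r) b = e r j x" if "r < dd" for r
      proof -
        have "pair_row n (e r) b = (\<Sum>j'<n. if j' = j then e r j x else 0)"
          unfolding pair_row_def
        proof (intro sum.cong refl)
          fix j' assume "j' \<in> {..<n}"
          then have "e r j' 0 = 0" using charsD(3)[OF span_chars[OF e_span[OF that]] PP_zero] by simp
          then show "e r j' (b j') = (if j' = j then e r j x else 0)" by (simp add: b_def)
        qed
        then show ?thesis using jn by simp
      qed
      have act_b: "(std (0, b, 0) *\<^sub>v v) $ r = cval (- e r j x) * v $ r" if "r < dd" "v \<in> carrier_vec dd" for r v
        using std_mult_vec[OF that(2,1,1), of 0 b 0] comb_0[OF \<Phi>_D] by (simp add: central_0 pair[OF that(1)])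
      \<comment> \<open>Subtracting the eigenvalue at \<open>t\<close> removes the coordinate
        \<open>t\<close> and only rescales the others; the coordinate at \<open>s\<close> survives
        because the two eigenvalues differ.\<close>
      define w' where "w' = std (0, b, 0) *\<^sub>v w + (- cval (- e t j x)) \<cdot>\<^sub>v w"
      have "(0, b, 0) \<in> heis m n" using b vecs_0 mats_0 by (simp add: heis_def)
      then have "w' \<in> W" unfolding w'_def using w(1) by (intro W)
      moreover have idx: "w' $ r = (cval (- e r j x) - cval (- e t j x)) * w $ r" if "r < dd" for r
        using act_b[OF that wc] that wc std_carrier[of "(0, b, 0)"] by (simp add: w'_def algebra_simps)
      have "cval (- e s j x) \<noteq> cval (- e t j x)" using x by (simp add: cval_inject)
      then have "w' $ s \<noteq> 0" using idx[OF s(1)] w(2) by simp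
      moreover have "w' $ r = 0" if "r \<in> insert t Y" for r
        using that idx[of r] t w(3) insert.prems by auto
      ultimately show ?case by blast
    qed
    obtain w where w: "w \<in> W" "w $ s \<noteq> 0" "\<forall>t\<in>{..<dd} - {s}. w $ t = 0" using sep[of "{..<dd} - {s}"] by auto
    have wc: "w \<in> carrier_vec dd" using w W(1) by auto
    have "unit_vec dd s = inverse (w $ s) \<cdot>\<^sub>v w"
    proof (rule eq_vecI)
      fix i assume "i < dim_vec (inverse (w $ s) \<cdot>\<^sub>v w)"
      then have "i < dd" using wc by simp
      then show "unit_vec dd s $ i = (inverse (w $ s) \<cdot>\<^sub>v w) $ i"
        using w wc s(1) by (cases "i = s") simp_all
    qed (use wc in simp)
    then have unit_s: "unit_vec dd s \<in> W" using W(4)[OF w(1)] by simp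
    have unit: "unit_vec dd t \<in> W" if t: "t < dd" for t
    proof -
      have "e t - e s \<in> span m n \<Phi>" using e_span t s by (intro span_diff) auto
      then obtain a where a: "a \<in> vecs m" "e t - e s = comb m n \<Phi> a" using span_comb by blast
      have "std (a, 0, 0) *\<^sub>v unit_vec dd s = unit_vec dd t"
      proof (rule eq_vecI)
        fix r assume "r < dim_vec (unit_vec dd t :: complex vec)"
        then have r: "r < dd" by simp
        obtain r' where r': "r' < dd" "e r = e r' + comb m n \<Phi> a" using pre_image[OF a(1) r] by blast
        have et: "e t = e s + comb m n \<Phi> a" using a(2) by (simp add: algebra_simps)
        have "r' = s \<longleftrightarrow> r = t"
          using r' et e_inj[OF r t] e_inj[OF r'(1) s(1)] by auto
        then show "(std (a, 0, 0) *\<^sub>v unit_vec dd s) $ r = unit_vec dd t $ r"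
          using std_mult_vec[OF _ r r', of "unit_vec dd s" 0 0] pair_row_0[OF e_span[OF r]] r r' t s
          by (simp add: central_0)
      qed (use std_carrier[of "(a, 0, 0)"] in auto)
      moreover have "(a, 0, 0) \<in> heis m n" using a vecs_0 mats_0 by (simp add: heis_def)
      ultimately show ?thesis using W(5)[OF _ unit_s] by metis
    qed
    have "v \<in> W" if v: "v \<in> carrier_vec dd" for v
    proof -
      have "vec dd (\<lambda>t. if t < l then v $ t else 0) \<in> W" if "l \<le> dd" for l
        using that
      proof (induction l)
        case 0
        have "vec dd (\<lambda>t. if t < 0 then v $ t else 0) = 0\<^sub>v dd" by (intro eq_vecI) auto
        then show ?case using W(2) by simp
      next
        case (Suc l)
        have "vec dd (\<lambda>t. if t < Suc l then v $ t else 0) =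
            vec dd (\<lambda>t. if t < l then v $ t else 0) + (v $ l) \<cdot>\<^sub>v unit_vec dd l"
          using Suc.prems by (intro eq_vecI) (auto simp: less_Suc_eq)
        then show ?case using Suc W(3,4) unit[of l] by simp
      qed
      from this[of dd] have "vec dd (\<lambda>t. if t < dd then v $ t else 0) \<in> W" by simp
      moreover have "vec dd (\<lambda>t. if t < dd then v $ t else 0) = v" using v by (intro eq_vecI) auto
      ultimately show ?thesis by simp
    qed
    then show ?thesis using W(1) by blast
  qed simp
qed

end
end
end

section \<open>Classification of the irreducible representations of finite level\<close>

locale heis_irrep = local_filtration S P PP \<pi> u R for S P :: "'k::field_char_0 set" and PP \<pi> u R +
  fixes m n k d :: nat and \<rho> :: "'k heis \<Rightarrow> complex mat" and N :: nat and Q :: "'k set"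
  assumes carrier: "g \<in> heis m n \<Longrightarrow> \<rho> g \<in> carrier_mat d d"
    and mult: "g \<in> heis m n \<Longrightarrow> h \<in> heis m n \<Longrightarrow> \<rho> (heis_mult g h) = \<rho> g * \<rho> h"
    and one: "\<rho> (0, 0, 0) = 1\<^sub>m d"
    and cong: "g \<in> heis m n \<Longrightarrow> h \<in> heis m n \<Longrightarrow> heis_cong m n k g h \<Longrightarrow> \<rho> g = \<rho> h"
    and irr: "irreducible_on (heis m n) d \<rho>"
    and N: "0 < N" "of_nat N \<in> PP k"
    and Q: "fin_reps S (PP k) Q"
begin

lemma d_pos: "0 < d"
  using irr by (simp add: irreducible_on_def)

lemma parts:
  "a \<in> vecs m \<Longrightarrow> (a, 0, 0) \<in> heis m n" "b \<in> vecs n \<Longrightarrow> (0, b, 0) \<in> heis m n"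
  "c \<in> mats m n \<Longrightarrow> (0, 0, c) \<in> heis m n" "(0, 0, 0) \<in> heis m n"
  by (auto simp: heis_def vecs_0 mats_0)

lemma outer_zero [simp]: "outer 0 b = 0" "outer a 0 = 0"
  by (auto simp: outer_def)

lemma mult_vec:
  assumes "g \<in> heis m n" "h \<in> heis m n" "v \<in> carrier_vec d"
  shows "\<rho> (heis_mult g h) *\<^sub>v v = \<rho> g *\<^sub>v (\<rho> h *\<^sub>v v)"
  using assoc_mult_mat_vec[OF carrier[OF assms(1)] carrier[OF assms(2)] assms(3)] mult[OF assms(1,2)] by simp

lemma carrier_vec: "g \<in> heis m n \<Longrightarrow> v \<in> carrier_vec d \<Longrightarrow> \<rho> g *\<^sub>v v \<in> carrier_vec d"
  using carrier by (rule mult_mat_vec_carrier)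

lemma smult_vec: "g \<in> heis m n \<Longrightarrow> v \<in> carrier_vec d \<Longrightarrow> \<rho> g *\<^sub>v (c \<cdot>\<^sub>v v) = c \<cdot>\<^sub>v (\<rho> g *\<^sub>v v)"
  using carrier by (rule mult_mat_vec)

lemma smult_vec_eq_iff:
  fixes v :: "complex vec"
  assumes "v \<in> carrier_vec d" "v \<noteq> 0\<^sub>v d"
  shows "c \<cdot>\<^sub>v v = c' \<cdot>\<^sub>v v \<longleftrightarrow> c = c'"
proof
  assume eq: "c \<cdot>\<^sub>v v = c' \<cdot>\<^sub>v v"
  obtain i where i: "i < d" "v $ i \<noteq> 0"
  proof -
    have "\<exists>i<d. v $ i \<noteq> 0"
    proof (rule ccontr)
      assume "\<not> (\<exists>i<d. v $ i \<noteq> 0)"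
      then have "v = 0\<^sub>v d" using assms(1) by (intro eq_vecI) auto
      with assms(2) show False by simp
    qed
    then show ?thesis using that by blast
  qed
  have "(c \<cdot>\<^sub>v v) $ i = (c' \<cdot>\<^sub>v v) $ i" using eq by simp
  then show "c = c'" using i assms(1) by simp
qed simp

lemma nonzero_image:
  assumes "g \<in> heis m n" "h \<in> heis m n" "heis_mult h g = (0, 0, 0)" "v \<in> carrier_vec d" "v \<noteq> 0\<^sub>v d"
  shows "\<rho> g *\<^sub>v v \<noteq> 0\<^sub>v d"
proof
  assume "\<rho> g *\<^sub>v v = 0\<^sub>v d"
  then have "\<rho> (heis_mult h g) *\<^sub>v v = 0\<^sub>v d"
    using mult_vec[OF assms(2,1,4)] mult_mat_zero_vec[OF carrier[OF assms(2)]] by simp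
  then show False using assms(3-5) one by simp
qed

text \<open>A subgroup isomorphic to a power of the additive group, embedded by \<open>\<iota>\<close>, has finite abelian image.\<close>
lemma family_eigenvector:
  fixes \<iota> :: "('i \<Rightarrow> 'k) \<Rightarrow> 'k heis"
  assumes X: "finite X" and V: "V = {a. \<forall>i\<in>X. a i \<in> S}"
    and heis: "\<And>a. a \<in> V \<Longrightarrow> \<iota> a \<in> heis m n"
    and add: "\<And>a b. a \<in> V \<Longrightarrow> b \<in> V \<Longrightarrow> heis_mult (\<iota> a) (\<iota> b) = \<iota> (a + b)"
    and zero: "\<iota> 0 = (0, 0, 0)"
    and cong': "\<And>a b. a \<in> V \<Longrightarrow> b \<in> V \<Longrightarrow> (\<And>i. i \<in> X \<Longrightarrow> a i - b i \<in> PP k) \<Longrightarrow> heis_cong m n k (\<iota> a) (\<iota> b)"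
  obtains v \<kappa> where "v \<in> carrier_vec d" "v \<noteq> 0\<^sub>v d" "\<And>a. a \<in> V \<Longrightarrow> \<rho> (\<iota> a) *\<^sub>v v = \<kappa> a \<cdot>\<^sub>v v"
    "\<And>a b. a \<in> V \<Longrightarrow> b \<in> V \<Longrightarrow> \<kappa> (a + b) = \<kappa> a * \<kappa> b" "\<And>a. a \<in> V \<Longrightarrow> \<kappa> a \<noteq> 0" "\<kappa> 0 = 1"
    "\<And>a b. a \<in> V \<Longrightarrow> b \<in> V \<Longrightarrow> (\<And>i. i \<in> X \<Longrightarrow> a i - b i \<in> PP k) \<Longrightarrow> \<kappa> a = \<kappa> b"
proof -
  have V_add: "a + b \<in> V" if "a \<in> V" "b \<in> V" for a b using that S_add by (auto simp: V)
  have V_0: "0 \<in> V" using S_0 by (auto simp: V)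
  have V_uminus: "- a \<in> V" if "a \<in> V" for a using that S_uminus by (auto simp: V)
  have \<rho>_add: "\<rho> (\<iota> a) * \<rho> (\<iota> b) = \<rho> (\<iota> (a + b))" if "a \<in> V" "b \<in> V" for a b
    using mult[OF heis[OF that(1)] heis[OF that(2)]] add[OF that] by simp
  have \<rho>_cong: "\<rho> (\<iota> a) = \<rho> (\<iota> b)" if "a \<in> V" "b \<in> V" "\<And>i. i \<in> X \<Longrightarrow> a i - b i \<in> PP k" for a b
    using cong[OF heis[OF that(1)] heis[OF that(2)] cong'[OF that]] .
  define \<M> where "\<M> = (\<lambda>a. \<rho> (\<iota> a)) ` V"
  \<comment> \<open>Every tuple is congruent to one with entries among the finitely many
    representatives in \<open>Q\<close>.\<close>
  have "\<M> \<subseteq> (\<lambda>a. \<rho> (\<iota> a)) ` (X \<rightarrow>\<^sub>E Q)"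
  proof
    fix M assume "M \<in> \<M>"
    then obtain a where a: "a \<in> V" "M = \<rho> (\<iota> a)" by (auto simp: \<M>_def)
    have "\<forall>i\<in>X. \<exists>r. r \<in> Q \<and> a i - r \<in> PP k" using Q a by (auto simp: fin_reps_def V)
    then obtain r where r: "\<And>i. i \<in> X \<Longrightarrow> r i \<in> Q \<and> a i - r i \<in> PP k" by metis
    have "restrict r X \<in> V" using r Q by (auto simp: V fin_reps_def)
    then have "M = \<rho> (\<iota> (restrict r X))" unfolding a(2) using a(1) r by (intro \<rho>_cong) auto
    then show "M \<in> (\<lambda>a. \<rho> (\<iota> a)) ` (X \<rightarrow>\<^sub>E Q)" using r by (intro image_eqI[of _ _ "restrict r X"]) auto
  qed
  moreover have "finite (X \<rightarrow>\<^sub>E Q)" using X Q by (intro finite_PiE) (auto simp: fin_reps_def)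
  ultimately have fin: "finite \<M>" using finite_subset by blast
  have power: "\<rho> (\<iota> a) ^\<^sub>m l = \<rho> (\<iota> (\<lambda>i. of_nat l * a i))" if a: "a \<in> V" for a l
  proof (induction l)
    case 0
    have "(\<lambda>i. of_nat 0 * a i) = 0" by auto
    then show ?case using zero one carrier[OF heis[OF a]] by simp
  next
    case (Suc l)
    have la: "(\<lambda>i. of_nat l * a i) \<in> V"
    proof (induction l)
      case 0
      have "(\<lambda>i. of_nat 0 * a i) = 0" by auto
      then show ?case using V_0 by simp
    next
      case (Suc l)
      have "(\<lambda>i. of_nat (Suc l) * a i) = (\<lambda>i. of_nat l * a i) + a" by (auto simp: distrib_right)
      then show ?case using V_add[OF Suc a] by simp
    qed
    have "(\<lambda>i. of_nat (Suc l) * a i) = (\<lambda>i. of_nat l * a i) + a" by (auto simp: distrib_right)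
    then show ?case using Suc \<rho>_add[OF la a] by simp
  qed
  have "\<exists>v\<in>carrier_vec d. v \<noteq> 0\<^sub>v d \<and> (\<forall>T\<in>\<M>. \<exists>c. T *\<^sub>v v = c \<cdot>\<^sub>v v)"
  proof (rule common_eigenvector[OF fin])
    fix T assume "T \<in> \<M>"
    then obtain a where a: "a \<in> V" "T = \<rho> (\<iota> a)" by (auto simp: \<M>_def)
    show "T \<in> carrier_mat d d" using a carrier heis by simp
    \<comment> \<open>The integer \<open>N\<close> lies in \<open>PP k\<close>, so the image of
      \<open>V\<close> has exponent dividing \<open>N\<close>; this provides the polynomial equation
      behind the common eigenvector.\<close>
    have Na: "of_nat N * a i \<in> PP k" if "i \<in> X" for i
      using PP_mult[OF _ N(2), of "a i"] a that by (simp add: V mult.commute)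
    then have "(\<lambda>i. of_nat N * a i) \<in> V" using PP_S by (auto simp: V)
    then have "T ^\<^sub>m N = \<rho> (\<iota> 0)" unfolding a(2) power[OF a(1)] using V_0 Na by (intro \<rho>_cong) auto
    then show "\<exists>N>0. T ^\<^sub>m N = 1\<^sub>m d" using N(1) zero one by auto
  next
    fix T T' assume "T \<in> \<M>" "T' \<in> \<M>"
    then obtain a b where "a \<in> V" "T = \<rho> (\<iota> a)" "b \<in> V" "T' = \<rho> (\<iota> b)" by (auto simp: \<M>_def)
    then show "T * T' = T' * T" by (simp add: \<rho>_add add.commute)
  qed (rule d_pos)
  then obtain v where v: "v \<in> carrier_vec d" "v \<noteq> 0\<^sub>v d" "\<forall>T\<in>\<M>. \<exists>c. T *\<^sub>v v = c \<cdot>\<^sub>v v" by blast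
  then have "\<forall>a\<in>V. \<exists>c. \<rho> (\<iota> a) *\<^sub>v v = c \<cdot>\<^sub>v v" by (auto simp: \<M>_def)
  then obtain \<kappa> where \<kappa>: "\<And>a. a \<in> V \<Longrightarrow> \<rho> (\<iota> a) *\<^sub>v v = \<kappa> a \<cdot>\<^sub>v v" by metis
  have \<kappa>_add: "\<kappa> (a + b) = \<kappa> a * \<kappa> b" if ab: "a \<in> V" "b \<in> V" for a b
  proof -
    have "\<kappa> (a + b) \<cdot>\<^sub>v v = \<rho> (\<iota> a) *\<^sub>v (\<rho> (\<iota> b) *\<^sub>v v)"
      using \<kappa>[OF V_add[OF ab]] mult_vec[OF heis[OF ab(1)] heis[OF ab(2)] v(1)] add[OF ab] by simp
    also have "\<dots> = (\<kappa> a * \<kappa> b) \<cdot>\<^sub>v v"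
      using \<kappa>[OF ab(1)] \<kappa>[OF ab(2)] smult_vec[OF heis[OF ab(1)] v(1)] by (simp add: smult_smult_assoc mult.commute)
    finally show ?thesis using smult_vec_eq_iff[OF v(1,2)] by simp
  qed
  have "\<kappa> 0 \<cdot>\<^sub>v v = 1 \<cdot>\<^sub>v v" using \<kappa>[OF V_0] zero one v(1) by simp
  then have \<kappa>_0: "\<kappa> 0 = 1" using smult_vec_eq_iff[OF v(1,2), of "\<kappa> 0" 1] by simp
  have \<kappa>_nz: "\<kappa> a \<noteq> 0" if "a \<in> V" for a
    using \<kappa>_add[OF that V_uminus[OF that]] \<kappa>_0 by auto
  have \<kappa>_cong: "\<kappa> a = \<kappa> b" if ab: "a \<in> V" "b \<in> V" "\<And>i. i \<in> X \<Longrightarrow> a i - b i \<in> PP k" for a b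
  proof -
    have "\<kappa> a \<cdot>\<^sub>v v = \<kappa> b \<cdot>\<^sub>v v" using \<kappa>[OF ab(1)] \<kappa>[OF ab(2)] \<rho>_cong[OF ab] by simp
    then show ?thesis using smult_vec_eq_iff[OF v(1,2)] by simp
  qed
  show ?thesis using that[OF v(1,2) \<kappa> \<kappa>_add \<kappa>_nz \<kappa>_0 \<kappa>_cong] .
qed

lemma commutes_scalar:
  assumes g: "g \<in> heis m n" and comm: "\<And>h. h \<in> heis m n \<Longrightarrow> \<rho> (heis_mult h g) = \<rho> (heis_mult g h)"
    and v: "v \<in> carrier_vec d" "v \<noteq> 0\<^sub>v d" "\<rho> g *\<^sub>v v = c \<cdot>\<^sub>v v" and w: "w \<in> carrier_vec d"
  shows "\<rho> g *\<^sub>v w = c \<cdot>\<^sub>v w"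
  using irr carrier carrier[OF g] _ v w
proof (rule commuting_scalar)
  show "\<rho> h * \<rho> g = \<rho> g * \<rho> h" if "h \<in> heis m n" for h
    using comm[OF that] mult[OF that g] mult[OF g that] by simp
qed

text \<open>Clifford theory made explicit. The centre acts by scalars, which define
  \<open>\<Phi>\<close>. An eigenvector \<open>v\<close> of the subgroup of all \<open>b\<close> and
  an eigenvector \<open>w\<close> of the subgroup of all \<open>a\<close> supply characters
  \<open>\<mu>\<close> and \<open>\<kappa>\<close>, whose product \<open>\<chi>\<close> is the
  twist. The translates of \<open>v\<close> by \<open>a\<close>, divided by
  \<open>\<kappa> a\<close>, depend only on \<open>comb m n \<Phi> a\<close> and transform like the
  basis of the standard representation twisted by \<open>\<chi>\<close>. This gives a nonzero
  intertwiner.\<close>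

theorem classification:
  obtains \<Phi> \<chi> where "\<And>i j. i < m \<Longrightarrow> j < n \<Longrightarrow> \<Phi> (i, j) \<in> chars k" "card (span m n \<Phi>) = d"
    "\<And>g h. g \<in> heis m n \<Longrightarrow> h \<in> heis m n \<Longrightarrow> \<chi> (heis_mult g h) = \<chi> g * \<chi> h"
    "\<And>g. g \<in> heis m n \<Longrightarrow> \<chi> g \<noteq> 0" "\<chi> (0, 0, 0) = 1"
    "\<And>g h. g \<in> heis m n \<Longrightarrow> h \<in> heis m n \<Longrightarrow> heis_cong m n k g h \<Longrightarrow> \<chi> g = \<chi> h"
    "\<And>g e. g \<in> heis m n \<Longrightarrow> bij_betw e {..<card (span m n \<Phi>)} (span m n \<Phi>) \<Longrightarrow>
      mtrace (\<rho> g) = \<chi> g * mtrace (std_rep m n \<Phi> e g)"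
proof -
  let ?X = "{..<m} \<times> {..<n}"
  have vecs_V: "vecs l = {a. \<forall>i\<in>{..<l}. a i \<in> S}" for l by (auto simp: vecs_def)
  have mats_V: "mats m n = {c. \<forall>p\<in>?X. c p \<in> S}" by (auto simp: mats_def)
  have add1: "heis_mult (a, 0, 0) (a', 0, 0) = (a + a', 0, 0)"
    and add2: "heis_mult (0, b, 0) (0, b', 0) = (0, b + b', 0)"
    and add3: "heis_mult (0, 0, c) (0, 0, c') = (0, 0, c + c')" for a a' b b' :: "nat \<Rightarrow> 'k" and c c' :: "nat \<times> nat \<Rightarrow> 'k"
    by (simp_all add: heis_mult_eq del: heis_mult.simps)
  have cong1: "heis_cong m n k (a, 0, 0) (a', 0, 0)" if "\<And>i. i \<in> {..<m} \<Longrightarrow> a i - a' i \<in> PP k" for a a'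
    using that by (simp add: PP_zero)
  have cong2: "heis_cong m n k (0, b, 0) (0, b', 0)" if "\<And>j. j \<in> {..<n} \<Longrightarrow> b j - b' j \<in> PP k" for b b'
    using that by (simp add: PP_zero)
  have cong3: "heis_cong m n k (0, 0, c) (0, 0, c')" if "\<And>p. p \<in> ?X \<Longrightarrow> c p - c' p \<in> PP k" for c c'
    using that by (simp add: PP_zero)
  obtain v\<^sub>0 z where v\<^sub>0: "v\<^sub>0 \<in> carrier_vec d" "v\<^sub>0 \<noteq> 0\<^sub>v d" "\<And>c. c \<in> mats m n \<Longrightarrow> \<rho> (0, 0, c) *\<^sub>v v\<^sub>0 = z c \<cdot>\<^sub>v v\<^sub>0"
    and z_add: "\<And>c c'. c \<in> mats m n \<Longrightarrow> c' \<in> mats m n \<Longrightarrow> z (c + c') = z c * z c'"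
    and z_nz: "\<And>c. c \<in> mats m n \<Longrightarrow> z c \<noteq> 0" and z_0: "z 0 = 1"
    and z_cong: "\<And>c c'. c \<in> mats m n \<Longrightarrow> c' \<in> mats m n \<Longrightarrow> (\<And>p. p \<in> ?X \<Longrightarrow> c p - c' p \<in> PP k) \<Longrightarrow> z c = z c'"
    by (rule family_eigenvector[where \<iota> = "\<lambda>c. (0, 0, c)" and X = ?X and V = "mats m n",
          OF _ mats_V parts(3) add3 refl cong3]) auto
  have scalar: "\<rho> (0, 0, c) *\<^sub>v w = z c \<cdot>\<^sub>v w" if c: "c \<in> mats m n" and w: "w \<in> carrier_vec d" for c w
  proof (rule commutes_scalar[OF parts(3)[OF c] _ v\<^sub>0(1,2) v\<^sub>0(3)[OF c] w])
    show "\<rho> (heis_mult h (0, 0, c)) = \<rho> (heis_mult (0, 0, c) h)" for h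
      by (cases h) (simp add: heis_mult_eq add.commute del: heis_mult.simps)
  qed
  obtain v \<mu> where v: "v \<in> carrier_vec d" "v \<noteq> 0\<^sub>v d" "\<And>b. b \<in> vecs n \<Longrightarrow> \<rho> (0, b, 0) *\<^sub>v v = \<mu> b \<cdot>\<^sub>v v"
    and \<mu>_add: "\<And>b b'. b \<in> vecs n \<Longrightarrow> b' \<in> vecs n \<Longrightarrow> \<mu> (b + b') = \<mu> b * \<mu> b'"
    and \<mu>_nz: "\<And>b. b \<in> vecs n \<Longrightarrow> \<mu> b \<noteq> 0" and \<mu>_0: "\<mu> 0 = 1"
    and \<mu>_cong: "\<And>b b'. b \<in> vecs n \<Longrightarrow> b' \<in> vecs n \<Longrightarrow> (\<And>j. j \<in> {..<n} \<Longrightarrow> b j - b' j \<in> PP k) \<Longrightarrow> \<mu> b = \<mu> b'"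
    by (rule family_eigenvector[where \<iota> = "\<lambda>b. (0, b, 0)" and X = "{..<n}" and V = "vecs n",
          OF _ vecs_V parts(2) add2 refl cong2]) auto
  \<comment> \<open>The elements \<open>a\<close> of the radical below act by scalars. The
    eigenvalues on \<open>w\<close> extend this character of the radical to all \<open>a\<close>, so
    that it can be removed by a twist.\<close>
  obtain w \<kappa> where w: "w \<in> carrier_vec d" "w \<noteq> 0\<^sub>v d" "\<And>a. a \<in> vecs m \<Longrightarrow> \<rho> (a, 0, 0) *\<^sub>v w = \<kappa> a \<cdot>\<^sub>v w"
    and \<kappa>_add: "\<And>a a'. a \<in> vecs m \<Longrightarrow> a' \<in> vecs m \<Longrightarrow> \<kappa> (a + a') = \<kappa> a * \<kappa> a'"
    and \<kappa>_nz: "\<And>a. a \<in> vecs m \<Longrightarrow> \<kappa> a \<noteq> 0" and \<kappa>_0: "\<kappa> 0 = 1"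
    and \<kappa>_cong: "\<And>a a'. a \<in> vecs m \<Longrightarrow> a' \<in> vecs m \<Longrightarrow> (\<And>i. i \<in> {..<m} \<Longrightarrow> a i - a' i \<in> PP k) \<Longrightarrow> \<kappa> a = \<kappa> a'"
    by (rule family_eigenvector[where \<iota> = "\<lambda>a. (a, 0, 0)" and X = "{..<m}" and V = "vecs m",
          OF _ vecs_V parts(1) add1 refl cong1]) auto
  define single where "single p x = (\<lambda>p'. if p' = p then x else 0)" for p :: "nat \<times> nat" and x :: 'k
  have single: "single p x \<in> mats m n" if "x \<in> S" for p x using that S_0 by (simp add: single_def mats_def)
  define \<Phi> where "\<Phi> p = (\<lambda>x. if x \<in> S then Cstar (z (single p x)) else 0)" for p
  have cval_\<Phi>: "cval (\<Phi> p x) = z (single p x)" if "x \<in> S" for p x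
    using that z_nz[OF single[OF that]] by (simp add: \<Phi>_def Cstar_inverse)
  have \<Phi>: "\<Phi> p \<in> chars k" for p
    unfolding chars_def extensions_def mem_Collect_eq
  proof (intro conjI ballI allI impI)
    fix x y assume xy: "x \<in> S" "y \<in> S"
    have "single p (x + y) = single p x + single p y" by (auto simp: single_def)
    then have "cval (\<Phi> p (x + y)) = cval (\<Phi> p x + \<Phi> p y)"
      using xy S_add[OF xy] by (simp add: cval_\<Phi> z_add single)
    then show "\<Phi> p (x + y) = \<Phi> p x + \<Phi> p y" by (simp only: cval_inject)
  next
    fix x assume x: "x \<in> PP k"
    have "z (single p x) = z 0"
      using x PP_zero single[OF PP_S[OF x]] mats_0 by (intro z_cong) (auto simp: single_def)
    then have "cval (\<Phi> p x) = cval 0" using PP_S[OF x] by (simp add: cval_\<Phi> z_0)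
    then show "\<Phi> p x = 0" by (simp only: cval_inject)
  qed (simp add: \<Phi>_def)
  have central: "cval (central m n \<Phi> c) = z c" if c: "c \<in> mats m n" for c
  proof -
    have "z (\<lambda>p. if p \<in> Y then c p else 0) = (\<Prod>p\<in>Y. z (single p (c p)))" if "finite Y" "Y \<subseteq> ?X" for Y
      using that
    proof (induction Y rule: finite_induct)
      case empty
      have "(\<lambda>p. if p \<in> {} then c p else 0) = 0" by auto
      then show ?case using z_0 by simp
    next
      case (insert p Y)
      have "(\<lambda>p'. if p' \<in> insert p Y then c p' else 0) = single p (c p) + (\<lambda>p'. if p' \<in> Y then c p' else 0)"
        using insert.hyps by (auto simp: single_def fun_eq_iff)
      moreover have "single p (c p) \<in> mats m n" using insert.prems c by (intro single) (auto simp: mats_def)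
      moreover have "(\<lambda>p'. if p' \<in> Y then c p' else 0) \<in> mats m n" using c S_0 by (auto simp: mats_def)
      ultimately show ?case using z_add insert by simp
    qed
    from this[of ?X] have "z (\<lambda>p. if p \<in> ?X then c p else 0) = (\<Prod>p\<in>?X. z (single p (c p)))" by simp
    moreover have "z (\<lambda>p. if p \<in> ?X then c p else 0) = z c"
      using c PP_zero by (intro z_cong) (auto simp: mats_def)
    moreover have "(\<Prod>p\<in>?X. z (single p (c p))) = (\<Prod>i<m. \<Prod>j<n. cval (\<Phi> (i, j) (c (i, j))))"
      using c by (subst prod.cartesian_product) (auto simp: cval_\<Phi> mats_def intro!: prod.cong)
    ultimately show ?thesis by (simp add: central_def cval_sum)
  qed
  have \<Phi>_D: "\<Phi> \<in> {..<m} \<times> {..<n} \<rightarrow> D" using \<Phi> by (auto simp: D_def)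
  define \<chi> where "\<chi> = (\<lambda>(a, b, c :: nat \<times> nat \<Rightarrow> 'k). \<kappa> a * \<mu> b)"
  have \<chi>_mult: "\<chi> (heis_mult g h) = \<chi> g * \<chi> h" if "g \<in> heis m n" "h \<in> heis m n" for g h
    using that by (auto simp: \<chi>_def heis_def \<kappa>_add \<mu>_add)
  have \<chi>_nz: "\<chi> g \<noteq> 0" if "g \<in> heis m n" for g
    using that \<kappa>_nz \<mu>_nz by (auto simp: \<chi>_def heis_def)
  have \<chi>_cong: "\<chi> g = \<chi> h" if "g \<in> heis m n" "h \<in> heis m n" "heis_cong m n k g h" for g h
  proof -
    obtain a b c a' b' c' where gh: "g = (a, b, c)" "h = (a', b', c')" by (cases g, cases h) auto
    have "\<kappa> a = \<kappa> a'" using that by (intro \<kappa>_cong) (auto simp: gh heis_def)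
    moreover have "\<mu> b = \<mu> b'" using that by (intro \<mu>_cong) (auto simp: gh heis_def)
    ultimately show ?thesis by (simp add: gh \<chi>_def)
  qed
  \<comment> \<open>If \<open>comb m n \<Phi> a\<close> is 0, the commutators of
    \<open>(a, 0, 0)\<close> lie in the kernel of the central character, so this element acts as a
    scalar, and \<open>w\<close> shows which one.\<close>
  have radical: "\<rho> (a, 0, 0) *\<^sub>v x = \<kappa> a \<cdot>\<^sub>v x" if a: "a \<in> vecs m" "comb m n \<Phi> a = 0" and x: "x \<in> carrier_vec d" for a x
  proof (rule commutes_scalar[OF parts(1)[OF a(1)] _ w(1,2) w(3)[OF a(1)] x])
    fix h assume h: "h \<in> heis m n"
    obtain a' b' c' where h_eq: "h = (a', b', c')" by (cases h) auto
    have mem: "a' \<in> vecs m" "b' \<in> vecs n" "c' \<in> mats m n" using h by (auto simp: h_eq heis_def)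
    have o: "outer a b' \<in> mats m n" using a(1) mem(2) by (rule outer_mats)
    have "heis_mult (a, 0, 0) h = heis_mult (0, 0, outer a b') (heis_mult h (a, 0, 0))"
      by (simp add: h_eq heis_mult_eq add_ac del: heis_mult.simps)
    moreover have "\<rho> (heis_mult (0, 0, outer a b') (heis_mult h (a, 0, 0))) = \<rho> (heis_mult h (a, 0, 0))"
    proof (rule eq_matI_mult_vec[of _ d d])
      let ?h = "heis_mult h (a, 0, 0)"
      have hh: "?h \<in> heis m n" using h parts(1)[OF a(1)] by (rule heis_mult_closed)
      show "\<rho> (heis_mult (0, 0, outer a b') ?h) \<in> carrier_mat d d"
        using heis_mult_closed[OF parts(3)[OF o] hh] by (rule carrier)
      show "\<rho> ?h \<in> carrier_mat d d" using hh by (rule carrier)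
      fix y :: "complex vec" assume y: "y \<in> carrier_vec d"
      have "z (outer a b') = cval (pair_row n (comb m n \<Phi> a) b')"
        using central[OF o] central_outer[OF \<Phi> a(1) mem(2)] by simp
      also have "\<dots> = 1" unfolding a(2) by (simp add: pair_row_def)
      finally show "\<rho> (heis_mult (0, 0, outer a b') ?h) *\<^sub>v y = \<rho> ?h *\<^sub>v y"
        using mult_vec[OF parts(3)[OF o] hh y] scalar[OF o carrier_vec[OF hh y]] by simp
    qed
    ultimately show "\<rho> (heis_mult h (a, 0, 0)) = \<rho> (heis_mult (a, 0, 0) h)" by simp
  qed
  define pre where "pre y = (SOME a. a \<in> vecs m \<and> comb m n \<Phi> a = y)" for y
  have pre: "pre y \<in> vecs m \<and> comb m n \<Phi> (pre y) = y" if "y \<in> span m n \<Phi>" for y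
  proof -
    have "\<exists>a. a \<in> vecs m \<and> comb m n \<Phi> a = y" using span_comb[OF that] by blast
    then show ?thesis unfolding pre_def by (rule someI_ex)
  qed
  \<comment> \<open>Division by \<open>\<kappa>\<close> makes the translate independent of the
    chosen preimage of \<open>y\<close>, since two preimages differ by an element of the
    radical.\<close>
  define f where "f y = inverse (\<kappa> (pre y)) \<cdot>\<^sub>v (\<rho> (pre y, 0, 0) *\<^sub>v v)" for y
  have f_carrier: "f y \<in> carrier_vec d" if "y \<in> span m n \<Phi>" for y
    using carrier_vec[OF parts(1) v(1)] pre[OF that] by (simp add: f_def)
  have f: "\<rho> (a, 0, 0) *\<^sub>v v = \<kappa> a \<cdot>\<^sub>v f (comb m n \<Phi> a)" if a: "a \<in> vecs m" for a
  proof -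
    let ?b = "pre (comb m n \<Phi> a)"
    have b: "?b \<in> vecs m" "comb m n \<Phi> ?b = comb m n \<Phi> a" using pre[OF comb_span[OF a]] by auto
    have diff: "a - ?b \<in> vecs m" using a b(1) by (rule vecs_diff)
    have "comb m n \<Phi> (a - ?b + ?b) = comb m n \<Phi> (a - ?b) + comb m n \<Phi> ?b"
      using comb_add[OF \<Phi>_D diff b(1)] .
    then have "comb m n \<Phi> (a - ?b) = 0" using b(2) by simp
    then have r: "\<rho> (a - ?b, 0, 0) *\<^sub>v x = \<kappa> (a - ?b) \<cdot>\<^sub>v x" if "x \<in> carrier_vec d" for x
      using radical[OF diff _ that] by blast
    have "(a, 0, 0) = heis_mult (a - ?b, 0, 0) (?b, 0, 0)" by (simp add: heis_mult_eq del: heis_mult.simps)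
    then have "\<rho> (a, 0, 0) *\<^sub>v v = \<rho> (a - ?b, 0, 0) *\<^sub>v (\<rho> (?b, 0, 0) *\<^sub>v v)"
      using mult_vec[OF parts(1)[OF diff] parts(1)[OF b(1)] v(1)] by simp
    also have "\<dots> = \<kappa> (a - ?b) \<cdot>\<^sub>v (\<rho> (?b, 0, 0) *\<^sub>v v)"
      using r[OF carrier_vec[OF parts(1)[OF b(1)] v(1)]] .
    also have "\<dots> = \<kappa> a \<cdot>\<^sub>v f (comb m n \<Phi> a)"
    proof -
      have "\<kappa> a = \<kappa> (a - ?b) * \<kappa> ?b" using \<kappa>_add[OF diff b(1)] by simp
      then have "\<kappa> a * inverse (\<kappa> ?b) = \<kappa> (a - ?b)" using \<kappa>_nz[OF b(1)] by (simp add: mult.assoc)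
      then show ?thesis unfolding f_def smult_smult_assoc by (rule arg_cong[OF sym])
    qed
    finally show ?thesis .
  qed
  have action: "\<rho> (a, b, c) *\<^sub>v f y = (\<chi> (a, b, c) * cval (central m n \<Phi> c - pair_row n (y + comb m n \<Phi> a) b)) \<cdot>\<^sub>v
      f (y + comb m n \<Phi> a)"
    if abc: "(a, b, c) \<in> heis m n" and y: "y \<in> span m n \<Phi>" for a b c y
  proof -
    have mem: "a \<in> vecs m" "b \<in> vecs n" "c \<in> mats m n" using abc by (auto simp: heis_def)
    let ?p = "pre y"
    have p: "?p \<in> vecs m" "comb m n \<Phi> ?p = y" using pre[OF y] by auto
    define a' where "a' = a + ?p"
    have a': "a' \<in> vecs m" using mem p vecs_add by (simp add: a'_def)
    have comb_a': "comb m n \<Phi> a' = y + comb m n \<Phi> a"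
      using comb_add[OF \<Phi>_D mem(1) p(1)] p(2) by (simp add: a'_def add.commute)
    have o: "outer a' b \<in> mats m n" using a' mem(2) by (rule outer_mats)
    have co: "c - outer a' b \<in> mats m n" using mem(3) o by (rule mats_diff)
    \<comment> \<open>Moving \<open>b\<close> to the right, next to its eigenvector
      \<open>v\<close>, costs the commutator \<open>outer a' b\<close>.\<close>
    have "heis_mult (a, b, c) (?p, 0, 0) = heis_mult (0, 0, c - outer a' b) (heis_mult (a', 0, 0) (0, b, 0))"
      by (simp add: heis_mult_eq a'_def del: heis_mult.simps)
    then have "\<rho> (a, b, c) *\<^sub>v (\<rho> (?p, 0, 0) *\<^sub>v v) =
        \<rho> (0, 0, c - outer a' b) *\<^sub>v (\<rho> (a', 0, 0) *\<^sub>v (\<rho> (0, b, 0) *\<^sub>v v))"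
      using mult_vec[OF abc parts(1)[OF p(1)] v(1)]
        mult_vec[OF parts(3)[OF co] heis_mult_closed[OF parts(1)[OF a'] parts(2)[OF mem(2)]] v(1)]
        mult_vec[OF parts(1)[OF a'] parts(2)[OF mem(2)] v(1)] by simp
    also have "\<dots> = z (c - outer a' b) \<cdot>\<^sub>v (\<mu> b \<cdot>\<^sub>v (\<kappa> a' \<cdot>\<^sub>v f (y + comb m n \<Phi> a)))"
      using v(3)[OF mem(2)] smult_vec[OF parts(1)[OF a'] v(1)] f[OF a'] comb_a'
        scalar[OF co] f_carrier[OF comb_span[OF a']] by simp
    also have "z (c - outer a' b) = cval (central m n \<Phi> c - pair_row n (y + comb m n \<Phi> a) b)"
    proof -
      have "cval (central m n \<Phi> (c - outer a' b + outer a' b)) =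
          cval (central m n \<Phi> (c - outer a' b)) * cval (pair_row n (comb m n \<Phi> a') b)"
        using central_add[OF \<Phi> co o] central_outer[OF \<Phi> a' mem(2)] by simp
      then have "cval (central m n \<Phi> c) = z (c - outer a' b) * cval (pair_row n (y + comb m n \<Phi> a) b)"
        using central[OF co] comb_a' by simp
      moreover have "cval (central m n \<Phi> c) =
          cval (central m n \<Phi> c - pair_row n (y + comb m n \<Phi> a) b) * cval (pair_row n (y + comb m n \<Phi> a) b)"
        by (simp flip: cval_add)
      ultimately show ?thesis by simp
    qed
    finally have image: "\<rho> (a, b, c) *\<^sub>v (\<rho> (?p, 0, 0) *\<^sub>v v) =
        cval (central m n \<Phi> c - pair_row n (y + comb m n \<Phi> a) b) \<cdot>\<^sub>v (\<mu> b \<cdot>\<^sub>v (\<kappa> a' \<cdot>\<^sub>v f (y + comb m n \<Phi> a)))" .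
    have "\<rho> (a, b, c) *\<^sub>v f y = inverse (\<kappa> ?p) \<cdot>\<^sub>v (\<rho> (a, b, c) *\<^sub>v (\<rho> (?p, 0, 0) *\<^sub>v v))"
      unfolding f_def by (rule smult_vec[OF abc carrier_vec[OF parts(1)[OF p(1)] v(1)]])
    also have "\<dots> = (inverse (\<kappa> ?p) * (cval (central m n \<Phi> c - pair_row n (y + comb m n \<Phi> a) b) * (\<mu> b * \<kappa> a'))) \<cdot>\<^sub>v
        f (y + comb m n \<Phi> a)"
      unfolding image smult_smult_assoc mult.assoc ..
    also have "inverse (\<kappa> ?p) * (cval (central m n \<Phi> c - pair_row n (y + comb m n \<Phi> a) b) * (\<mu> b * \<kappa> a')) =
        \<chi> (a, b, c) * cval (central m n \<Phi> c - pair_row n (y + comb m n \<Phi> a) b)"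
      using \<kappa>_add[OF mem(1) p(1)] \<kappa>_nz[OF p(1)] by (simp add: a'_def \<chi>_def field_simps)
    finally show ?thesis .
  qed
  have trace: "card (span m n \<Phi>) = d \<and> (\<forall>g\<in>heis m n. mtrace (\<rho> g) = \<chi> g * mtrace (std_rep m n \<Phi> e g))"
    if e: "bij_betw e {..<card (span m n \<Phi>)} (span m n \<Phi>)" for e
  proof -
    let ?D = "card (span m n \<Phi>)"
    let ?std = "std_rep m n \<Phi> e"
    define \<sigma> where "\<sigma> g = \<chi> g \<cdot>\<^sub>m ?std g" for g
    note std_c = std_carrier[where \<Phi> = \<Phi> and m = m and n = n and k = k and e = e, OF \<Phi> e]
    have \<sigma>_c: "\<sigma> g \<in> carrier_mat ?D ?D" for g using std_c[of g] by (simp add: \<sigma>_def)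
    have e_span': "e s \<in> span m n \<Phi>" if "s < ?D" for s using e that by (auto simp: bij_betw_def)
    have \<sigma>_vec: "\<sigma> g *\<^sub>v x = \<chi> g \<cdot>\<^sub>v (?std g *\<^sub>v x)" if "x \<in> carrier_vec ?D" for g x
      using std_c[of g] that by (intro eq_vecI) (auto simp: \<sigma>_def)
    have irr': "irreducible_on (heis m n) ?D \<sigma>"
      unfolding irreducible_on_def
    proof (intro conjI allI impI)
      note si = std_irreducible[where \<Phi> = \<Phi> and m = m and n = n and k = k and e = e, OF \<Phi> e]
      then show "0 < ?D" by (simp add: irreducible_on_def)
      fix W assume "W \<subseteq> carrier_vec ?D \<and> 0\<^sub>v ?D \<in> W \<and> (\<forall>v\<in>W. \<forall>w\<in>W. v + w \<in> W) \<and> (\<forall>c. \<forall>v\<in>W. c \<cdot>\<^sub>v v \<in> W) \<and>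
        (\<forall>g\<in>heis m n. \<forall>v\<in>W. \<sigma> g *\<^sub>v v \<in> W)"
      then have W: "W \<subseteq> carrier_vec ?D" "0\<^sub>v ?D \<in> W" "\<And>v w. v \<in> W \<Longrightarrow> w \<in> W \<Longrightarrow> v + w \<in> W"
        "\<And>c v. v \<in> W \<Longrightarrow> c \<cdot>\<^sub>v v \<in> W" "\<And>g v. g \<in> heis m n \<Longrightarrow> v \<in> W \<Longrightarrow> \<sigma> g *\<^sub>v v \<in> W" by blast+
      show "W = {0\<^sub>v ?D} \<or> W = carrier_vec ?D"
      proof (rule irreducible_onD[OF si W(1-4)])
        fix g x assume g: "g \<in> heis m n" and x: "x \<in> W"
        have "inverse (\<chi> g) \<cdot>\<^sub>v (\<sigma> g *\<^sub>v x) \<in> W" using W(4) W(5)[OF g x] by blast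
        moreover have "x \<in> carrier_vec ?D" using x W(1) by blast
        ultimately show "?std g *\<^sub>v x \<in> W" using \<sigma>_vec \<chi>_nz[OF g] by (simp add: smult_smult_assoc)
      qed
    qed
    \<comment> \<open>Sends the basis vector with index \<open>e t\<close> to
      \<open>f (e t)\<close>.\<close>
    define M where "M = mat d ?D (\<lambda>(r, t). f (e t) $ r)"
    have M: "M \<in> carrier_mat d ?D" by (simp add: M_def)
    have col_M: "col M t = f (e t)" if "t < ?D" for t
      using that f_carrier[OF e_span'[OF that]] by (intro eq_vecI) (auto simp: M_def)
    have intertwines: "\<rho> g * M = M * \<sigma> g" if g: "g \<in> heis m n" for g
    proof (rule eq_matI)
      fix r t assume "r < dim_row (M * \<sigma> g)" "t < dim_col (M * \<sigma> g)"
      then have r: "r < d" and t: "t < ?D" using M \<sigma>_c[of g] by auto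
      obtain a b c where g_eq: "g = (a, b, c)" by (cases g) auto
      have a: "a \<in> vecs m" using g by (simp add: g_eq heis_def)
      have "e t + comb m n \<Phi> a \<in> span m n \<Phi>"
        by (rule span_add[OF \<Phi> e_span'[OF t] comb_span[OF a]])
      then have "e t + comb m n \<Phi> a \<in> e ` {..<?D}" using e by (simp add: bij_betw_def)
      then obtain s where s: "s < ?D" "e s = e t + comb m n \<Phi> a" by fastforce
      have entry: "\<sigma> g $$ (s', t) = (if s' = s then \<chi> g * cval (central m n \<Phi> c - pair_row n (e s) b) else 0)"
        if "s' < ?D" for s'
      proof -
        have "e s' = e t + comb m n \<Phi> a \<longleftrightarrow> s' = s"
          using s that e bij_betw_imp_inj_on[OF e] by (auto simp: inj_on_def)
        then show ?thesis using that t by (auto simp: \<sigma>_def g_eq std_rep_def)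
      qed
      have "(M * \<sigma> g) $$ (r, t) = (\<Sum>s'\<in>{0..<?D}. M $$ (r, s') * \<sigma> g $$ (s', t))"
        using r t M \<sigma>_c[of g] by (simp add: scalar_prod_def)
      also have "\<dots> = (\<Sum>s'\<in>{0..<?D}. if s' = s then
          M $$ (r, s') * (\<chi> g * cval (central m n \<Phi> c - pair_row n (e s) b)) else 0)"
        by (intro sum.cong refl) (auto simp: entry)
      also have "\<dots> = M $$ (r, s) * (\<chi> g * cval (central m n \<Phi> c - pair_row n (e s) b))" using s(1) by simp
      also have "M $$ (r, s) = f (e s) $ r" using r s by (simp add: M_def)
      also have "f (e s) $ r * (\<chi> g * cval (central m n \<Phi> c - pair_row n (e s) b)) = (\<rho> g *\<^sub>v f (e t)) $ r"
        using action[of a b c "e t"] g e_span'[OF t] s(2) r f_carrier[OF e_span'[OF s(1)]] by (simp add: g_eq)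
      also have "\<dots> = (\<rho> g * M) $$ (r, t)"
        using r t M carrier[OF g] col_M[OF t] by simp
      finally show "(\<rho> g * M) $$ (r, t) = (M * \<sigma> g) $$ (r, t)" ..
    qed (use M carrier[OF g] \<sigma>_c[of g] in auto)
    \<comment> \<open>The column that belongs to 0 in the span is \<open>v\<close> itself.\<close>
    have nz: "\<exists>x\<in>carrier_vec ?D. M *\<^sub>v x \<noteq> 0\<^sub>v d"
    proof -
      obtain s where s: "s < ?D" "e s = 0"
      proof -
        have "0 \<in> e ` {..<?D}" using e span_0[OF \<Phi>] by (simp add: bij_betw_def)
        then show ?thesis using that by fastforce
      qed
      have "M *\<^sub>v unit_vec ?D s = f 0" using mult_mat_unit_vec[OF M s(1)] col_M[OF s(1)] s(2) by simp
      moreover have "f 0 = v"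
        using f[OF vecs_0] comb_0[OF \<Phi>_D] \<kappa>_0 one v(1) by simp
      ultimately show ?thesis using v(2) by (intro bexI[of _ "unit_vec ?D s"]) auto
    qed
    have "d = ?D" by (rule intertwiner(1)[OF irr irr' carrier \<sigma>_c M nz intertwines])
    moreover have "mtrace (\<rho> g) = \<chi> g * mtrace (?std g)" if g: "g \<in> heis m n" for g
    proof -
      have "mtrace (\<rho> g) = mtrace (\<sigma> g)" by (rule intertwiner(2)[OF irr irr' carrier \<sigma>_c M nz intertwines g])
      also have "\<dots> = \<chi> g * mtrace (?std g)"
        using std_c[of g] by (auto simp: \<sigma>_def mtrace_def sum_distrib_left intro!: sum.cong)
      finally show ?thesis .
    qed
    ultimately show ?thesis by simp
  qed
  obtain e where e: "bij_betw e {..<card (span m n \<Phi>)} (span m n \<Phi>)"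
    using ex_bij_betw_nat_finite[OF finite_span[OF \<Phi>]] unfolding atLeast0LessThan by (rule exE)
  show thesis
  proof (rule that)
    show "\<Phi> (i, j) \<in> chars k" for i j by (rule \<Phi>)
    show "card (span m n \<Phi>) = d" by (rule conjunct1[OF trace[OF e]])
    show "\<chi> (0, 0, 0) = 1" by (simp add: \<chi>_def \<kappa>_0 \<mu>_0)
    show "mtrace (\<rho> g) = \<chi> g * mtrace (std_rep m n \<Phi> e' g)"
      if g: "g \<in> heis m n" and e': "bij_betw e' {..<card (span m n \<Phi>)} (span m n \<Phi>)" for g e'
      by (rule bspec[OF conjunct2[OF trace[OF e']] g])
  qed (fact \<chi>_mult \<chi>_nz \<chi>_cong)+
qed

end

hide_const (open) Multiset.mult

section \<open>Limits of the group over the ring of integers and their continuous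
  representations\<close>

context local_filtration begin

definition heis_inv :: "'k heis \<Rightarrow> 'k heis" where
  "heis_inv = (\<lambda>(a, b, c). (- a, - b, outer a b - c))"

lemma heis_inv_closed: "g \<in> heis m n \<Longrightarrow> heis_inv g \<in> heis m n"
  by (auto simp: heis_def heis_inv_def intro!: vecs_uminus mats_diff outer_mats)

lemma heis_mult_inv: "heis_mult g (heis_inv g) = (0, 0, 0)" "heis_mult (heis_inv g) g = (0, 0, 0)"
  by (cases g; auto simp: heis_inv_def outer_def fun_eq_iff)+

lemma heis_one: "(0, 0, 0) \<in> heis m n"
  by (simp add: heis_def vecs_0 mats_0)

lemma heis_cong_sym:
  assumes "heis_cong m n k g h"
  shows "heis_cong m n k h g"
proof -
  obtain a b c a' b' c' where e: "g = (a, b, c)" "h = (a', b', c')" by (cases g, cases h) auto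
  have *: "y - x \<in> PP k" if "x - y \<in> PP k" for x y using PP_uminus[OF that] by simp
  show ?thesis using assms unfolding e heis_cong.simps by (simp add: *)
qed

lemma heis_cong_trans:
  assumes "heis_cong m n k g h" "heis_cong m n k h f"
  shows "heis_cong m n k g f"
proof -
  obtain a b c a' b' c' a'' b'' c'' where e: "g = (a, b, c)" "h = (a', b', c')" "f = (a'', b'', c'')"
    by (cases g, cases h, cases f) auto
  have *: "x - z \<in> PP k" if "x - y \<in> PP k" "y - z \<in> PP k" for x y z
    using PP_add[OF that] by simp
  have "a i - a'' i \<in> PP k" if "i < m" for i using assms that *[of "a i" "a' i" "a'' i"] by (simp add: e)
  moreover have "b j - b'' j \<in> PP k" if "j < n" for j using assms that *[of "b j" "b' j" "b'' j"] by (simp add: e)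
  moreover have "c (i, j) - c'' (i, j) \<in> PP k" if "i < m" "j < n" for i j
    using assms that *[of "c (i, j)" "c' (i, j)" "c'' (i, j)"] by (simp add: e)
  ultimately show ?thesis by (simp add: e)
qed

lemma heis_cong_mono: "k \<le> l \<Longrightarrow> heis_cong m n l g h \<Longrightarrow> heis_cong m n k g h"
  using PP_mono[of k l] by (cases g, cases h) auto

lemma heis_cong_inv:
  assumes "g \<in> heis m n" "h \<in> heis m n" "heis_cong m n k g h"
  shows "heis_cong m n k (heis_inv g) (heis_inv h)"
proof -
  obtain a b c a' b' c' where e: "g = (a, b, c)" "h = (a', b', c')" by (cases g, cases h) auto
  have "a i * b j - c (i, j) - (a' i * b' j - c' (i, j)) \<in> PP k" if ij: "i < m" "j < n" for i j
  proof -
    have mem: "b j \<in> S" "a' i \<in> S" using assms(1,2) ij by (auto simp: e heis_def vecs_def)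
    have d: "a i - a' i \<in> PP k" "b j - b' j \<in> PP k" "c (i, j) - c' (i, j) \<in> PP k" using assms(3) ij by (auto simp: e)
    have "b j * (a i - a' i) + a' i * (b j - b' j) - (c (i, j) - c' (i, j)) \<in> PP k"
      using PP_mult[OF mem(1) d(1)] PP_mult[OF mem(2) d(2)] d(3) PP_add PP_diff by blast
    then show ?thesis by (simp add: algebra_simps)
  qed
  moreover have "- x - (- y) \<in> PP k" if "x - y \<in> PP k" for x y using PP_uminus[OF that] by simp
  ultimately show ?thesis using assms(3) by (auto simp: e heis_inv_def outer_def)
qed

definition coherent :: "nat \<Rightarrow> nat \<Rightarrow> (nat \<Rightarrow> 'k heis) \<Rightarrow> bool" where
  "coherent m n s \<longleftrightarrow> (\<forall>l. s l \<in> heis m n \<and> heis_cong m n l (s (Suc l)) (s l))"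

end

text \<open>The interface between the representation theory and the inverse limit.
  \<open>lim\<close> sends a coherent sequence to its limit and \<open>level k\<close> chooses a
  representative modulo \<open>PP k\<close>; the sets of elements that agree at a given level form a
  base of the topology. Integers in \<open>PP k\<close> are provided for the classification.\<close>

locale heis_limit = local_filtration S P PP \<pi> u R for S P :: "'k::field_char_0 set" and PP \<pi> u R +
  fixes m n :: nat and G :: "'g monoid" and T :: "'g topology" and lim :: "(nat \<Rightarrow> 'k heis) \<Rightarrow> 'g"
    and level :: "nat \<Rightarrow> 'g \<Rightarrow> 'k heis"
  assumes carrier_lim: "carrier G = lim ` Collect (coherent m n)"
    and lim_mult: "coherent m n s \<Longrightarrow> coherent m n t \<Longrightarrow> lim s \<otimes>\<^bsub>G\<^esub> lim t = lim (\<lambda>l. heis_mult (s l) (t l))"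
    and lim_one: "\<one>\<^bsub>G\<^esub> = lim (\<lambda>_. (0, 0, 0))"
    and lim_cong: "coherent m n s \<Longrightarrow> coherent m n t \<Longrightarrow> (\<And>l. heis_cong m n l (s l) (t l)) \<Longrightarrow> lim s = lim t"
    and level_lim: "coherent m n s \<Longrightarrow> heis_cong m n l (level l (lim s)) (s l)"
    and level_closed: "g \<in> carrier G \<Longrightarrow> level l g \<in> heis m n"
    and topspace: "topspace T = carrier G"
    and open_level: "g \<in> carrier G \<Longrightarrow> openin T {h \<in> carrier G. heis_cong m n k (level k h) (level k g)}"
    and level_base: "openin T W \<Longrightarrow> g \<in> W \<Longrightarrow> \<exists>k. {h \<in> carrier G. heis_cong m n k (level k h) (level k g)} \<subseteq> W"
    and of_nat_PP: "\<exists>N>0. of_nat N \<in> PP k"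
begin

definition agree :: "nat \<Rightarrow> 'g \<Rightarrow> 'g \<Rightarrow> bool" where
  "agree k g h \<longleftrightarrow> heis_cong m n k (level k g) (level k h)"

lemma agree_refl: "agree k g g"
  unfolding agree_def by (rule heis_cong_refl)

lemma agree_sym: "agree k g h \<Longrightarrow> agree k h g"
  unfolding agree_def by (rule heis_cong_sym)

definition emb :: "'k heis \<Rightarrow> 'g" where
  "emb g = lim (\<lambda>_. g)"

lemma coherent_const: "g \<in> heis m n \<Longrightarrow> coherent m n (\<lambda>_. g)"
  by (simp add: coherent_def heis_cong_refl)

lemma coherentD: "coherent m n s \<Longrightarrow> s l \<in> heis m n" "coherent m n s \<Longrightarrow> heis_cong m n l (s (Suc l)) (s l)"
  by (simp_all add: coherent_def)

lemma coherent_mult: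
  assumes "coherent m n s" "coherent m n t"
  shows "coherent m n (\<lambda>l. heis_mult (s l) (t l))"
  unfolding coherent_def
proof (intro allI conjI)
  fix l
  show "heis_mult (s l) (t l) \<in> heis m n"
    by (rule heis_mult_closed[OF coherentD(1)[OF assms(1)] coherentD(1)[OF assms(2)]])
  show "heis_cong m n l (heis_mult (s (Suc l)) (t (Suc l))) (heis_mult (s l) (t l))"
    by (rule heis_cong_mult) (rule coherentD[OF assms(1)] coherentD[OF assms(2)])+
qed

lemma coherent_inv:
  assumes "coherent m n s"
  shows "coherent m n (\<lambda>l. heis_inv (s l))"
  unfolding coherent_def
proof (intro allI conjI)
  fix l
  show "heis_inv (s l) \<in> heis m n" by (rule heis_inv_closed[OF coherentD(1)[OF assms]])
  show "heis_cong m n l (heis_inv (s (Suc l))) (heis_inv (s l))"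
    by (rule heis_cong_inv) (rule coherentD[OF assms])+
qed

lemma lim_closed: "coherent m n s \<Longrightarrow> lim s \<in> carrier G"
  by (simp add: carrier_lim)

lemma emb_closed: "g \<in> heis m n \<Longrightarrow> emb g \<in> carrier G"
  by (simp add: emb_def lim_closed coherent_const)

lemma emb_mult: "g \<in> heis m n \<Longrightarrow> h \<in> heis m n \<Longrightarrow> emb (heis_mult g h) = emb g \<otimes>\<^bsub>G\<^esub> emb h"
  by (simp add: emb_def lim_mult coherent_const)

lemma emb_one: "emb (0, 0, 0) = \<one>\<^bsub>G\<^esub>"
  by (simp add: emb_def lim_one)

lemma one_closed: "\<one>\<^bsub>G\<^esub> \<in> carrier G"
  using emb_closed[OF heis_one] by (simp add: emb_one)

lemma level_emb: "g \<in> heis m n \<Longrightarrow> heis_cong m n l (level l (emb g)) g"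
  unfolding emb_def by (rule level_lim[OF coherent_const])

lemma carrierE:
  assumes "g \<in> carrier G"
  obtains s where "coherent m n s" "g = lim s"
  using assms by (auto simp: carrier_lim)

lemma mult_closed: "g \<in> carrier G \<Longrightarrow> h \<in> carrier G \<Longrightarrow> g \<otimes>\<^bsub>G\<^esub> h \<in> carrier G"
  by (elim carrierE) (simp only: lim_mult lim_closed coherent_mult)

lemma level_mult:
  assumes "g \<in> carrier G" "h \<in> carrier G"
  shows "heis_cong m n l (level l (g \<otimes>\<^bsub>G\<^esub> h)) (heis_mult (level l g) (level l h))"
proof -
  obtain s t where st: "coherent m n s" "g = lim s" "coherent m n t" "h = lim t" by (rule carrierE[OF assms(1)], rule carrierE[OF assms(2)])
  have "heis_cong m n l (level l (g \<otimes>\<^bsub>G\<^esub> h)) (heis_mult (s l) (t l))"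
    unfolding st(2,4) lim_mult[OF st(1,3)] by (rule level_lim[OF coherent_mult[OF st(1,3)]])
  moreover have "heis_cong m n l (heis_mult (s l) (t l)) (heis_mult (level l g) (level l h))"
    by (rule heis_cong_sym, rule heis_cong_mult[OF level_closed[OF assms(1)] coherentD(1)[OF st(1)]
          level_closed[OF assms(2)] coherentD(1)[OF st(3)]])
      (simp_all only: st(2,4) level_lim[OF st(1)] level_lim[OF st(3)])
  ultimately show ?thesis by (rule heis_cong_trans)
qed

lemma level_one: "heis_cong m n l (level l \<one>\<^bsub>G\<^esub>) (0, 0, 0)"
  using level_emb[OF heis_one] by (simp add: emb_one)

lemma ex_inverse:
  assumes "g \<in> carrier G"
  shows "\<exists>h\<in>carrier G. g \<otimes>\<^bsub>G\<^esub> h = \<one>\<^bsub>G\<^esub> \<and> h \<otimes>\<^bsub>G\<^esub> g = \<one>\<^bsub>G\<^esub>"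
proof -
  obtain s where s: "coherent m n s" "g = lim s" using assms by (rule carrierE)
  show ?thesis
    using lim_closed[OF coherent_inv[OF s(1)]] s lim_mult[OF s(1) coherent_inv[OF s(1)]]
      lim_mult[OF coherent_inv[OF s(1)] s(1)]
    by (intro bexI[of _ "lim (\<lambda>l. heis_inv (s l))"]) (simp_all add: heis_mult_inv lim_one)
qed

lemma agree_mult:
  assumes "g \<in> carrier G" "h \<in> carrier G" "g' \<in> carrier G" "h' \<in> carrier G" "agree k g g'" "agree k h h'"
  shows "agree k (g \<otimes>\<^bsub>G\<^esub> h) (g' \<otimes>\<^bsub>G\<^esub> h')"
proof -
  have "heis_cong m n k (heis_mult (level k g) (level k h)) (heis_mult (level k g') (level k h'))"
    by (rule heis_cong_mult[OF level_closed[OF assms(1)] level_closed[OF assms(3)] level_closed[OF assms(2)]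
          level_closed[OF assms(4)] assms(5)[unfolded agree_def] assms(6)[unfolded agree_def]])
  then show ?thesis
    unfolding agree_def
    by (rule heis_cong_trans[OF level_mult[OF assms(1,2)] heis_cong_trans[OF _ heis_cong_sym[OF level_mult[OF assms(3,4)]]]])
qed

lemma agree_emb:
  assumes "g \<in> heis m n" "h \<in> heis m n" "heis_cong m n k g h"
  shows "agree k (emb g) (emb h)"
  unfolding agree_def
  by (rule heis_cong_trans[OF level_emb[OF assms(1)] heis_cong_trans[OF assms(3) heis_cong_sym[OF level_emb[OF assms(2)]]]])

lemma agree_emb_level: "g \<in> carrier G \<Longrightarrow> agree k (emb (level k g)) g"
  unfolding agree_def by (rule level_emb[OF level_closed])

lemma continuous_mapI:
  assumes "\<And>g h. g \<in> carrier G \<Longrightarrow> h \<in> carrier G \<Longrightarrow> agree k g h \<Longrightarrow> f g = f h"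
  shows "continuous_map T euclidean (f :: 'g \<Rightarrow> complex)"
  unfolding continuous_map_def
proof (intro conjI allI impI)
  fix U :: "complex set" assume "openin euclidean U"
  show "openin T {x \<in> topspace T. f x \<in> U}"
  proof (subst openin_subopen, rule ballI)
    fix g assume g: "g \<in> {x \<in> topspace T. f x \<in> U}"
    let ?V = "{h \<in> carrier G. heis_cong m n k (level k h) (level k g)}"
    have "g \<in> carrier G" using g by (simp add: topspace)
    then have "openin T ?V" by (rule open_level)
    moreover have "g \<in> ?V" using \<open>g \<in> carrier G\<close> by (simp add: heis_cong_refl)
    moreover have "?V \<subseteq> {x \<in> topspace T. f x \<in> U}"
    proof
      fix h assume h: "h \<in> ?V"
      then have "f h = f g" using \<open>g \<in> carrier G\<close> by (intro assms) (simp_all add: agree_def)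
      then show "h \<in> {x \<in> topspace T. f x \<in> U}" using g h by (simp add: topspace)
    qed
    ultimately show "\<exists>V. openin T V \<and> g \<in> V \<and> V \<subseteq> {x \<in> topspace T. f x \<in> U}" by blast
  qed
qed simp

lemma level_base_common:
  assumes "finite I" "\<And>i. i \<in> I \<Longrightarrow> openin T (W i)" "\<And>i. i \<in> I \<Longrightarrow> g \<in> W i"
  shows "\<exists>k. \<forall>i\<in>I. {h \<in> carrier G. agree k h g} \<subseteq> W i"
proof (cases "I = {}")
  case False
  have "openin T (\<Inter>i\<in>I. W i)" using assms False by (intro openin_INT2) auto
  moreover have "g \<in> (\<Inter>i\<in>I. W i)" using assms(3) by blast
  ultimately obtain k where "{h \<in> carrier G. heis_cong m n k (level k h) (level k g)} \<subseteq> (\<Inter>i\<in>I. W i)"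
    using level_base by blast
  then show ?thesis by (auto simp: agree_def)
qed simp

text \<open>The group \<open>GL\<^sub>d(\<complex>)\<close> has no small subgroups: if the entries of \<open>E = \<rho> g - 1\<close> are small for all \<open>g\<close> in a
  subgroup, then \<open>2 E = (\<rho> (g\<^sup>2) - 1) - E\<^sup>2\<close> improves the bound by a constant factor.\<close>
lemma cont_rep_level:
  assumes "cont_rep G T d \<rho>"
  shows "\<exists>k. \<forall>g\<in>carrier G. \<forall>h\<in>carrier G. agree k g h \<longrightarrow> \<rho> g = \<rho> h"
proof -
  have \<rho>: "\<And>g. g \<in> carrier G \<Longrightarrow> \<rho> g \<in> carrier_mat d d" "\<rho> \<one>\<^bsub>G\<^esub> = 1\<^sub>m d"
    "\<And>g h. g \<in> carrier G \<Longrightarrow> h \<in> carrier G \<Longrightarrow> \<rho> (g \<otimes>\<^bsub>G\<^esub> h) = \<rho> g * \<rho> h"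
    and cont: "\<And>r c. r < d \<Longrightarrow> c < d \<Longrightarrow> continuous_map T euclidean (\<lambda>g. \<rho> g $$ (r, c))"
    using assms by (auto simp: cont_rep_def)
  define \<delta> :: "nat \<Rightarrow> nat \<Rightarrow> complex" where "\<delta> r c = (if r = c then 1 else 0)" for r c
  \<comment> \<open>Small enough for \<open>real d * \<epsilon> \<le> 1 / 2\<close>. Then the
    quadratic term is at most half of the current bound, so twice an entry of \<open>E\<close> is at
    most \<open>3 / 2\<close> times this bound, which explains the factor \<open>3 / 4\<close> per
    squaring.\<close>
  define \<epsilon> :: real where "\<epsilon> = 1 / (2 * real d + 2)"
  have \<epsilon>: "0 < \<epsilon>" "real d * \<epsilon> \<le> 1 / 2" by (auto simp: \<epsilon>_def field_simps)
  define W where "W = (\<lambda>(r, c). {g \<in> topspace T. \<rho> g $$ (r, c) \<in> {z. dist (\<delta> r c) z < \<epsilon>}})"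
  have "\<exists>k. \<forall>p\<in>{..<d} \<times> {..<d}. {h \<in> carrier G. agree k h \<one>\<^bsub>G\<^esub>} \<subseteq> W p"
  proof (rule level_base_common)
    fix p assume "p \<in> {..<d} \<times> {..<d}"
    then obtain r c where p: "p = (r, c)" "r < d" "c < d" by auto
    show "openin T (W p)"
      unfolding W_def p(1) split by (rule openin_continuous_map_preimage[OF cont[OF p(2,3)]]) (simp add: open_Collect_less continuous_on_dist)
    show "\<one>\<^bsub>G\<^esub> \<in> W p" using p \<epsilon> topspace one_closed by (simp add: W_def \<rho>(2) \<delta>_def)
  qed simp
  then obtain k where k_all: "\<forall>p\<in>{..<d} \<times> {..<d}. {h \<in> carrier G. agree k h \<one>\<^bsub>G\<^esub>} \<subseteq> W p" by (rule exE)
  have k: "g \<in> W (r, c)" if "r < d" "c < d" "g \<in> carrier G" "agree k g \<one>\<^bsub>G\<^esub>" for r c g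
    using bspec[OF k_all, of "(r, c)"] that by auto
  define N where "N = {g \<in> carrier G. agree k g \<one>\<^bsub>G\<^esub>}"
  define E where "E g = (\<lambda>r c. \<rho> g $$ (r, c) - \<delta> r c)" for g
  have one_one: "\<one>\<^bsub>G\<^esub> \<otimes>\<^bsub>G\<^esub> \<one>\<^bsub>G\<^esub> = \<one>\<^bsub>G\<^esub>"
  proof -
    have "heis_mult (0, 0, 0) (0, 0, 0) = (0, 0, 0 :: nat \<times> nat \<Rightarrow> 'k)" by (simp add: fun_eq_iff)
    then show ?thesis
      using lim_mult[OF coherent_const[OF heis_one] coherent_const[OF heis_one]] by (simp add: lim_one del: heis_mult.simps)
  qed
  have N_sq: "g \<otimes>\<^bsub>G\<^esub> g \<in> N" if "g \<in> N" for g
  proof -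
    have g: "g \<in> carrier G" "agree k g \<one>\<^bsub>G\<^esub>" using that by (simp_all add: N_def)
    have "agree k (g \<otimes>\<^bsub>G\<^esub> g) (\<one>\<^bsub>G\<^esub> \<otimes>\<^bsub>G\<^esub> \<one>\<^bsub>G\<^esub>)"
      by (rule agree_mult[OF g(1) g(1) one_closed one_closed g(2) g(2)])
    then show ?thesis using mult_closed[OF g(1) g(1)] by (simp add: N_def one_one)
  qed
  have bound: "cmod (E g r c) \<le> \<epsilon> * (3 / 4) ^ t" if "g \<in> N" "r < d" "c < d" for g r c t
    using that
  proof (induction t arbitrary: g r c)
    case 0
    then have "g \<in> W (r, c)" by (intro k) (auto simp: N_def)
    then have "dist (\<delta> r c) (\<rho> g $$ (r, c)) < \<epsilon>" by (simp add: W_def)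
    then show ?case by (simp add: E_def dist_norm norm_minus_commute)
  next
    case (Suc t)
    let ?b = "\<epsilon> * (3 / 4) ^ t"
    have g: "g \<in> carrier G" using Suc.prems by (simp add: N_def)
    have "\<rho> (g \<otimes>\<^bsub>G\<^esub> g) $$ (r, c) = (\<Sum>s\<in>{0..<d}. \<rho> g $$ (r, s) * \<rho> g $$ (s, c))"
      using \<rho>(1)[OF g] Suc.prems by (simp add: \<rho>(3)[OF g g] scalar_prod_def)
    also have "\<dots> = (\<Sum>s\<in>{0..<d}. E g r s * E g s c + \<delta> r s * \<rho> g $$ (s, c) + \<rho> g $$ (r, s) * \<delta> s c - \<delta> r s * \<delta> s c)"
      by (intro sum.cong refl) (simp add: E_def algebra_simps)
    also have "\<dots> = (\<Sum>s\<in>{0..<d}. E g r s * E g s c) + (\<Sum>s\<in>{0..<d}. \<delta> r s * \<rho> g $$ (s, c)) +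
        (\<Sum>s\<in>{0..<d}. \<rho> g $$ (r, s) * \<delta> s c) - (\<Sum>s\<in>{0..<d}. \<delta> r s * \<delta> s c)"
      by (simp add: sum.distrib sum_subtractf)
    also have "(\<Sum>s\<in>{0..<d}. \<delta> r s * \<rho> g $$ (s, c)) = \<rho> g $$ (r, c)"
      using Suc.prems by (simp add: \<delta>_def if_distrib[of "\<lambda>x. x * _"] cong: if_cong)
    also have "(\<Sum>s\<in>{0..<d}. \<rho> g $$ (r, s) * \<delta> s c) = \<rho> g $$ (r, c)"
      using Suc.prems by (simp add: \<delta>_def if_distrib[of "\<lambda>x. _ * x"] cong: if_cong)
    also have "(\<Sum>s\<in>{0..<d}. \<delta> r s * \<delta> s c) = \<delta> r c"
      using Suc.prems by (simp add: \<delta>_def[of r] if_distrib[of "\<lambda>x. x * _"] cong: if_cong)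
    finally have sq: "2 * E g r c = E (g \<otimes>\<^bsub>G\<^esub> g) r c - (\<Sum>s\<in>{0..<d}. E g r s * E g s c)"
      by (simp add: E_def)
    have "cmod (\<Sum>s\<in>{0..<d}. E g r s * E g s c) \<le> (\<Sum>s\<in>{0..<d}. ?b * \<epsilon>)"
    proof (rule order_trans[OF norm_sum sum_mono])
      fix s assume s: "s \<in> {0..<d}"
      have "?b \<le> \<epsilon>" using \<epsilon>(1) by (simp add: mult_left_le power_le_one)
      then have "cmod (E g s c) \<le> \<epsilon>" using Suc.IH[of g s c] Suc.prems s by force
      moreover have "cmod (E g r s) \<le> ?b" using Suc.IH[of g r s] Suc.prems s by simp
      ultimately show "cmod (E g r s * E g s c) \<le> ?b * \<epsilon>"
        unfolding norm_mult using \<epsilon>(1) by (intro mult_mono) auto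
    qed
    also have "\<dots> = ?b * (real d * \<epsilon>)" by simp
    also have "\<dots> \<le> ?b * (1 / 2)" using \<epsilon> by (intro mult_left_mono) auto
    finally have "cmod (2 * E g r c) \<le> ?b + ?b / 2"
      unfolding sq using norm_triangle_ineq4[of "E (g \<otimes>\<^bsub>G\<^esub> g) r c" "\<Sum>s\<in>{0..<d}. E g r s * E g s c"]
        Suc.IH[OF N_sq[OF Suc.prems(1)] Suc.prems(2,3)] by linarith
    then show ?case by (simp add: norm_mult)
  qed
  have E_0: "E g r c = 0" if "g \<in> N" "r < d" "c < d" for g r c
  proof -
    have "(\<lambda>t. \<epsilon> * (3 / 4) ^ t) \<longlonglongrightarrow> \<epsilon> * 0" by (intro tendsto_mult tendsto_const LIMSEQ_realpow_zero) auto
    then have "cmod (E g r c) \<le> \<epsilon> * 0" using bound[OF that] by (intro LIMSEQ_le_const) auto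
    then show ?thesis by simp
  qed
  have trivial: "\<rho> g = 1\<^sub>m d" if "g \<in> N" for g
    using \<rho>(1)[of g] E_0[OF that] that by (intro eq_matI) (auto simp: N_def E_def \<delta>_def)
  have "\<rho> g = \<rho> h" if g: "g \<in> carrier G" and h: "h \<in> carrier G" and "agree k g h" for g h
  proof -
    obtain h' where h': "h' \<in> carrier G" "h \<otimes>\<^bsub>G\<^esub> h' = \<one>\<^bsub>G\<^esub>" "h' \<otimes>\<^bsub>G\<^esub> h = \<one>\<^bsub>G\<^esub>"
      using ex_inverse[OF h] by blast
    have "agree k (h' \<otimes>\<^bsub>G\<^esub> g) (h' \<otimes>\<^bsub>G\<^esub> h)" by (rule agree_mult[OF h'(1) g h'(1) h agree_refl that(3)])
    then have "\<rho> (h' \<otimes>\<^bsub>G\<^esub> g) = 1\<^sub>m d" using h'(3) mult_closed[OF h'(1) g] by (intro trivial) (simp add: N_def)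
    then have "\<rho> h * (\<rho> h' * \<rho> g) = \<rho> h * 1\<^sub>m d" using \<rho>(3)[OF h'(1) g] by simp
    moreover have "\<rho> h * (\<rho> h' * \<rho> g) = (\<rho> h * \<rho> h') * \<rho> g"
      using assoc_mult_mat[OF \<rho>(1)[OF h] \<rho>(1)[OF h'(1)] \<rho>(1)[OF g]] by simp
    moreover have "\<rho> h * \<rho> h' = 1\<^sub>m d" using \<rho>(3)[OF h h'(1)] h'(2) \<rho>(2) by simp
    ultimately show ?thesis using \<rho>(1)[OF g] \<rho>(1)[OF h] by simp
  qed
  then show ?thesis by blast
qed

end

section \<open>Completions of rings of integers\<close>

context local_filtration begin

text \<open>Expansion in powers of \<open>\<pi>\<close> with digits in \<open>R\<close>: after
  \<open>k\<close> digits the remainder \<open>\<pi> ^ k * s\<close> lies in \<open>PP k\<close>.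
  Division by \<open>\<pi>\<close> brings in a factor \<open>u\<close>, which is removed by its
  inverse modulo \<open>PP k\<close>; hence the expansion is a congruence.\<close>

lemma fin_reps_PP: "\<exists>Q. fin_reps S (PP k) Q"
proof -
  have "\<exists>Q. finite Q \<and> Q \<subseteq> S \<and> (\<forall>x\<in>S. \<exists>r\<in>Q. \<exists>s\<in>S. x - r - \<pi> ^ l * s \<in> PP k)" for l
  proof (induction l)
    case 0
    have "0 \<in> S \<and> x \<in> S \<and> x - 0 - \<pi> ^ 0 * x \<in> PP k" if "x \<in> S" for x using that S_0 PP_zero by simp
    then show ?case using S_0 by (intro exI[of _ "{0}"]) blast
  next
    case (Suc l)
    obtain Q where Q: "finite Q" "Q \<subseteq> S" "\<forall>x\<in>S. \<exists>r\<in>Q. \<exists>s\<in>S. x - r - \<pi> ^ l * s \<in> PP k"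
      using Suc by blast
    obtain v where v: "v \<in> S" "v * u - 1 \<in> PP k" using unit_mod_PP[OF u] by blast
    let ?Q = "(\<lambda>(r, r'). r + \<pi> ^ l * r') ` (Q \<times> R)"
    have "\<exists>r\<in>?Q. \<exists>s\<in>S. x - r - \<pi> ^ Suc l * s \<in> PP k" if x: "x \<in> S" for x
    proof -
      obtain r s where rs: "r \<in> Q" "s \<in> S" "x - r - \<pi> ^ l * s \<in> PP k" using Q(3) x by blast
      obtain r' where r': "r' \<in> R" "s - r' \<in> P" using R rs(2) by (auto simp: fin_reps_def)
      obtain b where b: "b \<in> S" "u * (s - r') = \<pi> * b" using divide[of "s - r'" 1] r'(2) PP_1 by auto
      have "\<pi> ^ l * (s - r') \<in> S" using S_mult[OF S_power[OF pi_S] P_S[OF r'(2)]] .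
      then have "\<pi> ^ l * (s - r') * (v * u - 1) \<in> PP k" using v(2) by (rule PP_mult)
      then have "x - r - \<pi> ^ l * s - \<pi> ^ l * (s - r') * (v * u - 1) \<in> PP k" by (rule PP_diff[OF rs(3)])
      moreover have "x - r - \<pi> ^ l * s - \<pi> ^ l * (s - r') * (v * u - 1) =
          x - (r + \<pi> ^ l * r') - \<pi> ^ l * v * (u * (s - r'))" by (simp add: algebra_simps)
      moreover have "\<pi> ^ l * v * (u * (s - r')) = \<pi> ^ Suc l * (v * b)" unfolding b(2) by simp
      ultimately have "x - (r + \<pi> ^ l * r') - \<pi> ^ Suc l * (v * b) \<in> PP k" by simp
      moreover have "r + \<pi> ^ l * r' \<in> ?Q" using rs(1) r'(1) by force
      ultimately show ?thesis using S_mult[OF v(1) b(1)] by blast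
    qed
    moreover have "finite ?Q" using Q(1) R by (simp add: fin_reps_def)
    moreover have "?Q \<subseteq> S" using Q(2) R S_mult S_power[OF pi_S] by (auto simp: fin_reps_def subset_iff intro!: S_add)
    ultimately show ?case by blast
  qed
  from this[of k] obtain Q where Q: "finite Q" "Q \<subseteq> S" "\<forall>x\<in>S. \<exists>r\<in>Q. \<exists>s\<in>S. x - r - \<pi> ^ k * s \<in> PP k" by blast
  have "\<exists>r\<in>Q. x - r \<in> PP k" if x: "x \<in> S" for x
  proof -
    obtain r where r: "r \<in> Q" "\<exists>s\<in>S. x - r - \<pi> ^ k * s \<in> PP k" using bspec[OF Q(3) x] by (rule bexE)
    obtain s where s: "s \<in> S" "x - r - \<pi> ^ k * s \<in> PP k" using r(2) by (rule bexE)
    have "(x - r - \<pi> ^ k * s) + s * \<pi> ^ k \<in> PP k"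
      by (rule PP_add[OF s(2) PP_mult[OF s(1) P_power[OF pi(1)]]])
    moreover have "(x - r - \<pi> ^ k * s) + s * \<pi> ^ k = x - r" by (simp add: mult.commute)
    ultimately show ?thesis using r(1) by (intro bexI[of _ r]) simp_all
  qed
  then have "fin_reps S (PP k) Q" unfolding fin_reps_def using Q(1,2) by simp
  then show ?thesis by (rule exI)
qed

end

section \<open>The ring of integers of a number field at a prime ideal\<close>

locale integers_at_prime =
  fixes K P :: "'k::field_char_0 set"
  assumes K: "number_field K" and P: "primeideal P (ring_of_integers K)" and P_nonzero: "P \<noteq> {0}"
begin

abbreviation OK :: "'k ring" where "OK \<equiv> ring_of_integers K"

abbreviation S :: "'k set" where "S \<equiv> carrier OK"

definition PP :: "nat \<Rightarrow> 'k set" where "PP k = P [^]\<^bsub>ideals_set OK\<^esub> k"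

lemma O_simps [simp]: "mult OK = (*)" "add OK = (+)" "zero OK = 0" "one OK = 1"
  by (simp_all add: ring_of_integers_def)

lemma S_eq: "S = {x \<in> K. algebraic_int x}"
  by (simp add: ring_of_integers_def)

interpretation PI: primeideal P OK by (rule P)

lemma O_uminus: "x \<in> S \<Longrightarrow> \<ominus>\<^bsub>OK\<^esub> x = - x"
  using PI.r_neg[of x] by (simp add: eq_neg_iff_add_eq_0 add.commute)

lemma K_mult: "x \<in> K \<Longrightarrow> y \<in> K \<Longrightarrow> x * y \<in> K"
  using subringE(6)[OF subfieldE(1)] K unfolding number_field_def by fastforce

lemma K_inverse: "x \<in> K \<Longrightarrow> inverse x \<in> K"
proof (cases "x = 0")
  case False
  assume x: "x \<in> K"
  have "Units (class_ring\<lparr>carrier := K\<rparr>) = K - {0}"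
    using subfield.subfield_Units[of K class_ring] K by (simp add: number_field_def)
  then have "x \<in> Units (class_ring\<lparr>carrier := K\<rparr>)" using x False by simp
  then obtain y where "y \<in> K" "y * x = 1" by (auto simp: Units_def)
  then show ?thesis using inverse_unique[of x y] by (simp add: mult.commute)
qed simp

text \<open>Induction along the line extensions that witness the finite dimension, each of which
  adds one vector to the spanning set. The equation \<open>F = \<rat>\<close> keeps track of the
  base field.\<close>

lemma K_span: "\<exists>T. finite T \<and> K \<subseteq> rat_vs.span T"
proof -
  have "\<exists>T. finite T \<and> E \<subseteq> rat_vs.span T" if "ring.dimension class_ring n F E" "F = \<rat>" for n F and E :: "'k set"
    using that
  proof (induction rule: ring.dimension.induct[OF class_ring.ring_axioms, consumes 1, case_names zero_dim Suc_dim])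
    case (zero_dim F)
    show ?case using rat_vs.span_zero by (intro exI[of _ "{}"]) simp
  next
    case (Suc_dim v E n F)
    then obtain T where T: "finite T" "E \<subseteq> rat_vs.span T" by blast
    have "x \<in> rat_vs.span (insert v T)" if x: "x \<in> ring.line_extension class_ring F v E" for x
    proof -
      obtain k e where ke: "k \<in> \<rat>" "e \<in> E" "x = k * v + e"
        using x Suc_dim.prems by (auto simp: ring.line_extension_mem_iff[OF class_ring.ring_axioms])
      obtain r where r: "k = of_rat r" using ke(1) by (rule Rats_cases)
      have "e \<in> rat_vs.span (insert v T)" using ke(2) T(2) rat_vs.span_mono[of T "insert v T"] by blast
      moreover have "of_rat r * v \<in> rat_vs.span (insert v T)"
        by (rule rat_vs.span_scale) (simp add: rat_vs.span_base)
      ultimately show ?thesis unfolding ke(3) r by (intro rat_vs.span_add)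
    qed
    then show ?case using T(1) by (intro exI[of _ "insert v T"]) auto
  qed
  moreover obtain n where "ring.dimension class_ring n \<rat> K"
    using K by (auto simp: number_field_def ring.finite_dimension_def[OF class_ring.ring_axioms])
  ultimately show ?thesis by blast
qed

lemma S_props: "0 \<in> S" "1 \<in> S" "x \<in> S \<Longrightarrow> y \<in> S \<Longrightarrow> x + y \<in> S" "x \<in> S \<Longrightarrow> y \<in> S \<Longrightarrow> x * y \<in> S"
  "x \<in> S \<Longrightarrow> - x \<in> S"
  using PI.zero_closed PI.one_closed PI.add.m_closed[of x y] PI.m_closed[of x y] PI.a_inv_closed[of x] O_uminus[of x]
  by simp_all

lemma ideal_props:
  assumes I: "ideal I OK"
  shows "I \<subseteq> S" "0 \<in> I" "x \<in> I \<Longrightarrow> y \<in> I \<Longrightarrow> x + y \<in> I" "x \<in> S \<Longrightarrow> y \<in> I \<Longrightarrow> x * y \<in> I"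
proof -
  interpret I: ideal I OK by (rule I)
  show "I \<subseteq> S" "0 \<in> I" "x \<in> I \<Longrightarrow> y \<in> I \<Longrightarrow> x + y \<in> I" "x \<in> S \<Longrightarrow> y \<in> I \<Longrightarrow> x * y \<in> I"
    using I.a_subset I.zero_closed I.a_closed[of x y] I.I_l_closed[of y x] by simp_all
qed

lemma P_ideal: "ideal P OK"
  by (rule PI.ideal_axioms)

lemma P_prime: "x \<in> S \<Longrightarrow> y \<in> S \<Longrightarrow> x * y \<in> P \<Longrightarrow> x \<in> P \<or> y \<in> P"
  using PI.I_prime[of x y] by simp

lemma P_1: "1 \<notin> P"
proof
  assume "1 \<in> P"
  then have "x \<in> P" if "x \<in> S" for x using ideal_props(4)[OF P_ideal that, of 1] by simp
  then show False using PI.I_notcarr ideal_props(1)[OF P_ideal] by blast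
qed

lemma ex_number_field_prime: "\<exists>T. number_field_prime K S P T"
proof -
  obtain T where "finite T" "K \<subseteq> rat_vs.span T" using K_span by blast
  moreover have "\<exists>x\<in>P. x \<noteq> 0" using P_nonzero ideal_props(2)[OF P_ideal] by blast
  ultimately have "number_field_prime K S P T"
    using K_mult K_inverse S_eq S_props ideal_props[OF P_ideal] P_1 P_prime
    by (intro number_field_prime.intro) auto
  then show ?thesis ..
qed

lemma PP_0: "PP 0 = S" and PP_Suc': "PP (Suc k) = ideal_prod OK (PP k) P"
  by (simp_all add: PP_def nat_pow_def ideals_set_def)

lemma PP_ideal: "ideal (PP k) OK"
  by (induction k) (simp_all add: PP_0 PP_Suc' PI.oneideal PI.ideal_prod_is_ideal P_ideal)

lemma PP_1: "PP 1 = P"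
proof -
  have "ideal_prod OK S P = P"
    using PI.ideal_prod_commute[OF PI.oneideal P_ideal] PI.ideal_prod_one[OF P_ideal] by simp
  then show ?thesis using PP_Suc'[of 0] by (simp add: PP_0)
qed

text \<open>As \<open>S\<close> modulo \<open>P\<close> is finite, the powers of an element outside
  of \<open>P\<close> repeat, and this yields its inverse modulo \<open>P\<close>. The relation
  \<open>u P \<subseteq> \<pi> S\<close> passes to all powers of \<open>P\<close>, because products
  generate the product of two ideals.\<close>

lemma ex_local_filtration: "\<exists>\<pi> u R. local_filtration S P PP \<pi> u R"
proof -
  obtain T where "number_field_prime K S P T" using ex_number_field_prime by blast
  then interpret number_field_prime K S P T .
  obtain p where p: "prime p" "of_nat p \<in> P" using rational_prime_in_P by blast
  obtain R where "fin_reps S ((\<lambda>s. of_nat p * s) ` S) R" using fin_reps_mod_prime[OF p(1)] by blast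
  moreover have "(\<lambda>s. of_nat p * s) ` S \<subseteq> P" using P_mult[OF _ p(2)] by (auto simp: mult.commute)
  ultimately have R: "fin_reps S P R" unfolding fin_reps_def by (meson subsetD)
  obtain \<pi> u where u: "\<pi> \<in> P" "u \<in> S" "u \<notin> P" and div: "\<And>y. y \<in> P \<Longrightarrow> \<exists>b\<in>S. u * y = \<pi> * b"
    using local_uniformizer by blast
  have nz: "\<pi> \<noteq> 0"
  proof
    assume "\<pi> = 0"
    moreover obtain x where "x \<in> P" "x \<noteq> 0" using P_nonzero by blast
    ultimately show False using div[of x] u P_0 by auto
  qed
  have unit: "\<exists>b\<in>S. a * b - 1 \<in> P" if a: "a \<in> S" "a \<notin> P" for a
  proof -
    have pow: "a ^ k \<notin> P" for k
    proof (induction k)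
      case (Suc k)
      then show ?case using P_prime[OF a(1) S_power[OF a(1), of k]] a(2) by auto
    qed (simp add: P_1)
    have P_diff: "x - y \<in> P" if "x \<in> P" "y \<in> P" for x y
      using P_add[OF that(1) P_mult[OF S_uminus[OF S_1] that(2)]] by simp
    obtain i j where ij: "i < j" "a ^ j - a ^ i \<in> P"
      by (rule fin_reps_pigeonhole[OF R, of "\<lambda>k. a ^ k"]) (use S_power[OF a(1)] P_diff in auto)
    define l where "l = j - i - 1"
    have j: "j = i + Suc l" using ij(1) by (simp add: l_def)
    have "a ^ j - a ^ i = a ^ i * (a * a ^ l - 1)" by (simp add: j power_add algebra_simps)
    moreover have "a * a ^ l - 1 \<in> S" using S_diff[OF S_mult[OF a(1) S_power[OF a(1)]] S_1] .
    ultimately have "a * a ^ l - 1 \<in> P" using P_prime[OF S_power[OF a(1), of i]] pow ij(2) by metis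
    then show ?thesis using S_power[OF a(1)] by blast
  qed
  have divide: "\<exists>b\<in>S. u ^ k * y = \<pi> ^ k * b" if "y \<in> PP k" for k y
    using that
  proof (induction k arbitrary: y)
    case 0
    then show ?case by (auto simp: PP_0)
  next
    case (Suc k)
    from Suc.prems have "y \<in> ideal_prod OK (PP k) P" by (simp add: PP_Suc')
    then show ?case
    proof (induction y rule: ideal_prod.induct)
      case (prod x y)
      obtain b b' where b: "b \<in> S" "u ^ k * x = \<pi> ^ k * b" "b' \<in> S" "u * y = \<pi> * b'"
        using Suc.IH[OF prod(1)] div[OF prod(2)] by blast
      have "u ^ Suc k * (x * y) = (u ^ k * x) * (u * y)" by simp
      also have "\<dots> = \<pi> ^ Suc k * (b * b')" unfolding b(2,4) by simp
      finally show ?case using S_mult[OF b(1,3)] by auto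
    next
      case (sum x y)
      then obtain b b' where "b \<in> S" "u ^ Suc k * x = \<pi> ^ Suc k * b" "b' \<in> S" "u ^ Suc k * y = \<pi> ^ Suc k * b'" by blast
      then show ?case using S_add[of b b'] by (intro bexI[of _ "b + b'"]) (simp_all add: distrib_left)
    qed
  qed
  have sub: "PP (Suc k) \<subseteq> PP k" for k
    using PI.ideal_prod_inter[OF PP_ideal P_ideal] by (auto simp: PP_Suc')
  have prod: "x * y \<in> PP (Suc k)" if "x \<in> PP k" "y \<in> P" for x y k
    using ideal_prod.prod[of x "PP k" y P OK] that by (simp add: PP_Suc')
  have "local_filtration S P PP \<pi> u R"
  proof (rule local_filtration.intro)
    show "0 \<in> PP k" for k by (rule ideal_props(2)[OF PP_ideal])
    show "x + y \<in> PP k" if "x \<in> PP k" "y \<in> PP k" for x y k by (rule ideal_props(3)[OF PP_ideal that])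
    show "x * y \<in> PP k" if "x \<in> S" "y \<in> PP k" for x y k by (rule ideal_props(4)[OF PP_ideal that])
    show "PP (Suc k) \<subseteq> PP k" for k by (rule sub)
    show "x * y \<in> PP (Suc k)" if "x \<in> PP k" "y \<in> P" for x y k by (rule prod[OF that])
    show "\<exists>b\<in>S. a * b - 1 \<in> P" if "a \<in> S" "a \<notin> P" for a by (rule unit[OF that])
    show "\<exists>b\<in>S. u ^ k * y = \<pi> ^ k * b" if "y \<in> PP k" for k y by (rule divide[OF that])
  qed (fact S_props PP_0 PP_1 P_1 R u nz)+
  then show ?thesis by blast
qed

lemma ex_of_nat_PP: "\<exists>N>0. of_nat N \<in> PP k"
proof -
  obtain T where "number_field_prime K S P T" using ex_number_field_prime by blast
  then interpret number_field_prime K S P T .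
  obtain p where p: "prime p" "of_nat p \<in> P" using rational_prime_in_P by blast
  obtain \<pi> u R where "local_filtration S P PP \<pi> u R" using ex_local_filtration by blast
  then interpret local_filtration S P PP \<pi> u R .
  have "of_nat (p ^ k) \<in> PP k" using P_power[OF p(2), of k] by simp
  then show ?thesis using prime_gt_0_nat[OF p(1)] by (intro exI[of _ "p ^ k"]) simp
qed

lemma coset_eq: "I +>\<^bsub>OK\<^esub> x = (+) x ` I"
proof -
  have "I +>\<^bsub>OK\<^esub> x = (\<lambda>h. h + x) ` I" by (simp add: a_r_coset_def' UNION_singleton_eq_range)
  also have "\<dots> = (+) x ` I" by (rule image_cong[OF refl]) (rule add.commute)
  finally show ?thesis .
qed

lemma carrier_Quot: "carrier (OK Quot I) = cosets S I"
  unfolding FactRing_def A_RCOSETS_def' coset_eq cosets_def by (simp add: UNION_singleton_eq_range)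

lemma residue_card_eq: "residue_card OK P = card (cosets S P)"
  by (simp add: residue_card_def carrier_Quot)

lemma power_quot_simps:
  "carrier (power_quot OK P k) = cosets S (PP k)"
  "one (power_quot OK P k) = (+) 1 ` PP k" "zero (power_quot OK P k) = (+) 0 ` PP k"
  "x \<in> S \<Longrightarrow> y \<in> S \<Longrightarrow> add (power_quot OK P k) ((+) x ` PP k) ((+) y ` PP k) = (+) (x + y) ` PP k"
  "x \<in> S \<Longrightarrow> y \<in> S \<Longrightarrow> mult (power_quot OK P k) ((+) x ` PP k) ((+) y ` PP k) = (+) (x * y) ` PP k"
proof -
  interpret I: ideal "PP k" OK by (rule PP_ideal)
  have pq: "power_quot OK P k = OK Quot PP k" by (simp add: power_quot_def PP_def)
  show "carrier (power_quot OK P k) = cosets S (PP k)" by (simp add: pq carrier_Quot)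
  show "one (power_quot OK P k) = (+) 1 ` PP k" "zero (power_quot OK P k) = (+) 0 ` PP k"
    using coset_eq[of "PP k" 1] by (simp_all add: pq FactRing_def)
  show "add (power_quot OK P k) ((+) x ` PP k) ((+) y ` PP k) = (+) (x + y) ` PP k" if "x \<in> S" "y \<in> S"
    using I.a_rcos_sum[OF that] that S_props(3)[OF that] by (simp add: pq FactRing_def coset_eq)
  show "mult (power_quot OK P k) ((+) x ` PP k) ((+) y ` PP k) = (+) (x * y) ` PP k" if "x \<in> S" "y \<in> S"
    using I.rcoset_mult_add[OF that] that S_props(4)[OF that] by (simp add: pq FactRing_def coset_eq)
qed

end

context local_filtration begin

lemma span_restrict: "span m n (restrict \<Phi> ({..<m} \<times> {..<n})) = span m n \<Phi>"
  unfolding span_def by (rule dual.rowspan_cong) auto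

lemma comb_restrict: "comb m n (restrict \<Phi> ({..<m} \<times> {..<n})) a = comb m n \<Phi> a"
  by (auto simp: comb_def intro!: sum.cong)

lemma central_restrict: "central m n (restrict \<Phi> ({..<m} \<times> {..<n})) c = central m n \<Phi> c"
  by (simp add: central_def)

lemma std_rep_restrict: "std_rep m n (restrict \<Phi> ({..<m} \<times> {..<n})) e g = std_rep m n \<Phi> e g"
  unfolding std_rep_def span_restrict comb_restrict central_restrict ..

lemma common_level:
  fixes m n :: nat
  assumes "\<Phi> \<in> {..<m} \<times> {..<n} \<rightarrow> D"
  shows "\<exists>k. \<forall>i<m. \<forall>j<n. \<Phi> (i, j) \<in> chars k"
proof -
  have "\<forall>p\<in>{..<m} \<times> {..<n}. \<exists>k. \<Phi> p \<in> chars k" using assms by (auto simp: D_def Pi_iff)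
  then obtain l where l: "\<And>p. p \<in> {..<m} \<times> {..<n} \<Longrightarrow> \<Phi> p \<in> chars (l p)" by metis
  have "\<Phi> (i, j) \<in> chars (Max (l ` ({..<m} \<times> {..<n})))" if "i < m" "j < n" for i j
    using that by (intro chars_mono[OF _ l] Max_ge finite_imageI finite_cartesian_product finite_lessThan) auto
  then show ?thesis by blast
qed

text \<open>A matrix with a single nonzero entry is an outer product, and such matrices read off the
  entries of \<open>\<Phi>\<close>.\<close>

lemma outer_determines:
  assumes \<Phi>: "\<And>i j. i < m \<Longrightarrow> j < n \<Longrightarrow> \<Phi> (i, j) \<in> chars k" and \<Psi>: "\<And>i j. i < m \<Longrightarrow> j < n \<Longrightarrow> \<Psi> (i, j) \<in> chars l"
    and eq: "\<And>a b. a \<in> vecs m \<Longrightarrow> b \<in> vecs n \<Longrightarrow> central m n \<Phi> (outer a b) = central m n \<Psi> (outer a b)"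
    and ij: "i < m" "j < n"
  shows "\<Phi> (i, j) = \<Psi> (i, j)"
proof (rule ext)
  fix x
  show "\<Phi> (i, j) x = \<Psi> (i, j) x"
  proof (cases "x \<in> S")
    case True
    define a b where "a = (\<lambda>i'. if i' = i then x else 0)" and "b = (\<lambda>j'. if j' = j then 1 else 0 :: 'k)"
    have central: "central m n \<Theta> (outer a b) = \<Theta> (i, j) x"
      if \<Theta>: "\<And>i j. i < m \<Longrightarrow> j < n \<Longrightarrow> \<Theta> (i, j) \<in> chars r" for \<Theta> r
    proof -
      have zero: "\<Theta> (i', j') 0 = 0" if "i' < m" "j' < n" for i' j'
        using charsD(3)[OF \<Theta>[OF that] PP_zero] .
      have "central m n \<Theta> (outer a b) = (\<Sum>i'<m. \<Sum>j'<n. if i' = i then (if j' = j then \<Theta> (i, j) x else 0) else 0)"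
        unfolding central_def outer_def a_def b_def using zero by (intro sum.cong refl) auto
      also have "\<dots> = (\<Sum>i'<m. if i' = i then \<Theta> (i, j) x else 0)"
        using ij(2) by (intro sum.cong refl) simp
      finally show ?thesis using ij(1) by simp
    qed
    have "a \<in> vecs m" "b \<in> vecs n" using True S_0 S_1 by (simp_all add: a_def b_def vecs_def)
    then show ?thesis using eq[of a b] central[of \<Phi>, OF \<Phi>] central[of \<Psi>, OF \<Psi>] by simp
  next
    case False
    then show ?thesis using charsD(2)[OF \<Phi>[OF ij]] charsD(2)[OF \<Psi>[OF ij]] by simp
  qed
qed

end

section \<open>Twist classes as matrices over the dual\<close>

context heis_limit begin

lemma level_mono:
  assumes g: "g \<in> carrier G" and kl: "k \<le> l"
  shows "heis_cong m n k (level l g) (level k g)"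
proof -
  obtain s where s: "coherent m n s" "g = lim s" using g by (rule carrierE)
  have "heis_cong m n k (s l) (s k)"
    using kl
  proof (induction l rule: dec_induct)
    case (step l)
    have "heis_cong m n l (s (Suc l)) (s l)" using s(1) by (simp add: coherent_def)
    then have "heis_cong m n k (s (Suc l)) (s l)" by (rule heis_cong_mono[OF step.hyps(1)])
    then show ?case using step.IH by (rule heis_cong_trans)
  qed (rule heis_cong_refl)
  moreover have "heis_cong m n k (level l g) (s l)"
    unfolding s(2) using level_lim[OF s(1)] by (rule heis_cong_mono[OF kl])
  moreover have "heis_cong m n k (s k) (level k g)"
    unfolding s(2) using level_lim[OF s(1)] by (rule heis_cong_sym)
  ultimately show ?thesis by (meson heis_cong_trans)
qed

lemma agree_mono:
  assumes "g \<in> carrier G" "h \<in> carrier G" "k \<le> l" "agree l g h"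
  shows "agree k g h"
  unfolding agree_def
  by (rule heis_cong_trans[OF heis_cong_sym[OF level_mono[OF assms(1,3)]]
        heis_cong_trans[OF heis_cong_mono[OF assms(3) assms(4)[unfolded agree_def]] level_mono[OF assms(2,3)]]])

text \<open>Continuity becomes constancy at some level by \<open>cont_rep_level\<close>, and a
  one-dimensional representation is its own character and always irreducible.\<close>

lemma Irr_1_iff:
  "\<chi> \<in> Irr G T 1 \<longleftrightarrow> \<chi> \<in> extensional (carrier G) \<and> \<chi> \<one>\<^bsub>G\<^esub> = 1 \<and>
    (\<forall>g\<in>carrier G. \<forall>h\<in>carrier G. \<chi> (g \<otimes>\<^bsub>G\<^esub> h) = \<chi> g * \<chi> h) \<and>
    (\<exists>k. \<forall>g\<in>carrier G. \<forall>h\<in>carrier G. agree k g h \<longrightarrow> \<chi> g = \<chi> h)"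
proof
  assume "\<chi> \<in> Irr G T 1"
  then obtain \<rho> where \<rho>: "\<chi> = rep_character G 1 \<rho>" "cont_rep G T 1 \<rho>" by (auto simp: Irr_def)
  have \<chi>: "\<chi> g = \<rho> g $$ (0, 0)" if "g \<in> carrier G" for g using that by (simp add: \<rho>(1) rep_character_def)
  obtain k where "\<forall>g\<in>carrier G. \<forall>h\<in>carrier G. agree k g h \<longrightarrow> \<rho> g = \<rho> h" using cont_rep_level[OF \<rho>(2)] by blast
  then have "\<forall>g\<in>carrier G. \<forall>h\<in>carrier G. agree k g h \<longrightarrow> \<chi> g = \<chi> h" by (simp add: \<chi>)
  moreover have "\<chi> (g \<otimes>\<^bsub>G\<^esub> h) = \<chi> g * \<chi> h" if gh: "g \<in> carrier G" "h \<in> carrier G" for g h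
  proof -
    have "\<rho> g \<in> carrier_mat 1 1" "\<rho> h \<in> carrier_mat 1 1" using \<rho>(2) gh by (auto simp: cont_rep_def)
    then have "(\<rho> g * \<rho> h) $$ (0, 0) = \<rho> g $$ (0, 0) * \<rho> h $$ (0, 0)" by (simp add: scalar_prod_def)
    moreover have "\<rho> (g \<otimes>\<^bsub>G\<^esub> h) = \<rho> g * \<rho> h" using \<rho>(2) gh by (auto simp: cont_rep_def)
    ultimately show ?thesis using gh by (simp add: \<chi> mult_closed)
  qed
  moreover have "\<chi> \<one>\<^bsub>G\<^esub> = 1" using \<rho>(2) one_closed by (simp add: \<chi> cont_rep_def)
  moreover have "\<chi> \<in> extensional (carrier G)" by (simp add: \<rho>(1) rep_character_def)
  ultimately show "\<chi> \<in> extensional (carrier G) \<and> \<chi> \<one>\<^bsub>G\<^esub> = 1 \<and>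
    (\<forall>g\<in>carrier G. \<forall>h\<in>carrier G. \<chi> (g \<otimes>\<^bsub>G\<^esub> h) = \<chi> g * \<chi> h) \<and>
    (\<exists>k. \<forall>g\<in>carrier G. \<forall>h\<in>carrier G. agree k g h \<longrightarrow> \<chi> g = \<chi> h)" by blast
next
  assume *: "\<chi> \<in> extensional (carrier G) \<and> \<chi> \<one>\<^bsub>G\<^esub> = 1 \<and>
    (\<forall>g\<in>carrier G. \<forall>h\<in>carrier G. \<chi> (g \<otimes>\<^bsub>G\<^esub> h) = \<chi> g * \<chi> h) \<and>
    (\<exists>k. \<forall>g\<in>carrier G. \<forall>h\<in>carrier G. agree k g h \<longrightarrow> \<chi> g = \<chi> h)"
  then obtain k where k: "\<And>g h. g \<in> carrier G \<Longrightarrow> h \<in> carrier G \<Longrightarrow> agree k g h \<Longrightarrow> \<chi> g = \<chi> h" by blast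
  define \<rho> where "\<rho> g = mat 1 1 (\<lambda>_. \<chi> g)" for g
  have "continuous_map T euclidean (\<lambda>g. \<rho> g $$ (r, c))" if "r < 1" "c < 1" for r c
    using that k by (intro continuous_mapI[of k]) (simp add: \<rho>_def)
  moreover have "\<rho> (g \<otimes>\<^bsub>G\<^esub> h) = \<rho> g * \<rho> h" if "g \<in> carrier G" "h \<in> carrier G" for g h
    using * that by (intro eq_matI) (auto simp: \<rho>_def scalar_prod_def)
  moreover have "\<rho> \<one>\<^bsub>G\<^esub> = 1\<^sub>m 1" using * by (intro eq_matI) (auto simp: \<rho>_def)
  ultimately have "cont_rep G T 1 \<rho>" by (simp add: cont_rep_def \<rho>_def)
  moreover have "irreducible_rep G 1 \<rho>"
    unfolding irreducible_rep_iff irreducible_on_def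
  proof (intro conjI allI impI)
    fix W :: "complex vec set"
    assume W: "W \<subseteq> carrier_vec 1 \<and> 0\<^sub>v 1 \<in> W \<and> (\<forall>v\<in>W. \<forall>w\<in>W. v + w \<in> W) \<and> (\<forall>c. \<forall>v\<in>W. c \<cdot>\<^sub>v v \<in> W) \<and>
      (\<forall>g\<in>carrier G. \<forall>v\<in>W. \<rho> g *\<^sub>v v \<in> W)"
    show "W = {0\<^sub>v 1} \<or> W = carrier_vec 1"
    proof (cases "W \<subseteq> {0\<^sub>v 1}")
      case False
      then obtain w where w: "w \<in> W" "w \<noteq> 0\<^sub>v 1" by blast
      have wc: "w \<in> carrier_vec 1" using W w(1) by blast
      have nz: "w $ 0 \<noteq> 0"
      proof
        assume "w $ 0 = 0"
        then have "w = 0\<^sub>v 1" using wc by (intro eq_vecI) auto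
        with w(2) show False by blast
      qed
      have "v \<in> W" if v: "v \<in> carrier_vec 1" for v
      proof -
        have "v = (v $ 0 / w $ 0) \<cdot>\<^sub>v w" using v wc nz by (intro eq_vecI) auto
        moreover have "(v $ 0 / w $ 0) \<cdot>\<^sub>v w \<in> W" using W w(1) by blast
        ultimately show ?thesis by simp
      qed
      then show ?thesis using W by blast
    qed (use W in blast)
  qed simp
  moreover have "\<chi> = rep_character G 1 \<rho>"
    using * by (intro extensionalityI[of \<chi> "carrier G"]) (auto simp: rep_character_def \<rho>_def)
  ultimately show "\<chi> \<in> Irr G T 1" unfolding Irr_def by blast
qed

lemma Irr_1_nonzero:
  assumes "\<chi> \<in> Irr G T 1" "g \<in> carrier G"
  shows "\<chi> g \<noteq> 0"
proof -
  obtain h where "h \<in> carrier G" "g \<otimes>\<^bsub>G\<^esub> h = \<one>\<^bsub>G\<^esub>" using ex_inverse[OF assms(2)] by blast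
  then have "\<chi> g * \<chi> h = 1" using assms unfolding Irr_1_iff by metis
  then show ?thesis by auto
qed

lemma Irr_1_one: "(\<lambda>g\<in>carrier G. 1) \<in> Irr G T 1"
  unfolding Irr_1_iff by (simp add: one_closed mult_closed)

lemma Irr_1_inverse:
  assumes "\<chi> \<in> Irr G T 1"
  shows "(\<lambda>g\<in>carrier G. inverse (\<chi> g)) \<in> Irr G T 1"
proof -
  obtain k where k: "\<And>g h. g \<in> carrier G \<Longrightarrow> h \<in> carrier G \<Longrightarrow> agree k g h \<Longrightarrow> \<chi> g = \<chi> h"
    using assms unfolding Irr_1_iff by blast
  show ?thesis
    using assms unfolding Irr_1_iff
    by (auto simp: one_closed mult_closed intro!: exI[of _ k] arg_cong[of _ _ inverse] k)
qed

lemma Irr_1_mult: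
  assumes "\<chi> \<in> Irr G T 1" "\<psi> \<in> Irr G T 1"
  shows "(\<lambda>g\<in>carrier G. \<chi> g * \<psi> g) \<in> Irr G T 1"
proof -
  obtain k where k: "\<And>g h. g \<in> carrier G \<Longrightarrow> h \<in> carrier G \<Longrightarrow> agree k g h \<Longrightarrow> \<chi> g = \<chi> h"
    using assms(1) unfolding Irr_1_iff by blast
  obtain l where l: "\<And>g h. g \<in> carrier G \<Longrightarrow> h \<in> carrier G \<Longrightarrow> agree l g h \<Longrightarrow> \<psi> g = \<psi> h"
    using assms(2) unfolding Irr_1_iff by blast
  have "\<chi> g * \<psi> g = \<chi> h * \<psi> h" if gh: "g \<in> carrier G" "h \<in> carrier G" "agree (max k l) g h" for g h
    using k[OF gh(1,2) agree_mono[OF gh(1,2) max.cobounded1 gh(3)]]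
      l[OF gh(1,2) agree_mono[OF gh(1,2) max.cobounded2 gh(3)]] by simp
  then show ?thesis
    using assms unfolding Irr_1_iff by (auto simp: one_closed mult_closed intro!: exI[of _ "max k l"])
qed

lemma equiv_twist: "equiv (Irr G T d) (twist_equiv G T d)"
proof (rule equivI)
  show "twist_equiv G T d \<subseteq> Irr G T d \<times> Irr G T d" by (auto simp: twist_equiv_def)
  show "refl_on (Irr G T d) (twist_equiv G T d)"
    using Irr_1_one by (intro refl_onI) (auto simp: twist_equiv_def intro!: bexI[of _ "\<lambda>g\<in>carrier G. 1"])
  show "sym (twist_equiv G T d)"
  proof (rule symI)
    fix \<theta> \<eta> assume "(\<theta>, \<eta>) \<in> twist_equiv G T d"
    then obtain \<chi> where *: "\<theta> \<in> Irr G T d" "\<eta> \<in> Irr G T d" "\<chi> \<in> Irr G T 1" "\<forall>g\<in>carrier G. \<theta> g = \<chi> g * \<eta> g"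
      by (auto simp: twist_equiv_def)
    have "\<forall>g\<in>carrier G. \<eta> g = (\<lambda>g\<in>carrier G. inverse (\<chi> g)) g * \<theta> g"
      using *(4) Irr_1_nonzero[OF *(3)] by simp
    then show "(\<eta>, \<theta>) \<in> twist_equiv G T d"
      using *(1,2) Irr_1_inverse[OF *(3)] unfolding twist_equiv_def by blast
  qed
  show "trans (twist_equiv G T d)"
  proof (rule transI)
    fix \<theta> \<eta> \<zeta> assume "(\<theta>, \<eta>) \<in> twist_equiv G T d" "(\<eta>, \<zeta>) \<in> twist_equiv G T d"
    then obtain \<chi> \<psi> where *: "\<theta> \<in> Irr G T d" "\<zeta> \<in> Irr G T d" "\<chi> \<in> Irr G T 1" "\<psi> \<in> Irr G T 1"
      "\<forall>g\<in>carrier G. \<theta> g = \<chi> g * \<eta> g" "\<forall>g\<in>carrier G. \<eta> g = \<psi> g * \<zeta> g"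
      by (auto simp: twist_equiv_def)
    have "\<forall>g\<in>carrier G. \<theta> g = (\<lambda>g\<in>carrier G. \<chi> g * \<psi> g) g * \<zeta> g" using *(5,6) by simp
    then show "(\<theta>, \<zeta>) \<in> twist_equiv G T d"
      using *(1,2) Irr_1_mult[OF *(3,4)] unfolding twist_equiv_def by blast
  qed
qed

definition char_level :: "(nat \<times> nat \<Rightarrow> 'k \<Rightarrow> cstar) \<Rightarrow> nat" where
  "char_level \<Phi> = (SOME k. \<forall>i<m. \<forall>j<n. \<Phi> (i, j) \<in> chars k)"

definition span_enum :: "(nat \<times> nat \<Rightarrow> 'k \<Rightarrow> cstar) \<Rightarrow> nat \<Rightarrow> nat \<Rightarrow> 'k \<Rightarrow> cstar" where
  "span_enum \<Phi> = (SOME e. bij_betw e {..<card (span m n \<Phi>)} (span m n \<Phi>))"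

definition lift_rep :: "(nat \<times> nat \<Rightarrow> 'k \<Rightarrow> cstar) \<Rightarrow> 'g \<Rightarrow> complex mat" where
  "lift_rep \<Phi> g = std_rep m n \<Phi> (span_enum \<Phi>) (level (char_level \<Phi>) g)"

definition lift_char :: "(nat \<times> nat \<Rightarrow> 'k \<Rightarrow> cstar) \<Rightarrow> 'g \<Rightarrow> complex" where
  "lift_char \<Phi> = rep_character G (card (span m n \<Phi>)) (lift_rep \<Phi>)"

context
  fixes \<Phi> :: "nat \<times> nat \<Rightarrow> 'k \<Rightarrow> cstar"
  assumes \<Phi>: "\<Phi> \<in> {..<m} \<times> {..<n} \<rightarrow> D"
begin

lemma char_level: "i < m \<Longrightarrow> j < n \<Longrightarrow> \<Phi> (i, j) \<in> chars (char_level \<Phi>)"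
  using someI_ex[OF common_level[OF \<Phi>]] unfolding char_level_def by blast

lemma span_enum: "bij_betw (span_enum \<Phi>) {..<card (span m n \<Phi>)} (span m n \<Phi>)"
  unfolding span_enum_def
  using ex_bij_betw_nat_finite[OF finite_span[of m n \<Phi>, OF char_level]] unfolding atLeast0LessThan by (rule someI_ex)

lemma lift_carrier: "lift_rep \<Phi> g \<in> carrier_mat (card (span m n \<Phi>)) (card (span m n \<Phi>))"
  unfolding lift_rep_def by (rule std_carrier[OF char_level span_enum])

lemma lift_agree:
  assumes "g \<in> carrier G" "h \<in> carrier G" "agree (char_level \<Phi>) g h"
  shows "lift_rep \<Phi> g = lift_rep \<Phi> h"
  unfolding lift_rep_def
  by (rule std_cong[OF char_level span_enum level_closed[OF assms(1)] level_closed[OF assms(2)]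
        assms(3)[unfolded agree_def]])

lemma lift_cont_rep: "cont_rep G T (card (span m n \<Phi>)) (lift_rep \<Phi>)"
  unfolding cont_rep_def
proof (intro conjI ballI allI impI)
  fix g assume "g \<in> carrier G"
  show "lift_rep \<Phi> g \<in> carrier_mat (card (span m n \<Phi>)) (card (span m n \<Phi>))" by (rule lift_carrier)
next
  show "lift_rep \<Phi> \<one>\<^bsub>G\<^esub> = 1\<^sub>m (card (span m n \<Phi>))"
    unfolding lift_rep_def
    using std_cong[OF char_level span_enum level_closed[OF one_closed] heis_one level_one]
      std_one[OF char_level span_enum] by simp
next
  fix g h assume gh: "g \<in> carrier G" "h \<in> carrier G"
  show "lift_rep \<Phi> (g \<otimes>\<^bsub>G\<^esub> h) = lift_rep \<Phi> g * lift_rep \<Phi> h"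
    unfolding lift_rep_def
    using std_cong[OF char_level span_enum level_closed[OF mult_closed[OF gh]]
        heis_mult_closed[OF level_closed[OF gh(1)] level_closed[OF gh(2)]] level_mult[OF gh]]
      std_mult[OF char_level span_enum level_closed[OF gh(1)] level_closed[OF gh(2)]] by simp
next
  fix r c
  show "continuous_map T euclidean (\<lambda>g. lift_rep \<Phi> g $$ (r, c))"
    by (rule continuous_mapI[of "char_level \<Phi>"]) (simp add: lift_agree)
qed

lemma lift_emb: "g \<in> heis m n \<Longrightarrow> lift_rep \<Phi> (emb g) = std_rep m n \<Phi> (span_enum \<Phi>) g"
  unfolding lift_rep_def
  by (rule std_cong[OF char_level span_enum level_closed[OF emb_closed] _ level_emb])

lemma lift_irreducible: "irreducible_rep G (card (span m n \<Phi>)) (lift_rep \<Phi>)"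
  unfolding irreducible_rep_iff irreducible_on_def
proof (intro conjI allI impI)
  let ?d = "card (span m n \<Phi>)"
  note irr = std_irreducible[OF char_level span_enum]
  show "0 < ?d" using irr by (simp add: irreducible_on_def)
  fix W :: "complex vec set"
  assume "W \<subseteq> carrier_vec ?d \<and> 0\<^sub>v ?d \<in> W \<and> (\<forall>v\<in>W. \<forall>w\<in>W. v + w \<in> W) \<and> (\<forall>c. \<forall>v\<in>W. c \<cdot>\<^sub>v v \<in> W) \<and>
    (\<forall>g\<in>carrier G. \<forall>v\<in>W. lift_rep \<Phi> g *\<^sub>v v \<in> W)"
  then have W: "W \<subseteq> carrier_vec ?d" "0\<^sub>v ?d \<in> W" "\<And>v w. v \<in> W \<Longrightarrow> w \<in> W \<Longrightarrow> v + w \<in> W"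
    "\<And>c v. v \<in> W \<Longrightarrow> c \<cdot>\<^sub>v v \<in> W" "\<And>g v. g \<in> carrier G \<Longrightarrow> v \<in> W \<Longrightarrow> lift_rep \<Phi> g *\<^sub>v v \<in> W" by blast+
  show "W = {0\<^sub>v ?d} \<or> W = carrier_vec ?d"
  proof (rule irreducible_onD[OF irr W(1-4)])
    fix g v assume g: "g \<in> heis m n" "v \<in> W"
    show "std_rep m n \<Phi> (span_enum \<Phi>) g *\<^sub>v v \<in> W"
      using W(5)[OF emb_closed[OF g(1)] g(2)] by (simp add: lift_emb[OF g(1)])
  qed
qed

lemma lift_char_Irr: "lift_char \<Phi> \<in> Irr G T (card (span m n \<Phi>))"
  unfolding Irr_def lift_char_def using lift_cont_rep lift_irreducible by blast

lemma lift_char_mtrace: "g \<in> carrier G \<Longrightarrow> lift_char \<Phi> g = mtrace (lift_rep \<Phi> g)"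
  using lift_carrier[of g] by (simp add: lift_char_def rep_character_def mtrace_def)

lemma lift_char_central:
  assumes "c \<in> mats m n"
  shows "lift_char \<Phi> (emb (0, 0, c)) = of_nat (card (span m n \<Phi>)) * cval (central m n \<Phi> c)"
proof -
  have h: "(0, 0, c) \<in> heis m n" using assms by (simp add: heis_def vecs_0)
  have "lift_rep \<Phi> (emb (0, 0, c)) = cval (central m n \<Phi> c) \<cdot>\<^sub>m 1\<^sub>m (card (span m n \<Phi>))"
    by (rule trans[OF lift_emb[OF h] std_central[OF char_level span_enum]])
  then show ?thesis unfolding lift_char_mtrace[OF emb_closed[OF h]] by (simp add: mtrace_def)
qed

end

text \<open>The element is a commutator, of \<open>(a, 0, 0)\<close> and \<open>(0, b, 0)\<close>,
  and one-dimensional characters are trivial on commutators.\<close>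

lemma twist_trivial_outer:
  assumes \<chi>: "\<chi> \<in> Irr G T 1" and a: "a \<in> vecs m" and b: "b \<in> vecs n"
  shows "\<chi> (emb (0, 0, outer a b)) = 1"
proof -
  have mem: "(a, 0, 0) \<in> heis m n" "(0, b, 0) \<in> heis m n" "(0, 0, outer a b) \<in> heis m n"
    using a b outer_mats[OF a b] by (simp_all add: heis_def vecs_0 mats_0)
  have mult: "\<chi> (emb (heis_mult g h)) = \<chi> (emb g) * \<chi> (emb h)" if "g \<in> heis m n" "h \<in> heis m n" for g h
    using \<chi> that unfolding Irr_1_iff by (simp add: emb_mult emb_closed)
  have o: "outer 0 b' = 0" "outer a' 0 = 0" for a' b' :: "nat \<Rightarrow> 'k" by (auto simp: outer_def)
  have "heis_mult (a, 0, 0) (0, b, 0) = heis_mult (0, 0, outer a b) (heis_mult (0, b, 0) (a, 0, 0))"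
    by (simp add: heis_mult_eq o del: heis_mult.simps)
  then have "\<chi> (emb (a, 0, 0)) * \<chi> (emb (0, b, 0)) =
      \<chi> (emb (0, 0, outer a b)) * (\<chi> (emb (0, b, 0)) * \<chi> (emb (a, 0, 0)))"
    using mult mem heis_mult_closed[OF mem(2,1)] by metis
  then show ?thesis using Irr_1_nonzero[OF \<chi> emb_closed] mem by simp
qed

text \<open>A twist does not change the values at central commutators. There the character is
  \<open>d\<close> times the central character, which determines the matrix by
  \<open>outer_determines\<close>.\<close>

lemma lift_char_inj:
  assumes \<Phi>: "\<Phi> \<in> {..<m} \<times> {..<n} \<rightarrow>\<^sub>E D" and \<Psi>: "\<Psi> \<in> {..<m} \<times> {..<n} \<rightarrow>\<^sub>E D"
    and eq: "(lift_char \<Phi>, lift_char \<Psi>) \<in> twist_equiv G T d"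
    and d: "card (span m n \<Phi>) = d" "card (span m n \<Psi>) = d"
  shows "\<Phi> = \<Psi>"
proof -
  have \<Phi>': "\<Phi> \<in> {..<m} \<times> {..<n} \<rightarrow> D" and \<Psi>': "\<Psi> \<in> {..<m} \<times> {..<n} \<rightarrow> D" using \<Phi> \<Psi> by auto
  have d_pos: "0 < d" using lift_irreducible[OF \<Phi>'] d(1) by (simp add: irreducible_rep_def)
  obtain \<chi> where \<chi>: "\<chi> \<in> Irr G T 1" "\<forall>g\<in>carrier G. lift_char \<Phi> g = \<chi> g * lift_char \<Psi> g"
    using eq by (auto simp: twist_equiv_def)
  have central: "central m n \<Phi> (outer a b) = central m n \<Psi> (outer a b)" if ab: "a \<in> vecs m" "b \<in> vecs n" for a b
  proof -
    have o: "outer a b \<in> mats m n" by (rule outer_mats[OF ab])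
    then have "emb (0, 0, outer a b) \<in> carrier G" by (intro emb_closed) (simp add: heis_def vecs_0)
    then have "lift_char \<Phi> (emb (0, 0, outer a b)) = lift_char \<Psi> (emb (0, 0, outer a b))"
      using \<chi>(2) twist_trivial_outer[OF \<chi>(1) ab] by simp
    then have "cval (central m n \<Phi> (outer a b)) = cval (central m n \<Psi> (outer a b))"
      unfolding lift_char_central[OF \<Phi>' o] lift_char_central[OF \<Psi>' o] d using d_pos by simp
    then show ?thesis by (simp only: cval_inject)
  qed
  show ?thesis
  proof (rule PiE_ext[OF \<Phi> \<Psi>])
    fix p assume "p \<in> {..<m} \<times> {..<n}"
    then obtain i j where p: "p = (i, j)" "i < m" "j < n" by auto
    show "\<Phi> p = \<Psi> p"
      unfolding p(1) by (rule outer_determines[OF char_level[OF \<Phi>'] char_level[OF \<Psi>'] central p(2,3)])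
  qed
qed

text \<open>A continuous representation factors through some level, so it is determined by the dense
  subgroup over \<open>S\<close> and remains irreducible on it. The classification applies there,
  and the twist that it provides is carried to the whole group through
  \<open>level k\<close>.\<close>

lemma lift_char_surj:
  assumes \<theta>: "\<theta> \<in> Irr G T d"
  shows "\<exists>\<Phi>\<in>{..<m} \<times> {..<n} \<rightarrow>\<^sub>E D. card (span m n \<Phi>) = d \<and> (\<theta>, lift_char \<Phi>) \<in> twist_equiv G T d"
proof -
  obtain \<rho> where \<rho>: "\<theta> = rep_character G d \<rho>" "cont_rep G T d \<rho>" "irreducible_rep G d \<rho>"
    using \<theta> by (auto simp: Irr_def)
  obtain k where k: "\<And>g h. g \<in> carrier G \<Longrightarrow> h \<in> carrier G \<Longrightarrow> agree k g h \<Longrightarrow> \<rho> g = \<rho> h"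
    using cont_rep_level[OF \<rho>(2)] by blast
  have \<rho>_level: "\<rho> (emb (level k g)) = \<rho> g" if "g \<in> carrier G" for g
    using that by (intro k emb_closed level_closed agree_emb_level)
  obtain N where N: "0 < N" "of_nat N \<in> PP k" using of_nat_PP by blast
  obtain Q where Q: "fin_reps S (PP k) Q" using fin_reps_PP by blast
  have irr: "irreducible_on (carrier G) d \<rho>" using \<rho>(3) by (simp add: irreducible_rep_iff)
  interpret I: heis_irrep S P PP \<pi> u R m n k d "\<lambda>g. \<rho> (emb g)" N Q
  proof unfold_locales
    fix g h assume gh: "g \<in> heis m n" "h \<in> heis m n"
    show "\<rho> (emb (heis_mult g h)) = \<rho> (emb g) * \<rho> (emb h)"
      using \<rho>(2) gh by (simp add: emb_mult cont_rep_def emb_closed)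
    assume "heis_cong m n k g h"
    then show "\<rho> (emb g) = \<rho> (emb h)" using gh by (intro k emb_closed agree_emb)
  next
    show "\<rho> (emb (0, 0, 0)) = 1\<^sub>m d" using \<rho>(2) by (simp add: emb_one cont_rep_def)
    show "irreducible_on (heis m n) d (\<lambda>g. \<rho> (emb g))"
      unfolding irreducible_on_def
    proof (intro conjI allI impI)
      show "0 < d" using irr by (simp add: irreducible_on_def)
      fix W :: "complex vec set"
      assume "W \<subseteq> carrier_vec d \<and> 0\<^sub>v d \<in> W \<and> (\<forall>v\<in>W. \<forall>w\<in>W. v + w \<in> W) \<and> (\<forall>c. \<forall>v\<in>W. c \<cdot>\<^sub>v v \<in> W) \<and>
        (\<forall>g\<in>heis m n. \<forall>v\<in>W. \<rho> (emb g) *\<^sub>v v \<in> W)"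
      then have W: "W \<subseteq> carrier_vec d" "0\<^sub>v d \<in> W" "\<And>v w. v \<in> W \<Longrightarrow> w \<in> W \<Longrightarrow> v + w \<in> W"
        "\<And>c v. v \<in> W \<Longrightarrow> c \<cdot>\<^sub>v v \<in> W" "\<And>g v. g \<in> heis m n \<Longrightarrow> v \<in> W \<Longrightarrow> \<rho> (emb g) *\<^sub>v v \<in> W" by blast+
      show "W = {0\<^sub>v d} \<or> W = carrier_vec d"
      proof (rule irreducible_onD[OF irr W(1-4)])
        fix g v assume g: "g \<in> carrier G" "v \<in> W"
        show "\<rho> g *\<^sub>v v \<in> W" using W(5)[OF level_closed[OF g(1), of k] g(2)] by (simp add: \<rho>_level[OF g(1)])
      qed
    qed
    show "fin_reps S (PP k) Q" by (rule Q)
  qed (use N \<rho>(2) emb_closed in \<open>auto simp: cont_rep_def\<close>)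
  obtain \<Phi> \<chi> where \<Phi>: "\<And>i j. i < m \<Longrightarrow> j < n \<Longrightarrow> \<Phi> (i, j) \<in> chars k" "card (span m n \<Phi>) = d"
    and \<chi>: "\<And>g h. g \<in> heis m n \<Longrightarrow> h \<in> heis m n \<Longrightarrow> \<chi> (heis_mult g h) = \<chi> g * \<chi> h"
      "\<And>g. g \<in> heis m n \<Longrightarrow> \<chi> g \<noteq> 0" "\<chi> (0, 0, 0) = 1"
      "\<And>g h. g \<in> heis m n \<Longrightarrow> h \<in> heis m n \<Longrightarrow> heis_cong m n k g h \<Longrightarrow> \<chi> g = \<chi> h"
    and trace: "\<And>g e. g \<in> heis m n \<Longrightarrow> bij_betw e {..<card (span m n \<Phi>)} (span m n \<Phi>) \<Longrightarrow>
      mtrace (\<rho> (emb g)) = \<chi> g * mtrace (std_rep m n \<Phi> e g)"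
    by (rule I.classification) (rule that)
  let ?\<Phi> = "restrict \<Phi> ({..<m} \<times> {..<n})"
  have PiE: "?\<Phi> \<in> {..<m} \<times> {..<n} \<rightarrow>\<^sub>E D" using \<Phi>(1) by (auto simp: D_def)
  then have Pi: "?\<Phi> \<in> {..<m} \<times> {..<n} \<rightarrow> D" by auto
  have card: "card (span m n ?\<Phi>) = d" by (simp add: span_restrict \<Phi>(2))
  have \<Phi>k: "?\<Phi> (i, j) \<in> chars k" if "i < m" "j < n" for i j using \<Phi>(1)[OF that] that by simp
  define e where "e = span_enum ?\<Phi>"
  have e: "bij_betw e {..<card (span m n \<Phi>)} (span m n \<Phi>)"
    using span_enum[OF Pi] by (simp add: e_def span_restrict)
  have e': "bij_betw e {..<card (span m n ?\<Phi>)} (span m n ?\<Phi>)" using e by (simp add: span_restrict)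
  define \<psi> where "\<psi> = (\<lambda>g\<in>carrier G. \<chi> (level k g))"
  have "\<psi> \<in> Irr G T 1"
    unfolding Irr_1_iff
  proof (intro conjI ballI)
    show "\<psi> \<in> extensional (carrier G)" by (simp add: \<psi>_def)
    show "\<psi> \<one>\<^bsub>G\<^esub> = 1"
      using \<chi>(4)[OF level_closed[OF one_closed] heis_one level_one] \<chi>(3) one_closed by (simp add: \<psi>_def)
    show "\<psi> (g \<otimes>\<^bsub>G\<^esub> h) = \<psi> g * \<psi> h" if gh: "g \<in> carrier G" "h \<in> carrier G" for g h
      using \<chi>(4)[OF level_closed[OF mult_closed[OF gh]]
          heis_mult_closed[OF level_closed[OF gh(1)] level_closed[OF gh(2)]] level_mult[OF gh]]
        \<chi>(1)[OF level_closed[OF gh(1)] level_closed[OF gh(2)]] mult_closed[OF gh] gh by (simp add: \<psi>_def)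
    have "\<psi> g = \<psi> h" if gh: "g \<in> carrier G" "h \<in> carrier G" "agree k g h" for g h
      using \<chi>(4)[OF level_closed[OF gh(1)] level_closed[OF gh(2)] gh(3)[unfolded agree_def]] gh(1,2) by (simp add: \<psi>_def)
    then show "\<exists>k. \<forall>g\<in>carrier G. \<forall>h\<in>carrier G. agree k g h \<longrightarrow> \<psi> g = \<psi> h" by blast
  qed
  moreover have "\<theta> g = \<psi> g * lift_char ?\<Phi> g" if g: "g \<in> carrier G" for g
  proof -
    let ?l = "char_level ?\<Phi>"
    \<comment> \<open>The level \<open>k\<close> of the representation may differ from the level
      chosen for \<open>?\<Phi>\<close>; the two are compared at their maximum.\<close>
    let ?M = "max k ?l"
    have "\<theta> g = mtrace (\<rho> g)" using \<rho>(2) g by (auto simp: \<rho>(1) rep_character_def mtrace_def cont_rep_def)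
    also have "\<dots> = \<chi> (level k g) * mtrace (std_rep m n \<Phi> e (level k g))"
      using trace[OF level_closed[OF g, of k] e] \<rho>_level[OF g] by simp
    also have "std_rep m n \<Phi> e (level k g) = std_rep m n ?\<Phi> e (level k g)" by (simp only: std_rep_restrict)
    also have "\<dots> = std_rep m n ?\<Phi> e (level ?M g)"
      using std_cong[OF \<Phi>k e' level_closed[OF g] level_closed[OF g] level_mono[OF g max.cobounded1]] by simp
    also have "\<dots> = std_rep m n ?\<Phi> e (level ?l g)"
      by (rule std_cong[OF char_level[OF Pi] e' level_closed[OF g] level_closed[OF g] level_mono[OF g max.cobounded2]])
    finally show ?thesis
      using g by (simp add: \<psi>_def lift_char_mtrace[OF Pi g] lift_rep_def e_def)
  qed
  moreover have "lift_char ?\<Phi> \<in> Irr G T d" using lift_char_Irr[OF Pi] card by simp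
  ultimately have "(\<theta>, lift_char ?\<Phi>) \<in> twist_equiv G T d" using \<theta> unfolding twist_equiv_def by blast
  then show ?thesis using PiE card by blast
qed

theorem twist_classes_bij:
  "bij_betw (\<lambda>\<Phi>. twist_equiv G T d `` {lift_char \<Phi>}) {\<Phi> \<in> {..<m} \<times> {..<n} \<rightarrow>\<^sub>E D. card (span m n \<Phi>) = d}
    (twist_classes G T d)"
  unfolding bij_betw_def
proof (intro conjI inj_onI equalityI subsetI)
  note eq = equiv_twist[of d]
  have Irr: "lift_char \<Phi> \<in> Irr G T d" if "\<Phi> \<in> {..<m} \<times> {..<n} \<rightarrow>\<^sub>E D" "card (span m n \<Phi>) = d" for \<Phi>
    using lift_char_Irr[of \<Phi>] that by auto
  {
    fix \<Phi> \<Psi> assume *: "\<Phi> \<in> {\<Phi> \<in> {..<m} \<times> {..<n} \<rightarrow>\<^sub>E D. card (span m n \<Phi>) = d}"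
      "\<Psi> \<in> {\<Phi> \<in> {..<m} \<times> {..<n} \<rightarrow>\<^sub>E D. card (span m n \<Phi>) = d}"
      and "twist_equiv G T d `` {lift_char \<Phi>} = twist_equiv G T d `` {lift_char \<Psi>}"
    then have "(lift_char \<Phi>, lift_char \<Psi>) \<in> twist_equiv G T d"
      using eq_equiv_class[OF _ eq] Irr by blast
    then show "\<Phi> = \<Psi>" using * by (intro lift_char_inj) auto
  next
    fix C assume "C \<in> (\<lambda>\<Phi>. twist_equiv G T d `` {lift_char \<Phi>}) ` {\<Phi> \<in> {..<m} \<times> {..<n} \<rightarrow>\<^sub>E D. card (span m n \<Phi>) = d}"
    then show "C \<in> twist_classes G T d" unfolding twist_classes_def using Irr by (auto intro!: quotientI)
  next
    fix C assume "C \<in> twist_classes G T d"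
    then obtain \<theta> where \<theta>: "\<theta> \<in> Irr G T d" "C = twist_equiv G T d `` {\<theta>}"
      unfolding twist_classes_def by (rule quotientE)
    obtain \<Phi> where "\<Phi> \<in> {..<m} \<times> {..<n} \<rightarrow>\<^sub>E D" "card (span m n \<Phi>) = d" "(\<theta>, lift_char \<Phi>) \<in> twist_equiv G T d"
      using lift_char_surj[OF \<theta>(1)] by blast
    then show "C \<in> (\<lambda>\<Phi>. twist_equiv G T d `` {lift_char \<Phi>}) ` {\<Phi> \<in> {..<m} \<times> {..<n} \<rightarrow>\<^sub>E D. card (span m n \<Phi>) = d}"
      unfolding \<theta>(2) using equiv_class_eq[OF eq] by blast
  }
qed

theorem twist_zeta:
  "finite (twist_classes G T d)"
  "twist_zeta_coeff G T d = dirichlet_coeff_of_fps q (\<Sum>r\<le>m. dual.rank_fps {..<m} {..<n} r) d"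
proof -
  let ?A = "{\<Phi> \<in> {..<m} \<times> {..<n} \<rightarrow>\<^sub>E D. card (span m n \<Phi>) = d}"
  let ?F = "\<Sum>r\<le>m. dual.rank_fps {..<m} {..<n} r :: rat fps"
  have "finite ?A \<and> of_nat (card ?A) = dirichlet_coeff_of_fps q ?F d"
  proof (cases "\<exists>k. q ^ k = d")
    case True
    then obtain k where k: "d = q ^ k" by blast
    have "{l. q ^ l = q ^ k} = {k}" using q_ge_2 by auto
    moreover have "of_nat (card ?A) = fps_nth ?F k"
      using dual.card_mats_of_span[of "{..<m}" "{..<n}" k] by (simp add: k span_def)
    moreover have "finite ?A" using dual.finite_mats_of_span[of "{..<m}" "{..<n}" k] by (simp add: k span_def)
    ultimately show ?thesis by (simp add: dirichlet_coeff_of_fps_def k)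
  next
    case False
    \<comment> \<open>Row spans have order a power of \<open>q\<close>, so both sides vanish for all
      other dimensions.\<close>
    have "card (span m n \<Phi>) \<noteq> d" if "\<Phi> \<in> {..<m} \<times> {..<n} \<rightarrow>\<^sub>E D" for \<Phi>
    proof -
      have "\<Phi> \<in> {..<m} \<times> {..<n} \<rightarrow> D" using that by auto
      then have "\<exists>k. card (dual.rowspan {..<m} {..<n} \<Phi>) = q ^ k"
        by (rule conjunct1[OF dual.rank_exists[OF finite_lessThan finite_lessThan]])
      then show ?thesis using False by (auto simp: span_def)
    qed
    then have "?A = {}" by blast
    moreover have "{k. q ^ k = d} = {}" using False by blast
    ultimately show ?thesis by (simp only: dirichlet_coeff_of_fps_def) simp
  qed
  then show "finite (twist_classes G T d)" "twist_zeta_coeff G T d = dirichlet_coeff_of_fps q ?F d"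
    using bij_betw_finite[OF twist_classes_bij[of d]] bij_betw_same_card[OF twist_classes_bij[of d]]
    by (simp_all add: twist_zeta_coeff_def)
qed

end

section \<open>The completed group as a limit\<close>

context integers_at_prime begin

abbreviation A :: "(nat \<Rightarrow> 'k set) ring" where "A \<equiv> completion OK P"

abbreviation TA :: "(nat \<Rightarrow> 'k set) topology" where "TA \<equiv> adic_topology OK P"

definition coset :: "nat \<Rightarrow> 'k \<Rightarrow> 'k set" where
  "coset k x = (+) x ` PP k"

definition coset_seq :: "(nat \<Rightarrow> 'k) \<Rightarrow> nat \<Rightarrow> 'k set" where
  "coset_seq s = (\<lambda>l. coset l (s l))"

definition rep :: "nat \<Rightarrow> (nat \<Rightarrow> 'k set) \<Rightarrow> 'k" where
  "rep l x = (SOME y. y \<in> S \<and> x l = coset l y)"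

definition glim :: "nat \<Rightarrow> nat \<Rightarrow> (nat \<Rightarrow> 'k heis) \<Rightarrow> (nat \<Rightarrow> 'k set) gmn" where
  "glim m n s = (\<lambda>i\<in>{..<m}. coset_seq (\<lambda>l. fst (s l) i), \<lambda>j\<in>{..<n}. coset_seq (\<lambda>l. fst (snd (s l)) j),
    \<lambda>p\<in>{..<m} \<times> {..<n}. coset_seq (\<lambda>l. snd (snd (s l)) p))"

definition glevel :: "nat \<Rightarrow> (nat \<Rightarrow> 'k set) gmn \<Rightarrow> 'k heis" where
  "glevel l = (\<lambda>(a, b, c). (\<lambda>i. rep l (a i), \<lambda>j. rep l (b j), \<lambda>p. rep l (c p)))"

definition same_level :: "nat \<Rightarrow> (nat \<Rightarrow> 'k set) \<Rightarrow> (nat \<Rightarrow> 'k set) set" where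
  "same_level k x = {y \<in> carrier A. y k = x k}"

lemma carrier_completion:
  "carrier A = {x. (\<forall>k. x k \<in> cosets S (PP k)) \<and> (\<forall>k. x (Suc k) \<subseteq> x k)}"
  by (simp add: completion_def power_quot_simps)

lemma coset_seq_ops:
  assumes "\<And>l. s l \<in> S" "\<And>l. t l \<in> S"
  shows "add A (coset_seq s) (coset_seq t) = coset_seq (\<lambda>l. s l + t l)"
    "mult A (coset_seq s) (coset_seq t) = coset_seq (\<lambda>l. s l * t l)"
  using assms by (simp_all add: completion_def coset_seq_def coset_def power_quot_simps)

lemma zero_completion: "zero A = coset_seq (\<lambda>_. 0)"
  by (simp add: completion_def coset_seq_def coset_def power_quot_simps)

context
  fixes \<pi> u :: 'k and R :: "'k set"
  assumes lf: "local_filtration S P PP \<pi> u R"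
begin

interpretation F: local_filtration S P PP \<pi> u R by (rule lf)

lemma coset_eq_coset: "coset k x = coset k y \<longleftrightarrow> x - y \<in> PP k"
  unfolding coset_def by (rule coset_eq_iff[OF F.add_subgroup_PP])

lemma rep:
  assumes "x \<in> carrier A"
  shows "rep l x \<in> S" "x l = coset l (rep l x)"
proof -
  have "x l \<in> cosets S (PP l)" using assms by (simp add: carrier_completion)
  then have "\<exists>y. y \<in> S \<and> x l = coset l y" by (auto simp: cosets_def coset_def)
  then have "rep l x \<in> S \<and> x l = coset l (rep l x)" unfolding rep_def by (rule someI_ex)
  then show "rep l x \<in> S" "x l = coset l (rep l x)" by blast+
qed

lemma rep_Suc:
  assumes x: "x \<in> carrier A"
  shows "rep (Suc l) x - rep l x \<in> PP l"
proof -
  have "rep (Suc l) x \<in> coset (Suc l) (rep (Suc l) x)"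
    using F.PP_zero[of "Suc l"] by (force simp: coset_def)
  then have "rep (Suc l) x \<in> x (Suc l)" using rep(2)[OF x] by simp
  moreover have "x (Suc l) \<subseteq> x l" using x by (simp add: carrier_completion)
  ultimately have "rep (Suc l) x \<in> coset l (rep l x)" using rep(2)[OF x, of l] by blast
  then show ?thesis by (auto simp: coset_def)
qed

lemma coset_seq_rep: "x \<in> carrier A \<Longrightarrow> coset_seq (\<lambda>l. rep l x) = x"
  using rep(2) by (auto simp: coset_seq_def fun_eq_iff)

lemma coset_seq_closed:
  assumes s: "\<And>l. s l \<in> S" "\<And>l. s (Suc l) - s l \<in> PP l"
  shows "coset_seq s \<in> carrier A"
proof -
  have "coset (Suc l) (s (Suc l)) \<subseteq> coset l (s l)" for l
  proof -
    have "coset (Suc l) (s (Suc l)) \<subseteq> coset l (s (Suc l))" using F.PP_Suc[of l] by (auto simp: coset_def)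
    also have "\<dots> = coset l (s l)" using s(2) by (simp add: coset_eq_coset)
    finally show ?thesis .
  qed
  then show ?thesis using s(1) by (auto simp: carrier_completion coset_seq_def coset_def cosets_def)
qed

lemma rep_coset_seq:
  assumes s: "\<And>l. s l \<in> S" "\<And>l. s (Suc l) - s l \<in> PP l"
  shows "rep l (coset_seq s) - s l \<in> PP l"
proof -
  have "coset l (s l) = coset l (rep l (coset_seq s))"
    using rep(2)[OF coset_seq_closed[OF s], of l] by (simp add: coset_seq_def)
  then have "s l - rep l (coset_seq s) \<in> PP l" by (simp only: coset_eq_coset)
  then show ?thesis using F.PP_uminus by force
qed

lemma rep_eq_iff: "x \<in> carrier A \<Longrightarrow> y \<in> carrier A \<Longrightarrow> rep k x - rep k y \<in> PP k \<longleftrightarrow> x k = y k"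
  using rep(2)[of x k] rep(2)[of y k] coset_eq_coset[of k "rep k x" "rep k y"] by simp

lemma level_antimono:
  assumes x: "x \<in> carrier A" and y: "y \<in> carrier A" and kl: "k \<le> l" and eq: "x l = y l"
  shows "x k = y k"
  using kl eq
proof (induction l rule: dec_induct)
  case (step l)
  have "rep (Suc l) x - rep (Suc l) y \<in> PP (Suc l)" using step.prems by (simp only: rep_eq_iff[OF x y])
  then have 1: "rep (Suc l) x - rep (Suc l) y \<in> PP l" using F.PP_Suc[of l] by blast
  have "rep (Suc l) x - rep (Suc l) y - (rep (Suc l) x - rep l x) + (rep (Suc l) y - rep l y) \<in> PP l"
    by (rule F.PP_add[OF F.PP_diff[OF 1 rep_Suc[OF x]] rep_Suc[OF y]])
  then have "rep l x - rep l y \<in> PP l" by simp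
  then have "x l = y l" by (simp only: rep_eq_iff[OF x y])
  then show ?case by (rule step.IH)
qed

lemma same_level_mono:
  assumes "x \<in> carrier A" "k \<le> l"
  shows "same_level l x \<subseteq> same_level k x"
proof
  fix y assume "y \<in> same_level l x"
  then have y: "y \<in> carrier A" "y l = x l" by (simp_all add: same_level_def)
  then show "y \<in> same_level k x" using level_antimono[OF y(1) assms y(2)] by (simp add: same_level_def)
qed

lemma topspace_TA: "topspace TA = carrier A"
proof -
  have "carrier A \<subseteq> (\<Pi>\<^sub>E k\<in>UNIV. carrier (power_quot OK P k))" by (auto simp: carrier_completion power_quot_simps)
  then show ?thesis by (auto simp: adic_topology_def)
qed

lemma openin_same_level:
  assumes x: "x \<in> carrier A"
  shows "openin TA (same_level k x)"
proof -
  have "continuous_map TA (discrete_topology (carrier (power_quot OK P k))) (\<lambda>y. y k)"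
    unfolding adic_topology_def
    by (rule continuous_map_from_subtopology) (rule continuous_map_product_projection, simp)
  moreover have "openin (discrete_topology (carrier (power_quot OK P k))) {x k}"
    using x by (simp add: carrier_completion power_quot_simps)
  ultimately have "openin TA {y \<in> topspace TA. y k \<in> {x k}}" by (rule openin_continuous_map_preimage)
  then show ?thesis by (simp add: topspace_TA same_level_def)
qed

text \<open>A basic open set of the product constrains finitely many components, and in the inverse
  limit the component with the largest index determines those below it.\<close>

lemma same_level_base:
  assumes W: "openin TA W" "x \<in> W"
  shows "\<exists>k. same_level k x \<subseteq> W"
proof -
  let ?X = "\<lambda>k. discrete_topology (carrier (power_quot OK P k))"
  obtain U where U: "openin (product_topology ?X UNIV) U" "W = U \<inter> carrier A"
    using W(1) unfolding adic_topology_def openin_subtopology by blast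
  have "x \<in> U" using U(2) W(2) by blast
  then obtain V where V: "finite {i \<in> UNIV. V i \<noteq> topspace (?X i)}" "x \<in> Pi\<^sub>E UNIV V" "Pi\<^sub>E UNIV V \<subseteq> U"
    using U(1) unfolding openin_product_topology_alt by blast
  \<comment> \<open>The inserted 0 covers the case that no component is constrained.\<close>
  define k where "k = Max (insert 0 {i \<in> UNIV. V i \<noteq> topspace (?X i)})"
  have xA: "x \<in> carrier A" using U(2) W(2) by blast
  have "y \<in> W" if y: "y \<in> same_level k x" for y
  proof -
    have yA: "y \<in> carrier A" "x k = y k" using y by (auto simp: same_level_def)
    have "y i \<in> V i" for i
    proof (cases "V i = topspace (?X i)")
      case True
      then show ?thesis using yA(1) by (simp add: carrier_completion power_quot_simps)
    next
      case False
      then have "i \<le> k" unfolding k_def using V(1) by (intro Max_ge) auto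
      then have "x i = y i" using yA(2) by (rule level_antimono[OF xA yA(1)])
      moreover have "x i \<in> V i" using V(2) by (simp add: PiE_iff)
      ultimately show ?thesis by simp
    qed
    then have "y \<in> Pi\<^sub>E UNIV V" by (simp add: PiE_iff)
    then show ?thesis using V(3) U(2) yA(1) by blast
  qed
  then show ?thesis by blast
qed

definition box :: "nat \<Rightarrow> 'i set \<Rightarrow> ('i \<Rightarrow> nat \<Rightarrow> 'k set) \<Rightarrow> ('i \<Rightarrow> nat \<Rightarrow> 'k set) set" where
  "box k I a = (\<Pi>\<^sub>E i\<in>I. same_level k (a i))"

lemma openin_box:
  assumes "finite I" "a \<in> I \<rightarrow>\<^sub>E carrier A"
  shows "openin (product_topology (\<lambda>_. TA) I) (box k I a)"
proof -
  have "openin TA (same_level k (a i))" if "i \<in> I" for i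
    using assms(2) that by (intro openin_same_level) auto
  then show ?thesis unfolding box_def openin_PiE[OF assms(1)] by blast
qed

lemma box_mono: "a \<in> I \<rightarrow>\<^sub>E carrier A \<Longrightarrow> k \<le> l \<Longrightarrow> box l I a \<subseteq> box k I a"
  unfolding box_def by (intro PiE_mono same_level_mono) auto

lemma box_base:
  assumes I: "finite I" and a: "a \<in> I \<rightarrow>\<^sub>E carrier A"
    and W: "openin (product_topology (\<lambda>_. TA) I) W" "a \<in> W"
  shows "\<exists>k. box k I a \<subseteq> W"
proof -
  from bspec[OF iffD1[OF openin_product_topology_alt W(1)] W(2)]
  obtain U where U: "\<forall>i\<in>I. openin TA (U i)" "a \<in> Pi\<^sub>E I U" "Pi\<^sub>E I U \<subseteq> W"
    by (elim exE conjE) (rule that)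
  have "\<forall>i\<in>I. \<exists>k. same_level k (a i) \<subseteq> U i"
  proof
    fix i assume i: "i \<in> I"
    show "\<exists>k. same_level k (a i) \<subseteq> U i" by (rule same_level_base[OF bspec[OF U(1) i] PiE_mem[OF U(2) i]])
  qed
  then obtain \<kappa> where "\<forall>i\<in>I. same_level (\<kappa> i) (a i) \<subseteq> U i" by (rule bchoice[THEN exE])
  then have \<kappa>: "same_level (\<kappa> i) (a i) \<subseteq> U i" if "i \<in> I" for i using that by (rule bspec)
  define k where "k = Max (insert 0 (\<kappa> ` I))"
  have "same_level k (a i) \<subseteq> U i" if i: "i \<in> I" for i
  proof -
    have "\<kappa> i \<le> k" unfolding k_def using I i by (intro Max_ge) auto
    then have "same_level k (a i) \<subseteq> same_level (\<kappa> i) (a i)" using a i by (intro same_level_mono) auto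
    then show ?thesis using \<kappa>[OF i] by blast
  qed
  then have "box k I a \<subseteq> Pi\<^sub>E I U" unfolding box_def by (intro PiE_mono)
  then show ?thesis using U(3) by blast
qed

text \<open>Coherent sequences of elements and compatible sequences of cosets describe the same
  inverse limit, and \<open>glim\<close> and \<open>glevel\<close> pass between them entry by entry.
  As there are finitely many entries, a product of neighbourhoods contains one that is defined at a
  single level.\<close>

theorem heis_limit:
  "heis_limit S P PP \<pi> u R m n (G_group m n A) (G_topology m n TA) (glim m n) glevel"
proof -
  let ?G = "G_group m n A" and ?T = "G_topology m n TA"
  have carrier: "carrier ?G = ({..<m} \<rightarrow>\<^sub>E carrier A) \<times> ({..<n} \<rightarrow>\<^sub>E carrier A) \<times> ({..<m} \<times> {..<n} \<rightarrow>\<^sub>E carrier A)"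
    by (simp add: G_group_def)
  have level_closed: "glevel l g \<in> F.heis m n" if "g \<in> carrier ?G" for l g
    using that rep(1) by (auto simp: carrier glevel_def F.heis_def F.vecs_def F.mats_def PiE_iff)
  have comp: "fst (s l) i \<in> S \<and> fst (s (Suc l)) i - fst (s l) i \<in> PP l" (is "?a i")
    "fst (snd (s l)) j \<in> S \<and> fst (snd (s (Suc l))) j - fst (snd (s l)) j \<in> PP l" (is "?b j")
    "snd (snd (s l)) (i, j) \<in> S \<and> snd (snd (s (Suc l))) (i, j) - snd (snd (s l)) (i, j) \<in> PP l" (is "?c i j")
    if "F.coherent m n s" "i < m" "j < n" for s l i j
  proof -
    obtain a b c a' b' c' where e: "s l = (a, b, c)" "s (Suc l) = (a', b', c')" by (cases "s l", cases "s (Suc l)") auto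
    have "s l \<in> F.heis m n" "F.heis_cong m n l (s (Suc l)) (s l)" using that(1) by (auto simp: F.coherent_def)
    then show "?a i" "?b j" "?c i j" using that(2,3) by (auto simp: e F.heis_def F.vecs_def F.mats_def)
  qed
  \<comment> \<open>The vector parts are treated separately, because the other index range may be
    empty and then \<open>comp\<close> has no instance.\<close>
  have comp1: "fst (s l) i \<in> S \<and> fst (s (Suc l)) i - fst (s l) i \<in> PP l" if "F.coherent m n s" "i < m" for s l i
  proof -
    obtain a b c a' b' c' where e: "s l = (a, b, c)" "s (Suc l) = (a', b', c')" by (cases "s l", cases "s (Suc l)") auto
    have "s l \<in> F.heis m n" "F.heis_cong m n l (s (Suc l)) (s l)" using that(1) by (auto simp: F.coherent_def)
    then show ?thesis using that(2) by (auto simp: e F.heis_def F.vecs_def)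
  qed
  have comp2: "fst (snd (s l)) j \<in> S \<and> fst (snd (s (Suc l))) j - fst (snd (s l)) j \<in> PP l"
    if "F.coherent m n s" "j < n" for s l j
  proof -
    obtain a b c a' b' c' where e: "s l = (a, b, c)" "s (Suc l) = (a', b', c')" by (cases "s l", cases "s (Suc l)") auto
    have "s l \<in> F.heis m n" "F.heis_cong m n l (s (Suc l)) (s l)" using that(1) by (auto simp: F.coherent_def)
    then show ?thesis using that(2) by (auto simp: e F.heis_def F.vecs_def)
  qed
  have glim_closed: "glim m n s \<in> carrier ?G" if "F.coherent m n s" for s
    using comp1[OF that] comp2[OF that] comp(3)[OF that]
    by (auto simp: carrier glim_def intro!: coset_seq_closed)
  have level_glim: "F.heis_cong m n l (glevel l (glim m n s)) (s l)" if s: "F.coherent m n s" for s l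
  proof -
    have 1: "rep l (coset_seq (\<lambda>l. fst (s l) i)) - fst (s l) i \<in> PP l" if "i < m" for i
      using comp1[OF s that] by (intro rep_coset_seq) auto
    have 2: "rep l (coset_seq (\<lambda>l. fst (snd (s l)) j)) - fst (snd (s l)) j \<in> PP l" if "j < n" for j
      using comp2[OF s that] by (intro rep_coset_seq) auto
    have 3: "rep l (coset_seq (\<lambda>l. snd (snd (s l)) (i, j))) - snd (snd (s l)) (i, j) \<in> PP l" if "i < m" "j < n" for i j
      using comp(3)[OF s that] by (intro rep_coset_seq) auto
    have e: "s l = (fst (s l), fst (snd (s l)), snd (snd (s l)))" by simp
    show ?thesis
      by (subst e, simp only: glim_def glevel_def split F.heis_cong.simps) (simp add: 1 2 3)
  qed
  have glim_level: "F.coherent m n (\<lambda>l. glevel l g) \<and> glim m n (\<lambda>l. glevel l g) = g" if g: "g \<in> carrier ?G" for g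
  proof -
    obtain a b c where e: "g = (a, b, c)" by (cases g) auto
    have mem: "a \<in> {..<m} \<rightarrow>\<^sub>E carrier A" "b \<in> {..<n} \<rightarrow>\<^sub>E carrier A" "c \<in> {..<m} \<times> {..<n} \<rightarrow>\<^sub>E carrier A"
      using g by (auto simp: carrier e)
    have restr: "(\<lambda>i\<in>I. coset_seq (\<lambda>l. rep l (x i))) = x" if "x \<in> I \<rightarrow>\<^sub>E carrier A" for I and x :: "'i \<Rightarrow> nat \<Rightarrow> 'k set"
      using that by (intro extensionalityI[of _ I]) (auto simp: PiE_iff coset_seq_rep)
    have "F.heis_cong m n l (glevel (Suc l) g) (glevel l g)" for l
      using mem rep_Suc by (auto simp: e glevel_def PiE_iff)
    moreover have "glim m n (\<lambda>l. glevel l g) = g"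
      by (simp add: e glim_def glevel_def restr[OF mem(1)] restr[OF mem(2)] restr[OF mem(3)])
    ultimately show ?thesis using level_closed[OF g] by (simp add: F.coherent_def)
  qed
  have same: "{h \<in> carrier ?G. F.heis_cong m n k (glevel k h) (glevel k g)} =
      box k {..<m} (fst g) \<times> box k {..<n} (fst (snd g)) \<times> box k ({..<m} \<times> {..<n}) (snd (snd g))"
    if g: "g \<in> carrier ?G" for k g
  proof -
    obtain a b c where e: "g = (a, b, c)" by (cases g) auto
    have mem: "a \<in> {..<m} \<rightarrow>\<^sub>E carrier A" "b \<in> {..<n} \<rightarrow>\<^sub>E carrier A" "c \<in> {..<m} \<times> {..<n} \<rightarrow>\<^sub>E carrier A"
      using g by (auto simp: carrier e)
    have box: "x \<in> box k I y \<longleftrightarrow> x \<in> I \<rightarrow>\<^sub>E carrier A \<and> (\<forall>i\<in>I. rep k (x i) - rep k (y i) \<in> PP k)"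
      if "y \<in> I \<rightarrow>\<^sub>E carrier A" for I and x y :: "'i \<Rightarrow> nat \<Rightarrow> 'k set"
      using that by (auto simp: box_def same_level_def PiE_iff rep_eq_iff)
    have "h \<in> carrier ?G \<and> F.heis_cong m n k (glevel k h) (glevel k g) \<longleftrightarrow>
        h \<in> box k {..<m} a \<times> box k {..<n} b \<times> box k ({..<m} \<times> {..<n}) c" for h
    proof -
      obtain a' b' c' where h: "h = (a', b', c')" by (cases h) auto
      have cong: "F.heis_cong m n k (glevel k (a', b', c')) (glevel k (a, b, c)) \<longleftrightarrow>
          (\<forall>i\<in>{..<m}. rep k (a' i) - rep k (a i) \<in> PP k) \<and> (\<forall>j\<in>{..<n}. rep k (b' j) - rep k (b j) \<in> PP k) \<and>
          (\<forall>p\<in>{..<m} \<times> {..<n}. rep k (c' p) - rep k (c p) \<in> PP k)"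
        by (auto simp: glevel_def)
      show ?thesis
        unfolding h e carrier mem_Times_iff fst_conv snd_conv box[OF mem(1)] box[OF mem(2)] box[OF mem(3)] cong
        by (simp only: conj_ac)
    qed
    then show ?thesis unfolding e fst_conv snd_conv by blast
  qed
  show ?thesis
  proof (intro heis_limit.intro heis_limit_axioms.intro lf)
    show "carrier ?G = glim m n ` Collect (F.coherent m n)"
    proof (intro equalityI subsetI)
      fix g assume "g \<in> carrier ?G"
      then have "F.coherent m n (\<lambda>l. glevel l g) \<and> glim m n (\<lambda>l. glevel l g) = g" by (rule glim_level)
      then show "g \<in> glim m n ` Collect (F.coherent m n)" by (metis imageI mem_Collect_eq)
    qed (use glim_closed in blast)
    show "glim m n s \<otimes>\<^bsub>?G\<^esub> glim m n t = glim m n (\<lambda>l. heis_mult (s l) (t l))"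
      if s: "F.coherent m n s" and t: "F.coherent m n t" for s t
    proof -
      have h: "fst (heis_mult x y) i = fst x i + fst y i" "fst (snd (heis_mult x y)) i = fst (snd x) i + fst (snd y) i"
        "snd (snd (heis_mult x y)) (i, j) = snd (snd x) (i, j) + snd (snd y) (i, j) + fst x i * fst (snd y) j"
        for x y :: "'k heis" and i j
        by (cases x; cases y; simp)+
      have 1: "add A (coset_seq (\<lambda>l. fst (s l) i)) (coset_seq (\<lambda>l. fst (t l) i)) =
          coset_seq (\<lambda>l. fst (heis_mult (s l) (t l)) i)" if "i < m" for i
        unfolding h using comp1[OF s that] comp1[OF t that] by (intro coset_seq_ops) auto
      have 2: "add A (coset_seq (\<lambda>l. fst (snd (s l)) j)) (coset_seq (\<lambda>l. fst (snd (t l)) j)) =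
          coset_seq (\<lambda>l. fst (snd (heis_mult (s l) (t l))) j)" if "j < n" for j
        unfolding h using comp2[OF s that] comp2[OF t that] by (intro coset_seq_ops) auto
      have 3: "add A (add A (coset_seq (\<lambda>l. snd (snd (s l)) (i, j))) (coset_seq (\<lambda>l. snd (snd (t l)) (i, j))))
          (mult A (coset_seq (\<lambda>l. fst (s l) i)) (coset_seq (\<lambda>l. fst (snd (t l)) j))) =
          coset_seq (\<lambda>l. snd (snd (heis_mult (s l) (t l))) (i, j))" if ij: "i < m" "j < n" for i j
      proof -
        have mem: "snd (snd (s l)) (i, j) \<in> S" "snd (snd (t l)) (i, j) \<in> S" "fst (s l) i \<in> S" "fst (snd (t l)) j \<in> S" for l
          using comp[OF s ij, of l] comp[OF t ij, of l] by simp_all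
        show ?thesis
          unfolding h coset_seq_ops(1)[OF mem(1,2)] coset_seq_ops(2)[OF mem(3,4)]
          by (rule coset_seq_ops(1)) (simp_all add: mem S_props)
      qed
      show ?thesis
        unfolding glim_def G_group_def using 1 2 3 by (auto simp: fun_eq_iff restrict_def)
    qed
    show "\<one>\<^bsub>?G\<^esub> = glim m n (\<lambda>_. (0, 0, 0))"
      by (simp add: G_group_def glim_def zero_completion)
    show "glim m n s = glim m n t"
      if s: "F.coherent m n s" and t: "F.coherent m n t" and eq: "\<And>l. F.heis_cong m n l (s l) (t l)" for s t
    proof -
      have d: "i < m \<Longrightarrow> fst (s l) i - fst (t l) i \<in> PP l" "j < n \<Longrightarrow> fst (snd (s l)) j - fst (snd (t l)) j \<in> PP l"
        "i < m \<Longrightarrow> j < n \<Longrightarrow> snd (snd (s l)) (i, j) - snd (snd (t l)) (i, j) \<in> PP l" for i j l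
        using eq[of l] by (cases "s l"; cases "t l"; simp)+
      show ?thesis
        unfolding glim_def coset_seq_def using d by (auto simp: coset_eq_coset fun_eq_iff restrict_def)
    qed
    show "F.heis_cong m n l (glevel l (glim m n s)) (s l)" if "F.coherent m n s" for s l by (rule level_glim[OF that])
    show "glevel l g \<in> F.heis m n" if "g \<in> carrier ?G" for g l by (rule level_closed[OF that])
    show "topspace ?T = carrier ?G" by (simp add: G_topology_def carrier topspace_TA)
    show "openin ?T {h \<in> carrier ?G. F.heis_cong m n k (glevel k h) (glevel k g)}" if g: "g \<in> carrier ?G" for g k
      unfolding same[OF g] G_topology_def openin_prod_Times_iff
      using g by (auto simp: carrier intro!: openin_box)
    show "\<exists>k. {h \<in> carrier ?G. F.heis_cong m n k (glevel k h) (glevel k g)} \<subseteq> W"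
      if W: "openin ?T W" and gW: "g \<in> W" for W g
    proof -
      have g: "g \<in> carrier ?G" using openin_subset[OF W] gW by (auto simp: G_topology_def carrier topspace_TA)
      obtain a b c where e: "g = (a, b, c)" by (cases g) auto
      have mem: "a \<in> {..<m} \<rightarrow>\<^sub>E carrier A" "b \<in> {..<n} \<rightarrow>\<^sub>E carrier A" "c \<in> {..<m} \<times> {..<n} \<rightarrow>\<^sub>E carrier A"
        using g by (auto simp: carrier e)
      from mp[OF spec[OF spec[OF iffD1[OF openin_prod_topology_alt W[unfolded G_topology_def]]]] gW[unfolded e]]
      obtain U V where UV: "openin (product_topology (\<lambda>_. TA) {..<m}) U"
        "openin (prod_topology (product_topology (\<lambda>_. TA) {..<n}) (product_topology (\<lambda>_. TA) ({..<m} \<times> {..<n}))) V"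
        "a \<in> U" "(b, c) \<in> V" "U \<times> V \<subseteq> W"
        by (elim exE conjE) (rule that)
      from mp[OF spec[OF spec[OF iffD1[OF openin_prod_topology_alt UV(2)]]] UV(4)]
      obtain U' V' where UV': "openin (product_topology (\<lambda>_. TA) {..<n}) U'"
        "openin (product_topology (\<lambda>_. TA) ({..<m} \<times> {..<n})) V'" "b \<in> U'" "c \<in> V'" "U' \<times> V' \<subseteq> V"
        by (elim exE conjE) (rule that)
      obtain k1 where k1: "box k1 {..<m} a \<subseteq> U" using box_base[OF finite_lessThan mem(1) UV(1,3)] by (rule exE)
      obtain k2 where k2: "box k2 {..<n} b \<subseteq> U'" using box_base[OF finite_lessThan mem(2) UV'(1,3)] by (rule exE)
      obtain k3 where k3: "box k3 ({..<m} \<times> {..<n}) c \<subseteq> V'"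
        using box_base[OF finite_cartesian_product[OF finite_lessThan finite_lessThan] mem(3) UV'(2,4)] by (rule exE)
      define k where "k = max k1 (max k2 k3)"
      have "k1 \<le> k" "k2 \<le> k" "k3 \<le> k" by (simp_all add: k_def)
      then have "box k {..<m} a \<subseteq> U" "box k {..<n} b \<subseteq> U'" "box k ({..<m} \<times> {..<n}) c \<subseteq> V'"
        using subset_trans[OF box_mono[OF mem(1)] k1] subset_trans[OF box_mono[OF mem(2)] k2]
          subset_trans[OF box_mono[OF mem(3)] k3] by simp_all
      then have "box k {..<m} a \<times> box k {..<n} b \<times> box k ({..<m} \<times> {..<n}) c \<subseteq> U \<times> U' \<times> V'"
        by (intro Sigma_mono)
      also have "\<dots> \<subseteq> U \<times> V" by (rule Sigma_mono[OF order_refl UV'(5)])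
      also note UV(5)
      finally have "box k {..<m} a \<times> box k {..<n} b \<times> box k ({..<m} \<times> {..<n}) c \<subseteq> W" .
      then show ?thesis unfolding same[OF g] unfolding e fst_conv snd_conv by (rule exI)
    qed
    show "\<exists>N>0. of_nat N \<in> PP k" for k by (rule ex_of_nat_PP)
  qed
qed

end

end

section \<open>The twist zeta function\<close>

theorem theorem2:
  fixes K P :: "'k::field_char_0 set" and m n q :: nat
    and G :: "(nat \<Rightarrow> 'k set) gmn monoid" and T :: "(nat \<Rightarrow> 'k set) gmn topology"
  assumes "1 \<le> m" and "m \<le> n"
    and "number_field K"
    and "primeideal P (ring_of_integers K)" and "P \<noteq> {0}"
    and "q = residue_card (ring_of_integers K) P"
    and "G = G_group m n (completion (ring_of_integers K) P)"
    and "T = G_topology m n (adic_topology (ring_of_integers K) P)"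
  shows "(\<forall>i>0. finite (twist_classes G T i)) \<and>
    (\<forall>i>0. twist_zeta_coeff G T i =
      dirichlet_coeff_of_fps q
        (\<Sum>I\<in>Pow {..<m}. fps_const (f_poly m n I (1 / of_nat q)) *
          (\<Prod>i\<in>I.
             (fps_const (of_nat (q ^ ((m - i) * (n + i)))) * fps_X ^ (m - i)) /
             (1 - fps_const (of_nat (q ^ ((m - i) * (n + i)))) * fps_X ^ (m - i)))) i)"
proof -
  interpret I: integers_at_prime K P using assms(3-5) by (rule integers_at_prime.intro)
  obtain \<pi> u R where lf: "local_filtration (carrier (ring_of_integers K)) P I.PP \<pi> u R"
    using I.ex_local_filtration by blast
  interpret L: heis_limit "carrier (ring_of_integers K)" P I.PP \<pi> u R m n G T "I.glim m n" I.glevel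
    unfolding assms(7,8) by (rule I.heis_limit[OF lf])
  have q: "L.q = q" by (simp add: L.q_def assms(6) I.residue_card_eq)
  define W where "W = (L.dual.rank_fps {..<m} {..<n} :: nat \<Rightarrow> rat fps)"
  have "(\<Sum>r\<le>m. W r) = (\<Sum>I\<in>Pow {..<m}. fps_const (f_poly m n I (1 / of_nat q)) *
    (\<Prod>i\<in>I. (fps_const (of_nat (q ^ ((m - i) * (n + i)))) * fps_X ^ (m - i)) /
      (1 - fps_const (of_nat (q ^ ((m - i) * (n + i)))) * fps_X ^ (m - i))))"
  proof (rule rank_recursion_solution)
    show "2 \<le> q" using L.q_ge_2 q by simp
    show "W 0 = 1" by (simp add: W_def L.dual.rank_fps_0)
    show "W r = fps_X ^ r *
      (\<Sum>s\<le>r. fps_const (of_nat (q ^ (s * (m + n - s)) * rank_count q (m - s) (n - s) (r - s))) * W s)"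
      if "0 < r" "r \<le> m" for r
      using L.dual.rank_fps_rec[of "{..<m}" "{..<n}" r] that by (simp only: W_def q finite_lessThan card_lessThan)
  qed (fact refl assms(2))+
  then show ?thesis using L.twist_zeta unfolding W_def q by simp
qed

end
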